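(* Let $p$ be a prime and $k\in\mathbb{N}$. There exists an isomorphism $$H^{u,t}\,\mathbf{R}\mathrm{Hom}_{\mathcal{P}(2)}\big(G(H_*l_k),\,G(H_*BP\langle 2\rangle)\big)\;\cong\;\mathrm{Ext}^{u,t}_{E(2)_*}\big(H_*l_k,\,H_*BP\langle 2\rangle\big).$$
   Context: $H_*$ is mod $p$ homology. $E(2)=E(Q_0,Q_1,Q_2)$ is the exterior algebra over $\mathbb{F}_p$ on the Milnor primitives and $E(2)_*$ its dual coalgebra; graded $E(2)_*$-comodules are identified with graded $E(2)$-modules. $G(-)=\mathbf{R}\mathrm{Hom}_{E(2)_*}(\mathbb{F}_p,-)$ is the right derived functor from the derived category of $E(2)$ to the derived category of differential graded modules over $\mathcal{P}(2)=G(\mathbb{F}_p)=\mathbf{R}\mathrm{Hom}_{E(2)}(\mathbb{F}_p,\mathbb{F}_p)\simeq\mathbb{F}_p[v_0,v_1,v_2]$, with $v_i$ in cohomological degree $1$ and internal degree $2p^i-1$; $u$ is the cohomological degree and $t$ the internal degree. $BP\langle 2\rangle$ is the height $2$ truncated Brown–Peterson spectrum, with $H_*BP\langle 2\rangle\cong A//E(2)_*$ equal to $\mathbb{F}_p[\bar\xi_1,\bar\xi_2,\dots]\otimes E(\bar\tau_3,\bar\tau_4,\dots)$ for $p$ odd and $\mathbb{F}_2[\bar\xi_1^2,\bar\xi_2^2,\bar\xi_3^2,\bar\xi_4,\bar\xi_5,\dots]$ for $p=2$ (conjugate Milnor generators of the dual Steenrod algebra $A_*$). Let $A//E(1)_*$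 be $\mathbb{F}_p[\bar\xi_1,\bar\xi_2,\dots]\otimes E(\bar\tau_2,\bar\tau_3,\dots)$ for $p$ odd, $\mathbb{F}_2[\bar\xi_1^2,\bar\xi_2^2,\bar\xi_3,\dots]$ for $p=2$. Weight: $wt(xy)=wt(x)+wt(y)$, $wt(\bar\xi_j)=wt(\bar\tau_j)=p^j$ for $p$ odd, $wt(\bar\xi_j)=2^{j-1}$ for $p=2$. $B_1(k)\subset A//E(1)_*$ is the span of monomials of weight at most $k$; $l_k$ is the height one Brown–Gitler spectrum, a finite spectrum with $H_*l_k\cong B_1(k)$ as $A_*$-comodules. The $E(2)$-action on these subspaces of $A_*$ is by (graded) derivations with, for $p$ odd, $Q_j\bar\xi_k=0$, $Q_j\bar\tau_k=\bar\xi_{k-j}^{p^j}$ for $j\le k$ and $0$ otherwise; for $p=2$, $Q_j\bar\xi_k=\bar\xi_{k-j-1}^{2^{j+1}}$ for $j<k$ and $0$ otherwise ($\bar\xi_0=1$). *)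

theory Defs
  imports
    "HOL-Library.Function_Algebras"
    "HOL-Library.Multiset"
    "HOL-Library.Poly_Mapping"
    "Berlekamp_Zassenhaus.Finite_Field"
begin

section \<open>Linear algebra\<close>

text \<open>
  A graded vector space is a family of subspaces of one ambient vector space, and a graded map is a
  family of linear maps. A linear map defined on a subspace is represented by the function that
  vanishes outside it, so that maps can be compared by equality and added pointwise.
\<close>

definition lin_on ::
  "('f \<Rightarrow> 'a \<Rightarrow> 'a) \<Rightarrow> 'a set \<Rightarrow> ('f \<Rightarrow> 'b \<Rightarrow> 'b) \<Rightarrow> 'b set \<Rightarrow> ('a::plus \<Rightarrow> 'b::plus) \<Rightarrow> bool" where
  "lin_on s V s' W f \<longleftrightarrow>
     (\<forall>x\<in>V. f x \<in> W) \<and> (\<forall>x\<in>V. \<forall>y\<in>V. f (x + y) = f x + f y) \<and> (\<forall>c. \<forall>x\<in>V. f (s c x) = s' c (f x))"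

definition lin_maps ::
  "('f \<Rightarrow> 'a \<Rightarrow> 'a) \<Rightarrow> 'a set \<Rightarrow> ('f \<Rightarrow> 'b \<Rightarrow> 'b) \<Rightarrow> 'b set \<Rightarrow> ('a::plus \<Rightarrow> 'b::{plus,zero}) set" where
  "lin_maps s V s' W = {f. lin_on s V s' W f \<and> (\<forall>x. x \<notin> V \<longrightarrow> f x = 0)}"

definition basis_family ::
  "('f::field \<Rightarrow> 'a \<Rightarrow> 'a::ab_group_add) \<Rightarrow> 'a set \<Rightarrow> 'i set \<Rightarrow> ('i \<Rightarrow> 'a) \<Rightarrow> bool" where
  "basis_family s V I b \<longleftrightarrow>
     inj_on b I \<and> \<not> module.dependent s (b ` I) \<and> module.span s (b ` I) = V"

record ('f, 'v) subquotient =
  sq_scale :: "'f \<Rightarrow> 'v \<Rightarrow> 'v"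
  cycles :: "'v set"
  boundaries :: "'v set"

definition sq_class :: "('f, 'v::plus) subquotient \<Rightarrow> 'v \<Rightarrow> 'v set" where
  "sq_class H z = {z + b | b. b \<in> boundaries H}"

definition sq_carrier :: "('f, 'v::plus) subquotient \<Rightarrow> 'v set set" where
  "sq_carrier H = sq_class H ` cycles H"

definition sq_iso ::
  "('f, 'v::plus) subquotient \<Rightarrow> ('f, 'w::plus) subquotient \<Rightarrow> ('v set \<Rightarrow> 'w set) \<Rightarrow> bool" where
  "sq_iso H H' \<phi> \<longleftrightarrow> bij_betw \<phi> (sq_carrier H) (sq_carrier H') \<and>
     (\<forall>x\<in>cycles H. \<forall>y\<in>cycles H. \<forall>x'\<in>cycles H'. \<forall>y'\<in>cycles H'.
        \<phi> (sq_class H x) = sq_class H' x' \<longrightarrow> \<phi> (sq_class H y) = sq_class H' y' \<longrightarrow>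
        \<phi> (sq_class H (x + y)) = sq_class H' (x' + y') \<and>
        (\<forall>c. \<phi> (sq_class H (sq_scale H c x)) = sq_class H' (sq_scale H' c x')))"

definition pm_scale :: "'f::comm_ring_1 \<Rightarrow> ('k \<Rightarrow>\<^sub>0 'f) \<Rightarrow> ('k \<Rightarrow>\<^sub>0 'f)" where
  "pm_scale c x = Poly_Mapping.map ((*) c) x"

definition pm_extend :: "('k \<Rightarrow> ('l \<Rightarrow>\<^sub>0 'f::comm_ring_1)) \<Rightarrow> ('k \<Rightarrow>\<^sub>0 'f) \<Rightarrow> ('l \<Rightarrow>\<^sub>0 'f)" where
  "pm_extend f x = (\<Sum>b\<in>Poly_Mapping.keys x. pm_scale (Poly_Mapping.lookup x b) (f b))"


section \<open>Graded \<open>E(2)\<close>-modules and Ext\<close>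

definition qdeg :: "nat \<Rightarrow> nat \<Rightarrow> int" where
  "qdeg p i = 2 * int p ^ i - 1"

text \<open>
  Modules are graded homologically: \<open>Q\<^sub>i\<close> lowers the degree by \<open>qdeg p i\<close>, and
  \<open>eact M i n\<close> is its action on the component of degree \<open>n\<close>.
\<close>

record ('f, 'a) emod =
  escale :: "'f \<Rightarrow> 'a \<Rightarrow> 'a"
  ecomp :: "int \<Rightarrow> 'a set"
  eact :: "nat \<Rightarrow> int \<Rightarrow> 'a \<Rightarrow> 'a"

definition E2_module :: "nat \<Rightarrow> ('f::field, 'a::ab_group_add) emod \<Rightarrow> bool" where
  "E2_module p M \<longleftrightarrow>
     vector_space (escale M) \<and>
     (\<forall>n. module.subspace (escale M) (ecomp M n)) \<and>
     (\<forall>i<3. \<forall>n. lin_on (escale M) (ecomp M n) (escale M) (ecomp M (n - qdeg p i)) (eact M i n)) \<and>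
     (\<forall>i<3. \<forall>n. \<forall>x\<in>ecomp M n. eact M i (n - qdeg p i) (eact M i n x) = 0) \<and>
     (\<forall>i<3. \<forall>j<3. \<forall>n. \<forall>x\<in>ecomp M n.
        eact M i (n - qdeg p j) (eact M j n x) + eact M j (n - qdeg p i) (eact M i n x) = 0)"

text \<open>
  Internal degree \<open>t\<close>: maps raising the homological degree by \<open>t\<close>, that is, \<open>Hom(\<Sigma>\<^sup>t M, N)\<close>. With this
  convention \<open>v\<^sub>i \<in> Ext(\<F>\<^sub>p, \<F>\<^sub>p)\<close> has internal degree \<open>+ qdeg p i\<close>. Inserting the Koszul sign
  \<open>(-1)\<^sup>t\<close> in the linearity condition would give an isomorphic group, via \<open>x \<mapsto> (-1)\<^bsup>t|x|\<^esup> x\<close>.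
\<close>

definition Hom_E ::
  "nat \<Rightarrow> ('f, 'a::plus) emod \<Rightarrow> ('f, 'b::{plus,zero}) emod \<Rightarrow> int \<Rightarrow> (int \<Rightarrow> 'a \<Rightarrow> 'b) set" where
  "Hom_E p M N t = {f.
     (\<forall>n. f n \<in> lin_maps (escale M) (ecomp M n) (escale N) (ecomp N (n + t))) \<and>
     (\<forall>i<3. \<forall>n. \<forall>x\<in>ecomp M n. f (n - qdeg p i) (eact M i n x) = eact N i (n + t) (f n x))}"

fun eword :: "nat \<Rightarrow> ('f, 'a) emod \<Rightarrow> nat list \<Rightarrow> int \<Rightarrow> 'a \<Rightarrow> 'a" where
  "eword p M [] n x = x"
| "eword p M (i # w) n x = eact M i (n - (\<Sum>j\<leftarrow>w. qdeg p j)) (eword p M w n x)"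

text \<open>The strictly increasing words in \<open>Q\<^sub>0, Q\<^sub>1, Q\<^sub>2\<close> are the standard basis of \<open>E(2)\<close>.\<close>

definition free_E2_module :: "nat \<Rightarrow> ('f::field, 'a::ab_group_add) emod \<Rightarrow> bool" where
  "free_E2_module p M \<longleftrightarrow> E2_module p M \<and>
     (\<exists>B :: int \<Rightarrow> 'a set. \<forall>n.
        basis_family (escale M) (ecomp M n)
          {(w, m, b). sorted_wrt (<) w \<and> set w \<subseteq> {..<3} \<and> b \<in> B m \<and> n = m - (\<Sum>j\<leftarrow>w. qdeg p j)}
          (\<lambda>(w, m, b). eword p M w m b))"

definition free_resolution ::
  "nat \<Rightarrow> (int \<Rightarrow> ('f::field, 'r::ab_group_add) emod) \<Rightarrow> (int \<Rightarrow> int \<Rightarrow> 'r \<Rightarrow> 'r) \<Rightarrow>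
   (int \<Rightarrow> 'r \<Rightarrow> 'a) \<Rightarrow> ('f, 'a::ab_group_add) emod \<Rightarrow> bool" where
  "free_resolution p R d \<epsilon> M \<longleftrightarrow>
     (\<forall>s. free_E2_module p (R s)) \<and>
     (\<forall>s<0. \<forall>n. ecomp (R s) n = {0}) \<and>
     (\<forall>s. d s \<in> Hom_E p (R s) (R (s - 1)) 0) \<and>
     \<epsilon> \<in> Hom_E p (R 0) M 0 \<and>
     (\<forall>n. \<epsilon> n ` ecomp (R 0) n = ecomp M n) \<and>
     (\<forall>n. {x \<in> ecomp (R 0) n. \<epsilon> n x = 0} = d 1 n ` ecomp (R 1) n) \<and>
     (\<forall>s>0. \<forall>n. {x \<in> ecomp (R s) n. d s n x = 0} = d (s + 1) n ` ecomp (R (s + 1)) n)"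

definition HomE_cohomology ::
  "nat \<Rightarrow> (int \<Rightarrow> ('f, 'r::plus) emod) \<Rightarrow> (int \<Rightarrow> int \<Rightarrow> 'r \<Rightarrow> 'r) \<Rightarrow> ('f, 'b::{plus,zero}) emod \<Rightarrow>
   int \<Rightarrow> int \<Rightarrow> ('f, int \<Rightarrow> 'r \<Rightarrow> 'b) subquotient" where
  "HomE_cohomology p R d N u t =
     \<lparr>sq_scale = (\<lambda>c f n x. escale N c (f n x)),
      cycles = {f \<in> Hom_E p (R u) N t. \<forall>n. \<forall>x. f n (d (u + 1) n x) = 0},
      boundaries = {\<lambda>n x. g n (d u n x) | g. g \<in> Hom_E p (R (u - 1)) N t}\<rparr>"

text \<open>
  A type large enough to carry resolutions of every object with elements of type \<open>'a\<close>: writing \<open>\<Lambda>\<close>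
  for an exterior algebra and \<open>\<Gamma>\<close> for a divided power algebra on three generators, a graded
  \<open>E(2)\<close>-module \<open>M\<close> has the free resolution \<open>E(2) \<otimes> \<Gamma> \<otimes> M\<close>, and a dg module \<open>X\<close> over
  \<open>P = \<F>\<^sub>p[v\<^sub>0, v\<^sub>1, v\<^sub>2]\<close> has the semifree resolution \<open>X \<otimes> \<Lambda> \<otimes> P\<close>; both have bases indexed by
  subsets of \<open>{0, 1, 2}\<close>, multisets of elements of \<open>{0, 1, 2}\<close>, and basis elements of \<open>M\<close> or \<open>X\<close>.
\<close>

type_synonym ('f, 'a) resolving = "(nat set \<times> nat multiset \<times> 'a) \<Rightarrow>\<^sub>0 'f"

definition Ext_E2 ::
  "nat \<Rightarrow> ('f::field, 'a::ab_group_add) emod \<Rightarrow> ('f, 'b::ab_group_add) emod \<Rightarrow> int \<Rightarrow> int \<Rightarrow>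
   ('f, int \<Rightarrow> ('f, 'a) resolving \<Rightarrow> 'b) subquotient" where
  "Ext_E2 p M N u t =
     (let (R, d, \<epsilon>) = (SOME (R, d, \<epsilon>). free_resolution p R d \<epsilon> M) in HomE_cohomology p R d N u t)"


section \<open>Differential graded \<open>P(2)\<close>-modules and their derived Hom\<close>

text \<open>
  These are right dg modules over \<open>\<F>\<^sub>p[v\<^sub>0, v\<^sub>1, v\<^sub>2]\<close> (with zero differential), so that \<open>d\<close> and module
  homomorphisms commute with the \<open>v\<^sub>i\<close> without signs. The first index is the cohomological degree
  \<open>u\<close>, the second the internal degree \<open>t\<close>; \<open>v\<^sub>i\<close> has bidegree \<open>(1, qdeg p i)\<close>.
\<close>

record ('f, 'x) dgmod =
  dscale :: "'f \<Rightarrow> 'x \<Rightarrow> 'x"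
  dcomp :: "int \<Rightarrow> int \<Rightarrow> 'x set"
  diff :: "int \<Rightarrow> int \<Rightarrow> 'x \<Rightarrow> 'x"
  vact :: "nat \<Rightarrow> int \<Rightarrow> int \<Rightarrow> 'x \<Rightarrow> 'x"

definition P2_dgmodule :: "nat \<Rightarrow> ('f::field, 'x::ab_group_add) dgmod \<Rightarrow> bool" where
  "P2_dgmodule p X \<longleftrightarrow>
     vector_space (dscale X) \<and>
     (\<forall>u t. module.subspace (dscale X) (dcomp X u t)) \<and>
     (\<forall>u t. lin_on (dscale X) (dcomp X u t) (dscale X) (dcomp X (u + 1) t) (diff X u t)) \<and>
     (\<forall>i<3. \<forall>u t. lin_on (dscale X) (dcomp X u t) (dscale X) (dcomp X (u + 1) (t + qdeg p i)) (vact X i u t)) \<and>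
     (\<forall>u t. \<forall>x\<in>dcomp X u t. diff X (u + 1) t (diff X u t x) = 0) \<and>
     (\<forall>i<3. \<forall>u t. \<forall>x\<in>dcomp X u t.
        diff X (u + 1) (t + qdeg p i) (vact X i u t x) = vact X i (u + 1) t (diff X u t x)) \<and>
     (\<forall>i<3. \<forall>j<3. \<forall>u t. \<forall>x\<in>dcomp X u t.
        vact X i (u + 1) (t + qdeg p j) (vact X j u t x) = vact X j (u + 1) (t + qdeg p i) (vact X i u t x))"

definition Hom_P ::
  "nat \<Rightarrow> ('f, 'x::plus) dgmod \<Rightarrow> ('f, 'y::{plus,zero}) dgmod \<Rightarrow> int \<Rightarrow> int \<Rightarrow> (int \<Rightarrow> int \<Rightarrow> 'x \<Rightarrow> 'y) set" where
  "Hom_P p X Y a b = {f.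
     (\<forall>u t. f u t \<in> lin_maps (dscale X) (dcomp X u t) (dscale Y) (dcomp Y (u + a) (t + b))) \<and>
     (\<forall>i<3. \<forall>u t. \<forall>x\<in>dcomp X u t.
        f (u + 1) (t + qdeg p i) (vact X i u t x) = vact Y i (u + a) (t + b) (f u t x))}"

definition HomP_diff ::
  "('f, 'x) dgmod \<Rightarrow> ('f, 'y::ab_group_add) dgmod \<Rightarrow> int \<Rightarrow> int \<Rightarrow> (int \<Rightarrow> int \<Rightarrow> 'x \<Rightarrow> 'y) \<Rightarrow> (int \<Rightarrow> int \<Rightarrow> 'x \<Rightarrow> 'y)" where
  "HomP_diff X Y a b f = (\<lambda>u t x.
     if x \<in> dcomp X u t
     then (if even a then diff Y (u + a) (t + b) (f u t x) - f (u + 1) t (diff X u t x)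
           else diff Y (u + a) (t + b) (f u t x) + f (u + 1) t (diff X u t x))
     else 0)"

definition HomP_cohomology ::
  "nat \<Rightarrow> ('f, 'x::plus) dgmod \<Rightarrow> ('f, 'y::ab_group_add) dgmod \<Rightarrow> int \<Rightarrow> int \<Rightarrow>
   ('f, int \<Rightarrow> int \<Rightarrow> 'x \<Rightarrow> 'y) subquotient" where
  "HomP_cohomology p X Y a b =
     \<lparr>sq_scale = (\<lambda>c f u t x. dscale Y c (f u t x)),
      cycles = {f \<in> Hom_P p X Y a b. HomP_diff X Y a b f = 0},
      boundaries = HomP_diff X Y (a - 1) b ` Hom_P p X Y (a - 1) b\<rparr>"

definition dcycles :: "('f, 'x::zero) dgmod \<Rightarrow> int \<Rightarrow> int \<Rightarrow> 'x set" where
  "dcycles X u t = {x \<in> dcomp X u t. diff X u t x = 0}"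

definition dboundaries :: "('f, 'x) dgmod \<Rightarrow> int \<Rightarrow> int \<Rightarrow> 'x set" where
  "dboundaries X u t = diff X (u - 1) t ` dcomp X (u - 1) t"

definition dg_quasi_iso ::
  "nat \<Rightarrow> ('f, 'x::ab_group_add) dgmod \<Rightarrow> ('f, 'y::ab_group_add) dgmod \<Rightarrow> (int \<Rightarrow> int \<Rightarrow> 'x \<Rightarrow> 'y) \<Rightarrow> bool" where
  "dg_quasi_iso p X Y e \<longleftrightarrow>
     e \<in> Hom_P p X Y 0 0 \<and> HomP_diff X Y 0 0 e = 0 \<and>
     (\<forall>u t. \<forall>x\<in>dcycles X u t. e u t x \<in> dboundaries Y u t \<longrightarrow> x \<in> dboundaries X u t) \<and>
     (\<forall>u t. \<forall>y\<in>dcycles Y u t. \<exists>x\<in>dcycles X u t. y - e u t x \<in> dboundaries Y u t)"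

fun vword :: "nat \<Rightarrow> ('f, 'x) dgmod \<Rightarrow> nat list \<Rightarrow> int \<Rightarrow> int \<Rightarrow> 'x \<Rightarrow> 'x" where
  "vword p X [] u t x = x"
| "vword p X (i # w) u t x =
     vact X i (u + int (length w)) (t + (\<Sum>j\<leftarrow>w. qdeg p j)) (vword p X w u t x)"

text \<open>
  The basis of bidegree \<open>(u, t)\<close> of a free graded \<open>P(2)\<close>-module on the homogeneous generators
  \<open>B\<close>. Sorted words in \<open>v\<^sub>0, v\<^sub>1, v\<^sub>2\<close> stand for monomials.
\<close>

definition free_index ::
  "nat \<Rightarrow> (int \<Rightarrow> int \<Rightarrow> 'x set) \<Rightarrow> int \<Rightarrow> int \<Rightarrow> (nat list \<times> int \<times> int \<times> 'x) set" where
  "free_index p B u t = {(w, u', t', b). sorted w \<and> set w \<subseteq> {..<3} \<and> b \<in> B u' t' \<and>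
     u = u' + int (length w) \<and> t = t' + (\<Sum>j\<leftarrow>w. qdeg p j)}"

text \<open>
  \<open>B l\<close> is the set of generators of filtration \<open>l\<close>: the differential of a generator lies in the
  submodule spanned by generators of strictly smaller filtration.
\<close>

definition semifree :: "nat \<Rightarrow> ('f::field, 'x::ab_group_add) dgmod \<Rightarrow> bool" where
  "semifree p X \<longleftrightarrow> P2_dgmodule p X \<and>
     (\<exists>B :: nat \<Rightarrow> int \<Rightarrow> int \<Rightarrow> 'x set.
        (\<forall>u t. basis_family (dscale X) (dcomp X u t) (free_index p (\<lambda>u' t'. \<Union>l. B l u' t') u t)
                 (\<lambda>(w, u', t', b). vword p X w u' t' b)) \<and>
        (\<forall>l u t. \<forall>b\<in>B l u t. diff X u t b \<in> module.span (dscale X)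
           ((\<lambda>(w, u', t', b'). vword p X w u' t' b') `
              free_index p (\<lambda>u' t'. \<Union>l'<l. B l' u' t') (u + 1) t)))"

definition RHom_P2_cohomology ::
  "nat \<Rightarrow> ('f::field, 'x::ab_group_add) dgmod \<Rightarrow> ('f, 'y::ab_group_add) dgmod \<Rightarrow> int \<Rightarrow> int \<Rightarrow>
   ('f, int \<Rightarrow> int \<Rightarrow> ('f, 'x) resolving \<Rightarrow> 'y) subquotient" where
  "RHom_P2_cohomology p X Y u t =
     (let (Z, e) = (SOME (Z, e). semifree p Z \<and> dg_quasi_iso p Z X e) in HomP_cohomology p Z Y u t)"


section \<open>The functor \<open>G\<close>\<close>

text \<open>
  The Koszul resolution of \<open>\<F>\<^sub>p\<close> by free \<open>E(2)\<close>-modules is \<open>E(2) \<otimes> \<Gamma>\<close> with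
  \<open>d(e \<otimes> \<gamma>\<^sub>a) = \<Sum>\<^sub>i e Q\<^sub>i \<otimes> \<gamma>\<^bsub>a-i\<^esub>\<close>. The key \<open>(S, a)\<close> stands for \<open>Q\<^sub>S \<otimes> \<gamma>\<^sub>a\<close>, where \<open>Q\<^sub>S\<close> is the
  product of the \<open>Q\<^sub>i\<close>, \<open>i \<in> S\<close>, in increasing order and the multiset \<open>a\<close> indexes the basis of \<open>\<Gamma>\<close>.
  The operators \<open>v\<^sub>i: e \<otimes> \<gamma>\<^sub>a \<mapsto> e \<otimes> \<gamma>\<^bsub>a-i\<^esub>\<close> commute with \<open>d\<close>, with each other and with \<open>E(2)\<close>;
  they realise the equivalence of \<open>\<F>\<^sub>p[v\<^sub>0, v\<^sub>1, v\<^sub>2]\<close> with the derived endomorphisms of \<open>\<F>\<^sub>p\<close>.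
\<close>

type_synonym 'f koszul = "(nat set \<times> nat multiset) \<Rightarrow>\<^sub>0 'f"

definition koszul_comp :: "nat \<Rightarrow> int \<Rightarrow> int \<Rightarrow> 'f::field koszul set" where
  "koszul_comp p s n = {x. \<forall>(S, a) \<in> Poly_Mapping.keys x.
     S \<subseteq> {..<3} \<and> set_mset a \<subseteq> {..<3} \<and> int (size a) = s \<and>
     n = - (\<Sum>i\<in>S. qdeg p i) - (\<Sum>i\<in>#a. qdeg p i)}"

definition koszul_Q :: "nat \<Rightarrow> 'f::field koszul \<Rightarrow> 'f koszul" where
  "koszul_Q i = pm_extend (\<lambda>(S, a).
     if i \<in> S then 0 else Poly_Mapping.single (insert i S, a) ((-1) ^ card {j \<in> S. j < i}))"

definition koszul_mod :: "nat \<Rightarrow> int \<Rightarrow> ('f::field, 'f koszul) emod" where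
  "koszul_mod p s = \<lparr>escale = pm_scale, ecomp = koszul_comp p s, eact = (\<lambda>i n. koszul_Q i)\<rparr>"

definition koszul_d :: "nat \<Rightarrow> int \<Rightarrow> int \<Rightarrow> 'f::field koszul \<Rightarrow> 'f koszul" where
  "koszul_d p s n x = (if x \<in> koszul_comp p s n then
     pm_extend (\<lambda>(S, a). \<Sum>i \<in> set_mset a - S.
       Poly_Mapping.single (insert i S, a - {#i#}) ((-1) ^ card {j \<in> S. i < j})) x else 0)"

definition koszul_v :: "nat \<Rightarrow> nat \<Rightarrow> int \<Rightarrow> int \<Rightarrow> 'f::field koszul \<Rightarrow> 'f koszul" where
  "koszul_v p i s n x = (if x \<in> koszul_comp p s n then
     pm_extend (\<lambda>(S, a). if i \<in># a then Poly_Mapping.single (S, a - {#i#}) 1 else 0) x else 0)"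

text \<open>
  \<open>G(M)\<close> is \<open>Hom\<^sub>E(K, M)\<close> for the Koszul resolution \<open>K\<close>, with differential \<open>f \<mapsto> f \<circ> d\<close> and
  right action \<open>f v\<^sub>i = f \<circ> v\<^sub>i\<close>. The convention with differential \<open>f \<mapsto> (-1)\<^bsup>u+1\<^esup> f \<circ> d\<close> differs
  from this by an isomorphism that changes signs in each cohomological degree.
\<close>

definition G_functor ::
  "nat \<Rightarrow> ('f::field, 'a::ab_group_add) emod \<Rightarrow> ('f, int \<Rightarrow> 'f koszul \<Rightarrow> 'a) dgmod" where
  "G_functor p M =
     \<lparr>dscale = (\<lambda>c f n x. escale M c (f n x)),
      dcomp = (\<lambda>u t. Hom_E p (koszul_mod p u) M t),
      diff = (\<lambda>u t f n x. f n (koszul_d p (u + 1) n x)),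
      vact = (\<lambda>i u t f n x. f (n + qdeg p i) (koszul_v p i (u + 1) n x))\<rparr>"


section \<open>The homology of \<open>l\<^sub>k\<close> and of \<open>BP\<langle>2\<rangle>\<close>\<close>

text \<open>
  The dual Steenrod algebra in the conjugate generators. The pair \<open>(r, e)\<close> stands for the monomial
  \<open>\<Prod>\<^bsub>k\<in>r\<^esub> \<xi>\<^sub>k \<cdot> \<Prod>\<^bsub>k\<in>e\<^esub> \<tau>\<^sub>k\<close>, where the product of the \<open>\<tau>\<^sub>k\<close> is taken in increasing order; for
  \<open>p = 2\<close> only \<open>e = {}\<close> occurs.
\<close>

type_synonym steenrod_monom = "nat multiset \<times> nat set"

definition AE_monoms :: "nat \<Rightarrow> nat \<Rightarrow> steenrod_monom set" where
  "AE_monoms p m = {(r, e). 0 \<notin># r \<and>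
     (if p = 2 then e = {} \<and> (\<forall>k\<in>{1..m + 1}. even (count r k))
      else finite e \<and> (\<forall>k\<in>e. m < k))}"

definition monom_degree :: "nat \<Rightarrow> steenrod_monom \<Rightarrow> int" where
  "monom_degree p = (\<lambda>(r, e).
     (\<Sum>k\<in>#r. if p = 2 then 2 ^ k - 1 else 2 * (int p ^ k - 1)) + (\<Sum>k\<in>e. 2 * int p ^ k - 1))"

definition monom_weight :: "nat \<Rightarrow> steenrod_monom \<Rightarrow> nat" where
  "monom_weight p = (\<lambda>(r, e).
     (\<Sum>k\<in>#r. if p = 2 then 2 ^ (k - 1) else p ^ k) + (\<Sum>k\<in>e. p ^ k))"

text \<open>\<open>\<xi>\<^sub>k\<^sup>n\<close>, where \<open>\<xi>\<^sub>0 = 1\<close>.\<close>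

definition xi_power :: "nat \<Rightarrow> nat \<Rightarrow> nat multiset" where
  "xi_power k n = (if k = 0 then {#} else replicate_mset n k)"

text \<open>
  The derivation \<open>Q\<^sub>j\<close> evaluated on a monomial by the (graded) Leibniz rule. For \<open>p = 2\<close> the factor
  \<open>\<xi>\<^sub>k\<close>, which occurs \<open>count r k\<close> times, is replaced by \<open>\<xi>\<close> of index \<open>k-j-1\<close> to the power \<open>2\<^bsup>j+1\<^esup>\<close>;
  for odd \<open>p\<close> the factor \<open>\<tau>\<^sub>k\<close> is replaced by \<open>\<xi>\<close> of index \<open>k-j\<close> to the power \<open>p\<^sup>j\<close>, and the sign
  comes from moving \<open>Q\<^sub>j\<close> past the odd factors preceding \<open>\<tau>\<^sub>k\<close>.
\<close>

definition milnor_Q :: "nat \<Rightarrow> nat \<Rightarrow> (steenrod_monom \<Rightarrow>\<^sub>0 'f::field) \<Rightarrow> (steenrod_monom \<Rightarrow>\<^sub>0 'f)" where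
  "milnor_Q p j = pm_extend (\<lambda>(r, e).
     if p = 2 then
       (\<Sum>k | k \<in># r \<and> j < k.
          Poly_Mapping.single (r - {#k#} + xi_power (k - j - 1) (2 ^ (j + 1)), e) (of_nat (count r k)))
     else
       (\<Sum>k | k \<in> e \<and> j \<le> k.
          Poly_Mapping.single (r + xi_power (k - j) (p ^ j), e - {k}) ((-1) ^ card {i \<in> e. i < k})))"

definition steenrod_sub :: "nat \<Rightarrow> steenrod_monom set \<Rightarrow> ('f::field, steenrod_monom \<Rightarrow>\<^sub>0 'f) emod" where
  "steenrod_sub p S =
     \<lparr>escale = pm_scale,
      ecomp = (\<lambda>n. {x. \<forall>m \<in> Poly_Mapping.keys x. m \<in> S \<and> monom_degree p m = n}),
      eact = (\<lambda>j n. milnor_Q p j)\<rparr>"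

definition H_BP2 :: "nat \<Rightarrow> ('f::field, steenrod_monom \<Rightarrow>\<^sub>0 'f) emod" where
  "H_BP2 p = steenrod_sub p (AE_monoms p 2)"

definition H_l :: "nat \<Rightarrow> nat \<Rightarrow> ('f::field, steenrod_monom \<Rightarrow>\<^sub>0 'f) emod" where
  "H_l p k = steenrod_sub p {m \<in> AE_monoms p 1. monom_weight p m \<le> k}"

end

theory Submission
  imports Defs "HOL-Library.Product_Plus"
begin

text \<open>
  For an \<open>E(2)\<close>-module \<open>L\<close>, the dg module \<open>P(2) \<otimes> L\<close> with differential \<open>\<Sum>\<^sub>i v\<^sub>i \<otimes> Q\<^sub>i\<close> is a model of
  \<open>G(L) = Hom\<^sub>E(K, L)\<close>, where \<open>K\<close> is the Koszul resolution: an \<open>E(2)\<close>-linear map on \<open>K = E(2) \<otimes> \<Gamma>\<close> is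
  determined by its values on \<open>\<Gamma>\<close>. If \<open>L\<close> is bounded below, this model is semifree, because \<open>Q\<^sub>i\<close> lowers
  the degree. On the other side, \<open>E(2) \<otimes> \<Gamma> \<otimes> L\<close> is a free resolution of \<open>L\<close>, and by adjunction
  \<open>Hom\<^sub>P(P(2) \<otimes> L, Hom\<^sub>E(K, N)) \<cong> Hom\<^sub>E(E(2) \<otimes> \<Gamma> \<otimes> L, N)\<close> as complexes. Since neither side depends
  on the chosen resolutions, \<open>RHom\<^sub>P(G(L), G(N)) \<cong> Ext\<^sub>E(L, N)\<close> for every \<open>N\<close>.
\<close>

section \<open>Linear maps on subspaces\<close>

text \<open>Both sides are defined by \<open>SOME\<close> resolution whose elements lie in a
  prescribed type. Besides the comparison, two things are therefore required: a resolution must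
  exist in that very type, since otherwise \<open>SOME\<close> returns something arbitrary, and the
  cohomology of the Hom complex must be the same for a model living in any other type. The former is
  met by embedding the explicit models into finitely supported functions through a basis, the latter
  by lifting maps from a semifree object through mapping cones. The cone argument is the same over
  the exterior and over the polynomial algebra, so it is carried out once, for three operators that
  either anticommute with square zero or commute; a free resolution enters as a complex in
  nonpositive cohomological degrees. The lower bound on degrees acts twice: it makes the internal
  degree a filtration of the model of \<open>G(L)\<close>, and it stops the successive approximation
  by which cycles of the resolution of \<open>L\<close> are shown to bound. Square-zero relations
  are treated separately from anticommutation, because in characteristic two the latter does not
  imply the former.\<close>

lemma lin_onD:
  assumes "lin_on s V s' W f"
  shows "x \<in> V \<Longrightarrow> f x \<in> W" "x \<in> V \<Longrightarrow> y \<in> V \<Longrightarrow> f (x + y) = f x + f y" "x \<in> V \<Longrightarrow> f (s c x) = s' c (f x)"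
  using assms by (auto simp: lin_on_def)

lemma lin_on_zero:
  fixes f :: "'a::ab_group_add \<Rightarrow> 'b::ab_group_add"
  assumes "lin_on s V s' W f" "0 \<in> V"
  shows "f 0 = 0"
  using lin_onD(2)[OF assms(1), of 0 0] assms(2) by simp

lemma subspace_neg:
  assumes "vector_space s" "module.subspace s V" "x \<in> V"
  shows "- x \<in> V"
proof -
  interpret vector_space s by fact
  show ?thesis using assms(2,3) subspace_neg by blast
qed

lemma subspace_diff:
  assumes "vector_space s" "module.subspace s V" "x \<in> V" "y \<in> V"
  shows "x - y \<in> V"
proof -
  interpret vector_space s by fact
  show ?thesis using assms(2-) subspace_diff by blast
qed

lemma subspace_zero:
  assumes "vector_space s" "module.subspace s V"
  shows "0 \<in> V"
proof -
  interpret vector_space s by fact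
  show ?thesis using assms(2-) subspace_0 by blast
qed

lemma subspace_add:
  assumes "vector_space s" "module.subspace s V" "x \<in> V" "y \<in> V"
  shows "x + y \<in> V"
proof -
  interpret vector_space s by fact
  show ?thesis using assms(2-) subspace_add by blast
qed

lemma subspace_scale:
  assumes "vector_space s" "module.subspace s V" "x \<in> V"
  shows "s c x \<in> V"
proof -
  interpret vector_space s by fact
  show ?thesis using assms(2-) subspace_scale by blast
qed

lemma lin_on_neg:
  fixes f :: "'a::ab_group_add \<Rightarrow> 'b::ab_group_add"
  assumes "vector_space s" "module.subspace s V" "lin_on s V s' W f" "x \<in> V"
  shows "f (- x) = - f x"
proof -
  have "f (x + - x) = f x + f (- x)"
    using lin_onD(2)[OF assms(3,4)] subspace_neg[OF assms(1,2,4)] by blast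
  then show ?thesis using lin_on_zero[OF assms(3) subspace_zero[OF assms(1,2)]]
    by (simp add: add_eq_0_iff)
qed

lemma lin_on_diff:
  fixes f :: "'a::ab_group_add \<Rightarrow> 'b::ab_group_add"
  assumes "vector_space s" "module.subspace s V" "lin_on s V s' W f" "x \<in> V" "y \<in> V"
  shows "f (x - y) = f x - f y"
  using lin_onD(2)[OF assms(3,4) subspace_neg[OF assms(1,2,5)]] lin_on_neg[OF assms(1-3,5)] by simp

lemma lin_on_eq_on_span:
  fixes f g :: "'a::ab_group_add \<Rightarrow> 'b::ab_group_add"
  assumes "vector_space s" "module.subspace s V" "lin_on s V s' W f" "lin_on s V s' W' g"
    and T: "T \<subseteq> V" "\<And>x. x \<in> T \<Longrightarrow> f x = g x" and x: "x \<in> module.span s T"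
  shows "f x = g x"
proof -
  interpret vector_space s by fact
  \<comment> \<open>Membership in \<open>V\<close> is carried along, as linearity of
    \<open>f\<close> and \<open>g\<close> is known only there.\<close>
  have "x \<in> V \<and> f x = g x"
    using x
  proof (induction rule: span_induct_alt)
    case base
    then show ?case using assms(2) lin_on_zero assms(3,4) subspace_0 by metis
  next
    case (step c x y)
    then have "x \<in> V" "y \<in> V" "s c x \<in> V" using T assms(2) subspace_scale by auto
    then show ?case using step T assms(2) lin_onD[OF assms(3)] lin_onD[OF assms(4)]
      by (simp add: subspace_add)
  qed
  then show ?thesis by simp
qed

lemma basis_familyD:
  assumes "vector_space s" "basis_family s V I b" "i \<in> I"
  shows "b i \<in> V"
proof -
  interpret vector_space s by fact
  show ?thesis using assms by (auto simp: basis_family_def intro: span_base)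
qed

lemma basis_family_subspace:
  assumes "vector_space s" "basis_family s V I b"
  shows "module.subspace s V"
proof -
  interpret vector_space s by fact
  show ?thesis using assms by (auto simp: basis_family_def)
qed

lemma basis_family_extend:
  fixes s :: "'f::field \<Rightarrow> 'a::ab_group_add \<Rightarrow> 'a" and s' :: "'f \<Rightarrow> 'b::ab_group_add \<Rightarrow> 'b"
  assumes "vector_space s" "vector_space s'" "basis_family s V I b" "module.subspace s' W"
    "\<And>i. i \<in> I \<Longrightarrow> g i \<in> W"
  shows "\<exists>f\<in>lin_maps s V s' W. \<forall>i\<in>I. f (b i) = g i"
proof -
  interpret vector_space_pair s s' using assms by (simp add: vector_space_pair_def)
  have b: "inj_on b I" "vs1.independent (b ` I)" "vs1.span (b ` I) = V"
    using assms(3) by (auto simp: basis_family_def)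
  obtain h where h: "Vector_Spaces.linear s s' h" "\<forall>x\<in>b ` I. h x = g (the_inv_into I b x)"
    using linear_independent_extend[OF b(2), of "\<lambda>x. g (the_inv_into I b x)"] by blast
  have hb: "h (b i) = g i" if "i \<in> I" for i
    using h(2) that b(1) by (simp add: the_inv_into_f_f)
  have W: "h x \<in> W" if "x \<in> V" for x
  proof -
    have "x \<in> vs1.span (b ` I)" using b(3) that by simp
    then show ?thesis
    proof (induction rule: vs1.span_induct_alt)
      case base
      then show ?case using assms(4) linear_0[OF h(1)] vs2.subspace_0 by simp
    next
      case (step c x y)
      then show ?case using hb assms(4,5)
        by (auto simp: linear_add[OF h(1)] linear_scale[OF h(1)] vs2.subspace_add vs2.subspace_scale)
    qed
  qed
  \<comment> \<open>\<open>h\<close> is linear on the whole type; cutting it off outside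
    \<open>V\<close> puts it into \<open>lin_maps\<close>.\<close>
  define f where "f x = (if x \<in> V then h x else 0)" for x
  have V: "vs1.subspace V" using b(3) vs1.subspace_span by metis
  have "f \<in> lin_maps s V s' W"
    using W V by (auto simp: lin_maps_def lin_on_def f_def linear_add[OF h(1)] linear_scale[OF h(1)]
        vs1.subspace_add vs1.subspace_scale)
  moreover have "f (b i) = g i" if "i \<in> I" for i
    using hb[OF that] basis_familyD[OF assms(1,3) that] by (simp add: f_def)
  ultimately show ?thesis by blast
qed

text \<open>Dual coordinate functionals do the work: \<open>c i\<close> separates \<open>b i\<close>
  from the other vectors, which gives injectivity, and it vanishes on the span of the others, which
  gives independence. Only spanning has to be supplied by hand.\<close>

lemma basis_familyI:
  fixes s :: "'f::field \<Rightarrow> 'a::ab_group_add \<Rightarrow> 'a"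
  assumes "vector_space s" "module.subspace s V" "\<And>i. i \<in> I \<Longrightarrow> b i \<in> V"
    and coord: "\<And>i. i \<in> I \<Longrightarrow> lin_on s V (*) UNIV (c i)"
      "\<And>i j. i \<in> I \<Longrightarrow> j \<in> I \<Longrightarrow> c i (b j) = (if i = j then 1 else 0)"
    and span: "\<And>x. x \<in> V \<Longrightarrow> x \<in> module.span s (b ` I)"
  shows "basis_family s V I b"
proof -
  interpret vector_space s by fact
  have inj: "inj_on b I"
    by (rule inj_onI) (metis coord(2) zero_neq_one)
  have sub: "span A \<subseteq> V" if "A \<subseteq> b ` I" for A
    using that assms(2,3) by (intro span_minimal) auto
  have "independent (b ` I)"
  proof
    assume "dependent (b ` I)"
    then obtain i where i: "i \<in> I" "b i \<in> span (b ` I - {b i})"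
      by (auto simp: dependent_def)
    have "lin_on s V (*) UNIV (\<lambda>x. 0::'f)" by (simp add: lin_on_def)
    then have "c i (b i) = 0"
    proof (rule lin_on_eq_on_span[OF assms(1,2) coord(1)[OF i(1)] _ _ _ i(2)])
      show "b ` I - {b i} \<subseteq> V" using assms(3) by auto
      show "c i x = 0" if "x \<in> b ` I - {b i}" for x
        using that coord(2)[OF i(1)] by auto
    qed
    then show False using coord(2)[OF i(1) i(1)] by simp
  qed
  moreover have "span (b ` I) = V"
    using sub[of "b ` I"] span by auto
  ultimately show ?thesis using inj by (simp add: basis_family_def)
qed

section \<open>Differential graded modules over a graded algebra on three generators\<close>

text \<open>The scalar action depends on the cohomological degree \<open>u\<close>. A complex of
  \<open>E(2)\<close>-modules has a separate module, with its own scalar action, in each degree, and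
  the cone of a map takes its first factor from degree \<open>u + 1\<close>.\<close>

record ('f, 'x) gmod =
  gsc :: "int \<Rightarrow> 'f \<Rightarrow> 'x \<Rightarrow> 'x"
  gco :: "int \<Rightarrow> int \<Rightarrow> 'x set"
  gd :: "int \<Rightarrow> int \<Rightarrow> 'x \<Rightarrow> 'x"
  gop :: "nat \<Rightarrow> int \<Rightarrow> int \<Rightarrow> 'x \<Rightarrow> 'x"

text \<open>Multiplication by the sign of an integer; it turns a value of \<open>ins_sgn\<close>,
  which is \<open>0\<close>, \<open>1\<close> or \<open>-1\<close>, into an operation on any abelian
  group.\<close>

definition zs :: "int \<Rightarrow> 'a::ab_group_add \<Rightarrow> 'a" where
  "zs c y = (if c = 0 then 0 else if c > 0 then y else - y)"

definition sg :: "int \<Rightarrow> 'a::ab_group_add \<Rightarrow> 'a" where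
  "sg a y = (if even a then y else - y)"

lemma sg_simps [simp]: "sg a (sg a y) = y" "sg a 0 = 0" "sg (a + 1) y = - sg a y" "sg (a - 1) y = - sg a y"
  "sg a (- y) = - sg a y" "sg a (x + y) = sg a x + sg a y" "sg a (x - y) = sg a x - sg a y" "sg 0 y = y"
  by (auto simp: sg_def)

text \<open>The differential \<open>d f - (-1)^a f d\<close> of the Hom complex, for
  \<open>f\<close> of cohomological degree \<open>a\<close>. The value \<open>0\<close> off the
  components keeps the convention that maps vanish there, so that being a cocycle is an equation
  between functions.\<close>

definition gD ::
  "('f, 'x) gmod \<Rightarrow> ('f, 'y::ab_group_add) gmod \<Rightarrow> int \<Rightarrow> int \<Rightarrow> (int \<Rightarrow> int \<Rightarrow> 'x \<Rightarrow> 'y) \<Rightarrow> (int \<Rightarrow> int \<Rightarrow> 'x \<Rightarrow> 'y)" where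
  "gD X Y a b f = (\<lambda>u t x.
     if x \<in> gco X u t then gd Y (u + a) (t + b) (f u t x) - sg a (f (u + 1) t (gd X u t x)) else 0)"

text \<open>Words indexing the monomial basis of the exterior algebra if \<open>a\<close> holds, and
  of the polynomial algebra otherwise.\<close>

definition vwords :: "bool \<Rightarrow> nat list \<Rightarrow> bool" where
  "vwords a w \<longleftrightarrow> set w \<subseteq> {..<3} \<and> (if a then sorted_wrt (<) w else sorted w)"

text \<open>The sign in \<open>x\<^sub>i x\<^sub>w = \<plusminus>x\<^bsub>insort i w\<^esub>\<close>.\<close>

fun ins_sgn :: "bool \<Rightarrow> nat \<Rightarrow> nat list \<Rightarrow> int" where
  "ins_sgn a i [] = 1"
| "ins_sgn a i (j # w) = (if a then (if i < j then 1 else if i = j then 0 else - ins_sgn a i w) else 1)"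

lemma ins_sgn_False [simp]: "ins_sgn False i w = 1"
  by (cases w) simp_all

text \<open>In the exterior case a nonzero sign means that the letter \<open>i\<close> is new, so
  inserting it keeps the word strictly increasing.\<close>

lemma vwords_insort: "vwords a w \<Longrightarrow> i < 3 \<Longrightarrow> ins_sgn a i w \<noteq> 0 \<Longrightarrow> vwords a (insort i w)"
proof (induction w)
  case (Cons j w)
  then show ?case
    by (cases a) (auto simp: vwords_def set_insort_key split: if_splits)
qed (simp add: vwords_def)

text \<open>
  Three operators of bidegree \<open>(\<alpha>, \<beta> i)\<close>; they anticommute and have square zero if \<open>anti\<close> holds, and
  commute otherwise. The two cases cover \<open>E(2)\<close> and \<open>P(2)\<close>.
\<close>

locale grading =
  fixes \<alpha> :: int and \<beta> :: "nat \<Rightarrow> int" and anti :: bool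
begin

text \<open>The differential commutes with the operators without Koszul signs, in the exterior case
  too. The square-zero clause is separate because \<open>x = - x\<close> says nothing in
  characteristic two.\<close>

definition gmodule :: "('f::field, 'x::ab_group_add) gmod \<Rightarrow> bool" where
  "gmodule X \<longleftrightarrow>
     (\<forall>u. vector_space (gsc X u)) \<and>
     (\<forall>u t. module.subspace (gsc X u) (gco X u t)) \<and>
     (\<forall>u t. lin_on (gsc X u) (gco X u t) (gsc X (u + 1)) (gco X (u + 1) t) (gd X u t)) \<and>
     (\<forall>i<3. \<forall>u t. lin_on (gsc X u) (gco X u t) (gsc X (u + \<alpha>)) (gco X (u + \<alpha>) (t + \<beta> i)) (gop X i u t)) \<and>
     (\<forall>u t. \<forall>x\<in>gco X u t. gd X (u + 1) t (gd X u t x) = 0) \<and>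
     (\<forall>i<3. \<forall>u t. \<forall>x\<in>gco X u t.
        gd X (u + \<alpha>) (t + \<beta> i) (gop X i u t x) = gop X i (u + 1) t (gd X u t x)) \<and>
     (\<forall>i<3. \<forall>j<3. \<forall>u t. \<forall>x\<in>gco X u t.
        gop X i (u + \<alpha>) (t + \<beta> j) (gop X j u t x) =
          (if anti then - gop X j (u + \<alpha>) (t + \<beta> i) (gop X i u t x)
           else gop X j (u + \<alpha>) (t + \<beta> i) (gop X i u t x))) \<and>
     (\<forall>i<3. \<forall>u t. \<forall>x\<in>gco X u t. anti \<longrightarrow> gop X i (u + \<alpha>) (t + \<beta> i) (gop X i u t x) = 0)"

lemma gmoduleD:
  assumes "gmodule X"
  shows gmodule_vs: "vector_space (gsc X u)"
    and gmodule_sub: "module.subspace (gsc X u) (gco X u t)"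
    and gmodule_d: "lin_on (gsc X u) (gco X u t) (gsc X (u + 1)) (gco X (u + 1) t) (gd X u t)"
    and gmodule_op: "i < 3 \<Longrightarrow> lin_on (gsc X u) (gco X u t) (gsc X (u + \<alpha>)) (gco X (u + \<alpha>) (t + \<beta> i)) (gop X i u t)"
    and gmodule_dd: "x \<in> gco X u t \<Longrightarrow> gd X (u + 1) t (gd X u t x) = 0"
    and gmodule_dop: "i < 3 \<Longrightarrow> x \<in> gco X u t \<Longrightarrow>
        gd X (u + \<alpha>) (t + \<beta> i) (gop X i u t x) = gop X i (u + 1) t (gd X u t x)"
    and gmodule_opop: "i < 3 \<Longrightarrow> j < 3 \<Longrightarrow> x \<in> gco X u t \<Longrightarrow>
        gop X i (u + \<alpha>) (t + \<beta> j) (gop X j u t x) =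
          (if anti then - gop X j (u + \<alpha>) (t + \<beta> i) (gop X i u t x)
           else gop X j (u + \<alpha>) (t + \<beta> i) (gop X i u t x))"
    and gmodule_op2: "anti \<Longrightarrow> i < 3 \<Longrightarrow> x \<in> gco X u t \<Longrightarrow> gop X i (u + \<alpha>) (t + \<beta> i) (gop X i u t x) = 0"
proof -
  note X = assms[unfolded gmodule_def]
  show "vector_space (gsc X u)" by (rule X[THEN conjunct1, rule_format])
  show "module.subspace (gsc X u) (gco X u t)" by (rule X[THEN conjunct2, THEN conjunct1, rule_format])
  show "lin_on (gsc X u) (gco X u t) (gsc X (u + 1)) (gco X (u + 1) t) (gd X u t)"
    by (rule X[THEN conjunct2, THEN conjunct2, THEN conjunct1, rule_format])
  show "i < 3 \<Longrightarrow> lin_on (gsc X u) (gco X u t) (gsc X (u + \<alpha>)) (gco X (u + \<alpha>) (t + \<beta> i)) (gop X i u t)"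
    by (rule X[THEN conjunct2, THEN conjunct2, THEN conjunct2, THEN conjunct1, rule_format])
  show "x \<in> gco X u t \<Longrightarrow> gd X (u + 1) t (gd X u t x) = 0"
    by (rule X[THEN conjunct2, THEN conjunct2, THEN conjunct2, THEN conjunct2, THEN conjunct1, rule_format])
  show "i < 3 \<Longrightarrow> x \<in> gco X u t \<Longrightarrow>
        gd X (u + \<alpha>) (t + \<beta> i) (gop X i u t x) = gop X i (u + 1) t (gd X u t x)"
    by (rule X[THEN conjunct2, THEN conjunct2, THEN conjunct2, THEN conjunct2, THEN conjunct2, THEN conjunct1, rule_format])
  show "i < 3 \<Longrightarrow> j < 3 \<Longrightarrow> x \<in> gco X u t \<Longrightarrow>
        gop X i (u + \<alpha>) (t + \<beta> j) (gop X j u t x) =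
          (if anti then - gop X j (u + \<alpha>) (t + \<beta> i) (gop X i u t x)
           else gop X j (u + \<alpha>) (t + \<beta> i) (gop X i u t x))"
    by (rule X[THEN conjunct2, THEN conjunct2, THEN conjunct2, THEN conjunct2, THEN conjunct2, THEN conjunct2, THEN conjunct1, rule_format])
  show "anti \<Longrightarrow> i < 3 \<Longrightarrow> x \<in> gco X u t \<Longrightarrow> gop X i (u + \<alpha>) (t + \<beta> i) (gop X i u t x) = 0"
    by (rule X[THEN conjunct2, THEN conjunct2, THEN conjunct2, THEN conjunct2, THEN conjunct2, THEN conjunct2, THEN conjunct2, rule_format])
qed

definition ghom ::
  "('f, 'x::plus) gmod \<Rightarrow> ('f, 'y::{plus,zero}) gmod \<Rightarrow> int \<Rightarrow> int \<Rightarrow> (int \<Rightarrow> int \<Rightarrow> 'x \<Rightarrow> 'y) set" where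
  "ghom X Y a b = {f.
     (\<forall>u t. f u t \<in> lin_maps (gsc X u) (gco X u t) (gsc Y (u + a)) (gco Y (u + a) (t + b))) \<and>
     (\<forall>i<3. \<forall>u t. \<forall>x\<in>gco X u t.
        f (u + \<alpha>) (t + \<beta> i) (gop X i u t x) = gop Y i (u + a) (t + b) (f u t x))}"

lemma ghomD:
  assumes "f \<in> ghom X Y a b"
  shows ghom_lin: "lin_on (gsc X u) (gco X u t) (gsc Y (u + a)) (gco Y (u + a) (t + b)) (f u t)"
    and ghom_in: "x \<in> gco X u t \<Longrightarrow> f u t x \<in> gco Y (u + a) (t + b)"
    and ghom_out: "x \<notin> gco X u t \<Longrightarrow> f u t x = 0"
    and ghom_add: "x \<in> gco X u t \<Longrightarrow> y \<in> gco X u t \<Longrightarrow> f u t (x + y) = f u t x + f u t y"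
    and ghom_sc: "x \<in> gco X u t \<Longrightarrow> f u t (gsc X u c x) = gsc Y (u + a) c (f u t x)"
    and ghom_op: "i < 3 \<Longrightarrow> x \<in> gco X u t \<Longrightarrow>
        f (u + \<alpha>) (t + \<beta> i) (gop X i u t x) = gop Y i (u + a) (t + b) (f u t x)"
  using assms by (auto simp: ghom_def lin_maps_def lin_on_def)

lemma ghomI:
  assumes "\<And>u t. lin_on (gsc X u) (gco X u t) (gsc Y (u + a)) (gco Y (u + a) (t + b)) (f u t)"
    "\<And>u t x. x \<notin> gco X u t \<Longrightarrow> f u t x = 0"
    "\<And>i u t x. i < 3 \<Longrightarrow> x \<in> gco X u t \<Longrightarrow>
        f (u + \<alpha>) (t + \<beta> i) (gop X i u t x) = gop Y i (u + a) (t + b) (f u t x)"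
  shows "f \<in> ghom X Y a b"
  using assms by (auto simp: ghom_def lin_maps_def)

abbreviation vw :: "nat list \<Rightarrow> bool" where "vw \<equiv> vwords anti"
abbreviation ins_sg :: "nat \<Rightarrow> nat list \<Rightarrow> int" where "ins_sg \<equiv> ins_sgn anti"

lemmas vw_def = vwords_def
lemmas vw_insort = vwords_insort

section \<open>Words in the operators and their normal form\<close>

fun gword :: "('f, 'x) gmod \<Rightarrow> nat list \<Rightarrow> int \<Rightarrow> int \<Rightarrow> 'x \<Rightarrow> 'x" where
  "gword X [] u t x = x"
| "gword X (i # w) u t x = gop X i (u + \<alpha> * int (length w)) (t + (\<Sum>j\<leftarrow>w. \<beta> j)) (gword X w u t x)"

lemma sum_list_insort: "sum_list (map \<beta> (insort i w)) = \<beta> i + sum_list (map \<beta> w)"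
  by (induction w) auto

lemma gword_in:
  assumes "gmodule X" "x \<in> gco X u t" "set w \<subseteq> {..<3}"
  shows "gword X w u t x \<in> gco X (u + \<alpha> * int (length w)) (t + (\<Sum>j\<leftarrow>w. \<beta> j))"
  using assms(3)
proof (induction w)
  case (Cons i w)
  then have "gword X w u t x \<in> gco X (u + \<alpha> * int (length w)) (t + (\<Sum>j\<leftarrow>w. \<beta> j))" "i < 3" by auto
  from lin_onD(1)[OF gmodule_op[OF assms(1) this(2)] this(1)]
  show ?case by (simp add: algebra_simps)
qed (simp add: assms)

lemma gop_zs:
  assumes "gmodule X" "x \<in> gco X u t" "i < 3"
  shows "gop X i u t (zs c x) = zs c (gop X i u t x)"
  using lin_on_neg[OF gmodule_vs[OF assms(1)] gmodule_sub[OF assms(1)] gmodule_op[OF assms(1,3)] assms(2)]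
    lin_on_zero[OF gmodule_op[OF assms(1,3)] subspace_zero[OF gmodule_vs[OF assms(1)] gmodule_sub[OF assms(1)]]]
  by (simp add: zs_def)

text \<open>The straightening rule. A letter \<open>i\<close> larger than the head \<open>j\<close>
  is moved past it, at the cost of a sign in the exterior case, and is then inserted into the tail;
  if \<open>i = j\<close> in the exterior case both sides vanish, as \<open>ins_sgn\<close> is
  \<open>0\<close> there.\<close>

lemma gop_gword:
  assumes X: "gmodule X" and x: "x \<in> gco X u t" and "vw w" "i < 3"
  shows "gop X i (u + \<alpha> * int (length w)) (t + (\<Sum>j\<leftarrow>w. \<beta> j)) (gword X w u t x) =
    zs (ins_sg i w) (gword X (insort i w) u t x)"
  using assms(3)
proof (induction w)
  case (Cons j w)
  let ?U = "u + \<alpha> * int (length w)" and ?T = "t + (\<Sum>j\<leftarrow>w. \<beta> j)" and ?W = "gword X w u t x"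
  have j: "j < 3" "vw w" "set w \<subseteq> {..<3}" using Cons.prems by (auto simp: vw_def)
  have W: "?W \<in> gco X ?U ?T" using gword_in[OF X x] j by blast
  show ?case
  proof (cases "i < j \<or> i = j")
    case True
    show ?thesis
    proof (cases "anti \<and> i = j")
      case True
      then show ?thesis using gmodule_op2[OF X _ _ W, of i] assms(4) by (simp add: zs_def algebra_simps)
    next
      case False
      then show ?thesis using True by (auto simp add: zs_def)
    qed
  next
    case False
    have WI: "gword X (insort i w) u t x \<in> gco X (?U + \<alpha>) (?T + \<beta> i)"
      using gword_in[OF X x, of "insort i w"] j assms(4)
      by (simp add: set_insort_key sum_list_insort algebra_simps)
    have "gop X i (?U + \<alpha>) (?T + \<beta> j) (gop X j ?U ?T ?W) =
        zs (if anti then -1 else 1) (gop X j (?U + \<alpha>) (?T + \<beta> i) (gop X i ?U ?T ?W))"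
      by (subst gmodule_opop[OF X assms(4) j(1) W]) (simp add: zs_def)
    also have "gop X i ?U ?T ?W = zs (ins_sg i w) (gword X (insort i w) u t x)"
      using Cons.IH j by blast
    also have "gop X j (?U + \<alpha>) (?T + \<beta> i) \<dots> = zs (ins_sg i w) (gop X j (?U + \<alpha>) (?T + \<beta> i) (gword X (insort i w) u t x))"
      by (rule gop_zs[OF X WI j(1)])
    finally show ?thesis using False
      by (cases anti) (simp_all add: zs_def sum_list_insort algebra_simps)
  qed
qed (simp add: zs_def)

section \<open>Free and semifree modules, and maps out of them\<close>

definition gindex ::
  "(int \<Rightarrow> int \<Rightarrow> 'x set) \<Rightarrow> int \<Rightarrow> int \<Rightarrow> (nat list \<times> int \<times> int \<times> 'x) set" where
  "gindex B u t = {(w, u', t', b). vw w \<and> b \<in> B u' t' \<and>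
     u = u' + \<alpha> * int (length w) \<and> t = t' + (\<Sum>j\<leftarrow>w. \<beta> j)}"

abbreviation gwd :: "('f, 'x) gmod \<Rightarrow> nat list \<times> int \<times> int \<times> 'x \<Rightarrow> 'x" where
  "gwd X \<equiv> \<lambda>(w, u', t', b). gword X w u' t' b"

definition gfree :: "('f::field, 'x::ab_group_add) gmod \<Rightarrow> (int \<Rightarrow> int \<Rightarrow> 'x set) \<Rightarrow> bool" where
  "gfree X B \<longleftrightarrow> gmodule X \<and> (\<forall>u t. basis_family (gsc X u) (gco X u t) (gindex B u t) (gwd X))"

definition gsemifree :: "('f::field, 'x::ab_group_add) gmod \<Rightarrow> bool" where
  "gsemifree X \<longleftrightarrow> (\<exists>B :: nat \<Rightarrow> int \<Rightarrow> int \<Rightarrow> 'x set. gfree X (\<lambda>u t. \<Union>l. B l u t) \<and>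
     (\<forall>l u t. \<forall>b\<in>B l u t. gd X u t b \<in> module.span (gsc X (u + 1))
           (gwd X ` gindex (\<lambda>u' t'. \<Union>l'<l. B l' u' t') (u + 1) t)))"

lemma gindex_Nil: "b \<in> B u t \<Longrightarrow> ([], u, t, b) \<in> gindex B u t"
  by (simp add: gindex_def vw_def)

lemma gfree_gen:
  assumes "gfree X B" "b \<in> B u t"
  shows "b \<in> gco X u t"
proof -
  have "gmodule X" "basis_family (gsc X u) (gco X u t) (gindex B u t) (gwd X)"
    using assms(1) by (auto simp: gfree_def)
  from basis_familyD[OF gmodule_vs[OF this(1)] this(2) gindex_Nil[of b B, OF assms(2)]]
  show ?thesis by simp
qed

lemma ghom_gword:
  assumes X: "gmodule X" and f: "f \<in> ghom X Y a b" and x: "x \<in> gco X u t" and w: "set w \<subseteq> {..<3}"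
  shows "f (u + \<alpha> * int (length w)) (t + (\<Sum>j\<leftarrow>w. \<beta> j)) (gword X w u t x) = gword Y w (u + a) (t + b) (f u t x)"
  using w
proof (induction w)
  case (Cons i w)
  then have "i < 3" "set w \<subseteq> {..<3}" by auto
  with ghom_op[OF f this(1) gword_in[OF X x this(2)]] Cons.IH show ?case
    by (simp add: algebra_simps)
qed simp

text \<open>Formulated for the span of words in some family \<open>B\<close>, not for the whole
  module: the lifting argument compares maps on the part of lower filtration only.\<close>

lemma ghom_eq_on_span:
  fixes X :: "('f::field, 'x::ab_group_add) gmod" and Y :: "('f, 'y::ab_group_add) gmod"
  assumes X: "gmodule X" and f: "f \<in> ghom X Y a b" "g \<in> ghom X Y a b"
    and B: "\<And>u t x. x \<in> B u t \<Longrightarrow> x \<in> gco X u t" "\<And>u t x. x \<in> B u t \<Longrightarrow> f u t x = g u t x"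
    and x: "x \<in> module.span (gsc X u) (gwd X ` gindex B u t)"
  shows "f u t x = g u t x"
proof (rule lin_on_eq_on_span[OF gmodule_vs[OF X, of u] gmodule_sub[OF X, of u t] ghom_lin[OF f(1), of u t] ghom_lin[OF f(2), of u t], rotated 2])
  show "x \<in> module.span (gsc X u) (gwd X ` gindex B u t)" by (rule x)
  show "gwd X ` gindex B u t \<subseteq> gco X u t"
    using gword_in[OF X B(1)] by (auto simp: gindex_def vw_def)
  show "f u t y = g u t y" if "y \<in> gwd X ` gindex B u t" for y
    using that ghom_gword[OF X f(1) B(1)] ghom_gword[OF X f(2) B(1)] B(2)
    by (auto simp: gindex_def vw_def)
qed

lemma ghom_eqI:
  fixes Z :: "('f::field, 'x::ab_group_add) gmod" and Y :: "('f, 'y::ab_group_add) gmod"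
  assumes Z: "gfree Z B" and f: "f \<in> ghom Z Y a b" "g \<in> ghom Z Y a b"
    and B: "\<And>u t x. x \<in> B u t \<Longrightarrow> f u t x = g u t x"
  shows "f = g"
proof (intro ext)
  fix u t x
  have Z': "gmodule Z" "module.span (gsc Z u) (gwd Z ` gindex B u t) = gco Z u t"
    using Z by (auto simp: gfree_def basis_family_def)
  show "f u t x = g u t x"
  proof (cases "x \<in> gco Z u t")
    case True
    then show ?thesis using ghom_eq_on_span[OF Z'(1) f gfree_gen[OF Z] B] Z'(2) by blast
  qed (simp add: ghom_out[OF f(1)] ghom_out[OF f(2)])
qed

text \<open>The universal property of a free module. In each bidegree a linear map is prescribed on
  basis words; it commutes with the operators because the same straightening rule, with the same
  sign, holds in the source and in the target.\<close>

lemma ghom_extend: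
  fixes Z :: "('f::field, 'x::ab_group_add) gmod" and Y :: "('f, 'y::ab_group_add) gmod"
  assumes Z: "gfree Z B" and Y: "gmodule Y"
    and \<phi>: "\<And>u t x. x \<in> B u t \<Longrightarrow> \<phi> u t x \<in> gco Y (u + a) (t + b)"
  shows "\<exists>f\<in>ghom Z Y a b. \<forall>u t. \<forall>x\<in>B u t. f u t x = \<phi> u t x"
proof -
  have Z': "gmodule Z" and bas: "\<And>u t. basis_family (gsc Z u) (gco Z u t) (gindex B u t) (gwd Z)"
    using Z by (auto simp: gfree_def)
  let ?g = "\<lambda>(w, u', t', x). gword Y w (u' + a) (t' + b) (\<phi> u' t' x)"
  have in_Y: "?g k \<in> gco Y (u + a) (t + b)" if "k \<in> gindex B u t" for k u t
    using that gword_in[OF Y \<phi>] by (auto simp: gindex_def vw_def algebra_simps)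
  let ?P = "\<lambda>u t f. f \<in> lin_maps (gsc Z u) (gco Z u t) (gsc Y (u + a)) (gco Y (u + a) (t + b)) \<and>
      (\<forall>k\<in>gindex B u t. f (gwd Z k) = ?g k)"
  have ex: "\<exists>f. ?P u t f" for u t
    unfolding Bex_def[symmetric] by (rule basis_family_extend[OF gmodule_vs[OF Z'] gmodule_vs[OF Y] bas gmodule_sub[OF Y] in_Y])
  \<comment> \<open>One linear map is chosen in every bidegree. Nothing ties the choices together
    here; compatibility with the operators follows from their values on basis words.\<close>
  define f where "f u t = (SOME f. ?P u t f)" for u t
  have P: "?P u t (f u t)" for u t
    unfolding f_def by (rule someI_ex[OF ex])
  have f: "f u t \<in> lin_maps (gsc Z u) (gco Z u t) (gsc Y (u + a)) (gco Y (u + a) (t + b))"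
    "k \<in> gindex B u t \<Longrightarrow> f u t (gwd Z k) = ?g k" for u t k
    using P by blast+
  have lin: "lin_on (gsc Z u) (gco Z u t) (gsc Y (u + a)) (gco Y (u + a) (t + b)) (f u t)" for u t
    using f(1) by (simp add: lin_maps_def)
  have f_zs: "f u t (zs c x) = zs c (f u t x)" if "x \<in> gco Z u t" for u t c x
    using lin_on_neg[OF gmodule_vs[OF Z'] gmodule_sub[OF Z'] lin that]
     lin_on_zero[OF lin subspace_zero[OF gmodule_vs[OF Z'] gmodule_sub[OF Z']]] by (simp add: zs_def)
  have "f \<in> ghom Z Y a b"
  proof (rule ghomI)
    fix i :: nat and u t x
    assume i: "i < 3" and x: "x \<in> gco Z u t"
    have l1: "lin_on (gsc Z u) (gco Z u t) (gsc Y (u + a + \<alpha>)) (gco Y (u + a + \<alpha>) (t + b + \<beta> i))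
        (\<lambda>x. f (u + \<alpha>) (t + \<beta> i) (gop Z i u t x))"
      using lin_onD[OF gmodule_op[OF Z' i, of u t]] lin_onD[OF lin[of "u + \<alpha>" "t + \<beta> i"]]
      by (simp add: lin_on_def algebra_simps)
    have l2: "lin_on (gsc Z u) (gco Z u t) (gsc Y (u + a + \<alpha>)) (gco Y (u + a + \<alpha>) (t + b + \<beta> i))
        (\<lambda>x. gop Y i (u + a) (t + b) (f u t x))"
      using lin_onD[OF gmodule_op[OF Y i, of "u + a" "t + b"]] lin_onD[OF lin[of u t]]
      by (simp add: lin_on_def)
    show "f (u + \<alpha>) (t + \<beta> i) (gop Z i u t x) = gop Y i (u + a) (t + b) (f u t x)"
    proof (rule lin_on_eq_on_span[OF gmodule_vs[OF Z'] gmodule_sub[OF Z'] l1 l2, where T = "gwd Z ` gindex B u t"])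
      show "gwd Z ` gindex B u t \<subseteq> gco Z u t"
        using basis_familyD[OF gmodule_vs[OF Z'] bas] by auto
      show "x \<in> module.span (gsc Z u) (gwd Z ` gindex B u t)"
        using bas[of u t] x by (simp add: basis_family_def)
      fix y assume "y \<in> gwd Z ` gindex B u t"
      then obtain w u' t' z where k: "(w, u', t', z) \<in> gindex B u t" and y: "y = gword Z w u' t' z" by auto
      then have w: "vw w" and z: "z \<in> B u' t'" and ut: "u = u' + \<alpha> * int (length w)" "t = t' + (\<Sum>j\<leftarrow>w. \<beta> j)"
        by (auto simp: gindex_def)
      have zZ: "z \<in> gco Z u' t'" by (rule gfree_gen[OF Z z])
      let ?c = "ins_sg i w"
      have 1: "gop Z i u t y = zs ?c (gword Z (insort i w) u' t' z)"
        unfolding y ut by (rule gop_gword[OF Z' zZ w i])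
      have 2: "gop Y i (u + a) (t + b) (f u t y) = zs ?c (gword Y (insort i w) (u' + a) (t' + b) (\<phi> u' t' z))"
        using gop_gword[OF Y \<phi>[OF z] w i] f(2)[OF k] by (simp add: y ut algebra_simps)
      show "f (u + \<alpha>) (t + \<beta> i) (gop Z i u t y) = gop Y i (u + a) (t + b) (f u t y)"
      \<comment> \<open>If the sign is \<open>0\<close>, both sides vanish; otherwise the inserted
        word indexes a basis element of the next bidegree, where the value of \<open>f\<close> is
        prescribed.\<close>
      proof (cases "?c = 0")
        case True
        then show ?thesis unfolding 1 2
          using lin_on_zero[OF lin subspace_zero[OF gmodule_vs[OF Z'] gmodule_sub[OF Z']]] by (simp add: zs_def)
      next
        case False
        have k': "(insort i w, u', t', z) \<in> gindex B (u + \<alpha>) (t + \<beta> i)"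
          using vw_insort[OF w i False] z ut by (simp add: gindex_def sum_list_insort algebra_simps)
        have "gword Z (insort i w) u' t' z \<in> gco Z (u + \<alpha>) (t + \<beta> i)"
          using basis_familyD[OF gmodule_vs[OF Z'] bas k'] by simp
        then show ?thesis unfolding 1 2 using f(2)[OF k'] by (simp add: f_zs)
      qed
    qed
  qed (use lin f(1) in \<open>auto simp: lin_maps_def\<close>)
  moreover have "f u t x = \<phi> u t x" if "x \<in> B u t" for u t x
    using f(2)[OF gindex_Nil[of x B, OF that]] by simp
  ultimately show ?thesis by blast
qed

end

section \<open>Isomorphisms of subquotients\<close>

text \<open>A \<open>subquotient\<close> is a bare record. These closure properties make its classes
  the cosets of a subgroup and make addition and scaling of classes well defined.\<close>

definition sq_wf :: "('f, 'v::ab_group_add) subquotient \<Rightarrow> bool" where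
  "sq_wf H \<longleftrightarrow> 0 \<in> boundaries H \<and> (\<forall>x\<in>boundaries H. \<forall>y\<in>boundaries H. x + y \<in> boundaries H) \<and>
     (\<forall>x\<in>boundaries H. - x \<in> boundaries H) \<and> boundaries H \<subseteq> cycles H \<and>
     (\<forall>x\<in>cycles H. \<forall>y\<in>cycles H. x + y \<in> cycles H) \<and> (\<forall>x\<in>cycles H. - x \<in> cycles H) \<and> (\<forall>c. \<forall>x\<in>cycles H. sq_scale H c x \<in> cycles H) \<and>
     (\<forall>c. \<forall>x\<in>cycles H. \<forall>y\<in>cycles H. x - y \<in> boundaries H \<longrightarrow>
        sq_scale H c x - sq_scale H c y \<in> boundaries H)"

text \<open>A map of representatives that induces an isomorphism on classes: the equivalence about
  boundaries gives well-definedness and injectivity, the final clause surjectivity.\<close>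

definition sq_map ::
  "('f, 'v::ab_group_add) subquotient \<Rightarrow> ('f, 'w::ab_group_add) subquotient \<Rightarrow> ('v \<Rightarrow> 'w) \<Rightarrow> bool" where
  "sq_map H H' \<Phi> \<longleftrightarrow> (\<forall>x\<in>cycles H. \<Phi> x \<in> cycles H') \<and>
     (\<forall>x\<in>cycles H. \<forall>y\<in>cycles H. \<Phi> (x + y) = \<Phi> x + \<Phi> y) \<and>
     (\<forall>c. \<forall>x\<in>cycles H. \<Phi> (sq_scale H c x) = sq_scale H' c (\<Phi> x)) \<and>
     (\<forall>x\<in>cycles H. \<Phi> x \<in> boundaries H' \<longleftrightarrow> x \<in> boundaries H) \<and>
     (\<forall>y\<in>cycles H'. \<exists>x\<in>cycles H. y - \<Phi> x \<in> boundaries H')"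

lemma sq_class_eq_iff:
  assumes "sq_wf H"
  shows "sq_class H x = sq_class H y \<longleftrightarrow> x - y \<in> boundaries H"
proof
  assume "sq_class H x = sq_class H y"
  moreover have "x + 0 \<in> sq_class H x" using assms unfolding sq_wf_def sq_class_def by blast
  ultimately show "x - y \<in> boundaries H" by (auto simp: sq_class_def)
next
  assume a: "x - y \<in> boundaries H"
  have neg: "y - x \<in> boundaries H" using assms a unfolding sq_wf_def by (metis minus_diff_eq)
  have add: "u + v \<in> boundaries H" if "u \<in> boundaries H" "v \<in> boundaries H" for u v
    using that assms by (auto simp: sq_wf_def)
  have 1: "z + b \<in> sq_class H w" if "z - w \<in> boundaries H" "b \<in> boundaries H" for z w b
  proof -
    have "z + b = w + ((z - w) + b)" by simp
    then show ?thesis using add[OF that] unfolding sq_class_def by blast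
  qed
  show "sq_class H x = sq_class H y"
    using 1[OF a] 1[OF neg] by (auto simp: sq_class_def[of H x] sq_class_def[of H y])
qed

lemma sq_map_iso:
  fixes H :: "('f, 'v::ab_group_add) subquotient" and H' :: "('f, 'w::ab_group_add) subquotient"
  assumes H: "sq_wf H" and H': "sq_wf H'" and \<Phi>: "sq_map H H' \<Phi>"
  shows "\<exists>\<phi>. sq_iso H H' \<phi>"
proof -
  \<comment> \<open>The class map picks some cycle in the class; \<open>bd\<close> shows that the
    choice does not matter.\<close>
  define \<phi> where "\<phi> C = sq_class H' (\<Phi> (SOME z. z \<in> cycles H \<and> C = sq_class H z))" for C
  have bd: "\<Phi> x - \<Phi> y \<in> boundaries H' \<longleftrightarrow> x - y \<in> boundaries H" if xy: "x \<in> cycles H" "y \<in> cycles H" for x y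
  proof -
    have neg: "x - y \<in> cycles H"
      using xy H unfolding sq_wf_def by (metis add_uminus_conv_diff)
    have "\<Phi> x = \<Phi> (x - y) + \<Phi> y"
      using neg xy \<Phi> unfolding sq_map_def by (metis diff_add_cancel)
    moreover have "\<Phi> (x - y) \<in> boundaries H' \<longleftrightarrow> x - y \<in> boundaries H"
      using neg \<Phi> unfolding sq_map_def by blast
    ultimately show ?thesis by simp
  qed
  have \<Phi>_in: "\<Phi> x \<in> cycles H'" if "x \<in> cycles H" for x using \<Phi> that by (simp add: sq_map_def)
  have cls: "\<phi> (sq_class H x) = sq_class H' (\<Phi> x)" if x: "x \<in> cycles H" for x
  proof -
    have "\<exists>z. z \<in> cycles H \<and> sq_class H x = sq_class H z" using x by blast
    from someI_ex[OF this] show ?thesis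
      unfolding \<phi>_def by (metis (mono_tags, lifting) x bd sq_class_eq_iff[OF H] sq_class_eq_iff[OF H'])
  qed
  have "bij_betw \<phi> (sq_carrier H) (sq_carrier H')"
    unfolding bij_betw_def
  proof
    show "inj_on \<phi> (sq_carrier H)"
      by (auto simp: inj_on_def sq_carrier_def cls sq_class_eq_iff[OF H] sq_class_eq_iff[OF H'] bd)
    show "\<phi> ` sq_carrier H = sq_carrier H'"
    proof
      show "\<phi> ` sq_carrier H \<subseteq> sq_carrier H'"
        by (auto simp: sq_carrier_def cls \<Phi>_in)
      show "sq_carrier H' \<subseteq> \<phi> ` sq_carrier H"
      proof
        fix C assume "C \<in> sq_carrier H'"
        then obtain y where y: "y \<in> cycles H'" "C = sq_class H' y" by (auto simp: sq_carrier_def)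
        then obtain x where x: "x \<in> cycles H" "y - \<Phi> x \<in> boundaries H'" using \<Phi> by (auto simp: sq_map_def)
        then have "C = \<phi> (sq_class H x)" using y cls by (simp add: sq_class_eq_iff[OF H'])
        then show "C \<in> \<phi> ` sq_carrier H" using x by (auto simp: sq_carrier_def)
      qed
    qed
  qed
  moreover have "\<phi> (sq_class H (x + y)) = sq_class H' (x' + y') \<and>
        (\<forall>c. \<phi> (sq_class H (sq_scale H c x)) = sq_class H' (sq_scale H' c x'))"
    if x: "x \<in> cycles H" "y \<in> cycles H" "x' \<in> cycles H'" "y' \<in> cycles H'"
      "\<phi> (sq_class H x) = sq_class H' x'" "\<phi> (sq_class H y) = sq_class H' y'" for x y x' y'
  proof -
    have d: "\<Phi> x - x' \<in> boundaries H'" "\<Phi> y - y' \<in> boundaries H'"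
      using x by (simp_all add: cls sq_class_eq_iff[OF H'])
    have "x + y \<in> cycles H" "\<And>c. sq_scale H c x \<in> cycles H" using x H by (auto simp: sq_wf_def)
    moreover have "\<Phi> (x + y) - (x' + y') \<in> boundaries H'"
    proof -
      have "\<Phi> (x + y) - (x' + y') = (\<Phi> x - x') + (\<Phi> y - y')"
        using x \<Phi> by (simp add: sq_map_def)
      then show ?thesis using d H' unfolding sq_wf_def by metis
    qed
    moreover have "\<Phi> (sq_scale H c x) - sq_scale H' c x' \<in> boundaries H'" for c
    proof -
      have "\<Phi> (sq_scale H c x) = sq_scale H' c (\<Phi> x)" using x \<Phi> by (simp add: sq_map_def)
      then show ?thesis using d(1) H' x \<Phi>_in unfolding sq_wf_def by metis
    qed
    ultimately show ?thesis by (simp add: cls sq_class_eq_iff[OF H'])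
  qed
  ultimately show ?thesis unfolding sq_iso_def by blast
qed

section \<open>Linearity and closure properties of the Hom complex\<close>

context grading
begin

lemma subspace_sg:
  assumes "vector_space s" "module.subspace s V" "x \<in> V"
  shows "sg a x \<in> V"
  using subspace_neg[OF assms] assms(3) by (simp add: sg_def)

lemma sg_sg: "sg (a + b) y = sg a (sg b y)"
  by (auto simp: sg_def)

lemma lin_onI:
  assumes "\<And>x. x \<in> V \<Longrightarrow> f x \<in> W" "\<And>x y. x \<in> V \<Longrightarrow> y \<in> V \<Longrightarrow> f (x + y) = f x + f y"
    "\<And>c x. x \<in> V \<Longrightarrow> f (s c x) = s' c (f x)"
  shows "lin_on s V s' W f"
  using assms by (auto simp: lin_on_def)

lemma ghom_zero:
  fixes X :: "('f::field, 'x::ab_group_add) gmod" and Y :: "('f, 'y::ab_group_add) gmod"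
  assumes "gmodule X" "f \<in> ghom X Y a b"
  shows "f u t 0 = 0"
  using lin_on_zero[OF ghom_lin[OF assms(2)] subspace_zero[OF gmodule_vs gmodule_sub]] assms(1) by blast

lemma gco_closed:
  fixes X :: "('f::field, 'x::ab_group_add) gmod"
  assumes "gmodule X"
  shows "0 \<in> gco X u t" "x \<in> gco X u t \<Longrightarrow> y \<in> gco X u t \<Longrightarrow> x + y \<in> gco X u t"
    "x \<in> gco X u t \<Longrightarrow> y \<in> gco X u t \<Longrightarrow> x - y \<in> gco X u t"
    "x \<in> gco X u t \<Longrightarrow> - x \<in> gco X u t" "x \<in> gco X u t \<Longrightarrow> sg a x \<in> gco X u t"
    "x \<in> gco X u t \<Longrightarrow> gsc X u c x \<in> gco X u t"
  using subspace_zero[OF gmodule_vs[OF assms] gmodule_sub[OF assms]] subspace_add[OF gmodule_vs[OF assms] gmodule_sub[OF assms]]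
    subspace_diff[OF gmodule_vs[OF assms] gmodule_sub[OF assms]] subspace_neg[OF gmodule_vs[OF assms] gmodule_sub[OF assms]]
    subspace_sg[OF gmodule_vs[OF assms] gmodule_sub[OF assms]] subspace_scale[OF gmodule_vs[OF assms] gmodule_sub[OF assms]]
  by auto

lemma gd_in:
  assumes "gmodule X" "x \<in> gco X u t"
  shows "gd X u t x \<in> gco X (u + 1) t"
  using lin_onD(1)[OF gmodule_d[OF assms(1)] assms(2)] .

lemma gop_in:
  assumes "gmodule X" "i < 3" "x \<in> gco X u t"
  shows "gop X i u t x \<in> gco X (u + \<alpha>) (t + \<beta> i)"
  using lin_onD(1)[OF gmodule_op[OF assms(1,2)] assms(3)] .

lemma gsc_lin:
  assumes "gmodule X"
  shows "gsc X u c (x + y) = gsc X u c x + gsc X u c y" "gsc X u c (x - y) = gsc X u c x - gsc X u c y"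
    "gsc X u c (- x) = - gsc X u c x" "gsc X u c (sg a x) = sg a (gsc X u c x)" "gsc X u c 0 = 0"
proof -
  interpret vector_space "gsc X u" by (rule gmodule_vs[OF assms])
  show "gsc X u c (x + y) = gsc X u c x + gsc X u c y" "gsc X u c (x - y) = gsc X u c x - gsc X u c y"
    "gsc X u c (- x) = - gsc X u c x" "gsc X u c 0 = 0"
    by (simp_all add: scale_right_distrib scale_right_diff_distrib)
  show "gsc X u c (sg a x) = sg a (gsc X u c x)" by (simp add: sg_def)
qed

lemma gd_lin:
  assumes "gmodule X" "x \<in> gco X u t"
  shows "y \<in> gco X u t \<Longrightarrow> gd X u t (x + y) = gd X u t x + gd X u t y"
    "y \<in> gco X u t \<Longrightarrow> gd X u t (x - y) = gd X u t x - gd X u t y"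
    "gd X u t (- x) = - gd X u t x" "gd X u t (sg a x) = sg a (gd X u t x)"
    "gd X u t (gsc X u c x) = gsc X (u + 1) c (gd X u t x)" "gd X u t 0 = 0"
  using lin_onD[OF gmodule_d[OF assms(1)]] lin_on_diff[OF gmodule_vs[OF assms(1)] gmodule_sub[OF assms(1)] gmodule_d[OF assms(1)]]
    lin_on_neg[OF gmodule_vs[OF assms(1)] gmodule_sub[OF assms(1)] gmodule_d[OF assms(1)]]
    lin_on_zero[OF gmodule_d[OF assms(1)] gco_closed(1)[OF assms(1)]] assms(2)
  by (auto simp: sg_def)

lemma gop_lin:
  assumes "gmodule X" "i < 3" "x \<in> gco X u t"
  shows "y \<in> gco X u t \<Longrightarrow> gop X i u t (x + y) = gop X i u t x + gop X i u t y"
    "y \<in> gco X u t \<Longrightarrow> gop X i u t (x - y) = gop X i u t x - gop X i u t y"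
    "gop X i u t (- x) = - gop X i u t x" "gop X i u t (sg a x) = sg a (gop X i u t x)"
    "gop X i u t (gsc X u c x) = gsc X (u + \<alpha>) c (gop X i u t x)" "gop X i u t 0 = 0"
  using lin_onD[OF gmodule_op[OF assms(1,2)]] lin_on_diff[OF gmodule_vs[OF assms(1)] gmodule_sub[OF assms(1)] gmodule_op[OF assms(1,2)]]
    lin_on_neg[OF gmodule_vs[OF assms(1)] gmodule_sub[OF assms(1)] gmodule_op[OF assms(1,2)]]
    lin_on_zero[OF gmodule_op[OF assms(1,2)] gco_closed(1)[OF assms(1)]] assms(3)
  by (auto simp: sg_def)

lemma ghom_lin':
  fixes X :: "('f::field, 'x::ab_group_add) gmod" and Y :: "('f, 'y::ab_group_add) gmod"
  assumes "gmodule X" "f \<in> ghom X Y a b" "x \<in> gco X u t"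
  shows "y \<in> gco X u t \<Longrightarrow> f u t (x - y) = f u t x - f u t y"
    "f u t (- x) = - f u t x" "f u t (sg a' x) = sg a' (f u t x)"
  using lin_on_diff[OF gmodule_vs[OF assms(1)] gmodule_sub[OF assms(1)] ghom_lin[OF assms(2)]]
    lin_on_neg[OF gmodule_vs[OF assms(1)] gmodule_sub[OF assms(1)] ghom_lin[OF assms(2)]] assms(3)
  by (auto simp: sg_def)

lemma gD_ghom:
  fixes X :: "('f::field, 'x::ab_group_add) gmod" and Y :: "('f, 'y::ab_group_add) gmod"
  assumes X: "gmodule X" and Y: "gmodule Y" and f: "f \<in> ghom X Y a b"
  shows "gD X Y a b f \<in> ghom X Y (a + 1) b"
proof (rule ghomI)
  fix u t
  have fd: "f (u + 1) t (gd X u t x) \<in> gco Y (u + a + 1) (t + b)" if "x \<in> gco X u t" for x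
    using ghom_in[OF f gd_in[OF X that]] by (simp add: algebra_simps)
  have scd: "f (u + 1) t (gsc X (u + 1) c (gd X u t x)) = gsc Y (u + a + 1) c (f (u + 1) t (gd X u t x))" if "x \<in> gco X u t" for x c
    using ghom_sc[OF f gd_in[OF X that], of c] by (simp add: add_ac)
  note fx = ghom_in[OF f] and dx = gd_in[OF X]
  show "lin_on (gsc X u) (gco X u t) (gsc Y (u + (a + 1))) (gco Y (u + (a + 1)) (t + b)) (gD X Y a b f u t)"
    unfolding add.assoc[symmetric]
  proof (rule lin_onI)
    fix x assume x: "x \<in> gco X u t"
    show "gD X Y a b f u t x \<in> gco Y (u + a + 1) (t + b)"
      using x gco_closed[OF Y] gd_in[OF Y] fx fd by (simp add: gD_def)
    fix y assume y: "y \<in> gco X u t"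
    show "gD X Y a b f u t (x + y) = gD X Y a b f u t x + gD X Y a b f u t y"
      using x y by (simp add: gD_def gco_closed[OF X] ghom_add[OF f] gd_lin[OF X] gd_lin[OF Y] fx dx)
  next
    fix c x assume x: "x \<in> gco X u t"
    with scd[OF x, of c] show "gD X Y a b f u t (gsc X u c x) = gsc Y (u + a + 1) c (gD X Y a b f u t x)"
      by (simp add: gD_def gco_closed[OF X] ghom_sc[OF f, of _ u] gd_lin[OF X] gd_lin[OF Y] fx dx gsc_lin[OF Y] scd)
  qed
next
  fix i :: nat and u t x assume i: "i < 3" and x: "x \<in> gco X u t"
  have 1: "f (u + \<alpha> + 1) (t + \<beta> i) (gop X i (u + 1) t (gd X u t x)) = gop Y i (u + a + 1) (t + b) (f (u + 1) t (gd X u t x))"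
    using ghom_op[OF f i gd_in[OF X x]] by (simp add: algebra_simps)
  have 2: "gd Y (u + \<alpha> + a) (t + \<beta> i + b) (gop Y i (u + a) (t + b) (f u t x)) =
      gop Y i (u + a + 1) (t + b) (gd Y (u + a) (t + b) (f u t x))"
    using gmodule_dop[OF Y i ghom_in[OF f x]] by (simp add: algebra_simps)
  have fd: "f (u + 1) t (gd X u t x) \<in> gco Y (u + a + 1) (t + b)"
    using ghom_in[OF f gd_in[OF X x]] by (simp add: algebra_simps)
  show "gD X Y a b f (u + \<alpha>) (t + \<beta> i) (gop X i u t x) = gop Y i (u + (a + 1)) (t + b) (gD X Y a b f u t x)"
    unfolding add.assoc[symmetric] using x
    by (simp add: gD_def gop_in[OF X i] ghom_op[OF f i] gmodule_dop[OF X i] 1 2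
        gop_lin[OF Y i] gd_in[OF Y ghom_in[OF f x]] gco_closed[OF Y] fd)
qed (simp add: gD_def)

lemma ghom_comp:
  fixes X :: "('f::field, 'x::ab_group_add) gmod" and Y :: "('f, 'y::ab_group_add) gmod"
    and W :: "('f, 'w::ab_group_add) gmod"
  assumes g: "g \<in> ghom X Y a b" and f: "f \<in> ghom Y W a' b'" and X: "gmodule X" "gmodule Y"
  shows "(\<lambda>u t x. f (u + a) (t + b) (g u t x)) \<in> ghom X W (a + a') (b + b')"
proof (rule ghomI)
  fix u t
  show "lin_on (gsc X u) (gco X u t) (gsc W (u + (a + a'))) (gco W (u + (a + a')) (t + (b + b')))
      (\<lambda>x. f (u + a) (t + b) (g u t x))"
    using ghom_in[OF f ghom_in[OF g]] ghom_sc[OF f ghom_in[OF g]]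
    by (intro lin_onI) (simp_all add: add.assoc ghom_add[OF g] ghom_add[OF f] ghom_sc[OF g] ghom_in[OF g])
  show "f (u + a) (t + b) (g u t x) = 0" if "x \<notin> gco X u t" for x
    using ghom_out[OF g that] ghom_zero[OF X(2) f] by simp
  fix i :: nat and x assume i: "i < 3" and x: "x \<in> gco X u t"
  show "f (u + \<alpha> + a) (t + \<beta> i + b) (g (u + \<alpha>) (t + \<beta> i) (gop X i u t x)) =
      gop W i (u + (a + a')) (t + (b + b')) (f (u + a) (t + b) (g u t x))"
    using ghom_op[OF g i x] ghom_op[OF f i ghom_in[OF g x]] by (simp add: add_ac)
qed

text \<open>The Leibniz rule: \<open>D (f g)\<close> is \<open>D f\<close> after \<open>g\<close>,
  plus \<open>f\<close> after \<open>D g\<close> with the sign of the degree of \<open>f\<close>.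
  The two occurrences of \<open>f d g\<close> cancel.\<close>

lemma gD_comp:
  assumes g: "g \<in> ghom X Y a b" and f: "f \<in> ghom Y W a' b'"
    and X: "gmodule X" "gmodule Y" "gmodule W" and x: "x \<in> gco X u t"
  shows "gD X W (a + a') (b + b') (\<lambda>u t x. f (u + a) (t + b) (g u t x)) u t x =
     gD Y W a' b' f (u + a) (t + b) (g u t x) + sg a' (f (u + (a + 1)) (t + b) (gD X Y a b g u t x))"
proof -
  have i: "gd Y (u + a) (t + b) (g u t x) \<in> gco Y (u + (a + 1)) (t + b)" "g (u + 1) t (gd X u t x) \<in> gco Y (u + (a + 1)) (t + b)"
    using gd_in[OF X(2) ghom_in[OF g x]] ghom_in[OF g gd_in[OF X(1) x]] by (simp_all add: add_ac)
  have "sg a' (f (u + (a + 1)) (t + b) (gD X Y a b g u t x)) =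
     sg a' (f (u + (a + 1)) (t + b) (gd Y (u + a) (t + b) (g u t x))) - sg a' (sg a (f (u + (a + 1)) (t + b) (g (u + 1) t (gd X u t x))))"
    using x i by (simp add: gD_def ghom_lin'[OF X(2) f] gco_closed[OF X(2)])
  then show ?thesis using x ghom_in[OF g x] by (simp add: gD_def sg_sg[symmetric] add_ac)
qed

lemma ghom_plus:
  assumes "gmodule Y" "f \<in> ghom X Y a b" "g \<in> ghom X Y a b" "gmodule X"
  shows "f + g \<in> ghom X Y a b"
proof (rule ghomI)
  fix u t
  show "lin_on (gsc X u) (gco X u t) (gsc Y (u + a)) (gco Y (u + a) (t + b)) ((f + g) u t)"
    using assms by (intro lin_onI) (simp_all add: gco_closed ghom_in ghom_add ghom_sc gsc_lin)
next
  fix i :: nat and u t x assume "i < 3" "x \<in> gco X u t"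
  then show "(f + g) (u + \<alpha>) (t + \<beta> i) (gop X i u t x) = gop Y i (u + a) (t + b) ((f + g) u t x)"
    using assms by (simp add: ghom_op[OF assms(2)] ghom_op[OF assms(3)] gop_lin(1)[OF assms(1)] ghom_in)
qed (simp add: ghom_out[OF assms(2)] ghom_out[OF assms(3)])

lemma ghom_neg:
  assumes "gmodule Y" "f \<in> ghom X Y a b" "gmodule X"
  shows "- f \<in> ghom X Y a b"
proof (rule ghomI)
  fix u t
  show "lin_on (gsc X u) (gco X u t) (gsc Y (u + a)) (gco Y (u + a) (t + b)) ((- f) u t)"
    using assms by (intro lin_onI) (simp_all add: gco_closed ghom_in ghom_add ghom_sc gsc_lin)
next
  fix i :: nat and u t x assume "i < 3" "x \<in> gco X u t"
  then show "(- f) (u + \<alpha>) (t + \<beta> i) (gop X i u t x) = gop Y i (u + a) (t + b) ((- f) u t x)"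
    using assms by (simp add: ghom_op[OF assms(2)] gop_lin(3)[OF assms(1)] ghom_in)
qed (simp add: ghom_out[OF assms(2)])

lemma ghom_scale:
  assumes "gmodule Y" "f \<in> ghom X Y a b" "gmodule X"
  shows "(\<lambda>u t x. gsc Y (u + a) c (f u t x)) \<in> ghom X Y a b"
proof (rule ghomI)
  fix u t
  interpret vector_space "gsc Y (u + a)" by (rule gmodule_vs[OF assms(1)])
  show "lin_on (gsc X u) (gco X u t) (gsc Y (u + a)) (gco Y (u + a) (t + b)) (\<lambda>x. gsc Y (u + a) c (f u t x))"
    using assms by (intro lin_onI) (simp_all add: gco_closed ghom_in ghom_add ghom_sc gsc_lin mult.commute)
next
  fix i :: nat and u t x assume "i < 3" "x \<in> gco X u t"
  then show "gsc Y (u + \<alpha> + a) c (f (u + \<alpha>) (t + \<beta> i) (gop X i u t x)) =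
      gop Y i (u + a) (t + b) (gsc Y (u + a) c (f u t x))"
    using gop_lin(5)[OF assms(1) _ ghom_in[OF assms(2)], of i x u t c] ghom_op[OF assms(2), of i x u t]
    by (simp add: add_ac)
qed (simp add: ghom_out[OF assms(2)] gsc_lin[OF assms(1)])

lemma gD_plus:
  assumes "gmodule Y" "f \<in> ghom X Y a b" "g \<in> ghom X Y a b"
  shows "gD X Y a b (f + g) = gD X Y a b f + gD X Y a b g"
  using assms by (auto simp: gD_def fun_eq_iff gd_lin(1) ghom_in)

lemma gD_neg:
  assumes "gmodule Y" "f \<in> ghom X Y a b"
  shows "gD X Y a b (- f) = - gD X Y a b f"
  using assms by (auto simp: gD_def fun_eq_iff gd_lin(3) ghom_in)

lemma gD_scale:
  assumes "gmodule X" "gmodule Y" "f \<in> ghom X Y a b"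
  shows "gD X Y a b (\<lambda>u t x. gsc Y (u + a) c (f u t x)) = (\<lambda>u t x. gsc Y (u + (a + 1)) c (gD X Y a b f u t x))"
proof (intro ext)
  fix u t x
  show "gD X Y a b (\<lambda>u t x. gsc Y (u + a) c (f u t x)) u t x = gsc Y (u + (a + 1)) c (gD X Y a b f u t x)"
    using gd_lin(5)[OF assms(2) ghom_in[OF assms(3)], of x u t c]
    by (simp add: gD_def gsc_lin[OF assms(2)] add_ac)
qed

lemma ghom_0:
  assumes "gmodule X" "gmodule Y"
  shows "0 \<in> ghom X Y a b"
proof -
  have "gop Y i u t 0 = 0" if "i < 3" for i u t
    using gop_lin(6)[OF assms(2) that gco_closed(1)[OF assms(2)]] .
  then show ?thesis
    by (intro ghomI lin_onI) (simp_all add: gco_closed[OF assms(2)] gsc_lin[OF assms(2)])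
qed

lemma gD_0: "gmodule Y \<Longrightarrow> gD X Y a b 0 = 0"
  using gd_lin(6)[OF _ gco_closed(1), of Y] by (simp add: gD_def fun_eq_iff)

section \<open>Lifting against acyclic modules\<close>

definition acyclic :: "('f::field, 'x::ab_group_add) gmod \<Rightarrow> bool" where
  "acyclic X \<longleftrightarrow> (\<forall>u t. \<forall>x\<in>gco X u t. gd X u t x = 0 \<longrightarrow> (\<exists>y\<in>gco X (u - 1) t. gd X (u - 1) t y = x))"

text \<open>Maps from a semifree module into an acyclic one have no cohomology. The primitive
  \<open>g\<close> is built along the filtration: on a new generator \<open>x\<close> some
  \<open>y\<close> with \<open>d y = f x + (-1)^a g (d x)\<close> is needed, where
  \<open>g (d x)\<close> is already known because \<open>d x\<close> involves older generators only;
  the right side is a cycle since \<open>f\<close> is a cocycle.\<close>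

lemma acyclic_lift:
  fixes Z :: "('f::field, 'x::ab_group_add) gmod" and C :: "('f, 'y::ab_group_add) gmod"
  assumes Z: "gsemifree Z" and C: "gmodule C" "acyclic C"
    and f: "f \<in> ghom Z C (a + 1) b" "gD Z C (a + 1) b f = 0"
  shows "\<exists>g\<in>ghom Z C a b. gD Z C a b g = f"
proof -
  obtain B :: "nat \<Rightarrow> int \<Rightarrow> int \<Rightarrow> 'x set" where B: "gfree Z (\<lambda>u t. \<Union>l. B l u t)"
    "\<And>l u t b. b \<in> B l u t \<Longrightarrow> gd Z u t b \<in> module.span (gsc Z (u + 1))
           (gwd Z ` gindex (\<lambda>u' t'. \<Union>l'<l. B l' u' t') (u + 1) t)"
    using Z by (auto simp: gsemifree_def)
  have Z: "gmodule Z" using B(1) by (simp add: gfree_def)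
  define BB where "BB l u t = (\<Union>l'<l. B l' u t)" for l :: nat and u t
  have BZ: "x \<in> gco Z u t" if "x \<in> B l u t" for l u t x
    by (rule gfree_gen[OF B(1)]) (use that in auto)
  have BBZ: "x \<in> gco Z u t" if "x \<in> BB l u t" for l u t x
    using that BZ by (auto simp: BB_def)
  have gindex_mono: "gindex A u t \<subseteq> gindex A' u t" if "\<And>u t. A u t \<subseteq> A' u t" for A A' :: "int \<Rightarrow> int \<Rightarrow> 'x set" and u t
    using that by (auto simp: gindex_def)
  \<comment> \<open>\<open>BB l\<close> collects the levels strictly below \<open>l\<close>, so a
    generator in \<open>BB (Suc l)\<close> has level at most \<open>l\<close> and its differential
    lies in the span over \<open>BB l\<close>.\<close>
  have dB: "gd Z u t x \<in> module.span (gsc Z (u + 1)) (gwd Z ` gindex (BB l) (u + 1) t)"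
    if "x \<in> BB (Suc l) u t" for l u t x
  proof -
    interpret vector_space "gsc Z (u + 1)" by (rule gmodule_vs[OF Z])
    from that obtain l' where l': "l' \<le> l" "x \<in> B l' u t" by (auto simp: BB_def less_Suc_eq_le)
    have "span (gwd Z ` gindex (\<lambda>u' t'. \<Union>l''<l'. B l'' u' t') (u + 1) t) \<subseteq> span (gwd Z ` gindex (BB l) (u + 1) t)"
      using l'(1) by (intro span_mono image_mono gindex_mono, unfold BB_def, intro UN_mono) auto
    then show ?thesis using B(2)[OF l'(2)] by blast
  qed
  have BB_Suc: "BB l u t \<subseteq> BB (Suc l) u t" for l u t unfolding BB_def by (intro UN_mono) auto
  \<comment> \<open>Each approximation is a homomorphism on all of \<open>Z\<close>, but solves
    \<open>D g = f\<close> only on the generators in \<open>BB l\<close>.\<close>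
  define P where "P l g \<longleftrightarrow> g \<in> ghom Z C a b \<and> (\<forall>u t. \<forall>x\<in>BB l u t. gD Z C a b g u t x = f u t x)" for l g
  define Q where "Q l g g' \<longleftrightarrow> (\<forall>u t. \<forall>x\<in>BB l u t. g' u t x = g u t x)" for l :: nat and g g' :: "int \<Rightarrow> int \<Rightarrow> 'x \<Rightarrow> 'y"
  have P0: "P 0 0" using ghom_0[OF Z C(1)] by (simp add: P_def BB_def)
  have step: "\<exists>g'. P (Suc l) g' \<and> Q l g g'" if g: "P l g" for l g
  proof -
    have gh: "g \<in> ghom Z C a b" and gD: "\<And>u t x. x \<in> BB l u t \<Longrightarrow> gD Z C a b g u t x = f u t x"
      using g by (auto simp: P_def)
    have ex: "\<exists>y. y \<in> gco C (u + a) (t + b) \<and> gd C (u + a) (t + b) y = f u t x + sg a (g (u + 1) t (gd Z u t x))"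
      if x: "x \<in> BB (Suc l) u t" for u t x
    proof -
      have xZ: "x \<in> gco Z u t" and dxZ: "gd Z u t x \<in> gco Z (u + 1) t" using BBZ[OF x] gd_in[OF Z] by auto
      have gdx: "g (u + 1) t (gd Z u t x) \<in> gco C (u + a + 1) (t + b)"
        using ghom_in[OF gh dxZ] by (simp add: add_ac)
      have fx: "f u t x \<in> gco C (u + a + 1) (t + b)" using ghom_in[OF f(1) xZ] by (simp add: add_ac)
      \<comment> \<open>\<open>d x\<close> lies in the span of words on older generators, where
        \<open>D g = f\<close> is already known.\<close>
      have 1: "gD Z C a b g (u + 1) t (gd Z u t x) = f (u + 1) t (gd Z u t x)"
        by (rule ghom_eq_on_span[OF Z gD_ghom[OF Z C(1) gh] f(1) BBZ gD dB[OF x]])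
      have 2: "gd C (u + a + 1) (t + b) (g (u + 1) t (gd Z u t x)) = f (u + 1) t (gd Z u t x)"
        using 1 dxZ gmodule_dd[OF Z xZ] ghom_zero[OF Z gh] by (simp add: gD_def add_ac)
      have 3: "gd C (u + a + 1) (t + b) (f u t x) + sg a (f (u + 1) t (gd Z u t x)) = 0"
        using fun_cong[OF fun_cong[OF fun_cong[OF f(2)]], of u t x] xZ by (simp add: gD_def add.assoc[symmetric])
      have "gd C (u + a + 1) (t + b) (f u t x + sg a (g (u + 1) t (gd Z u t x))) = 0"
        using 2 3 gd_lin[OF C(1)] gco_closed[OF C(1)] fx gdx by simp
      moreover have "f u t x + sg a (g (u + 1) t (gd Z u t x)) \<in> gco C (u + a + 1) (t + b)"
        using gco_closed[OF C(1)] fx gdx by simp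
      ultimately show ?thesis using C(2) unfolding acyclic_def by (metis add_diff_cancel_right')
    qed
    \<comment> \<open>Old generators keep their values, so the approximations stabilise; on the new
      ones a primitive is chosen.\<close>
    define \<phi> where "\<phi> u t x = (if x \<in> BB l u t then g u t x else if x \<in> BB (Suc l) u t then
      (SOME y. y \<in> gco C (u + a) (t + b) \<and> gd C (u + a) (t + b) y = f u t x + sg a (g (u + 1) t (gd Z u t x))) else 0)" for u t x
    have "\<phi> u t x \<in> gco C (u + a) (t + b)" for u t x
      using someI_ex[OF ex] ghom_in[OF gh BBZ] gco_closed[OF C(1)] by (auto simp: \<phi>_def)
    from ghom_extend[OF B(1) C(1), of \<phi>, OF this] obtain g' where g': "g' \<in> ghom Z C a b"
      "\<And>u t x. x \<in> (\<Union>l. B l u t) \<Longrightarrow> g' u t x = \<phi> u t x" by blast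
    have g'BB: "g' u t x = \<phi> u t x" if "x \<in> BB l u t" for l u t x
      using g'(2) that by (auto simp: BB_def)
    have g'g: "g' u t x = g u t x" if "x \<in> BB l u t" for u t x
      using g'BB[OF that] that by (simp add: \<phi>_def)
    have "gD Z C a b g' u t x = f u t x" if x: "x \<in> BB (Suc l) u t" for u t x
    proof -
      have d: "g' (u + 1) t (gd Z u t x) = g (u + 1) t (gd Z u t x)"
        by (rule ghom_eq_on_span[OF Z g'(1) gh BBZ g'g dB[OF x]])
      show ?thesis
      proof (cases "x \<in> BB l u t")
        case True
        then show ?thesis using gD[OF True] d g'g[OF True] BBZ[OF x] by (simp add: gD_def)
      next
        case False
        then have "gd C (u + a) (t + b) (g' u t x) = f u t x + sg a (g (u + 1) t (gd Z u t x))"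
          using someI_ex[OF ex[OF x]] g'BB[OF x] x by (simp add: \<phi>_def)
        then show ?thesis using BBZ[OF x] d by (simp add: gD_def)
      qed
    qed
    then show ?thesis using g'(1) g'g by (auto simp: P_def Q_def)
  qed
  \<comment> \<open>Dependent choice is used because each step extends the particular solution found
    in the step before it.\<close>
  obtain gs where gs: "\<And>n. P n (gs n)" "\<And>n. Q n (gs n) (gs (Suc n))"
    using dependent_nat_choice[of P Q] P0 step by metis
  have gs_const: "gs (m + k) u t x = gs m u t x" if "x \<in> BB m u t" for m k u t x
  proof (induction k)
    case (Suc k)
    have "x \<in> BB (m + k) u t" using that by (auto simp: BB_def)
    then show ?case using gs(2)[of "m + k"] Suc by (simp add: Q_def)
  qed simp
  \<comment> \<open>A generator may occur in several levels. Its least level fixes which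
    approximation defines the limit there, and every later one agrees.\<close>
  define lv where "lv u t x = (LEAST l. x \<in> B l u t)" for u t x
  have lv: "x \<in> BB (Suc (lv u t x)) u t" "Suc (lv u t x) \<le> Suc l" if "x \<in> B l u t" for l u t x
    using LeastI[of "\<lambda>l. x \<in> B l u t", OF that] Least_le[of "\<lambda>l. x \<in> B l u t", OF that] unfolding lv_def BB_def by auto
  define \<phi> where "\<phi> u t x = gs (Suc (lv u t x)) u t x" for u t x
  have ghs: "gs n \<in> ghom Z C a b" for n using gs(1) by (simp add: P_def)
  have "\<phi> u t x \<in> gco C (u + a) (t + b)" if "x \<in> (\<Union>l. B l u t)" for u t x
    using ghom_in[OF ghs] BZ that by (auto simp: \<phi>_def)
  from ghom_extend[OF B(1) C(1), of \<phi>, OF this] obtain g where g: "g \<in> ghom Z C a b"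
    "\<And>u t x. x \<in> (\<Union>l. B l u t) \<Longrightarrow> g u t x = \<phi> u t x" by blast
  have ggs: "g u t x = gs m u t x" if xm: "x \<in> BB m u t" for m u t x
  proof -
    obtain l where l: "l < m" "x \<in> B l u t" using xm by (auto simp: BB_def)
    then have "g u t x = gs (Suc (lv u t x)) u t x" using g(2) by (auto simp: \<phi>_def)
    then show ?thesis using gs_const[OF lv(1)[OF l(2)], of "m - Suc (lv u t x)"] lv(2)[OF l(2)] l(1) by simp
  qed
  have "gD Z C a b g = f"
  proof (rule ghom_eqI[OF B(1) gD_ghom[OF Z C(1) g(1)] f(1)])
    fix u t x assume "x \<in> (\<Union>l. B l u t)"
    then obtain l where l: "x \<in> B l u t" by auto
    then have x: "x \<in> BB (Suc l) u t" by (auto simp: BB_def)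
    have dx: "gd Z u t x \<in> module.span (gsc Z (u + 1)) (gwd Z ` gindex (BB (Suc l)) (u + 1) t)"
      using dB[of x "Suc l"] x BB_Suc by blast
    have "g (u + 1) t (gd Z u t x) = gs (Suc l) (u + 1) t (gd Z u t x)"
      by (rule ghom_eq_on_span[OF Z g(1) ghs BBZ ggs dx])
    then have "gD Z C a b g u t x = gD Z C a b (gs (Suc l)) u t x"
      using ggs[OF x] by (simp add: gD_def)
    then show "gD Z C a b g u t x = f u t x" using gs(1)[of "Suc l"] x by (simp add: P_def)
  qed
  then show ?thesis using g(1) by blast
qed

end

context grading
begin

section \<open>Quasi-isomorphisms and independence of resolutions\<close>

definition gquasi_iso ::
  "('f::field, 'x::ab_group_add) gmod \<Rightarrow> ('f, 'y::ab_group_add) gmod \<Rightarrow> (int \<Rightarrow> int \<Rightarrow> 'x \<Rightarrow> 'y) \<Rightarrow> bool" where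
  "gquasi_iso X Y e \<longleftrightarrow> e \<in> ghom X Y 0 0 \<and> gD X Y 0 0 e = 0 \<and>
     (\<forall>u t. \<forall>x\<in>gco X u t. gd X u t x = 0 \<longrightarrow> (\<exists>y\<in>gco Y (u - 1) t. e u t x = gd Y (u - 1) t y) \<longrightarrow>
        (\<exists>x'\<in>gco X (u - 1) t. x = gd X (u - 1) t x')) \<and>
     (\<forall>u t. \<forall>y\<in>gco Y u t. gd Y u t y = 0 \<longrightarrow>
        (\<exists>x\<in>gco X u t. gd X u t x = 0 \<and> (\<exists>z\<in>gco Y (u - 1) t. y - e u t x = gd Y (u - 1) t z)))"

text \<open>The mapping cone of \<open>e\<close>, with \<open>X\<close> shifted by one. The minus
  sign on the differential of \<open>X\<close> makes the square vanish when \<open>e\<close> is a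
  chain map.\<close>

definition gcone ::
  "(int \<Rightarrow> int \<Rightarrow> 'x \<Rightarrow> 'y) \<Rightarrow> ('f, 'x::ab_group_add) gmod \<Rightarrow> ('f, 'y::ab_group_add) gmod \<Rightarrow> ('f, 'x \<times> 'y) gmod" where
  "gcone e X Y = \<lparr>gsc = (\<lambda>u c (x, y). (gsc X (u + 1) c x, gsc Y u c y)),
     gco = (\<lambda>u t. gco X (u + 1) t \<times> gco Y u t),
     gd = (\<lambda>u t (x, y). (- gd X (u + 1) t x, e (u + 1) t x + gd Y u t y)),
     gop = (\<lambda>i u t (x, y). (gop X i (u + 1) t x, gop Y i u t y))\<rparr>"

lemma gcone_sel [simp]:
  "gsc (gcone e X Y) u c (x, y) = (gsc X (u + 1) c x, gsc Y u c y)"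
  "gco (gcone e X Y) u t = gco X (u + 1) t \<times> gco Y u t"
  "gd (gcone e X Y) u t (x, y) = (- gd X (u + 1) t x, e (u + 1) t x + gd Y u t y)"
  "gop (gcone e X Y) i u t (x, y) = (gop X i (u + 1) t x, gop Y i u t y)"
  by (simp_all add: gcone_def)

lemma gmodule_gcone:
  fixes X :: "('f::field, 'x::ab_group_add) gmod" and Y :: "('f, 'y::ab_group_add) gmod"
  assumes X: "gmodule X" and Y: "gmodule Y" and e: "e \<in> ghom X Y 0 0" "gD X Y 0 0 e = 0"
  shows "gmodule (gcone e X Y)"
proof -
  let ?C = "gcone e X Y"
  have vs: "vector_space (gsc ?C u)" for u
  proof -
    interpret X: vector_space "gsc X (u + 1)" by (rule gmodule_vs[OF X])
    interpret Y: vector_space "gsc Y u" by (rule gmodule_vs[OF Y])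
    show ?thesis
      by unfold_locales (auto simp: X.scale_right_distrib X.scale_left_distrib Y.scale_right_distrib Y.scale_left_distrib)
  qed
  have sub: "module.subspace (gsc ?C u) (gco ?C u t)" for u t
  proof -
    interpret vector_space "gsc ?C u" by (rule vs)
    show ?thesis
      by (rule subspaceI) (auto simp: zero_prod_def gco_closed[OF X] gco_closed[OF Y])
  qed
  have ein: "e u t x \<in> gco Y u t" if "x \<in> gco X u t" for u t x using ghom_in[OF e(1) that] by simp
  have eop: "e (u + \<alpha>) (t + \<beta> i) (gop X i u t x) = gop Y i u t (e u t x)" if "i < 3" "x \<in> gco X u t" for i u t x
    using ghom_op[OF e(1) that] by simp
  have ed: "e (u + 1) t (gd X u t x) = gd Y u t (e u t x)" if "x \<in> gco X u t" for u t x
    using fun_cong[OF fun_cong[OF fun_cong[OF e(2)]], of u t x] that by (simp add: gD_def)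
  note cl = gco_closed[OF X] gco_closed[OF Y] gd_in[OF X] gd_in[OF Y] ein gd_lin[OF X] gd_lin[OF Y]
    gsc_lin[OF X] gsc_lin[OF Y] gop_lin[OF X] gop_lin[OF Y] gop_in[OF X] gop_in[OF Y]
  have oin: "gop X i (u + 1) t x \<in> gco X (u + \<alpha> + 1) (t + \<beta> i)" if "i < 3" "x \<in> gco X (u + 1) t" for i u t x
    using gop_in[OF X that] by (simp add: add_ac)
  have din: "gd X (u + 1) t x \<in> gco X (2 + u) t" if "x \<in> gco X (u + 1) t" for x u t
    using gd_in[OF X that] by (simp add: add_ac)
  show ?thesis
    unfolding gmodule_def
  proof (intro conjI allI impI ballI)
    fix u t
    show "lin_on (gsc ?C u) (gco ?C u t) (gsc ?C (u + 1)) (gco ?C (u + 1) t) (gd ?C u t)"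
      using ghom_add[OF e(1)] ghom_sc[OF e(1)] by (intro lin_onI) (auto simp: cl din)
  next
    fix i :: nat and u t assume i: "i < 3"
    have sc: "gop X i (u + 1) t (gsc X (u + 1) c x) = gsc X (u + \<alpha> + 1) c (gop X i (u + 1) t x)"
      if "x \<in> gco X (u + 1) t" for x c
      using gop_lin(5)[OF X i that] by (simp add: add_ac)
    have sc': "gsc X (u + 1 + \<alpha>) c y = gsc X (u + \<alpha> + 1) c y" for c y by (simp add: add_ac)
    show "lin_on (gsc ?C u) (gco ?C u t) (gsc ?C (u + \<alpha>)) (gco ?C (u + \<alpha>) (t + \<beta> i)) (gop ?C i u t)"
      by (intro lin_onI) (auto simp: cl i oin sc sc')
    fix x assume "x \<in> gco ?C u t"
    then obtain y z where x: "x = (y, z)" "y \<in> gco X (u + 1) t" "z \<in> gco Y u t" by auto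
    have 1: "gd X (u + \<alpha> + 1) (t + \<beta> i) (gop X i (u + 1) t y) = gop X i (u + 1 + 1) t (gd X (u + 1) t y)"
      using gmodule_dop[OF X i x(2)] by (simp add: add_ac)
    have 2: "e (u + \<alpha> + 1) (t + \<beta> i) (gop X i (u + 1) t y) = gop Y i (u + 1) t (e (u + 1) t y)"
      using eop[OF i x(2)] by (simp add: add_ac)
    show "gd ?C (u + \<alpha>) (t + \<beta> i) (gop ?C i u t x) = gop ?C i (u + 1) t (gd ?C u t x)"
      using x(2,3) gmodule_dop[OF Y i x(3)] gop_lin(3)[OF X i din[OF x(2)]]
      by (simp add: x(1) 1 2 gop_lin[OF X i] gop_lin[OF Y i] cl)
    have "gop X i (u + \<alpha> + 1) (t + \<beta> i) (gop X i (u + 1) t y) = 0" if anti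
      using gmodule_op2[OF X that i x(2)] by (simp add: add_ac)
    then show "gop ?C i (u + \<alpha>) (t + \<beta> i) (gop ?C i u t x) = 0" if anti
      using gmodule_op2[OF Y that i x(3)] that by (simp add: x(1) zero_prod_def)
  next
    fix i j :: nat and u t x assume ij: "i < 3" "j < 3" and "x \<in> gco ?C u t"
    then obtain y z where x: "x = (y, z)" "y \<in> gco X (u + 1) t" "z \<in> gco Y u t" by auto
    have "gop X i (u + \<alpha> + 1) (t + \<beta> j) (gop X j (u + 1) t y) =
          (if anti then - gop X j (u + \<alpha> + 1) (t + \<beta> i) (gop X i (u + 1) t y)
           else gop X j (u + \<alpha> + 1) (t + \<beta> i) (gop X i (u + 1) t y))"
      using gmodule_opop[OF X ij x(2)] by (simp add: add_ac)
    then show "gop ?C i (u + \<alpha>) (t + \<beta> j) (gop ?C j u t x) =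
          (if anti then - gop ?C j (u + \<alpha>) (t + \<beta> i) (gop ?C i u t x)
           else gop ?C j (u + \<alpha>) (t + \<beta> i) (gop ?C i u t x))"
      using gmodule_opop[OF Y ij x(3)] by (simp add: x(1))
  next
    fix u t x assume "x \<in> gco ?C u t"
    then obtain y z where x: "x = (y, z)" "y \<in> gco X (u + 1) t" "z \<in> gco Y u t" by auto
    show "gd ?C (u + 1) t (gd ?C u t x) = 0"
      using x(2,3) gmodule_dd[OF X x(2)] gmodule_dd[OF Y x(3)] ghom_lin'(2)[OF X e(1) gd_in[OF X x(2)]]
        gd_lin(3)[OF X din[OF x(2)]] ed[OF x(2)]
      by (simp add: x(1) zero_prod_def cl ed)
  qed (rule vs sub)+
qed

text \<open>For a cycle \<open>(x, y)\<close> the element \<open>e x\<close> is a boundary, so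
  injectivity on cohomology gives \<open>x = d x'\<close>. Then \<open>y + e x'\<close> is a cycle
  of \<open>Y\<close>, and surjectivity writes it as \<open>e x'' + d z\<close>; the pair
  \<open>(x'' - x', z)\<close> bounds \<open>(x, y)\<close>.\<close>

lemma acyclic_gcone:
  fixes X :: "('f::field, 'x::ab_group_add) gmod" and Y :: "('f, 'y::ab_group_add) gmod"
  assumes X: "gmodule X" and Y: "gmodule Y" and e: "gquasi_iso X Y e"
  shows "acyclic (gcone e X Y)"
  unfolding acyclic_def
proof (intro allI ballI impI)
  fix u t w assume "w \<in> gco (gcone e X Y) u t" and dw: "gd (gcone e X Y) u t w = 0"
  then obtain x y where w: "w = (x, y)" "x \<in> gco X (u + 1) t" "y \<in> gco Y u t" by auto
  have eh: "e \<in> ghom X Y 0 0" and eD: "gD X Y 0 0 e = 0" using e by (auto simp: gquasi_iso_def)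
  have ein: "e u t x \<in> gco Y u t" if "x \<in> gco X u t" for u t x using ghom_in[OF eh that] by simp
  have ed: "e (u + 1) t (gd X u t x) = gd Y u t (e u t x)" if "x \<in> gco X u t" for u t x
    using fun_cong[OF fun_cong[OF fun_cong[OF eD]], of u t x] that by (simp add: gD_def)
  have dx: "gd X (u + 1) t x = 0" and ey: "e (u + 1) t x = gd Y u t (- y)"
    using dw w gd_lin(3)[OF Y w(3)] by (auto simp: zero_prod_def add_eq_0_iff2)
  have "\<exists>x'\<in>gco X (u + 1 - 1) t. x = gd X (u + 1 - 1) t x'"
    using e w(2) dx ey gco_closed(4)[OF Y w(3)] unfolding gquasi_iso_def by (metis add_diff_cancel_right')
  then obtain x' where x': "x' \<in> gco X u t" "x = gd X u t x'" by auto
  let ?c = "y + e u t x'"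
  have c: "?c \<in> gco Y u t" using w(3) ein[OF x'(1)] gco_closed[OF Y] by simp
  have "gd Y u t ?c = 0"
    using ey gd_lin(1)[OF Y w(3) ein[OF x'(1)]] gd_lin(3)[OF Y w(3)] ed[OF x'(1)] x'(2) by simp
  then obtain x'' z where x'': "x'' \<in> gco X u t" "gd X u t x'' = 0" and z: "z \<in> gco Y (u - 1) t" "?c - e u t x'' = gd Y (u - 1) t z"
    using e c unfolding gquasi_iso_def by blast
  have "gd (gcone e X Y) (u - 1) t (x'' - x', z) = w"
    using x' x'' gd_lin(2)[OF X x''(1) x'(1)] by (simp add: w(1) ghom_lin'(1)[OF X eh x''(1) x'(1)] z(2)[symmetric])
  moreover have "(x'' - x', z) \<in> gco (gcone e X Y) (u - 1) t"
    using x'(1) x''(1) z(1) gco_closed[OF X] by simp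
  ultimately show "\<exists>y\<in>gco (gcone e X Y) (u - 1) t. gd (gcone e X Y) (u - 1) t y = w" by blast
qed

lemma gsemifree_gmodule: "gsemifree Z \<Longrightarrow> gmodule Z"
  by (auto simp: gsemifree_def gfree_def)

text \<open>Because of the shift, the first component of a map of degree \<open>a\<close> into the
  cone has degree \<open>a + 1\<close> as a map to \<open>X\<close>.\<close>

lemma ghom_gcone_proj:
  fixes X :: "('f::field, 'x::ab_group_add) gmod" and Y :: "('f, 'y::ab_group_add) gmod"
    and Z :: "('f, 'z::ab_group_add) gmod"
  assumes "H \<in> ghom Z (gcone e X Y) a b"
  shows "(\<lambda>u t x. fst (H u t x)) \<in> ghom Z X (a + 1) b" "(\<lambda>u t x. snd (H u t x)) \<in> ghom Z Y a b"
proof -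
  have P: "gsc (gcone e X Y) u c p = (gsc X (u + 1) c (fst p), gsc Y u c (snd p))"
    "gop (gcone e X Y) i u t p = (gop X i (u + 1) t (fst p), gop Y i u t (snd p))" for u c p i t
    by (cases p; simp)+
  have in': "fst (H u t x) \<in> gco X (u + a + 1) (t + b)" "snd (H u t x) \<in> gco Y (u + a) (t + b)"
    if "x \<in> gco Z u t" for u t x
    using ghom_in[OF assms that] by (auto simp: mem_Times_iff)
  show "(\<lambda>u t x. fst (H u t x)) \<in> ghom Z X (a + 1) b"
    using ghom_add[OF assms] ghom_sc[OF assms] ghom_op[OF assms] ghom_out[OF assms] in'
    by (intro ghomI lin_onI) (simp_all add: P add.assoc)
  show "(\<lambda>u t x. snd (H u t x)) \<in> ghom Z Y a b"
    using ghom_add[OF assms] ghom_sc[OF assms] ghom_op[OF assms] ghom_out[OF assms] in'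
    by (intro ghomI lin_onI) (simp_all add: P)
qed

lemma ghom_gcone_pair:
  fixes X :: "('f::field, 'x::ab_group_add) gmod" and Y :: "('f, 'y::ab_group_add) gmod"
    and Z :: "('f, 'z::ab_group_add) gmod"
  assumes f: "f \<in> ghom Z X (a + 1) b" and g: "g \<in> ghom Z Y a b"
  shows "(\<lambda>u t x. (f u t x, g u t x)) \<in> ghom Z (gcone e X Y) a b"
  using ghom_add[OF f] ghom_sc[OF f] ghom_op[OF f] ghom_out[OF f] ghom_in[OF f]
     ghom_add[OF g] ghom_sc[OF g] ghom_op[OF g] ghom_out[OF g] ghom_in[OF g]
  by (intro ghomI lin_onI) (simp_all add: add.assoc zero_prod_def)

text \<open>The map \<open>(0, f)\<close> into the cone of \<open>e\<close> is a cocycle of degree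
  0, hence of the form \<open>D (h, k)\<close> with \<open>(h, k)\<close> of degree -1. By the shift
  \<open>h\<close> has degree 0 as a map to \<open>X\<close>; the two components of the equation say
  that \<open>h\<close> is a chain map and that \<open>k\<close> is a homotopy between
  \<open>e h\<close> and \<open>f\<close>.\<close>

lemma lift_surj:
  fixes X :: "('f::field, 'x::ab_group_add) gmod" and Y :: "('f, 'y::ab_group_add) gmod"
    and Z :: "('f, 'z::ab_group_add) gmod"
  assumes Z: "gsemifree Z" and X: "gmodule X" and Y: "gmodule Y" and e: "gquasi_iso X Y e"
    and f: "f \<in> ghom Z Y 0 0" "gD Z Y 0 0 f = 0"
  shows "\<exists>g\<in>ghom Z X 0 0. gD Z X 0 0 g = 0 \<and>
     (\<exists>k\<in>ghom Z Y (-1) 0. (\<lambda>u t x. f u t x - e u t (g u t x)) = gD Z Y (-1) 0 k)"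
proof -
  let ?C = "gcone e X Y"
  have Z': "gmodule Z" by (rule gsemifree_gmodule[OF Z])
  have e': "e \<in> ghom X Y 0 0" "gD X Y 0 0 e = 0" using e by (auto simp: gquasi_iso_def)
  have C: "gmodule ?C" "acyclic ?C" using gmodule_gcone[OF X Y e'] acyclic_gcone[OF X Y e] .
  let ?F = "\<lambda>u t x. (0 :: 'x, f u t x)"
  have F: "?F \<in> ghom Z ?C 0 0"
    using ghom_gcone_pair[OF ghom_0[OF Z' X] f(1), of e] by (simp add: zero_fun_def)
  have e0: "e u t 0 = 0" for u t by (rule ghom_zero[OF X e'(1)])
  have d0: "gd X u t 0 = 0" for u t by (rule gd_lin(6)[OF X gco_closed(1)[OF X]])
  have "gD Z ?C 0 0 ?F u t x = 0" for u t x
    using fun_cong[OF fun_cong[OF fun_cong[OF f(2)]], of u t x] by (auto simp: gD_def e0 d0 zero_prod_def)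
  then have "gD Z ?C 0 0 ?F = 0" by (auto simp: fun_eq_iff)
  then obtain H where H: "H \<in> ghom Z ?C (-1) 0" "gD Z ?C (-1) 0 H = ?F"
    using acyclic_lift[OF Z C, of ?F "-1" 0] F by auto
  define h where "h u t x = fst (H u t x)" for u t x
  define k where "k u t x = snd (H u t x)" for u t x
  have hk: "h \<in> ghom Z X 0 0" "k \<in> ghom Z Y (-1) 0"
    using ghom_gcone_proj[OF H(1)] unfolding h_def[abs_def] k_def[abs_def] by simp_all
  have Hhk: "H u t x = (h u t x, k u t x)" for u t x by (simp add: h_def k_def)
  have eq: "- gd X u t (h u t x) + h (u + 1) t (gd Z u t x) = 0"
    "e u t (h u t x) + gd Y (u - 1) t (k u t x) + k (u + 1) t (gd Z u t x) = f u t x" if "x \<in> gco Z u t" for u t x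
    using fun_cong[OF fun_cong[OF fun_cong[OF H(2)]], of u t x] that by (simp_all add: gD_def Hhk sg_def)
  have "gD Z X 0 0 h u t x = 0" for u t x using eq(1)[of x u t] by (simp add: gD_def)
  then have "gD Z X 0 0 h = 0" by (auto simp: fun_eq_iff)
  moreover have "f u t x - e u t (h u t x) = gD Z Y (-1) 0 k u t x" for u t x
  proof (cases "x \<in> gco Z u t")
    case True
    then show ?thesis using eq(2)[OF True, symmetric] by (simp add: gD_def sg_def)
  qed (simp add: gD_def ghom_out[OF f(1)] ghom_out[OF hk(1)] e0)
  ultimately show ?thesis using hk by blast
qed

text \<open>Here \<open>(f, - k)\<close> is a cocycle of degree -1 of maps to the cone, and a
  primitive of degree -2 has as its first component, up to sign, a null homotopy of
  \<open>f\<close>.\<close>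

lemma lift_inj:
  fixes X :: "('f::field, 'x::ab_group_add) gmod" and Y :: "('f, 'y::ab_group_add) gmod"
    and Z :: "('f, 'z::ab_group_add) gmod"
  assumes Z: "gsemifree Z" and X: "gmodule X" and Y: "gmodule Y" and e: "gquasi_iso X Y e"
    and f: "f \<in> ghom Z X 0 0" "gD Z X 0 0 f = 0"
    and k: "k \<in> ghom Z Y (-1) 0" "(\<lambda>u t x. e u t (f u t x)) = gD Z Y (-1) 0 k"
  shows "\<exists>h\<in>ghom Z X (-1) 0. f = gD Z X (-1) 0 h"
proof -
  let ?C = "gcone e X Y"
  have Z': "gmodule Z" by (rule gsemifree_gmodule[OF Z])
  have e': "e \<in> ghom X Y 0 0" "gD X Y 0 0 e = 0" using e by (auto simp: gquasi_iso_def)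
  have C: "gmodule ?C" "acyclic ?C" using gmodule_gcone[OF X Y e'] acyclic_gcone[OF X Y e] .
  let ?F = "\<lambda>u t x. (f u t x, (- k) u t x)"
  have F: "?F \<in> ghom Z ?C (-1) 0"
    using ghom_gcone_pair[of f Z X "-1" 0 "- k" Y e] f(1) ghom_neg[OF Y k(1) Z'] by simp
  have "gD Z ?C (-1) 0 ?F u t x = 0" for u t x
  proof (cases "x \<in> gco Z u t")
    case True
    have "- gd X u t (f u t x) + f (u + 1) t (gd Z u t x) = 0"
      using fun_cong[OF fun_cong[OF fun_cong[OF f(2)]], of u t x] True by (simp add: gD_def)
    moreover have "e u t (f u t x) = gd Y (u - 1) t (k u t x) + k (u + 1) t (gd Z u t x)"
      using fun_cong[OF fun_cong[OF fun_cong[OF k(2)]], of u t x] True by (simp add: gD_def sg_def)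
    moreover have "gd Y (u - 1) t (- k u t x) = - gd Y (u - 1) t (k u t x)"
      using gd_lin(3)[OF Y ghom_in[OF k(1) True]] by simp
    ultimately show ?thesis using True by (simp add: gD_def sg_def zero_prod_def)
  qed (simp add: gD_def)
  then have "gD Z ?C (-1) 0 ?F = 0" by (auto simp: fun_eq_iff)
  then obtain H where H: "H \<in> ghom Z ?C (-2) 0" "gD Z ?C (-2) 0 H = ?F"
    using acyclic_lift[OF Z C, of ?F "-2" 0] F by auto
  define h where "h u t x = fst (H u t x)" for u t x
  have h: "h \<in> ghom Z X (-1) 0"
    using ghom_gcone_proj[OF H(1)] unfolding h_def[abs_def] by simp
  have fh: "f u t x = gD Z X (-1) 0 (- h) u t x" for u t x
  proof (cases "x \<in> gco Z u t")
    case True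
    have "- gd X (u - 1) t (h u t x) - h (u + 1) t (gd Z u t x) = f u t x"
    proof -
      have "fst (gD Z ?C (-2) 0 H u t x) = - gd X (u - 1) t (h u t x) - h (u + 1) t (gd Z u t x)"
        using True by (cases "H u t x") (simp add: gD_def sg_def h_def)
      then show ?thesis using H(2) by simp
    qed
    moreover have "gd X (u - 1) t (- h u t x) = - gd X (u - 1) t (h u t x)"
      using gd_lin(3)[OF X ghom_in[OF h True]] by simp
    ultimately show ?thesis using True by (simp add: gD_def sg_def)
  qed (simp add: gD_def ghom_out[OF f(1)])
  have "f = gD Z X (-1) 0 (- h)"
    by (intro ext) (rule fh)
  then show ?thesis using ghom_neg[OF X h Z'] by blast
qed

definition gH ::
  "('f::field, 'x::ab_group_add) gmod \<Rightarrow> ('f, 'y::ab_group_add) gmod \<Rightarrow> int \<Rightarrow> int \<Rightarrow>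
   ('f, int \<Rightarrow> int \<Rightarrow> 'x \<Rightarrow> 'y) subquotient" where
  "gH X Y a b = \<lparr>sq_scale = (\<lambda>c f u t x. gsc Y (u + a) c (f u t x)),
      cycles = {f \<in> ghom X Y a b. gD X Y a b f = 0},
      boundaries = gD X Y (a - 1) b ` ghom X Y (a - 1) b\<rparr>"

lemma gD_gD:
  fixes X :: "('f::field, 'x::ab_group_add) gmod" and Y :: "('f, 'y::ab_group_add) gmod"
  assumes X: "gmodule X" and Y: "gmodule Y" and f: "f \<in> ghom X Y a b"
  shows "gD X Y (a + 1) b (gD X Y a b f) = 0"
proof (intro ext)
  fix u t x
  show "gD X Y (a + 1) b (gD X Y a b f) u t x = 0 u t x"
  proof (cases "x \<in> gco X u t")
    case True
    have fd: "f (u + 1) t (gd X u t x) \<in> gco Y (u + a + 1) (t + b)"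
      using ghom_in[OF f gd_in[OF X True]] by (simp add: add_ac)
    have "gd Y (u + a + 1) (t + b) (gD X Y a b f u t x) = - sg a (gd Y (u + a + 1) (t + b) (f (u + 1) t (gd X u t x)))"
      using True gd_lin(2)[OF Y gd_in[OF Y ghom_in[OF f True]] gco_closed(5)[OF Y fd]] gd_lin(4)[OF Y fd]
        gmodule_dd[OF Y ghom_in[OF f True]] by (simp add: gD_def)
    moreover have "gD X Y a b f (u + 1) t (gd X u t x) = gd Y (u + a + 1) (t + b) (f (u + 1) t (gd X u t x))"
      using gd_in[OF X True] gmodule_dd[OF X True] ghom_zero[OF X f] by (simp add: gD_def add_ac)
    ultimately show ?thesis using True by (simp add: gD_def[of X Y "a + 1"] add.assoc)
  qed (simp add: gD_def)
qed

lemma gH_wf: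
  fixes X :: "('f::field, 'x::ab_group_add) gmod" and Y :: "('f, 'y::ab_group_add) gmod"
  assumes X: "gmodule X" and Y: "gmodule Y"
  shows "sq_wf (gH X Y a b)"
  unfolding sq_wf_def gH_def subquotient.simps
proof (intro conjI ballI allI impI)
  show "0 \<in> gD X Y (a - 1) b ` ghom X Y (a - 1) b"
    using gD_0[OF Y] ghom_0[OF X Y] by (metis imageI)
  fix x assume x: "x \<in> gD X Y (a - 1) b ` ghom X Y (a - 1) b"
  then show "- x \<in> gD X Y (a - 1) b ` ghom X Y (a - 1) b"
    using gD_neg[OF Y, symmetric] ghom_neg[OF Y _ X] by fastforce
  fix y assume y: "y \<in> gD X Y (a - 1) b ` ghom X Y (a - 1) b"
  with x show "x + y \<in> gD X Y (a - 1) b ` ghom X Y (a - 1) b"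
  proof -
    obtain g h where "g \<in> ghom X Y (a - 1) b" "x = gD X Y (a - 1) b g"
      "h \<in> ghom X Y (a - 1) b" "y = gD X Y (a - 1) b h" using x y by auto
    then show ?thesis using gD_plus[OF Y, of g X "a - 1" b h] ghom_plus[OF Y, of g X "a - 1" b h, OF _ _ X]
      by (metis imageI)
  qed
next
  show "gD X Y (a - 1) b ` ghom X Y (a - 1) b \<subseteq> {f \<in> ghom X Y a b. gD X Y a b f = 0}"
    using gD_gD[OF X Y, of _ "a - 1" b] gD_ghom[OF X Y, of _ "a - 1" b] by auto
next
  fix x assume x: "x \<in> {f \<in> ghom X Y a b. gD X Y a b f = 0}"
  then show "- x \<in> {f \<in> ghom X Y a b. gD X Y a b f = 0}"
    using gD_neg[OF Y, of x X a b] ghom_neg[OF Y _ X, of x a b] by auto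
  fix y assume y: "y \<in> {f \<in> ghom X Y a b. gD X Y a b f = 0}"
  with x show "x + y \<in> {f \<in> ghom X Y a b. gD X Y a b f = 0}"
    using gD_plus[OF Y, of x X a b y] ghom_plus[OF Y _ _ X, of x a b y] by auto
next
  fix c x assume x: "x \<in> {f \<in> ghom X Y a b. gD X Y a b f = 0}"
  then show "(\<lambda>u t xa. gsc Y (u + a) c (x u t xa)) \<in> {f \<in> ghom X Y a b. gD X Y a b f = 0}"
    using gD_scale[OF X Y, of x a b c] ghom_scale[OF Y _ X, of x a b c] gsc_lin[OF Y] by (auto simp: fun_eq_iff)
next
  fix c x y assume "x - y \<in> gD X Y (a - 1) b ` ghom X Y (a - 1) b"
  then obtain h where h: "h \<in> ghom X Y (a - 1) b" "x - y = gD X Y (a - 1) b h" by auto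
  have "gD X Y (a - 1) b (\<lambda>u t x. gsc Y (u + (a - 1)) c (h u t x)) = (\<lambda>u t z. gsc Y (u + a) c ((x - y) u t z))"
    using gD_scale[OF X Y h(1), of c] h(2) by simp
  also have "\<dots> = (\<lambda>u t xa. gsc Y (u + a) c (x u t xa)) - (\<lambda>u t x. gsc Y (u + a) c (y u t x))"
    by (simp add: fun_eq_iff gsc_lin[OF Y])
  finally show "(\<lambda>u t xa. gsc Y (u + a) c (x u t xa)) - (\<lambda>u t x. gsc Y (u + a) c (y u t x)) \<in> gD X Y (a - 1) b ` ghom X Y (a - 1) b"
    using ghom_scale[OF Y h(1) X, of c] by (auto simp: image_iff intro: sym)
qed

text \<open>The identity has to be cut off outside the components to be an element of
  \<open>ghom\<close>.\<close>

lemma gid: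
  assumes "gmodule Z"
  shows "(\<lambda>u t x. if x \<in> gco Z u t then x else 0) \<in> ghom Z Z 0 0"
    "gD Z Z 0 0 (\<lambda>u t x. if x \<in> gco Z u t then x else 0) = 0"
  using gco_closed[OF assms] gop_in[OF assms] gd_in[OF assms]
  by (auto intro!: ghomI lin_onI simp: gD_def fun_eq_iff)

text \<open>Add and subtract \<open>e' g\<close>:
  \<open>e (1 - g' g) = (e - e' g) + (e' - e g') g\<close>, and both summands are boundaries by
  \<open>k\<close> and \<open>k'\<close>. As \<open>e\<close> is a quasi-isomorphism and
  \<open>Z\<close> is semifree, \<open>1 - g' g\<close> is itself a boundary.\<close>

lemma homotopy_inverse:
  fixes X :: "('f::field, 'x::ab_group_add) gmod" and Z :: "('f, 'z::ab_group_add) gmod"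
    and Z' :: "('f, 'w::ab_group_add) gmod"
  assumes Z: "gsemifree Z" and Z': "gmodule Z'" and X: "gmodule X"
    and e: "gquasi_iso Z X e" and e': "e' \<in> ghom Z' X 0 0"
    and g: "g \<in> ghom Z Z' 0 0" "gD Z Z' 0 0 g = 0" and g': "g' \<in> ghom Z' Z 0 0" "gD Z' Z 0 0 g' = 0"
    and k: "k \<in> ghom Z X (-1) 0" "(\<lambda>u t x. e u t x - e' u t (g u t x)) = gD Z X (-1) 0 k"
    and k': "k' \<in> ghom Z' X (-1) 0" "(\<lambda>u t x. e' u t x - e u t (g' u t x)) = gD Z' X (-1) 0 k'"
  shows "\<exists>m\<in>ghom Z Z (-1) 0. \<forall>u t. \<forall>x\<in>gco Z u t. gD Z Z (-1) 0 m u t x = x - g' u t (g u t x)"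
proof -
  let ?i = "\<lambda>u t x. if x \<in> gco Z u t then x else 0"
  have Zm: "gmodule Z" by (rule gsemifree_gmodule[OF Z])
  have eh: "e \<in> ghom Z X 0 0" using e by (simp add: gquasi_iso_def)
  define gg where "gg = (\<lambda>u t x. g' u t (g u t x))"
  have gg: "gg \<in> ghom Z Z 0 0" using ghom_comp[OF g(1) g'(1) Zm Z'] by (simp add: gg_def)
  have Dgg: "gD Z Z 0 0 gg = 0"
  proof (intro ext)
    fix u t x
    show "gD Z Z 0 0 gg u t x = 0 u t x"
      using gD_comp[OF g(1) g'(1) Zm Z' Zm, of x u t] g'(2) g(2) ghom_zero[OF Z' g'(1)]
      by (cases "x \<in> gco Z u t") (simp_all add: gg_def, simp add: gD_def)
  qed
  let ?f = "?i + - gg"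
  have f: "?f \<in> ghom Z Z 0 0" using ghom_plus[OF Zm gid(1)[OF Zm] ghom_neg[OF Zm gg Zm] Zm] .
  have Df: "gD Z Z 0 0 ?f = 0"
    using gD_plus[OF Zm gid(1)[OF Zm] ghom_neg[OF Zm gg Zm]] gD_neg[OF Zm gg] Dgg gid(2)[OF Zm] by simp
  define kg where "kg = (\<lambda>u t x. k' u t (g u t x))"
  have kg: "kg \<in> ghom Z X (-1) 0" using ghom_comp[OF g(1) k'(1) Zm Z'] by (simp add: kg_def)
  have Dkg: "gD Z X (-1) 0 kg u t x = e' u t (g u t x) - e u t (g' u t (g u t x))" if "x \<in> gco Z u t" for u t x
    using gD_comp[OF g(1) k'(1) Zm Z' X that] g(2) ghom_zero[OF Z' k'(1)] fun_cong[OF fun_cong[OF fun_cong[OF k'(2)]], of u t "g u t x"]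
    by (simp add: kg_def)
  have "(\<lambda>u t x. e u t (?f u t x)) = gD Z X (-1) 0 (k + kg)"
  proof (intro ext)
    fix u t x
    show "e u t (?f u t x) = gD Z X (-1) 0 (k + kg) u t x"
    proof (cases "x \<in> gco Z u t")
      case True
      have "e u t (?f u t x) = e u t x - e u t (gg u t x)"
        using ghom_lin'(1)[OF Zm eh True, of "gg u t x"] ghom_in[OF gg True] True by simp
      then show ?thesis
        using gD_plus[OF X k(1) kg] Dkg[OF True] fun_cong[OF fun_cong[OF fun_cong[OF k(2)]], of u t x, symmetric] by (simp add: gg_def)
    next
      case False
      then show ?thesis using ghom_out[OF gg False] ghom_zero[OF Zm eh] by (simp add: gD_def)
    qed
  qed
  from lift_inj[OF Z Zm X e f Df ghom_plus[OF X k(1) kg Zm] this] obtain m where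
    m: "m \<in> ghom Z Z (-1) 0" "?f = gD Z Z (-1) 0 m" by blast
  have "gD Z Z (-1) 0 m u t x = x - g' u t (g u t x)" if "x \<in> gco Z u t" for u t x
    using fun_cong[OF fun_cong[OF fun_cong[OF m(2)]], of u t x] that by (simp add: gg_def)
  then show ?thesis using m(1) by blast
qed

text \<open>The two resolutions may have different element types. Lifting gives maps
  \<open>g\<close> and \<open>g'\<close> in both directions, homotopy inverse to each other, and
  precomposition with \<open>g\<close> induces the isomorphism.\<close>

theorem resolution_independence:
  fixes X :: "('f::field, 'x::ab_group_add) gmod" and Z :: "('f, 'z::ab_group_add) gmod"
    and Z' :: "('f, 'w::ab_group_add) gmod" and Y :: "('f, 'y::ab_group_add) gmod"
  assumes Z: "gsemifree Z" and Z': "gsemifree Z'" and X: "gmodule X" and Y: "gmodule Y"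
    and e: "gquasi_iso Z X e" and e': "gquasi_iso Z' X e'"
  shows "\<exists>\<Phi>. sq_map (gH Z' Y a b) (gH Z Y a b) \<Phi>"
proof -
  have Zm: "gmodule Z" "gmodule Z'" using gsemifree_gmodule Z Z' by auto
  have eh: "e \<in> ghom Z X 0 0" "gD Z X 0 0 e = 0" "e' \<in> ghom Z' X 0 0" "gD Z' X 0 0 e' = 0"
    using e e' by (simp_all add: gquasi_iso_def)
  obtain g k where g: "g \<in> ghom Z Z' 0 0" "gD Z Z' 0 0 g = 0"
    and k: "k \<in> ghom Z X (-1) 0" "(\<lambda>u t x. e u t x - e' u t (g u t x)) = gD Z X (-1) 0 k"
    using lift_surj[OF Z Zm(2) X e' eh(1,2)] by blast
  obtain g' k' where g': "g' \<in> ghom Z' Z 0 0" "gD Z' Z 0 0 g' = 0"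
    and k': "k' \<in> ghom Z' X (-1) 0" "(\<lambda>u t x. e' u t x - e u t (g' u t x)) = gD Z' X (-1) 0 k'"
    using lift_surj[OF Z' Zm(1) X e eh(3,4)] by blast
  obtain m where m: "m \<in> ghom Z Z (-1) 0" "\<And>u t x. x \<in> gco Z u t \<Longrightarrow> gD Z Z (-1) 0 m u t x = x - g' u t (g u t x)"
    using homotopy_inverse[OF Z Zm(2) X e eh(3) g g' k k'] by blast
  obtain m' where m': "m' \<in> ghom Z' Z' (-1) 0" "\<And>u t x. x \<in> gco Z' u t \<Longrightarrow> gD Z' Z' (-1) 0 m' u t x = x - g u t (g' u t x)"
    using homotopy_inverse[OF Z' Zm(1) X e' eh(1) g' g k' k] by blast
  \<comment> \<open>Precomposition with a chain map of degree 0 commutes with the differential of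
    the Hom complex.\<close>
  have pull: "(\<lambda>u t x. f u t (h u t x)) \<in> ghom A Y a b"
    "gD A Y a b (\<lambda>u t x. f u t (h u t x)) = (\<lambda>u t x. gD A' Y a b f u t (h u t x))"
    if h: "h \<in> ghom A A' 0 0" "gD A A' 0 0 h = 0" and f: "f \<in> ghom A' Y a b" and A: "gmodule A" "gmodule A'"
    for A :: "('f, 'm::ab_group_add) gmod" and A' :: "('f, 'n::ab_group_add) gmod" and h f a b
  proof -
    show "(\<lambda>u t x. f u t (h u t x)) \<in> ghom A Y a b" using ghom_comp[OF h(1) f A] by simp
    show "gD A Y a b (\<lambda>u t x. f u t (h u t x)) = (\<lambda>u t x. gD A' Y a b f u t (h u t x))"
    proof (intro ext)
      fix u t x
      show "gD A Y a b (\<lambda>u t x. f u t (h u t x)) u t x = gD A' Y a b f u t (h u t x)"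
      proof (cases "x \<in> gco A u t")
        case True
        then show ?thesis using gD_comp[OF h(1) f A Y True] h(2) ghom_zero[OF A(2) f] by simp
      next
        case False
        then show ?thesis using ghom_out[OF h(1) False] ghom_zero[OF A(2) gD_ghom[OF A(2) Y f]]
          by (simp add: gD_def[of A Y])
      qed
    qed
  qed
  \<comment> \<open>If \<open>1 - n = D m\<close> and \<open>f\<close> is a cocycle, then by the
    Leibniz rule \<open>f (1 - n)\<close> is \<open>D (f m)\<close> up to the sign
    \<open>(-1)^a\<close>, which is absorbed into the primitive \<open>?h'\<close>.\<close>
  have homot: "\<exists>h\<in>ghom A Y (a - 1) b. (\<lambda>u t x. f u t (if x \<in> gco A u t then x - n u t x else 0)) = gD A Y (a - 1) b h"
    if m: "m \<in> ghom A A (-1) 0" "\<And>u t x. x \<in> gco A u t \<Longrightarrow> gD A A (-1) 0 m u t x = x - n u t x"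
      and f: "f \<in> ghom A Y a b" "gD A Y a b f = 0" and A: "gmodule A"
    for A :: "('f, 'm::ab_group_add) gmod" and m n f a b
  proof -
    let ?h = "\<lambda>u t x. f (u + -1) (t + 0) (m u t x)"
    have h: "?h \<in> ghom A Y (a - 1) b" using ghom_comp[OF m(1) f(1) A A] by simp
    have Dh: "gD A Y (a - 1) b ?h u t x = sg a (f u t (x - n u t x))" if "x \<in> gco A u t" for u t x
      using gD_comp[OF m(1) f(1) A A Y that] f(2) m(2)[OF that] by simp
    have in_: "x - n u t x \<in> gco A u t" if "x \<in> gco A u t" for u t x
      using ghom_in[OF gD_ghom[OF A A m(1)] that] m(2)[OF that] by simp
    let ?h' = "if even a then ?h else - ?h"
    have h': "?h' \<in> ghom A Y (a - 1) b" using h ghom_neg[OF Y h A] by simp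
    moreover have "f u t (if x \<in> gco A u t then x - n u t x else 0) = gD A Y (a - 1) b ?h' u t x" for u t x
    proof (cases "x \<in> gco A u t")
      case True
      have "gD A Y (a - 1) b ?h' u t x = sg a (gD A Y (a - 1) b ?h u t x)"
        using gD_neg[OF Y h] by (simp add: sg_def)
      then show ?thesis using Dh[OF True] True by simp
    qed (simp add: gD_def ghom_zero[OF A f(1)])
    ultimately show ?thesis by blast
  qed
  define \<Phi> where "\<Phi> f = (\<lambda>u t x. f u t (g u t x))" for f :: "int \<Rightarrow> int \<Rightarrow> 'w \<Rightarrow> 'y"
  have "sq_map (gH Z' Y a b) (gH Z Y a b) \<Phi>"
    unfolding sq_map_def gH_def subquotient.simps
  proof (intro conjI ballI allI)
    fix f assume f: "f \<in> {f \<in> ghom Z' Y a b. gD Z' Y a b f = 0}"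
    show \<Phi>f: "\<Phi> f \<in> {f \<in> ghom Z Y a b. gD Z Y a b f = 0}"
      using pull[OF g, of f a b] f Zm by (auto simp: \<Phi>_def fun_eq_iff)
    show "\<Phi> f \<in> gD Z Y (a - 1) b ` ghom Z Y (a - 1) b \<longleftrightarrow> f \<in> gD Z' Y (a - 1) b ` ghom Z' Y (a - 1) b"
    proof
      assume "f \<in> gD Z' Y (a - 1) b ` ghom Z' Y (a - 1) b"
      then obtain h where "h \<in> ghom Z' Y (a - 1) b" "f = gD Z' Y (a - 1) b h" by auto
      then show "\<Phi> f \<in> gD Z Y (a - 1) b ` ghom Z Y (a - 1) b"
        using pull[OF g _ Zm, of h "a - 1" b] by (simp add: \<Phi>_def image_iff) (metis (no_types))
    next
      assume "\<Phi> f \<in> gD Z Y (a - 1) b ` ghom Z Y (a - 1) b"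
      then obtain h where h: "h \<in> ghom Z Y (a - 1) b" "\<Phi> f = gD Z Y (a - 1) b h" by auto
      let ?hg = "\<lambda>u t x. h u t (g' u t x)"
      have hg: "?hg \<in> ghom Z' Y (a - 1) b" "gD Z' Y (a - 1) b ?hg = (\<lambda>u t x. f u t (g u t (g' u t x)))"
        using pull[OF g' h(1) Zm(2,1)] unfolding h(2)[symmetric] \<Phi>_def by auto
      obtain j where j: "j \<in> ghom Z' Y (a - 1) b"
        "(\<lambda>u t x. f u t (if x \<in> gco Z' u t then x - g u t (g' u t x) else 0)) = gD Z' Y (a - 1) b j"
        using homot[OF m', of f a b] f Zm by blast
      \<comment> \<open>\<open>f = f g g' + f (1 - g g')\<close>: the first term is a boundary by
        assumption, the second by homotopy.\<close>
      have "f = gD Z' Y (a - 1) b (?hg + j)"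
      proof (intro ext)
        fix u t x
        show "f u t x = gD Z' Y (a - 1) b (?hg + j) u t x"
        proof (cases "x \<in> gco Z' u t")
          case True
          have "g u t (g' u t x) \<in> gco Z' u t" using ghom_in[OF g(1) ghom_in[OF g'(1) True]] by simp
          then have "f u t (x - g u t (g' u t x)) = f u t x - f u t (g u t (g' u t x))"
            using ghom_lin'(1)[OF Zm(2), of f Y a b x] f True by simp
          then show ?thesis using True fun_cong[OF fun_cong[OF fun_cong[OF j(2)]], of u t x, symmetric] gD_plus[OF Y hg(1) j(1)] hg(2) by simp
        next
          case False
          then show ?thesis using f ghom_out[of f] by (auto simp: gD_def)
        qed
      qed
      then show "f \<in> gD Z' Y (a - 1) b ` ghom Z' Y (a - 1) b"
        using ghom_plus[OF Y hg(1) j(1) Zm(2)] by blast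
    qed
  next
    fix f assume f: "f \<in> {f \<in> ghom Z Y a b. gD Z Y a b f = 0}"
    let ?h = "\<lambda>u t x. f u t (g' u t x)"
    have h: "?h \<in> {f \<in> ghom Z' Y a b. gD Z' Y a b f = 0}"
      using pull[OF g', of f a b] f Zm by (auto simp: fun_eq_iff)
    obtain j where j: "j \<in> ghom Z Y (a - 1) b"
        "(\<lambda>u t x. f u t (if x \<in> gco Z u t then x - g' u t (g u t x) else 0)) = gD Z Y (a - 1) b j"
      using homot[OF m, of f a b] f Zm by blast
    have "f - \<Phi> ?h = gD Z Y (a - 1) b j"
    proof (intro ext)
      fix u t x
      show "(f - \<Phi> ?h) u t x = gD Z Y (a - 1) b j u t x"
      proof (cases "x \<in> gco Z u t")
        case True
        have "g' u t (g u t x) \<in> gco Z u t" using ghom_in[OF g'(1) ghom_in[OF g(1) True]] by simp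
        then have "f u t (x - g' u t (g u t x)) = f u t x - f u t (g' u t (g u t x))"
          using ghom_lin'(1)[OF Zm(1), of f Y a b x] f True by simp
        then show ?thesis using True fun_cong[OF fun_cong[OF fun_cong[OF j(2)]], of u t x] by (simp add: \<Phi>_def)
      next
        case False
        then show ?thesis using f ghom_out[of f Z Y a b] ghom_out[OF g(1) False] ghom_zero[OF Zm(2) g'(1)] ghom_zero[OF Zm(1), of f]
          by (auto simp: gD_def \<Phi>_def)
      qed
    qed
    then show "\<exists>x\<in>{f \<in> ghom Z' Y a b. gD Z' Y a b f = 0}. f - \<Phi> x \<in> gD Z Y (a - 1) b ` ghom Z Y (a - 1) b"
      using h j(1) by blast
  qed (auto simp: \<Phi>_def fun_eq_iff)
  then show ?thesis by blast
qed

end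

text \<open>Well-formedness enters to know that sums and multiples of cycles again name classes, at
  which the inverse may be evaluated.\<close>

lemma sq_iso_sym:
  assumes H: "sq_wf H" and H': "sq_wf H'" and iso: "sq_iso H H' \<phi>"
  shows "\<exists>\<psi>. sq_iso H' H \<psi>"
proof -
  define \<psi> where "\<psi> = the_inv_into (sq_carrier H) \<phi>"
  have bij: "bij_betw \<phi> (sq_carrier H) (sq_carrier H')" using iso by (simp add: sq_iso_def)
  have \<psi>: "bij_betw \<psi> (sq_carrier H') (sq_carrier H)"
    unfolding \<psi>_def by (rule bij_betw_the_inv_into[OF bij])
  have eq: "\<psi> C = D \<longleftrightarrow> \<phi> D = C" if "C \<in> sq_carrier H'" "D \<in> sq_carrier H" for C D
    using that bij unfolding \<psi>_def
    by (metis bij_betw_def f_the_inv_into_f the_inv_into_f_f)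
  have car: "sq_class H x \<in> sq_carrier H" if "x \<in> cycles H" for x using that by (simp add: sq_carrier_def)
  have car': "sq_class H' x \<in> sq_carrier H'" if "x \<in> cycles H'" for x using that by (simp add: sq_carrier_def)
  have cl: "x + y \<in> cycles H" "sq_scale H c x \<in> cycles H" if "x \<in> cycles H" "y \<in> cycles H" for x y c
    using that H by (auto simp: sq_wf_def)
  have cl': "x + y \<in> cycles H'" "sq_scale H' c x \<in> cycles H'" if "x \<in> cycles H'" "y \<in> cycles H'" for x y c
    using that H' by (auto simp: sq_wf_def)
  have "sq_iso H' H \<psi>"
    unfolding sq_iso_def
  proof (intro conjI ballI impI allI)
    fix x y x' y' assume xy: "x \<in> cycles H'" "y \<in> cycles H'" "x' \<in> cycles H" "y' \<in> cycles H"
      and e: "\<psi> (sq_class H' x) = sq_class H x'" "\<psi> (sq_class H' y) = sq_class H y'"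
    have "\<phi> (sq_class H x') = sq_class H' x" "\<phi> (sq_class H y') = sq_class H' y"
      using e xy by (simp_all add: eq car car')
    then have "\<phi> (sq_class H (x' + y')) = sq_class H' (x + y)"
      "\<And>c. \<phi> (sq_class H (sq_scale H c x')) = sq_class H' (sq_scale H' c x)"
      using iso xy unfolding sq_iso_def by blast+
    then show "\<psi> (sq_class H' (x + y)) = sq_class H (x' + y')"
      "\<And>c. \<psi> (sq_class H' (sq_scale H' c x)) = sq_class H (sq_scale H c x')"
      using cl[OF xy(3,4)] cl'[OF xy(1,2)] by (simp_all add: eq car car')
  qed (rule \<psi>)
  then show ?thesis by blast
qed

text \<open>\<open>sq_iso\<close> speaks of representatives, so composing requires naming cycles for
  the intermediate classes.\<close>

lemma sq_iso_trans:
  assumes "sq_iso H H' \<phi>" "sq_iso H' H'' \<psi>"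
  shows "sq_iso H H'' (\<psi> \<circ> \<phi>)"
  unfolding sq_iso_def
proof (intro conjI ballI impI allI)
  show "bij_betw (\<psi> \<circ> \<phi>) (sq_carrier H) (sq_carrier H'')"
    using assms by (auto simp: sq_iso_def intro: bij_betw_trans)
  fix x y x' y' assume xy: "x \<in> cycles H" "y \<in> cycles H" "x' \<in> cycles H''" "y' \<in> cycles H''"
    and e: "(\<psi> \<circ> \<phi>) (sq_class H x) = sq_class H'' x'" "(\<psi> \<circ> \<phi>) (sq_class H y) = sq_class H'' y'"
  have "\<phi> (sq_class H z) \<in> sq_carrier H'" if "z \<in> cycles H" for z
    using that assms(1) by (auto simp: sq_iso_def sq_carrier_def bij_betw_def)
  then obtain x1 y1 where 1: "x1 \<in> cycles H'" "y1 \<in> cycles H'" "\<phi> (sq_class H x) = sq_class H' x1" "\<phi> (sq_class H y) = sq_class H' y1"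
    using xy unfolding sq_carrier_def by (metis imageE)
  then have "\<psi> (sq_class H' x1) = sq_class H'' x'" "\<psi> (sq_class H' y1) = sq_class H'' y'" using e by auto
  moreover have "\<phi> (sq_class H (x + y)) = sq_class H' (x1 + y1)"
    "\<And>c. \<phi> (sq_class H (sq_scale H c x)) = sq_class H' (sq_scale H' c x1)"
    using assms(1) xy 1 unfolding sq_iso_def by blast+
  ultimately show "(\<psi> \<circ> \<phi>) (sq_class H (x + y)) = sq_class H'' (x' + y')"
    "\<And>c. (\<psi> \<circ> \<phi>) (sq_class H (sq_scale H c x)) = sq_class H'' (sq_scale H'' c x')"
    using assms(2) xy 1(1,2) unfolding sq_iso_def comp_def by simp_all
qed

text \<open>When cycles and boundaries are exactly the images of those of a well-formed subquotient,
  both well-formedness and the comparison come at once. This spares a direct verification for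
  \<open>HomE_cohomology\<close>.\<close>

lemma sq_image:
  assumes H: "sq_wf H" and c: "cycles H' = \<Psi> ` cycles H" and b: "boundaries H' = \<Psi> ` boundaries H"
    and inj: "inj_on \<Psi> (cycles H)" and add: "\<And>x y. x \<in> cycles H \<Longrightarrow> y \<in> cycles H \<Longrightarrow> \<Psi> (x + y) = \<Psi> x + \<Psi> y"
    and scale: "\<And>c x. x \<in> cycles H \<Longrightarrow> \<Psi> (sq_scale H c x) = sq_scale H' c (\<Psi> x)"
  shows "sq_wf H'" "sq_map H H' \<Psi>"
proof -
  have Hb: "boundaries H \<subseteq> cycles H" "0 \<in> boundaries H" "\<And>x. x \<in> boundaries H \<Longrightarrow> - x \<in> boundaries H"
    "\<And>x y. x \<in> boundaries H \<Longrightarrow> y \<in> boundaries H \<Longrightarrow> x + y \<in> boundaries H"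
    "\<And>x y. x \<in> cycles H \<Longrightarrow> y \<in> cycles H \<Longrightarrow> x + y \<in> cycles H" "\<And>x. x \<in> cycles H \<Longrightarrow> - x \<in> cycles H"
    "\<And>c x. x \<in> cycles H \<Longrightarrow> sq_scale H c x \<in> cycles H"
    "\<And>x y c. x \<in> cycles H \<Longrightarrow> y \<in> cycles H \<Longrightarrow> x - y \<in> boundaries H \<Longrightarrow> sq_scale H c x - sq_scale H c y \<in> boundaries H"
    using H unfolding sq_wf_def by blast+
  have zero: "\<Psi> 0 = 0" using add[of 0 0] Hb(1,2) by auto
  have neg: "\<Psi> (- x) = - \<Psi> x" if "x \<in> cycles H" for x
    using add[OF that Hb(6)[OF that]] zero by (simp add: add_eq_0_iff)
  have diff: "\<Psi> (x - y) = \<Psi> x - \<Psi> y" "x - y \<in> cycles H" if "x \<in> cycles H" "y \<in> cycles H" for x y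
    using add[OF that(1) Hb(6)[OF that(2)]] neg[OF that(2)] Hb(5)[OF that(1) Hb(6)[OF that(2)]] by auto
  have bd: "\<Psi> x \<in> \<Psi> ` boundaries H \<longleftrightarrow> x \<in> boundaries H" if "x \<in> cycles H" for x
    using that inj Hb(1) by (auto simp: inj_on_def)
  show "sq_map H H' \<Psi>"
    unfolding sq_map_def c b
  proof (intro conjI ballI allI)
    fix y assume "y \<in> \<Psi> ` cycles H"
    then obtain x where "x \<in> cycles H" "y = \<Psi> x" by auto
    then show "\<exists>x\<in>cycles H. y - \<Psi> x \<in> \<Psi> ` boundaries H" using zero Hb(2) by (metis diff_self imageI)
  qed (use add scale bd in auto)
  show "sq_wf H'"
    unfolding sq_wf_def c b
  proof (intro conjI ballI allI impI)
    show "0 \<in> \<Psi> ` boundaries H" using zero Hb(2) by (metis imageI)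
    show "\<Psi> ` boundaries H \<subseteq> \<Psi> ` cycles H" using Hb(1) by blast
  next
    fix x y assume "x \<in> \<Psi> ` boundaries H" "y \<in> \<Psi> ` boundaries H"
    then obtain x' y' where "x' \<in> boundaries H" "y' \<in> boundaries H" "x = \<Psi> x'" "y = \<Psi> y'" by auto
    then show "x + y \<in> \<Psi> ` boundaries H" using add[of x' y'] Hb(1,4) by (metis imageI subsetD)
  next
    fix x assume "x \<in> \<Psi> ` boundaries H"
    then obtain x' where "x' \<in> boundaries H" "x = \<Psi> x'" by auto
    then show "- x \<in> \<Psi> ` boundaries H" using neg[of x'] Hb(1,3) by (metis imageI subsetD)
  next
    fix x y assume "x \<in> \<Psi> ` cycles H" "y \<in> \<Psi> ` cycles H"
    then obtain x' y' where "x' \<in> cycles H" "y' \<in> cycles H" "x = \<Psi> x'" "y = \<Psi> y'" by auto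
    then show "x + y \<in> \<Psi> ` cycles H" using add[of x' y'] Hb(5) by (metis imageI)
  next
    fix x assume "x \<in> \<Psi> ` cycles H"
    then obtain x' where x': "x' \<in> cycles H" "x = \<Psi> x'" by auto
    then show "- x \<in> \<Psi> ` cycles H" using neg[of x'] Hb(6) by (metis imageI)
    fix c show "sq_scale H' c x \<in> \<Psi> ` cycles H" using x' scale[of x' c] Hb(7) by (metis imageI)
  next
    fix c x y assume "x \<in> \<Psi> ` cycles H" "y \<in> \<Psi> ` cycles H" "x - y \<in> \<Psi> ` boundaries H"
    then obtain x' y' where xy: "x' \<in> cycles H" "y' \<in> cycles H" "x = \<Psi> x'" "y = \<Psi> y'" "\<Psi> x' - \<Psi> y' \<in> \<Psi> ` boundaries H" by auto
    then have "x' - y' \<in> boundaries H" using diff[of x' y'] bd[of "x' - y'"] by auto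
    then have "sq_scale H c x' - sq_scale H c y' \<in> boundaries H" using Hb(8) xy by blast
    moreover have "sq_scale H' c x - sq_scale H' c y = \<Psi> (sq_scale H c x' - sq_scale H c y')"
      using xy scale diff(1)[of "sq_scale H c x'" "sq_scale H c y'"] Hb(7) by simp
    ultimately show "sq_scale H' c x - sq_scale H' c y \<in> \<Psi> ` boundaries H" by simp
  qed
qed

section \<open>Bases\<close>

lemma vector_space_mult: "vector_space ((*) :: 'f::field \<Rightarrow> 'f \<Rightarrow> 'f)"
  by unfold_locales (auto simp: algebra_simps)

lemma basis_family_coord:
  assumes "vector_space s" "basis_family s V I b" "i \<in> I"
  shows "\<exists>c. lin_on s V (*) UNIV c \<and> (\<forall>j\<in>I. c (b j) = (if i = j then 1 else 0))"
proof -
  interpret F: vector_space "(*) :: 'f::field \<Rightarrow> 'f \<Rightarrow> 'f" by (rule vector_space_mult)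
  obtain c where "c \<in> lin_maps s V (*) UNIV" "\<forall>j\<in>I. c (b j) = (if i = j then 1 else 0)"
    using basis_family_extend[OF assms(1) vector_space_mult assms(2), of UNIV "\<lambda>j. if i = j then 1 else 0"]
    by auto
  then show ?thesis by (auto simp: lin_maps_def)
qed

lemma lin_on_id: "vector_space s \<Longrightarrow> lin_on s V s V (\<lambda>x. x)"
  by (simp add: lin_on_def)

text \<open>Coordinates on the image are the old coordinates after the inverse of
  \<open>J\<close>.\<close>

lemma basis_family_image:
  fixes s :: "'f::field \<Rightarrow> 'a::ab_group_add \<Rightarrow> 'a" and s' :: "'f \<Rightarrow> 'b::ab_group_add \<Rightarrow> 'b"
  assumes s: "vector_space s" "vector_space s'" and b: "basis_family s V I b"
    and J: "lin_on s V s' W J" "inj_on J V"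
  shows "basis_family s' (J ` V) I (\<lambda>i. J (b i))"
proof -
  interpret S: vector_space s by fact
  interpret S': vector_space s' by fact
  have V: "S.subspace V" by (rule basis_family_subspace[OF s(1) b])
  have bV: "b i \<in> V" if "i \<in> I" for i by (rule basis_familyD[OF s(1) b that])
  have span: "S.span (b ` I) = V" using b by (simp add: basis_family_def)
  obtain c where c: "\<And>i. i \<in> I \<Longrightarrow> lin_on s V (*) UNIV (c i)" "\<And>i j. i \<in> I \<Longrightarrow> j \<in> I \<Longrightarrow> c i (b j) = (if i = j then 1 else 0)"
    using basis_family_coord[OF s(1) b] by metis
  define c' where "c' i y = c i (the_inv_into V J y)" for i y
  have inv: "the_inv_into V J (J x) = x" if "x \<in> V" for x by (rule the_inv_into_f_f[OF J(2) that])
  show ?thesis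
  proof (rule basis_familyI[OF s(2), where c = c'])
    show "S'.subspace (J ` V)"
    proof (rule S'.subspaceI)
      show "0 \<in> J ` V" using lin_on_zero[OF J(1) S.subspace_0[OF V]] S.subspace_0[OF V] by (metis imageI)
      show "x + y \<in> J ` V" if "x \<in> J ` V" "y \<in> J ` V" for x y
        using that lin_onD(2)[OF J(1), symmetric] S.subspace_add[OF V] by auto
      show "s' c x \<in> J ` V" if "x \<in> J ` V" for c x
        using that lin_onD(3)[OF J(1), symmetric] S.subspace_scale[OF V] by auto
    qed
    show "J (b i) \<in> J ` V" if "i \<in> I" for i using bV[OF that] by simp
    show "c' i (J (b j)) = (if i = j then 1 else 0)" if "i \<in> I" "j \<in> I" for i j
      using c(2)[OF that] bV[OF that(2)] by (simp add: c'_def inv)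
    show "lin_on s' (J ` V) (*) UNIV (c' i)" if "i \<in> I" for i
      using lin_onD[OF c(1)[OF that]] S.subspace_add[OF V] S.subspace_scale[OF V]
      by (auto simp: lin_on_def c'_def inv lin_onD(2)[OF J(1), symmetric] lin_onD(3)[OF J(1), symmetric])
    fix y assume "y \<in> J ` V"
    then obtain x where x: "x \<in> V" "y = J x" by auto
    from x(1) have "x \<in> S.span (b ` I)" using span by simp
    then have "x \<in> V \<and> J x \<in> S'.span ((\<lambda>i. J (b i)) ` I)"
    proof (induction rule: S.span_induct_alt)
      case base
      then show ?case using lin_on_zero[OF J(1) S.subspace_0[OF V]] S.subspace_0[OF V] S'.span_zero by simp
    next
      case (step c x y)
      then obtain i where i: "i \<in> I" "x = b i" by auto
      then have "J (s c x + y) = s' c (J (b i)) + J y" "s c x + y \<in> V"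
        using lin_onD(2,3)[OF J(1)] step bV S.subspace_scale[OF V] S.subspace_add[OF V] by auto
      moreover have "J (b i) \<in> S'.span ((\<lambda>i. J (b i)) ` I)" using i by (intro S'.span_base) auto
      ultimately show ?case using step i by (simp add: S'.span_add S'.span_scale)
    qed
    then show "y \<in> S'.span ((\<lambda>i. J (b i)) ` I)" using x by simp
  qed
qed

lemma basis_family_reindex:
  assumes "basis_family s V I b" "bij_betw h I J" "\<And>i. i \<in> I \<Longrightarrow> b' (h i) = b i"
  shows "basis_family s V J b'"
proof -
  have "b' ` J = b ` I" using assms(2,3) by (auto simp: bij_betw_def image_iff)
  moreover have "inj_on b' J"
  proof (rule inj_onI)
    fix x y assume xy: "x \<in> J" "y \<in> J" "b' x = b' y"
    then obtain i j where ij: "i \<in> I" "j \<in> I" "x = h i" "y = h j" using assms(2) by (auto simp: bij_betw_def)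
    then have "b i = b j" using xy(3) assms(3) by simp
    then show "x = y" using ij assms(1) unfolding basis_family_def inj_on_def by blast
  qed
  ultimately show ?thesis using assms(1) by (simp add: basis_family_def)
qed

lemma subspace_basis:
  assumes "vector_space s" "module.subspace s V"
  shows "\<exists>B. basis_family s V B (\<lambda>b. b)"
proof -
  interpret vector_space s by fact
  obtain B where "B \<subseteq> V" "independent B" "V \<subseteq> span B" by (rule basis_exists[of V])
  then have "span B = V" using span_minimal[OF _ assms(2)] by blast
  then show ?thesis using \<open>independent B\<close> by (auto simp: basis_family_def)
qed

definition delta :: "'k \<Rightarrow> 'a::zero \<Rightarrow> 'k \<Rightarrow> 'a" where
  "delta k b = (\<lambda>k'. if k' = k then b else 0)"

lemma vector_space_fun:
  assumes "vector_space s"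
  shows "vector_space (\<lambda>c (x :: 'k \<Rightarrow> 'a::ab_group_add) k. s c (x k))"
proof -
  interpret vector_space s by fact
  show ?thesis by unfold_locales (auto simp: fun_eq_iff scale_right_distrib scale_left_distrib)
qed

text \<open>For finite \<open>K\<close> this is the direct sum of the \<open>V k\<close>; it stands
  in for the tensor product of a space with basis \<open>K\<close> and a module.\<close>

definition fun_sub :: "'k set \<Rightarrow> ('k \<Rightarrow> 'a set) \<Rightarrow> ('k \<Rightarrow> 'a::zero) set" where
  "fun_sub K V = {x. \<forall>k. if k \<in> K then x k \<in> V k else x k = 0}"

lemma fun_sub_subspace:
  assumes "vector_space s" "\<And>k. k \<in> K \<Longrightarrow> module.subspace s (V k)"
  shows "module.subspace (\<lambda>c x k. s c (x k)) (fun_sub K V)"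
proof -
  interpret vector_space s by fact
  interpret F: vector_space "\<lambda>c x k. s c (x k)" by (rule vector_space_fun[OF assms(1)])
  show ?thesis
    by (rule F.subspaceI)
      (auto simp: fun_sub_def assms(2) subspace_0 subspace_add subspace_scale split: if_splits)
qed

lemma fun_sum_delta:
  fixes x :: "'k \<Rightarrow> 'a::ab_group_add"
  assumes "finite K" "\<And>k. k \<notin> K \<Longrightarrow> x k = 0"
  shows "x = (\<Sum>k\<in>K. delta k (x k))"
proof
  fix k
  have "(\<Sum>k\<in>K. delta k (x k)) k = (\<Sum>k'\<in>K. delta k' (x k') k)"
    using assms(1) by (induction K rule: finite_induct) auto
  also have "\<dots> = (\<Sum>k'\<in>K. if k = k' then x k else 0)"
    by (rule sum.cong) (auto simp: delta_def)
  finally show "x k = (\<Sum>k\<in>K. delta k (x k)) k" using assms by (simp add: sum.delta)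
qed

text \<open>The coordinate at \<open>(k, b)\<close> is the \<open>b\<close>-coordinate of the value
  at \<open>k\<close>. Spanning uses that \<open>K\<close> is finite: a function is then the finite
  sum of its pieces.\<close>

lemma fun_basis:
  fixes s :: "'f::field \<Rightarrow> 'a::ab_group_add \<Rightarrow> 'a" and K :: "'k set"
  assumes s: "vector_space s" and K: "finite K" and B: "\<And>k. k \<in> K \<Longrightarrow> basis_family s (V k) (Bas k) (\<lambda>b. b)"
  shows "basis_family (\<lambda>c x k. s c (x k)) (fun_sub K V) (Sigma K Bas) (\<lambda>(k, b). delta k b)"
proof -
  interpret vector_space s by fact
  interpret F: vector_space "\<lambda>c (x :: 'k \<Rightarrow> 'a) k. s c (x k)" by (rule vector_space_fun[OF s])
  have V: "subspace (V k)" if "k \<in> K" for k by (rule basis_family_subspace[OF s B[OF that]])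
  have BV: "b \<in> V k" if "k \<in> K" "b \<in> Bas k" for k b using basis_familyD[OF s B[OF that(1)] that(2)] .
  obtain c where c: "\<And>k b. k \<in> K \<Longrightarrow> b \<in> Bas k \<Longrightarrow> lin_on s (V k) (*) UNIV (c k b)"
    "\<And>k b b'. k \<in> K \<Longrightarrow> b \<in> Bas k \<Longrightarrow> b' \<in> Bas k \<Longrightarrow> c k b b' = (if b = b' then 1 else 0)"
    using basis_family_coord[OF s B] by metis
  show ?thesis
  proof (rule basis_familyI[where c = "\<lambda>(k, b) x. c k b (x k)"])
    show "F.subspace (fun_sub K V)" by (rule fun_sub_subspace[OF s V])
    show "(case i of (k, b) \<Rightarrow> delta k b) \<in> fun_sub K V" if "i \<in> Sigma K Bas" for i
      using that by (auto simp: fun_sub_def delta_def subspace_0[OF V] BV)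
    fix i assume i: "i \<in> Sigma K Bas"
    then obtain k b where kb: "i = (k, b)" "k \<in> K" "b \<in> Bas k" by auto
    have fs: "x k \<in> V k" if "x \<in> fun_sub K V" for x using that kb(2) by (auto simp: fun_sub_def split: if_splits)
    show "lin_on (\<lambda>c x k. s c (x k)) (fun_sub K V) (*) UNIV (case i of (k, b) \<Rightarrow> \<lambda>x. c k b (x k))"
      using lin_onD[OF c(1)[OF kb(2,3)] fs] fs by (simp add: lin_on_def kb)
    show "(case i of (k, b) \<Rightarrow> \<lambda>x. c k b (x k)) (case j of (k, b) \<Rightarrow> delta k b) = (if i = j then 1 else 0)"
      if j: "j \<in> Sigma K Bas" for j
    proof -
      obtain k' b' where j': "j = (k', b')" "k' \<in> K" "b' \<in> Bas k'" using j by auto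
      show ?thesis
        using c(2)[OF kb(2,3), of b'] j' lin_on_zero[OF c(1)[OF kb(2,3)] subspace_0[OF V[OF kb(2)]]]
        by (cases "k = k'") (simp_all add: kb delta_def)
    qed
  next
    fix x assume x: "x \<in> fun_sub K V"
    have "delta k y \<in> F.span ((\<lambda>(k, b). delta k b) ` Sigma K Bas)" if k: "k \<in> K" and y: "y \<in> V k" for k y
    proof -
      have "y \<in> span (Bas k)" using B[OF k] y by (simp add: basis_family_def)
      then show ?thesis
      proof (induction rule: span_induct_alt)
        case base
        have "delta k 0 = (0 :: 'k \<Rightarrow> 'a)" by (auto simp: delta_def)
        then show ?case using F.span_zero by (simp only:)
      next
        case (step c x y)
        have 1: "delta k (s c x + y) = (\<lambda>k'. s c (delta k x k')) + delta k y" by (auto simp: delta_def)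
        have 2: "delta k x \<in> F.span ((\<lambda>(k, b). delta k b) ` Sigma K Bas)"
          using step(1) k by (intro F.span_base) auto
        show ?case unfolding 1 by (rule F.span_add[OF F.span_scale[OF 2] step(2)])
      qed
    qed
    moreover have "x k \<in> V k" if "k \<in> K" for k using x that by (auto simp: fun_sub_def split: if_splits)
    moreover have "x = (\<Sum>k\<in>K. delta k (x k))" using x by (intro fun_sum_delta[OF K]) (auto simp: fun_sub_def split: if_splits)
    ultimately show "x \<in> F.span ((\<lambda>(k, b). delta k b) ` Sigma K Bas)"
      by (metis (no_types, lifting) F.span_sum)
  qed (rule vector_space_fun[OF s])
qed

section \<open>Finitely supported functions as a vector space\<close>

lemma lookup_pm_scale: "Poly_Mapping.lookup (pm_scale c x) k = c * Poly_Mapping.lookup x k"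
  by (simp add: pm_scale_def Poly_Mapping.map.rep_eq when_def)

lemma vector_space_pm: "vector_space (pm_scale :: 'f::field \<Rightarrow> ('k \<Rightarrow>\<^sub>0 'f) \<Rightarrow> _)"
  by unfold_locales
    (auto intro!: poly_mapping_eqI simp: lookup_pm_scale lookup_add algebra_simps)

lemma pm_sum_single:
  "x = (\<Sum>k\<in>Poly_Mapping.keys x. pm_scale (Poly_Mapping.lookup x k) (Poly_Mapping.single k (1::'f::field)))"
proof (rule poly_mapping_eqI)
  fix k
  have "Poly_Mapping.lookup (\<Sum>k\<in>Poly_Mapping.keys x. pm_scale (Poly_Mapping.lookup x k) (Poly_Mapping.single k 1)) k =
     (\<Sum>k'\<in>Poly_Mapping.keys x. if k' = k then Poly_Mapping.lookup x k else 0)"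
    unfolding lookup_sum by (rule sum.cong) (auto simp: lookup_pm_scale lookup_single when_def)
  also have "\<dots> = Poly_Mapping.lookup x k" by (simp add: sum.delta in_keys_iff)
  finally show "Poly_Mapping.lookup x k = Poly_Mapping.lookup (\<Sum>k\<in>Poly_Mapping.keys x. pm_scale (Poly_Mapping.lookup x k) (Poly_Mapping.single k 1)) k"
    by simp
qed

lemma pm_basis:
  fixes A :: "'k set"
  shows "basis_family (pm_scale :: 'f::field \<Rightarrow> _) {x. Poly_Mapping.keys x \<subseteq> A} A (\<lambda>k. Poly_Mapping.single k 1)"
proof (rule basis_familyI[OF vector_space_pm, where c = "\<lambda>k x. Poly_Mapping.lookup x k"])
  interpret vector_space "pm_scale :: 'f \<Rightarrow> ('k \<Rightarrow>\<^sub>0 'f) \<Rightarrow> _" by (rule vector_space_pm)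
  show "subspace {x. Poly_Mapping.keys x \<subseteq> A}"
  proof (rule subspaceI)
    fix x y :: "'k \<Rightarrow>\<^sub>0 'f" assume "x \<in> {x. Poly_Mapping.keys x \<subseteq> A}" "y \<in> {x. Poly_Mapping.keys x \<subseteq> A}"
    then show "x + y \<in> {x. Poly_Mapping.keys x \<subseteq> A}" using Poly_Mapping.keys_add[of x y] by blast
  qed (auto simp: in_keys_iff lookup_pm_scale)
  fix x :: "'k \<Rightarrow>\<^sub>0 'f" assume "x \<in> {x. Poly_Mapping.keys x \<subseteq> A}"
  then show "x \<in> span ((\<lambda>k. Poly_Mapping.single k 1) ` A)"
    by (subst pm_sum_single, intro span_sum span_scale span_base) auto
qed (auto simp: lin_on_def lookup_add lookup_pm_scale lookup_single)

text \<open>This moves an explicit model into the type \<open>resolving\<close>. The basis element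
  with index \<open>i\<close> goes to the key \<open>\<kappa> i\<close>; a linear left inverse
  \<open>L\<close>, which exists because \<open>\<kappa>\<close> is injective, shows that nothing
  collapses.\<close>

lemma embed_pm:
  fixes s :: "'f::field \<Rightarrow> 'a::ab_group_add \<Rightarrow> 'a" and \<kappa> :: "'i \<Rightarrow> 'k"
  assumes s: "vector_space s" and b: "basis_family s V I b" and \<kappa>: "inj_on \<kappa> I"
  shows "\<exists>J :: 'a \<Rightarrow> ('k \<Rightarrow>\<^sub>0 'f). lin_on s V pm_scale UNIV J \<and> inj_on J V"
proof -
  interpret S: vector_space s by fact
  interpret P: vector_space "pm_scale :: 'f \<Rightarrow> ('k \<Rightarrow>\<^sub>0 'f) \<Rightarrow> _" by (rule vector_space_pm)
  have V: "S.subspace V" by (rule basis_family_subspace[OF s b])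
  obtain J :: "'a \<Rightarrow> ('k \<Rightarrow>\<^sub>0 'f)" where J: "J \<in> lin_maps s V pm_scale UNIV" "\<forall>i\<in>I. J (b i) = Poly_Mapping.single (\<kappa> i) 1"
    using basis_family_extend[OF s vector_space_pm b P.subspace_UNIV, of "\<lambda>i. Poly_Mapping.single (\<kappa> i) 1"] by auto
  have pmb: "basis_family (pm_scale :: 'f \<Rightarrow> ('k \<Rightarrow>\<^sub>0 'f) \<Rightarrow> _) UNIV UNIV (\<lambda>k. Poly_Mapping.single k 1)"
    using pm_basis[of "UNIV :: 'k set"] by simp
  obtain L where L: "L \<in> lin_maps pm_scale UNIV s UNIV"
    "\<forall>k\<in>UNIV. L (Poly_Mapping.single k 1) = (if k \<in> \<kappa> ` I then b (the_inv_into I \<kappa> k) else 0)"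
    using basis_family_extend[OF vector_space_pm s pmb S.subspace_UNIV, of "\<lambda>k. if k \<in> \<kappa> ` I then b (the_inv_into I \<kappa> k) else 0"]
    by auto
  have LJ: "lin_on s V s UNIV (\<lambda>x. L (J x))"
    using J(1) L(1) by (auto simp: lin_maps_def lin_on_def)
  have "L (J x) = x" if x: "x \<in> V" for x
  proof (rule lin_on_eq_on_span[OF s V LJ lin_on_id[OF s]])
    show "b ` I \<subseteq> V" using basis_familyD[OF s b] by auto
    show "x \<in> S.span (b ` I)" using x b by (simp add: basis_family_def)
    show "L (J y) = y" if "y \<in> b ` I" for y
      using that J(2) L(2) the_inv_into_f_f[OF \<kappa>] by auto
  qed
  then have "inj_on J V" by (metis inj_onI)
  then show ?thesis using J(1) by (auto simp: lin_maps_def)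
qed

lemma lin_on_image_subspace:
  assumes "vector_space s" "vector_space s'" "module.subspace s V" "lin_on s V s' W J"
  shows "module.subspace s' (J ` V)"
proof -
  interpret S: vector_space s by fact
  interpret S': vector_space s' by fact
  show ?thesis
  proof (rule S'.subspaceI)
    show "0 \<in> J ` V" using lin_on_zero[OF assms(4) S.subspace_0[OF assms(3)]] S.subspace_0[OF assms(3)] by (metis imageI)
    show "x + y \<in> J ` V" if "x \<in> J ` V" "y \<in> J ` V" for x y
      using that lin_onD(2)[OF assms(4), symmetric] S.subspace_add[OF assms(3)] by auto
    show "s' c x \<in> J ` V" if "x \<in> J ` V" for c x
      using that lin_onD(3)[OF assms(4), symmetric] S.subspace_scale[OF assms(3)] by auto
  qed
qed

lemma lin_on_span:
  assumes "vector_space s" "vector_space s'" "module.subspace s V" "lin_on s V s' W J"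
    "T \<subseteq> V" "x \<in> module.span s T"
  shows "J x \<in> module.span s' (J ` T)"
proof -
  interpret S: vector_space s by fact
  interpret S': vector_space s' by fact
  have "x \<in> V \<and> J x \<in> S'.span (J ` T)"
    using assms(6)
  proof (induction rule: S.span_induct_alt)
    case base
    then show ?case using lin_on_zero[OF assms(4)] S.subspace_0[OF assms(3)] S'.span_zero by simp
  next
    case (step c x y)
    then have "x \<in> V" "s c x \<in> V" using assms(5) S.subspace_scale[OF assms(3)] by auto
    moreover have "J x \<in> S'.span (J ` T)" using step by (intro S'.span_base) auto
    ultimately show ?case using step
      by (simp add: lin_onD(2,3)[OF assms(4)] S.subspace_add[OF assms(3)] S'.span_add S'.span_scale)
  qed
  then show ?thesis by simp
qed

section \<open>Transport along isomorphisms and embeddings\<close>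

context grading
begin

text \<open>The inverse of a bijective chain map is again a chain map. The direction from
  \<open>Y\<close> to \<open>X\<close> is the one needed to resolve \<open>X\<close> by a model
  \<open>Y\<close>.\<close>

lemma gquasi_iso_bij:
  fixes X :: "('f::field, 'x::ab_group_add) gmod" and Y :: "('f, 'y::ab_group_add) gmod"
  assumes X: "gmodule X" and Y: "gmodule Y" and e: "e \<in> ghom X Y 0 0" "gD X Y 0 0 e = 0"
    and bij: "\<And>u t. bij_betw (e u t) (gco X u t) (gco Y u t)"
  shows "\<exists>e'. gquasi_iso Y X e'"
proof -
  define e' where "e' u t y = (if y \<in> gco Y u t then the_inv_into (gco X u t) (e u t) y else 0)" for u t y
  have inv: "e' u t (e u t x) = x" "e u t x \<in> gco Y u t" if "x \<in> gco X u t" for u t x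
    using that bij[of u t] by (auto simp: e'_def bij_betw_def the_inv_into_f_f)
  have ex: "\<exists>x\<in>gco X u t. y = e u t x" if "y \<in> gco Y u t" for u t y
    using that bij[of u t] by (auto simp: bij_betw_def)
  have ed: "e (u + 1) t (gd X u t x) = gd Y u t (e u t x)" if "x \<in> gco X u t" for u t x
    using fun_cong[OF fun_cong[OF fun_cong[OF e(2)]], of u t x] that by (simp add: gD_def)
  have eop: "e (u + \<alpha>) (t + \<beta> i) (gop X i u t x) = gop Y i u t (e u t x)" if "i < 3" "x \<in> gco X u t" for i u t x
    using ghom_op[OF e(1) that] by simp
  have e'h: "e' \<in> ghom Y X 0 0"
  proof (rule ghomI)
    fix u t
    show "lin_on (gsc Y u) (gco Y u t) (gsc X (u + 0)) (gco X (u + 0) (t + 0)) (e' u t)"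
    proof (rule lin_onI)
      fix y assume "y \<in> gco Y u t"
      then obtain x where x: "x \<in> gco X u t" "y = e u t x" using ex by blast
      then show "e' u t y \<in> gco X (u + 0) (t + 0)" using inv by simp
      show "e' u t (gsc Y u c y) = gsc X (u + 0) c (e' u t y)" for c
        using inv(1)[of "gsc X u c x" u t] inv(1)[of x u t] x gco_closed[OF X] ghom_sc[OF e(1)] by simp
      fix y' assume "y' \<in> gco Y u t"
      then obtain x' where x': "x' \<in> gco X u t" "y' = e u t x'" using ex by blast
      then show "e' u t (y + y') = e' u t y + e' u t y'"
        using inv(1)[of "x + x'" u t] inv(1) x gco_closed[OF X] ghom_add[OF e(1)] by simp
    qed
    show "e' u t y = 0" if "y \<notin> gco Y u t" for y using that by (simp add: e'_def)
    fix i :: nat and y assume i: "i < 3" and "y \<in> gco Y u t"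
    then obtain x where x: "x \<in> gco X u t" "y = e u t x" using ex by blast
    show "e' (u + \<alpha>) (t + \<beta> i) (gop Y i u t y) = gop X i (u + 0) (t + 0) (e' u t y)"
      using inv(1)[OF gop_in[OF X i x(1)]] eop[OF i x(1)] inv(1)[OF x(1)] x(2) by simp
  qed
  moreover have "gD Y X 0 0 e' = 0"
  proof (intro ext)
    fix u t y
    show "gD Y X 0 0 e' u t y = 0 u t y"
    proof (cases "y \<in> gco Y u t")
      case True
      then obtain x where x: "x \<in> gco X u t" "y = e u t x" using ex by blast
      then show ?thesis using True inv(1)[OF x(1)] inv(1)[OF gd_in[OF X x(1)]] ed[OF x(1)] by (simp add: gD_def)
    qed (simp add: gD_def)
  qed
  moreover have "\<exists>y'\<in>gco Y (u - 1) t. y = gd Y (u - 1) t y'"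
    if y: "y \<in> gco Y u t" and x: "x \<in> gco X (u - 1) t" "e' u t y = gd X (u - 1) t x" for u t x y
  proof -
    obtain z where z: "z \<in> gco X u t" "y = e u t z" using ex[OF y] by blast
    then have "y = e u t (gd X (u - 1) t x)" using x(2) inv by simp
    then show ?thesis using ed[OF x(1)] inv(2)[OF x(1)] by auto
  qed
  moreover have "\<exists>y\<in>gco Y u t. gd Y u t y = 0 \<and> (\<exists>z\<in>gco X (u - 1) t. x - e' u t y = gd X (u - 1) t z)"
    if x: "x \<in> gco X u t" "gd X u t x = 0" for u t x
    using x inv[OF x(1)] ed[OF x(1)] ghom_zero[OF X e(1)] gd_lin(6)[OF X gco_closed(1)[OF X], of "u - 1" t] gco_closed(1)[OF X, of "u - 1" t]
    by (intro bexI[of _ "e u t x"]) auto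
  ultimately show ?thesis unfolding gquasi_iso_def by blast
qed

text \<open>There is one embedding \<open>J u\<close> for each \<open>u\<close>, meant to be linear
  and injective on a space \<open>W u\<close> that contains the components of all internal degrees.
  The differential is set to \<open>0\<close> off the image because the maps of a free resolution
  must vanish outside their domain.\<close>

definition transport ::
  "(int \<Rightarrow> 'x \<Rightarrow> 'y) \<Rightarrow> (int \<Rightarrow> 'x set) \<Rightarrow> ('f \<Rightarrow> 'y \<Rightarrow> 'y) \<Rightarrow> ('f, 'x) gmod \<Rightarrow> ('f, 'y::zero) gmod" where
  "transport J W s' X = \<lparr>gsc = (\<lambda>u. s'), gco = (\<lambda>u t. J u ` gco X u t),
     gd = (\<lambda>u t y. if y \<in> J u ` gco X u t then J (u + 1) (gd X u t (the_inv_into (W u) (J u) y)) else 0),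
     gop = (\<lambda>i u t y. J (u + \<alpha>) (gop X i u t (the_inv_into (W u) (J u) y)))\<rparr>"

context
  fixes X :: "('f::field, 'x::ab_group_add) gmod" and J :: "int \<Rightarrow> 'x \<Rightarrow> 'y::ab_group_add" and W :: "int \<Rightarrow> 'x set"
    and s' :: "'f \<Rightarrow> 'y \<Rightarrow> 'y" and J' :: "int \<Rightarrow> 'y \<Rightarrow> 'x" and T
  assumes X: "gmodule X" and s': "vector_space s'"
    and J: "\<And>u. lin_on (gsc X u) (W u) s' UNIV (J u)" "\<And>u. inj_on (J u) (W u)"
    and W: "\<And>u t. gco X u t \<subseteq> W u"
  defines "J' \<equiv> \<lambda>u. the_inv_into (W u) (J u)" and "T \<equiv> transport J W s' X"
begin

lemma transport_lin: "lin_on (gsc X u) (gco X u t) s' UNIV (J u)" "inj_on (J u) (gco X u t)"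
  using J(1)[of u] W[of u t] inj_on_subset[OF J(2) W] by (auto simp: lin_on_def subset_iff)

lemma transport_inv: "x \<in> gco X u t \<Longrightarrow> J' u (J u x) = x"
  using the_inv_into_f_f[OF J(2)] W unfolding J'_def by blast

lemma transport_sel:
  "gsc T u = s'" "gco T u t = J u ` gco X u t"
  "x \<in> gco X u t \<Longrightarrow> gd T u t (J u x) = J (u + 1) (gd X u t x)"
  "y \<notin> gco T u t \<Longrightarrow> gd T u t y = 0"
  "x \<in> gco X u t \<Longrightarrow> gop T i u t (J u x) = J (u + \<alpha>) (gop X i u t x)"
  using transport_inv by (simp_all add: T_def transport_def J'_def)

lemmas transport_J = lin_onD(2,3)[OF transport_lin(1), symmetric]

lemma transport_neg: "x \<in> gco X u t \<Longrightarrow> J u (- x) = - J u x"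
  using lin_on_neg[OF gmodule_vs[OF X] gmodule_sub[OF X] transport_lin(1)] .

lemma transport_zero: "J u 0 = 0"
  using lin_on_zero[OF transport_lin(1) gco_closed(1)[OF X]] .

lemma gmodule_transport: "gmodule T"
  unfolding gmodule_def
proof (intro conjI allI ballI impI)
  fix u t
  show "module.subspace (gsc T u) (gco T u t)"
    unfolding transport_sel by (rule lin_on_image_subspace[OF gmodule_vs[OF X] s' gmodule_sub[OF X] transport_lin(1)])
  show "lin_on (gsc T u) (gco T u t) (gsc T (u + 1)) (gco T (u + 1) t) (gd T u t)"
    by (rule lin_onI)
      (auto simp: transport_sel transport_J transport_J(1)[OF gd_in[OF X] gd_in[OF X]] transport_J(2)[OF gd_in[OF X]]
        gco_closed[OF X] gd_in[OF X] gd_lin[OF X])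
  fix x assume "x \<in> gco T u t"
  then obtain x' where x': "x' \<in> gco X u t" "x = J u x'" by (auto simp: transport_sel)
  show "gd T (u + 1) t (gd T u t x) = 0"
    using x' by (simp add: transport_sel gd_in[OF X] gmodule_dd[OF X] transport_zero)
next
  fix i :: nat and u t assume i: "i < 3"
  show "lin_on (gsc T u) (gco T u t) (gsc T (u + \<alpha>)) (gco T (u + \<alpha>) (t + \<beta> i)) (gop T i u t)"
    by (rule lin_onI)
      (auto simp: transport_sel transport_J transport_J(1)[OF gop_in[OF X i] gop_in[OF X i]] transport_J(2)[OF gop_in[OF X i]]
        gco_closed[OF X] gop_in[OF X i] gop_lin[OF X i])
  fix x assume "x \<in> gco T u t"
  then obtain x' where x': "x' \<in> gco X u t" "x = J u x'" by (auto simp: transport_sel)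
  show "gd T (u + \<alpha>) (t + \<beta> i) (gop T i u t x) = gop T i (u + 1) t (gd T u t x)"
    using transport_sel(3)[OF gop_in[OF X i x'(1)]] transport_sel(5)[OF gd_in[OF X x'(1)], of i]
    gmodule_dop[OF X i x'(1)]
    by (simp add: x' transport_sel add_ac)
  show "gop T i (u + \<alpha>) (t + \<beta> i) (gop T i u t x) = 0" if anti
    using transport_sel(5)[OF gop_in[OF X i x'(1)], of i] by (simp add: x' transport_sel gmodule_op2[OF X that i x'(1)] transport_zero)
  fix j :: nat assume j: "j < 3"
  have *: "gop T i (u + \<alpha>) (t + \<beta> j) (gop T j u t x) = J (u + \<alpha> + \<alpha>) (gop X i (u + \<alpha>) (t + \<beta> j) (gop X j u t x'))"
    if "j < 3" for i j
    using transport_sel(5)[OF gop_in[OF X that x'(1)], of i] by (simp add: x' transport_sel)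
  show "gop T i (u + \<alpha>) (t + \<beta> j) (gop T j u t x) =
          (if anti then - gop T j (u + \<alpha>) (t + \<beta> i) (gop T i u t x)
           else gop T j (u + \<alpha>) (t + \<beta> i) (gop T i u t x))"
    unfolding *[OF i] *[OF j] using gmodule_opop[OF X i j x'(1)] transport_neg[OF gop_in[OF X j gop_in[OF X i x'(1)]]]
    by simp
qed (simp add: transport_sel s')

lemma gword_transport:
  assumes "x \<in> gco X u t" "set w \<subseteq> {..<3}"
  shows "gword T w u t (J u x) = J (u + \<alpha> * int (length w)) (gword X w u t x)"
  using assms(2)
proof (induction w)
  case (Cons i w)
  then have i: "i < 3" and w: "set w \<subseteq> {..<3}" by auto
  have "gword T (i # w) u t (J u x) = J (u + \<alpha> * int (length w) + \<alpha>) (gword X (i # w) u t x)"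
    using transport_sel(5)[OF gword_in[OF X assms(1) w], of i] Cons.IH[OF w] by simp
  then show ?case by (simp add: algebra_simps)
qed simp

text \<open>The second claim matches the words on a subfamily of generators before and after
  transport; it carries the filtration of a semifree module along.\<close>

lemma gfree_transport:
  assumes "gfree X B"
  shows "gfree T (\<lambda>u t. J u ` B u t)"
    "(\<And>u t. B' u t \<subseteq> B u t) \<Longrightarrow>
      gwd T ` gindex (\<lambda>u t. J u ` B' u t) u t = J u ` gwd X ` gindex B' u t"
proof -
  have BX: "B u t \<subseteq> gco X u t" for u t using gfree_gen[OF assms] by auto
  let ?h = "\<lambda>(w, u', t', b). (w, u', t', J u' b)"
  have word: "gwd T (?h k) = J u (gwd X k)" if k: "k \<in> gindex B u t" for u t k
  proof -
    obtain w u' t' b where k: "k = (w, u', t', b)" "vw w" "b \<in> B u' t'" "u = u' + \<alpha> * int (length w)"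
      using k by (auto simp: gindex_def)
    have "b \<in> gco X u' t'" "set w \<subseteq> {..<3}" using BX k by (auto simp: vw_def)
    from gword_transport[OF this] show ?thesis by (simp add: k)
  qed
  have img: "?h ` gindex B' u t = gindex (\<lambda>u t. J u ` B' u t) u t" for B' u t
  proof
    show "?h ` gindex B' u t \<subseteq> gindex (\<lambda>u t. J u ` B' u t) u t" by (auto simp: gindex_def)
    show "gindex (\<lambda>u t. J u ` B' u t) u t \<subseteq> ?h ` gindex B' u t"
    proof
      fix k assume "k \<in> gindex (\<lambda>u t. J u ` B' u t) u t"
      then obtain w u' t' b where "k = ?h (w, u', t', b)" "(w, u', t', b) \<in> gindex B' u t"
        by (auto simp: gindex_def)
      then show "k \<in> ?h ` gindex B' u t" by blast
    qed
  qed
  have inj: "inj_on ?h (gindex B u t)" for u t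
  proof (rule inj_onI)
    fix k l assume kl: "k \<in> gindex B u t" "l \<in> gindex B u t" "?h k = ?h l"
    then obtain w u' t' b b' where "k = (w, u', t', b)" "l = (w, u', t', b')" "b \<in> B u' t'" "b' \<in> B u' t'" "J u' b = J u' b'"
      by (auto simp: gindex_def)
    then show "k = l" using inj_onD[OF transport_lin(2)] BX by blast
  qed
  show "gfree T (\<lambda>u t. J u ` B u t)"
    unfolding gfree_def
  proof (intro conjI allI gmodule_transport)
    fix u t
    have "basis_family s' (J u ` gco X u t) (gindex B u t) (\<lambda>k. J u (gwd X k))"
      using assms by (intro basis_family_image[OF gmodule_vs[OF X] s' _ transport_lin]) (simp add: gfree_def)
    then show "basis_family (gsc T u) (gco T u t) (gindex (\<lambda>u t. J u ` B u t) u t) (gwd T)"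
      unfolding transport_sel using inj img word by (intro basis_family_reindex[of _ _ "gindex B u t" _ ?h]) (auto simp: bij_betw_def)
  qed
  assume B': "\<And>u t. B' u t \<subseteq> B u t"
  then have "gindex B' u t \<subseteq> gindex B u t" by (auto simp: gindex_def)
  then show "gwd T ` gindex (\<lambda>u t. J u ` B' u t) u t = J u ` gwd X ` gindex B' u t"
    unfolding img[symmetric] image_image using word by (intro image_cong) auto
qed

lemma gsemifree_transport:
  assumes "gsemifree X"
  shows "gsemifree T"
proof -
  obtain B :: "nat \<Rightarrow> int \<Rightarrow> int \<Rightarrow> 'x set" where B: "gfree X (\<lambda>u t. \<Union>l. B l u t)"
    "\<And>l u t b. b \<in> B l u t \<Longrightarrow> gd X u t b \<in> module.span (gsc X (u + 1))
           (gwd X ` gindex (\<lambda>u' t'. \<Union>l'<l. B l' u' t') (u + 1) t)"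
    using assms by (auto simp: gsemifree_def)
  have "gfree T (\<lambda>u t. \<Union>l. J u ` B l u t)"
    using gfree_transport(1)[OF B(1)] by (simp add: image_UN)
  moreover have "gd T u t b \<in> module.span (gsc T (u + 1))
           (gwd T ` gindex (\<lambda>u' t'. \<Union>l'<l. J u' ` B l' u' t') (u + 1) t)" if b: "b \<in> J u ` B l u t" for l u t b
  proof -
    obtain x where x: "x \<in> B l u t" "b = J u x" using b by auto
    have xX: "x \<in> gco X u t" using x(1) by (intro gfree_gen[OF B(1)]) auto
    let ?B = "\<lambda>u' t'. \<Union>l'<l. B l' u' t'"
    have sub: "gwd X ` gindex ?B (u + 1) t \<subseteq> gco X (u + 1) t"
    proof -
      have "gindex ?B (u + 1) t \<subseteq> gindex (\<lambda>u t. \<Union>l. B l u t) (u + 1) t" by (auto simp: gindex_def)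
      moreover have "basis_family (gsc X (u + 1)) (gco X (u + 1) t) (gindex (\<lambda>u t. \<Union>l. B l u t) (u + 1) t) (gwd X)"
        using B(1) by (simp add: gfree_def)
      note basis_familyD[OF gmodule_vs[OF X] this]
      ultimately show ?thesis by blast
    qed
    have "gwd T ` gindex (\<lambda>u' t'. \<Union>l'<l. J u' ` B l' u' t') (u + 1) t = J (u + 1) ` gwd X ` gindex ?B (u + 1) t"
    proof -
      have "?B u t \<subseteq> (\<Union>l. B l u t)" for u t by auto
      from gfree_transport(2)[OF B(1) this, of "u + 1" t] show ?thesis by (simp add: image_UN)
    qed
    moreover have "J (u + 1) (gd X u t x) \<in> module.span s' (J (u + 1) ` gwd X ` gindex ?B (u + 1) t)"
      by (rule lin_on_span[OF gmodule_vs[OF X] s' gmodule_sub[OF X] transport_lin(1) sub B(2)[OF x(1)]])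
    ultimately show ?thesis unfolding x(2) transport_sel(1) transport_sel(3)[OF xX] by (simp only:)
  qed
  ultimately show ?thesis unfolding gsemifree_def by (intro exI[of _ "\<lambda>l u t. J u ` B l u t"]) simp
qed

lemma gquasi_iso_transport:
  fixes Y :: "('f, 'z::ab_group_add) gmod"
  assumes e: "gquasi_iso X Y e"
  shows "\<exists>e'. gquasi_iso T Y e'"
proof -
  define e' where "e' u t y = (if y \<in> gco T u t then e u t (J' u y) else 0)" for u t y
  have eh: "e \<in> ghom X Y 0 0" "gD X Y 0 0 e = 0" using e by (auto simp: gquasi_iso_def)
  have e'J: "e' u t (J u x) = e u t x" if "x \<in> gco X u t" for u t x
    using that by (simp add: e'_def transport_sel transport_inv)
  have ed: "e (u + 1) t (gd X u t x) = gd Y u t (e u t x)" if "x \<in> gco X u t" for u t x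
    using fun_cong[OF fun_cong[OF fun_cong[OF eh(2)]], of u t x] that by (simp add: gD_def)
  have eop: "e (u + \<alpha>) (t + \<beta> i) (gop X i u t x) = gop Y i u t (e u t x)" if "i < 3" "x \<in> gco X u t" for i u t x
    using ghom_op[OF eh(1) that] by simp
  have "e' \<in> ghom T Y 0 0"
  proof (rule ghomI)
    fix u t
    show "lin_on (gsc T u) (gco T u t) (gsc Y (u + 0)) (gco Y (u + 0) (t + 0)) (e' u t)"
      using ghom_in[OF eh(1)]
      by (intro lin_onI) (auto simp: transport_sel transport_J gco_closed[OF X] e'J ghom_add[OF eh(1)] ghom_sc[OF eh(1)])
    show "e' u t y = 0" if "y \<notin> gco T u t" for y using that by (simp add: e'_def)
    fix i :: nat and y assume i: "i < 3" and "y \<in> gco T u t"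
    then obtain x where x: "x \<in> gco X u t" "y = J u x" by (auto simp: transport_sel)
    show "e' (u + \<alpha>) (t + \<beta> i) (gop T i u t y) = gop Y i (u + 0) (t + 0) (e' u t y)"
      using x by (simp add: transport_sel e'J gop_in[OF X i] eop[OF i])
  qed
  moreover have "gD T Y 0 0 e' = 0"
    by (auto simp: gD_def fun_eq_iff transport_sel e'J gd_in[OF X] ed)
  moreover have "\<exists>y'\<in>gco T (u - 1) t. y = gd T (u - 1) t y'"
    if y: "y \<in> gco T u t" "gd T u t y = 0" and z: "z \<in> gco Y (u - 1) t" "e' u t y = gd Y (u - 1) t z" for u t y z
  proof -
    obtain x where x: "x \<in> gco X u t" "y = J u x" using y(1) by (auto simp: transport_sel)
    have "J (u + 1) (gd X u t x) = J (u + 1) 0" using y(2) x by (simp add: transport_sel transport_zero)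
    then have "gd X u t x = 0"
      using inj_onD[OF transport_lin(2)] gd_in[OF X x(1)] gco_closed(1)[OF X] by blast
    then obtain x' where x': "x' \<in> gco X (u - 1) t" "x = gd X (u - 1) t x'"
      using e x z e'J unfolding gquasi_iso_def by metis
    then show ?thesis using transport_sel(3)[OF x'(1)] x by (auto simp: transport_sel)
  qed
  moreover have "\<exists>y\<in>gco T u t. gd T u t y = 0 \<and> (\<exists>w\<in>gco Y (u - 1) t. z - e' u t y = gd Y (u - 1) t w)"
    if z: "z \<in> gco Y u t" "gd Y u t z = 0" for u t z
  proof -
    obtain x w where x: "x \<in> gco X u t" "gd X u t x = 0" "w \<in> gco Y (u - 1) t" "z - e u t x = gd Y (u - 1) t w"
      using e z unfolding gquasi_iso_def by blast
    show ?thesis using x by (intro bexI[of _ "J u x"]) (auto simp: transport_sel e'J transport_zero)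
  qed
  ultimately show ?thesis unfolding gquasi_iso_def by blast
qed

end

end

section \<open>The two instances: dg modules over \<open>P(2)\<close> and complexes of \<open>E(2)\<close>-modules\<close>

locale exterior =
  fixes p :: nat
  assumes p_pos: "p > 0"
begin

sublocale P: grading 1 "qdeg p" False .
sublocale E: grading 0 "\<lambda>i. - qdeg p i" True .

lemma qdeg_pos: "qdeg p i > 0"
proof -
  have "int p ^ i > 0" using p_pos by simp
  then show ?thesis unfolding qdeg_def by linarith
qed

definition gP :: "('f, 'x) dgmod \<Rightarrow> ('f, 'x) gmod" where
  "gP X = \<lparr>gsc = (\<lambda>u. dscale X), gco = dcomp X, gd = diff X, gop = vact X\<rparr>"

lemma gP_sel [simp]: "gsc (gP X) u = dscale X" "gco (gP X) = dcomp X" "gd (gP X) = diff X" "gop (gP X) = vact X"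
  by (simp_all add: gP_def)

lemma gmodule_gP: "P2_dgmodule p X \<longleftrightarrow> P.gmodule (gP X)"
  unfolding P2_dgmodule_def P.gmodule_def by simp

lemma ghom_gP: "Hom_P p X Y a b = P.ghom (gP X) (gP Y) a b"
  unfolding Hom_P_def P.ghom_def by simp

lemma gD_gP: "HomP_diff X Y a b f = gD (gP X) (gP Y) a b f"
  unfolding HomP_diff_def gD_def sg_def by (auto simp: fun_eq_iff)

lemma gH_gP: "HomP_cohomology p X Y a b = P.gH (gP X) (gP Y) a b"
  unfolding HomP_cohomology_def P.gH_def ghom_gP gD_gP[abs_def] by simp

lemma gquasi_iso_gP: "dg_quasi_iso p X Y e \<longleftrightarrow> P.gquasi_iso (gP X) (gP Y) e"
  unfolding dg_quasi_iso_def P.gquasi_iso_def ghom_gP gD_gP dcycles_def dboundaries_def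
  by (simp add: Ball_def Bex_def image_iff conj_assoc imp_conjL)

lemma gword_gP: "vword p X w u t x = P.gword (gP X) w u t x"
  by (induction w) simp_all

lemma gindex_gP: "free_index p B u t = P.gindex B u t"
  by (simp add: free_index_def P.gindex_def vwords_def cong: conj_cong) (rule arg_cong[where f = Collect], auto simp: fun_eq_iff)

lemma gsemifree_gP: "semifree p X \<longleftrightarrow> P.gsemifree (gP X)"
  unfolding semifree_def P.gsemifree_def P.gfree_def gmodule_gP gword_gP gindex_gP by simp

text \<open>Homological degree \<open>s\<close> of a resolution becomes cohomological degree
  \<open>u = - s\<close>, so that the differential raises the degree as \<open>gmod\<close>
  expects.\<close>

definition gE :: "(int \<Rightarrow> ('f, 'r) emod) \<Rightarrow> (int \<Rightarrow> int \<Rightarrow> 'r \<Rightarrow> 'r) \<Rightarrow> ('f, 'r) gmod" where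
  "gE R d = \<lparr>gsc = (\<lambda>u. escale (R (- u))), gco = (\<lambda>u. ecomp (R (- u))), gd = (\<lambda>u. d (- u)),
     gop = (\<lambda>i u. eact (R (- u)) i)\<rparr>"

lemma gE_sel [simp]: "gsc (gE R d) u = escale (R (- u))" "gco (gE R d) u = ecomp (R (- u))" "gd (gE R d) u = d (- u)"
    "gop (gE R d) i u = eact (R (- u)) i"
  by (simp_all add: gE_def)

text \<open>The complex concentrated in degree 0; an augmented free resolution is then a
  quasi-isomorphism onto it.\<close>

definition gM :: "('f, 'a::zero) emod \<Rightarrow> ('f, 'a) gmod" where
  "gM M = \<lparr>gsc = (\<lambda>u. escale M), gco = (\<lambda>u n. if u = 0 then ecomp M n else {0}), gd = (\<lambda>u n x. 0),
     gop = (\<lambda>i u n x. if u = 0 then eact M i n x else 0)\<rparr>"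

lemma gM_sel [simp]: "gsc (gM M) u = escale M" "gco (gM M) u n = (if u = 0 then ecomp M n else {0})" "gd (gM M) u n x = 0"
    "gop (gM M) i u n x = (if u = 0 then eact M i n x else 0)"
  by (simp_all add: gM_def)

lemma E2_moduleD:
  assumes "E2_module p M"
  shows E2_vs: "vector_space (escale M)" and E2_sub: "module.subspace (escale M) (ecomp M n)"
    and E2_lin: "i < 3 \<Longrightarrow> lin_on (escale M) (ecomp M n) (escale M) (ecomp M (n - qdeg p i)) (eact M i n)"
    and E2_sq: "i < 3 \<Longrightarrow> x \<in> ecomp M n \<Longrightarrow> eact M i (n - qdeg p i) (eact M i n x) = 0"
    and E2_anti: "i < 3 \<Longrightarrow> j < 3 \<Longrightarrow> x \<in> ecomp M n \<Longrightarrow>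
        eact M i (n - qdeg p j) (eact M j n x) = - eact M j (n - qdeg p i) (eact M i n x)"
  using assms unfolding E2_module_def eq_neg_iff_add_eq_0 by blast+

lemma gmodule_gM:
  assumes M: "E2_module p M"
  shows "E.gmodule (gM M)"
proof -
  interpret vector_space "escale M" by (rule E2_vs[OF M])
  have zero: "eact M i n 0 = 0" if "i < 3" for i n
    using lin_on_zero[OF E2_lin[OF M that] subspace_zero[OF E2_vs[OF M] E2_sub[OF M]]] .
  have sub0: "subspace {0}" by (rule subspace_single_0)
  show ?thesis
    unfolding E.gmodule_def
  proof (intro conjI allI impI ballI)
    fix u t
    show "module.subspace (gsc (gM M) u) (gco (gM M) u t)" using E2_sub[OF M] sub0 by simp
    show "lin_on (gsc (gM M) u) (gco (gM M) u t) (gsc (gM M) (u + 1)) (gco (gM M) (u + 1) t) (gd (gM M) u t)"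
      using subspace_0[OF E2_sub[OF M]] by (simp add: lin_on_def)
  next
    fix i :: nat and u t assume i: "i < 3"
    show "lin_on (gsc (gM M) u) (gco (gM M) u t) (gsc (gM M) (u + 0)) (gco (gM M) (u + 0) (t + - qdeg p i)) (gop (gM M) i u t)"
      using E2_lin[OF M i, of t] by (cases "u = 0") (simp_all add: lin_on_def)
    fix x assume x: "x \<in> gco (gM M) u t"
    show "gd (gM M) (u + 0) (t + - qdeg p i) (gop (gM M) i u t x) = gop (gM M) i (u + 1) t (gd (gM M) u t x)"
      by (simp add: zero[OF i])
    show "gop (gM M) i (u + 0) (t + - qdeg p i) (gop (gM M) i u t x) = 0"
      using E2_sq[OF M i, of x t] x by (cases "u = 0") simp_all
  next
    fix i j :: nat and u t x assume i: "i < 3" "j < 3" and x: "x \<in> gco (gM M) u t"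
    show "gop (gM M) i (u + 0) (t + - qdeg p j) (gop (gM M) j u t x) =
          (if True then - gop (gM M) j (u + 0) (t + - qdeg p i) (gop (gM M) i u t x)
           else gop (gM M) j (u + 0) (t + - qdeg p i) (gop (gM M) i u t x))"
      using E2_anti[OF M i, of x t] x by (cases "u = 0") simp_all
  qed (simp_all add: E2_vs[OF M])
qed

lemma gword_gE: "eword p (R (- u)) w n x = E.gword (gE R d) w u n x"
proof (induction w)
  case (Cons i w)
  have "(\<Sum>j\<leftarrow>w. - qdeg p j) = - (\<Sum>j\<leftarrow>w. qdeg p j)" by (induction w) auto
  then show ?case using Cons by simp
qed simp

definition gens :: "(int \<Rightarrow> int \<Rightarrow> 'r set) \<Rightarrow> int \<Rightarrow> int \<Rightarrow> 'r set" where
  "gens B u t = (if u \<le> 0 then B (- u) t else {})"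

text \<open>Both index sets describe the same words; the index on the complex side only records the
  degree \<open>u\<close> in addition, which is constant here because the operators of
  \<open>E(2)\<close> do not change it.\<close>

lemma basis_family_gE:
  assumes "basis_family s V {(w, m, b). sorted_wrt (<) w \<and> set w \<subseteq> {..<3} \<and> b \<in> B m \<and> n = m - (\<Sum>j\<leftarrow>w. qdeg p j)}
          (\<lambda>(w, m, b). eword p (R (- u)) w m b)" "B' u = B"
  shows "basis_family s V (E.gindex B' u n) (E.gwd (gE R d))"
proof (rule basis_family_reindex[OF assms(1), of "\<lambda>(w, m, b). (w, u, m, b)"])
  have *: "(\<Sum>j\<leftarrow>w. - qdeg p j) = - (\<Sum>j\<leftarrow>w. qdeg p j)" for w by (induction w) auto
  show "bij_betw (\<lambda>(w, m, b). (w, u, m, b))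
     {(w, m, b). sorted_wrt (<) w \<and> set w \<subseteq> {..<3} \<and> b \<in> B m \<and> n = m - (\<Sum>j\<leftarrow>w. qdeg p j)} (E.gindex B' u n)"
    using assms(2) by (auto simp: bij_betw_def inj_on_def E.gindex_def vwords_def * image_iff)
qed (auto simp: gword_gE[symmetric])

lemma basis_family_gE':
  assumes "basis_family (gsc X u) (gco X u n) (E.gindex B u n) (E.gwd X)" "\<And>u. u > 0 \<Longrightarrow> B u = (\<lambda>t. {})"
    and R: "R (- u) = \<lparr>escale = gsc X u, ecomp = gco X u, eact = (\<lambda>i. gop X i u)\<rparr>"
  shows "basis_family (gsc X u) (gco X u n)
     {(w, m, b). sorted_wrt (<) w \<and> set w \<subseteq> {..<3} \<and> b \<in> B u m \<and> n = m - (\<Sum>j\<leftarrow>w. qdeg p j)}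
          (\<lambda>(w, m, b). eword p (R (- u)) w m b)"
proof (rule basis_family_reindex[OF assms(1), of "\<lambda>(w, u, m, b). (w, m, b)"])
  have *: "(\<Sum>j\<leftarrow>w. - qdeg p j) = - (\<Sum>j\<leftarrow>w. qdeg p j)" for w by (induction w) auto
  show "bij_betw (\<lambda>(w, u, m, b). (w, m, b)) (E.gindex B u n)
     {(w, m, b). sorted_wrt (<) w \<and> set w \<subseteq> {..<3} \<and> b \<in> B u m \<and> n = m - (\<Sum>j\<leftarrow>w. qdeg p j)}"
    by (auto simp: bij_betw_def inj_on_def E.gindex_def vwords_def * image_iff)
  have "eword p (R (- u)) w m b = E.gword X w u m b" for w m b
    by (induction w) (simp_all add: R *)
  then show "\<And>i. i \<in> E.gindex B u n \<Longrightarrow>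
    (case case i of (w, u, m, b) \<Rightarrow> (w, m, b) of (w, m, b) \<Rightarrow> eword p (R (- u)) w m b) = E.gwd X i"
    by (auto simp: E.gindex_def)
qed

text \<open>A complex of free modules with generators in nonpositive cohomological degrees is
  filtered by the homological degree \<open>- u\<close> of the generators, which the differential
  lowers.\<close>

lemma gsemifree_E:
  assumes X: "E.gfree X B" and B: "\<And>u. u > 0 \<Longrightarrow> B u = (\<lambda>t. {})"
  shows "E.gsemifree X"
  unfolding E.gsemifree_def
proof (intro exI conjI allI ballI)
  let ?B = "\<lambda>(l::nat) u t. if u = - int l then B u t else {}"
  have Un: "(\<Union>l. ?B l u t) = B u t" for u t
    using B[of u] by (cases "u > 0") (auto intro!: exI[of _ "nat (- u)"])
  show "E.gfree X (\<lambda>u t. \<Union>l. ?B l u t)" unfolding Un by (rule X)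
  fix l u t b assume b: "b \<in> ?B l u t"
  then have u: "u = - int l" by (auto split: if_splits)
  have bas: "basis_family (gsc X u) (gco X u t) (E.gindex B u t) (E.gwd X)" for u t
    using X by (simp add: E.gfree_def)
  have "b \<in> B u t" using b by (auto split: if_splits)
  then have "gd X u t b \<in> gco X (u + 1) t"
    using E.gd_in[OF _ E.gfree_gen[OF X]] X by (auto simp: E.gfree_def)
  then have "gd X u t b \<in> module.span (gsc X (u + 1)) (E.gwd X ` E.gindex B (u + 1) t)"
    using bas[of "u + 1" t] by (simp add: basis_family_def)
  moreover have "E.gindex B (u + 1) t = E.gindex (\<lambda>u' t'. \<Union>l'<l. ?B l' u' t') (u + 1) t"
  proof -
    have "B (u + 1) t' = (\<Union>l'<l. ?B l' (u + 1) t')" for t'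
    proof (cases l)
      case 0
      then show ?thesis using B[of "u + 1"] u by simp
    next
      case (Suc n)
      then show ?thesis using u by (auto intro!: bexI[of _ n])
    qed
    then show ?thesis by (auto simp: E.gindex_def)
  qed
  ultimately show "gd X u t b \<in> module.span (gsc X (u + 1))
      (E.gwd X ` E.gindex (\<lambda>u' t'. \<Union>l'<l. ?B l' u' t') (u + 1) t)" by simp
qed

lemma Hom_E_D:
  assumes "f \<in> Hom_E p M N t"
  shows "lin_on (escale M) (ecomp M n) (escale N) (ecomp N (n + t)) (f n)"
    "x \<in> ecomp M n \<Longrightarrow> f n x \<in> ecomp N (n + t)" "x \<notin> ecomp M n \<Longrightarrow> f n x = 0"
    "i < 3 \<Longrightarrow> x \<in> ecomp M n \<Longrightarrow> f (n - qdeg p i) (eact M i n x) = eact N i (n + t) (f n x)"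
  using assms by (auto simp: Hom_E_def lin_maps_def lin_on_def)

text \<open>Exactness in positive homological degrees and at the augmentation is the statement that
  the resolution maps quasi-isomorphically to the module in degree 0.\<close>

lemma free_resolution_gE:
  fixes M :: "('f::field, 'a::ab_group_add) emod" and R :: "int \<Rightarrow> ('f, 'r::ab_group_add) emod"
  assumes R: "free_resolution p R d \<epsilon> M" and M: "E2_module p M"
  shows "E.gsemifree (gE R d)" "E.gquasi_iso (gE R d) (gM M) (\<lambda>u t x. if u = 0 then \<epsilon> t x else 0)"
proof -
  have free: "free_E2_module p (R s)" for s using R by (simp add: free_resolution_def)
  then have mod: "E2_module p (R s)" for s by (auto simp: free_E2_module_def)
  have neg: "ecomp (R s) n = {0}" if "s < 0" for s n using R that by (auto simp: free_resolution_def)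
  have d: "d s \<in> Hom_E p (R s) (R (s - 1)) 0" for s using R by (auto simp: free_resolution_def)
  have \<epsilon>: "\<epsilon> \<in> Hom_E p (R 0) M 0" "\<And>n. \<epsilon> n ` ecomp (R 0) n = ecomp M n"
    using R by (auto simp: free_resolution_def)
  have ex0: "\<And>n. {x \<in> ecomp (R 0) n. \<epsilon> n x = 0} = d 1 n ` ecomp (R 1) n"
    using R by (auto simp: free_resolution_def)
  have ex: "\<And>s n. s > 0 \<Longrightarrow> {x \<in> ecomp (R s) n. d s n x = 0} = d (s + 1) n ` ecomp (R (s + 1)) n"
    using R by (auto simp: free_resolution_def)
  have "\<forall>s. \<exists>B. \<forall>n. basis_family (escale (R s)) (ecomp (R s) n)
          {(w, m, b). sorted_wrt (<) w \<and> set w \<subseteq> {..<3} \<and> b \<in> B m \<and> n = m - (\<Sum>j\<leftarrow>w. qdeg p j)}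
          (\<lambda>(w, m, b). eword p (R s) w m b)"
    using free unfolding free_E2_module_def by blast
  from choice[OF this] obtain B where B: "\<And>s n. basis_family (escale (R s)) (ecomp (R s) n)
          {(w, m, b). sorted_wrt (<) w \<and> set w \<subseteq> {..<3} \<and> b \<in> B s m \<and> n = m - (\<Sum>j\<leftarrow>w. qdeg p j)}
          (\<lambda>(w, m, b). eword p (R s) w m b)"
    by blast
  have din: "d s n x \<in> ecomp (R (s - 1)) n" if "x \<in> ecomp (R s) n" for s n x
    using Hom_E_D(2)[OF d that] by simp
  \<comment> \<open>The vanishing of \<open>d d\<close> is read off from exactness where the middle
    term has positive degree; otherwise the composite lands in a zero module.\<close>
  have dd: "d (s - 1) n (d s n x) = 0" if x: "x \<in> ecomp (R s) n" for s n x
  proof (cases "s - 1 > 0")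
    case True
    then have "d (s - 1 + 1) n ` ecomp (R (s - 1 + 1)) n = {x \<in> ecomp (R (s - 1)) n. d (s - 1) n x = 0}"
      using ex by blast
    then show ?thesis using x by auto
  next
    case False
    then have "ecomp (R (s - 1 - 1)) n = {0}" by (intro neg) simp
    then show ?thesis using din[OF din[OF x]] by simp
  qed
  have X: "E.gmodule (gE R d)"
    unfolding E.gmodule_def
  proof (intro conjI allI impI ballI)
    fix i :: nat and u t x assume i: "i < 3" and x: "x \<in> gco (gE R d) u t"
    show "gd (gE R d) (u + 0) (t + - qdeg p i) (gop (gE R d) i u t x) = gop (gE R d) i (u + 1) t (gd (gE R d) u t x)"
      using Hom_E_D(4)[OF d i, of x "- u" t] x by simp
  next
    fix u t
    show "lin_on (gsc (gE R d) u) (gco (gE R d) u t) (gsc (gE R d) (u + 1)) (gco (gE R d) (u + 1) t) (gd (gE R d) u t)"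
      using Hom_E_D(1)[OF d, of "- u" t] by simp
    fix x assume "x \<in> gco (gE R d) u t"
    then show "gd (gE R d) (u + 1) t (gd (gE R d) u t x) = 0" using dd[of x "- u" t] by simp
  next
    fix i j :: nat and u t x assume i: "i < 3" "j < 3" and x: "x \<in> gco (gE R d) u t"
    show "gop (gE R d) i (u + 0) (t + - qdeg p j) (gop (gE R d) j u t x) =
          (if True then - gop (gE R d) j (u + 0) (t + - qdeg p i) (gop (gE R d) i u t x)
           else gop (gE R d) j (u + 0) (t + - qdeg p i) (gop (gE R d) i u t x))"
      using E2_anti[OF mod i] x by simp
  qed (use E2_vs[OF mod] E2_sub[OF mod] E2_lin[OF mod] E2_sq[OF mod] in simp_all)
  have "E.gfree (gE R d) (gens B)"
    unfolding E.gfree_def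
  proof (intro conjI allI X)
    fix u n
    show "basis_family (gsc (gE R d) u) (gco (gE R d) u n) (E.gindex (gens B) u n) (E.gwd (gE R d))"
    proof (cases "u \<le> 0")
      case True
      show ?thesis using basis_family_gE[where R = R and d = d and B = "B (- u)" and u = u and n = n and B' = "gens B", OF B[of "- u" n]] True by (simp add: gens_def[abs_def])
    next
      case False
      interpret vector_space "escale (R (- u))" by (rule E2_vs[OF mod])
      have "E.gindex (gens B) u n = {}" using False by (auto simp: E.gindex_def gens_def)
      then show ?thesis using False neg independent_empty by (simp add: basis_family_def)
    qed
  qed
  then show "E.gsemifree (gE R d)" by (rule gsemifree_E) (auto simp: gens_def fun_eq_iff)
  let ?e = "\<lambda>u t x. if u = 0 then \<epsilon> t x else (0::'a)"
  have "?e \<in> E.ghom (gE R d) (gM M) 0 0"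
  proof (rule E.ghomI)
    fix u t
    show "lin_on (gsc (gE R d) u) (gco (gE R d) u t) (gsc (gM M) (u + 0)) (gco (gM M) (u + 0) (t + 0)) (?e u t)"
    proof (cases "u = 0")
      case False
      interpret vector_space "escale M" by (rule E2_vs[OF M])
      show ?thesis using False by (simp add: lin_on_def)
    qed (use Hom_E_D(1)[OF \<epsilon>(1), of t] in simp)
  qed (use Hom_E_D(3,4)[OF \<epsilon>(1)] in auto)
  moreover have "gD (gE R d) (gM M) 0 0 ?e = 0"
  proof (intro ext)
    fix u t x
    have "\<epsilon> t (d 1 t x) = 0" if "x \<in> ecomp (R 1) t" using ex0[of t] that by blast
    then show "gD (gE R d) (gM M) 0 0 ?e u t x = 0 u t x"
      by (cases "u = -1") (simp_all add: gD_def)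
  qed
  moreover have "\<exists>x'\<in>gco (gE R d) (u - 1) t. x = gd (gE R d) (u - 1) t x'"
    if x: "x \<in> gco (gE R d) u t" "gd (gE R d) u t x = 0" and y: "\<exists>y\<in>gco (gM M) (u - 1) t. ?e u t x = gd (gM M) (u - 1) t y" for u t x
  proof -
    consider "u = 0" | "u < 0" | "u > 0" by linarith
    then show ?thesis
    proof cases
      case 1
      then show ?thesis using x y ex0[of t] by auto
    next
      case 2
      then show ?thesis using x ex[of "- u" t] by (auto simp: algebra_simps)
    next
      case 3
      then have "x = 0" "0 \<in> ecomp (R (- (u - 1))) t" using x neg[of "- u" t] subspace_zero[OF E2_vs[OF mod] E2_sub[OF mod]] by auto
      moreover have "d (- (u - 1)) t 0 = 0"
        using lin_on_zero[OF Hom_E_D(1)[OF d]] calculation(2) by blast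
      ultimately show ?thesis by (metis gE_sel(2,3))
    qed
  qed
  moreover have "\<exists>x\<in>gco (gE R d) u t. gd (gE R d) u t x = 0 \<and> (\<exists>z\<in>gco (gM M) (u - 1) t. y - ?e u t x = gd (gM M) (u - 1) t z)"
    if y: "y \<in> gco (gM M) u t" for u t y
  proof (cases "u = 0")
    case True
    then obtain x where x: "x \<in> ecomp (R 0) t" "y = \<epsilon> t x" using y \<epsilon>(2)[of t] by auto
    then have "d 0 t x = 0" using din[OF x(1)] neg[of "-1" t] by simp
    then show ?thesis using x True by auto
  next
    case False
    then have "y = 0" using y by simp
    moreover have "0 \<in> ecomp (R (- u)) t" using subspace_zero[OF E2_vs[OF mod] E2_sub[OF mod]] .
    moreover have "d (- u) t 0 = 0"
        using lin_on_zero[OF Hom_E_D(1)[OF d]] calculation(2) by blast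
    ultimately show ?thesis using False subspace_zero[OF E2_vs[OF M] E2_sub[OF M]] by (auto intro!: bexI[of _ 0])
  qed
  ultimately show "E.gquasi_iso (gE R d) (gM M) ?e" unfolding E.gquasi_iso_def by blast
qed

definition ofE :: "('f, 'r) gmod \<Rightarrow> int \<Rightarrow> ('f, 'r) emod" where
  "ofE X s = \<lparr>escale = gsc X (- s), ecomp = gco X (- s), eact = (\<lambda>i. gop X i (- s))\<rparr>"

lemma gE_ofE: "gE (ofE X) (\<lambda>s. gd X (- s)) = X"
  by (simp add: gE_def ofE_def)

text \<open>The converse translation, used to produce a resolution. Generators only in degrees
  \<open>u \<le> 0\<close> force the components with \<open>u > 0\<close> to vanish, and
  \<open>out\<close> supplies the vanishing of the differential outside its domain that
  \<open>Hom_E\<close> demands.\<close>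

lemma free_resolution_ofE:
  assumes X: "E.gfree X B" and B: "\<And>u. u > 0 \<Longrightarrow> B u = (\<lambda>t. {})" and M: "E2_module p M"
    and e: "E.gquasi_iso X (gM M) e" and out: "\<And>u t x. x \<notin> gco X u t \<Longrightarrow> gd X u t x = 0"
  shows "free_resolution p (ofE X) (\<lambda>s. gd X (- s)) (e 0) M"
proof -
  have Xm: "E.gmodule X" and bas: "\<And>u t. basis_family (gsc X u) (gco X u t) (E.gindex B u t) (E.gwd X)"
    using X by (auto simp: E.gfree_def)
  have pos: "gco X u t = {0}" if "u > 0" for u t
  proof -
    interpret vector_space "gsc X u" by (rule E.gmodule_vs[OF Xm])
    have "E.gindex B u t = {}" using B that by (auto simp: E.gindex_def)
    then show ?thesis using bas[of u t] by (simp add: basis_family_def)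
  qed
  have eh: "e \<in> E.ghom X (gM M) 0 0" and eD: "gD X (gM M) 0 0 e = 0" using e by (auto simp: E.gquasi_iso_def)
  have ed: "e (u + 1) t (gd X u t x) = 0" if "x \<in> gco X u t" for u t x
    using fun_cong[OF fun_cong[OF fun_cong[OF eD]], of u t x] that by (simp add: gD_def)
  have inj: "\<exists>x'\<in>gco X (u - 1) t. x = gd X (u - 1) t x'" if "x \<in> gco X u t" "gd X u t x = 0" "e u t x = 0" for u t x
  proof -
    have "0 \<in> gco (gM M) (u - 1) t" using E.gco_closed(1)[OF gmodule_gM[OF M]] .
    then show ?thesis using e that unfolding E.gquasi_iso_def by (metis gM_sel(3))
  qed
  show ?thesis
    unfolding free_resolution_def
  proof (intro conjI allI impI)
    fix s :: int
    have "E2_module p (ofE X s)"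
      unfolding E2_module_def eq_neg_iff_add_eq_0[symmetric]
    proof (intro conjI allI impI ballI)
      fix i j :: nat and n x assume i: "i < 3" "j < 3" and x: "x \<in> ecomp (ofE X s) n"
      show "eact (ofE X s) i (n - qdeg p j) (eact (ofE X s) j n x) = - eact (ofE X s) j (n - qdeg p i) (eact (ofE X s) i n x)"
        using E.gmodule_opop[OF Xm i, of x "- s" n] x by (simp add: ofE_def)
    next
      fix i :: nat and n assume i: "i < 3"
      show "lin_on (escale (ofE X s)) (ecomp (ofE X s) n) (escale (ofE X s)) (ecomp (ofE X s) (n - qdeg p i)) (eact (ofE X s) i n)"
        using E.gmodule_op[OF Xm i, of "- s" n] by (simp add: ofE_def)
      show "eact (ofE X s) i (n - qdeg p i) (eact (ofE X s) i n x) = 0" if "x \<in> ecomp (ofE X s) n" for x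
        using E.gmodule_op2[OF Xm _ i, of x "- s" n] that by (simp add: ofE_def)
    qed (simp_all add: ofE_def E.gmodule_vs[OF Xm] E.gmodule_sub[OF Xm])
    moreover have "basis_family (escale (ofE X s)) (ecomp (ofE X s) n)
          {(w, m, b). sorted_wrt (<) w \<and> set w \<subseteq> {..<3} \<and> b \<in> B (- s) m \<and> n = m - (\<Sum>j\<leftarrow>w. qdeg p j)}
          (\<lambda>(w, m, b). eword p (ofE X s) w m b)" for n
      using basis_family_gE'[OF bas[of "- s" n] B, of "ofE X"] by (simp add: ofE_def)
    ultimately show "free_E2_module p (ofE X s)" unfolding free_E2_module_def by blast
    show "gd X (- s) \<in> Hom_E p (ofE X s) (ofE X (s - 1)) 0"
      using E.gmodule_d[OF Xm, of "- s"] E.gmodule_dop[OF Xm, of _ _ "- s"] out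
      by (auto simp: Hom_E_def lin_maps_def ofE_def)
    fix n
    show "ecomp (ofE X s) n = {0}" if "s < 0" using pos that by (simp add: ofE_def)
    show "{x \<in> ecomp (ofE X s) n. gd X (- s) n x = 0} = gd X (- (s + 1)) n ` ecomp (ofE X (s + 1)) n" if "s > 0"
    proof -
      have "e (- s) n x = 0" if "x \<in> gco X (- s) n" for x
        using E.ghom_in[OF eh that] \<open>s > 0\<close> by simp
      then show ?thesis
        using inj[of _ "- s" n] E.gmodule_dd[OF Xm, of _ "- s - 1" n] E.gd_in[OF Xm, of _ "- s - 1" n]
        by (auto simp: ofE_def image_iff)
    qed
  next
    show "e 0 \<in> Hom_E p (ofE X 0) M 0"
      using E.ghom_lin[OF eh, of 0] E.ghom_out[OF eh] E.ghom_op[OF eh, of _ _ 0]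
      by (auto simp: Hom_E_def lin_maps_def ofE_def)
    fix n
    have d0: "gd X 0 n x = 0" if "x \<in> gco X 0 n" for x using E.gd_in[OF Xm that] pos by simp
    show "{x \<in> ecomp (ofE X 0) n. e 0 n x = 0} = gd X (- 1) n ` ecomp (ofE X 1) n"
      using inj[of _ 0 n] d0 ed[of _ "-1" n] E.gd_in[OF Xm, of _ "-1" n] by (auto simp: ofE_def image_iff)
    show "e 0 n ` ecomp (ofE X 0) n = ecomp M n"
    proof
      show "e 0 n ` ecomp (ofE X 0) n \<subseteq> ecomp M n" using E.ghom_in[OF eh, of _ 0 n] by (auto simp: ofE_def)
      show "ecomp M n \<subseteq> e 0 n ` ecomp (ofE X 0) n"
      proof
        fix y assume "y \<in> ecomp M n"
        then obtain x where "x \<in> gco X 0 n" "y - e 0 n x = 0"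
          using e unfolding E.gquasi_iso_def by (metis gM_sel(2,3))
        then show "y \<in> e 0 n ` ecomp (ofE X 0) n" by (auto simp: ofE_def)
      qed
    qed
  qed
qed

text \<open>A map of degree \<open>u\<close> to a complex concentrated in degree 0 has one nonzero
  component, that in degree \<open>- u\<close>, so evaluating there loses nothing. The differential
  of the Hom complex and precomposition with \<open>d\<close> differ by a sign, which changes
  neither cycles nor boundaries.\<close>

lemma HomE_gH:
  assumes X: "E.gmodule (gE R d)" and d: "\<And>s n x. x \<notin> ecomp (R s) n \<Longrightarrow> d s n x = 0" and N: "E2_module p N"
  shows "sq_wf (HomE_cohomology p R d N u t)"
    "sq_map (E.gH (gE R d) (gM N) u t) (HomE_cohomology p R d N u t) (\<lambda>f. f (- u))"
proof -
  let ?X = "gE R d" and ?N = "gM N"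
  have Nm: "E.gmodule ?N" by (rule gmodule_gM[OF N])
  have out: "f v n x = 0" if f: "f \<in> E.ghom ?X ?N a t" and v: "v \<noteq> - a" for f v n x a
  proof (cases "x \<in> gco ?X v n")
    case True
    then show ?thesis using E.ghom_in[OF f True] v by (auto simp: add_eq_0_iff2)
  qed (rule E.ghom_out[OF f])
  have Hom: "f (- a) \<in> Hom_E p (R a) N t" if f: "f \<in> E.ghom ?X ?N a t" for f a
    using E.ghom_lin[OF f, of "- a"] E.ghom_out[OF f, of _ "- a"] E.ghom_op[OF f, of _ _ "- a"]
    by (auto simp: Hom_E_def lin_maps_def)
  \<comment> \<open>Conversely, a single module map placed in degree \<open>- a\<close> and zero
    elsewhere is an element of the Hom complex.\<close>
  have ext: "(\<lambda>v. if v = - a then F else (\<lambda>n x. 0)) \<in> E.ghom ?X ?N a t" if F: "F \<in> Hom_E p (R a) N t" for F a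
  proof (rule E.ghomI)
    fix v n
    interpret vector_space "escale N" by (rule E2_vs[OF N])
    show "lin_on (gsc ?X v) (gco ?X v n) (gsc ?N (v + a)) (gco ?N (v + a) (n + t)) ((if v = - a then F else (\<lambda>n x. 0)) n)"
    proof (cases "v = - a")
      case True
      then show ?thesis using Hom_E_D(1)[OF F, of n] by simp
    next
      case False
      then show ?thesis by (simp add: lin_on_def subspace_0[OF E2_sub[OF N]])
    qed
  qed (use Hom_E_D(3,4)[OF F] in \<open>auto simp: add_eq_0_iff2\<close>)
  have f0: "f v n 0 = 0" if "f \<in> E.ghom ?X ?N a t" for f v n a
    by (rule E.ghom_zero[OF X that])
  have D: "gD ?X ?N a t f (- (a + 1)) n x = - sg a (f (- a) n (d (a + 1) n x))" if f: "f \<in> E.ghom ?X ?N a t" for f a n x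
    using d[of x "a + 1" n] f0[OF f] by (simp add: gD_def add_ac)
  have D0: "gD ?X ?N a t f v n x = 0" if f: "f \<in> E.ghom ?X ?N a t" and v: "v \<noteq> - (a + 1)" for f a n x v
    using out[OF f, of "v + 1"] v by (simp add: gD_def)
  have Hc: "cycles (HomE_cohomology p R d N u t) = (\<lambda>f. f (- u)) ` cycles (E.gH ?X ?N u t)"
  proof
    show "(\<lambda>f. f (- u)) ` cycles (E.gH ?X ?N u t) \<subseteq> cycles (HomE_cohomology p R d N u t)"
    proof
      fix F assume "F \<in> (\<lambda>f. f (- u)) ` cycles (E.gH ?X ?N u t)"
      then obtain f where f: "f \<in> E.ghom ?X ?N u t" "gD ?X ?N u t f = 0" "F = f (- u)" by (auto simp: E.gH_def)
      have "F n (d (u + 1) n x) = 0" for n x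
        using D[OF f(1), of n x] f(2,3) by (simp add: sg_def split: if_splits)
      then show "F \<in> cycles (HomE_cohomology p R d N u t)"
        using Hom[OF f(1)] f(3) by (simp add: HomE_cohomology_def)
    qed
    show "cycles (HomE_cohomology p R d N u t) \<subseteq> (\<lambda>f. f (- u)) ` cycles (E.gH ?X ?N u t)"
    proof
      fix F assume "F \<in> cycles (HomE_cohomology p R d N u t)"
      then have F: "F \<in> Hom_E p (R u) N t" "\<And>n x. F n (d (u + 1) n x) = 0" by (auto simp: HomE_cohomology_def)
      let ?f = "\<lambda>v. if v = - u then F else (\<lambda>n x. 0)"
      have "gD ?X ?N u t ?f v n x = 0" for v n x
        using D[OF ext[OF F(1)], of n x] D0[OF ext[OF F(1)], of v n x] F(2) by (cases "v = - (u + 1)") simp_all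
      then have "gD ?X ?N u t ?f = 0" by (auto simp: fun_eq_iff)
      then show "F \<in> (\<lambda>f. f (- u)) ` cycles (E.gH ?X ?N u t)"
        using ext[OF F(1)] by (intro image_eqI[of _ _ ?f]) (auto simp: E.gH_def)
    qed
  qed
  have Hb: "boundaries (HomE_cohomology p R d N u t) = (\<lambda>f. f (- u)) ` boundaries (E.gH ?X ?N u t)"
  proof
    have Du: "gD ?X ?N (u - 1) t f (- u) = (\<lambda>n x. sg u (f (- (u - 1)) n (d u n x)))" if "f \<in> E.ghom ?X ?N (u - 1) t" for f
      using D[OF that] by (simp add: fun_eq_iff)
    show "(\<lambda>f. f (- u)) ` boundaries (E.gH ?X ?N u t) \<subseteq> boundaries (HomE_cohomology p R d N u t)"
    proof
      fix F assume "F \<in> (\<lambda>f. f (- u)) ` boundaries (E.gH ?X ?N u t)"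
      then obtain f where f: "f \<in> E.ghom ?X ?N (u - 1) t" "F = gD ?X ?N (u - 1) t f (- u)" by (auto simp: E.gH_def)
      \<comment> \<open>The sign between the two differentials is moved into the primitive.\<close>
      define h where "h = (if even u then f else - f)"
      have "h \<in> E.ghom ?X ?N (u - 1) t" unfolding h_def using f(1) E.ghom_neg[OF Nm f(1) X] by (cases "even u") simp_all
      let ?g = "h (- (u - 1))"
      have "?g \<in> Hom_E p (R (u - 1)) N t" by (rule Hom) fact
      moreover have "F = (\<lambda>n x. ?g n (d u n x))"
        using f by (auto simp: Du sg_def fun_eq_iff h_def)
      ultimately show "F \<in> boundaries (HomE_cohomology p R d N u t)" by (auto simp: HomE_cohomology_def)
    qed
    show "boundaries (HomE_cohomology p R d N u t) \<subseteq> (\<lambda>f. f (- u)) ` boundaries (E.gH ?X ?N u t)"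
    proof
      fix F assume "F \<in> boundaries (HomE_cohomology p R d N u t)"
      then obtain g where g: "g \<in> Hom_E p (R (u - 1)) N t" "F = (\<lambda>n x. g n (d u n x))" by (auto simp: HomE_cohomology_def)
      let ?f = "\<lambda>v. if v = - (u - 1) then g else (\<lambda>n x. 0)"
      let ?f' = "if even u then ?f else - ?f"
      have f': "?f' \<in> E.ghom ?X ?N (u - 1) t" using ext[OF g(1)] E.ghom_neg[OF Nm ext[OF g(1)] X] by simp
      moreover have "F = gD ?X ?N (u - 1) t ?f' (- u)"
        unfolding Du[OF f'] by (auto simp: g(2) sg_def fun_eq_iff)
      ultimately show "F \<in> (\<lambda>f. f (- u)) ` boundaries (E.gH ?X ?N u t)" by (auto simp: E.gH_def)
    qed
  qed
  have inj: "inj_on (\<lambda>f. f (- u)) (cycles (E.gH ?X ?N u t))"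
  proof (rule inj_onI)
    fix f g assume fg: "f \<in> cycles (E.gH ?X ?N u t)" "g \<in> cycles (E.gH ?X ?N u t)" "f (- u) = g (- u)"
    then have "f \<in> E.ghom ?X ?N u t" "g \<in> E.ghom ?X ?N u t" by (auto simp: E.gH_def)
    from out[OF this(1)] out[OF this(2)] have "f v n x = g v n x" for v n x
      using fg(3) by (cases "v = - u") simp_all
    then show "f = g" by (simp add: fun_eq_iff)
  qed
  show "sq_wf (HomE_cohomology p R d N u t)" "sq_map (E.gH ?X ?N u t) (HomE_cohomology p R d N u t) (\<lambda>f. f (- u))"
    by (rule sq_image[OF E.gH_wf[OF X Nm] Hc Hb inj]; simp add: E.gH_def HomE_cohomology_def)+
qed

end

section \<open>The resolution \<open>E(2) \<otimes> \<Gamma> \<otimes> M\<close>\<close>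

type_synonym kkey = "nat set \<times> nat multiset"

text \<open>The sign in \<open>Q_i Q_S\<close>: the letter \<open>i\<close>, entering from the left,
  passes the elements of \<open>S\<close> below it.\<close>

definition sgl :: "nat \<Rightarrow> nat set \<Rightarrow> 'a::ab_group_add \<Rightarrow> 'a" where
  "sgl i S = sg (int (card {j \<in> S. j < i}))"

text \<open>The sign in \<open>Q_S Q_i\<close>: the letter \<open>i\<close>, entering from the
  right, passes the elements of \<open>S\<close> above it.\<close>

definition sgr :: "nat \<Rightarrow> nat set \<Rightarrow> 'a::ab_group_add \<Rightarrow> 'a" where
  "sgr i S = sg (int (card {j \<in> S. i < j}))"

lemma sg_0: "sg a 0 = 0" by (simp add: sg_def)

lemma sgl_lin: "sgl i S (x + y) = sgl i S x + sgl i S y" "sgl i S (- x) = - sgl i S x" "sgl i S 0 = 0"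
  "sgl i S (sg a x) = sg a (sgl i S x)" "sgl i S (sgr j T x) = sgr j T (sgl i S x)"
  by (auto simp: sgl_def sgr_def sg_def)

lemma sgr_lin: "sgr i S (x + y) = sgr i S x + sgr i S y" "sgr i S (- x) = - sgr i S x" "sgr i S 0 = 0"
  "sgr i S (sg a x) = sg a (sgr i S x)"
  by (auto simp: sgr_def sg_def)

lemma sg_sum: "sg a (\<Sum>i\<in>A. g i) = (\<Sum>i\<in>A. sg a (g i))"
  by (simp add: sg_def sum_negf)

lemma sgr_sum: "sgr i S (\<Sum>i\<in>A. g i) = (\<Sum>j\<in>A. sgr i S (g j))"
  by (simp add: sgr_def sg_sum)

lemma sgl_sum: "sgl i S (\<Sum>i\<in>A. g i) = (\<Sum>j\<in>A. sgl i S (g j))"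
  by (simp add: sgl_def sg_sum)

lemma card_less_remove:
  assumes "finite S" "i \<in> S"
  shows "int (card {k \<in> S - {i}. k < j}) = int (card {k \<in> S. k < j}) - (if i < j then 1 else 0)"
    "int (card {k \<in> S - {i}. j < k}) = int (card {k \<in> S. j < k}) - (if j < i then 1 else 0)"
proof -
  have *: "int (card {k \<in> S - {i}. P k}) = int (card {k \<in> S. P k}) - (if P i then 1 else 0)" for P
  proof (cases "P i")
    case True
    have "{k \<in> S. P k} = insert i {k \<in> S - {i}. P k}" using assms True by auto
    then have "card {k \<in> S. P k} = Suc (card {k \<in> S - {i}. P k})" using assms by simp
    then show ?thesis using True by simp
  next
    case False
    then have "{k \<in> S - {i}. P k} = {k \<in> S. P k}" by auto
    then show ?thesis using False by simp
  qed
  show "int (card {k \<in> S - {i}. k < j}) = int (card {k \<in> S. k < j}) - (if i < j then 1 else 0)"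
    "int (card {k \<in> S - {i}. j < k}) = int (card {k \<in> S. j < k}) - (if j < i then 1 else 0)"
    by (rule *)+
qed

lemma sg_cong_parity: "even (a - b) \<Longrightarrow> sg a y = sg b y"
  by (auto simp: sg_def)

lemma sg_odd: "odd (a - b) \<Longrightarrow> sg a y = - sg b y"
  by (auto simp: sg_def)

text \<open>Exactly one of \<open>i < j\<close> and \<open>j < i\<close> holds, so the total counts
  on the two sides differ by one.\<close>

lemma sgl_anti:
  assumes "finite S" "i \<in> S" "j \<in> S" "i \<noteq> j"
  shows "sgl i S (sgl j (S - {i}) y) = - sgl j S (sgl i (S - {j}) y)"
  unfolding sgl_def grading.sg_sg[symmetric] card_less_remove[OF assms(1,2)] card_less_remove[OF assms(1,3)]
  by (rule sg_odd) (use assms(4) in auto)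

lemma sgr_anti:
  assumes "finite S" "i \<in> S" "j \<in> S" "i \<noteq> j"
  shows "sgr i S (sgr j (S - {i}) y) = - sgr j S (sgr i (S - {j}) y)"
  unfolding sgr_def grading.sg_sg[symmetric] card_less_remove[OF assms(1,2)] card_less_remove[OF assms(1,3)]
  by (rule sg_odd) (use assms(4) in auto)

text \<open>Left and right multiplication on the exterior algebra commute: taking \<open>i\<close>
  out changes the count above \<open>j\<close> exactly when taking \<open>j\<close> out changes the
  count below \<open>i\<close>.\<close>

lemma sgl_sgr:
  assumes "finite S" "i \<in> S" "j \<in> S" "i \<noteq> j"
  shows "sgl i S (sgr j (S - {i}) y) = sgr j S (sgl i (S - {j}) y)"
  unfolding sgr_def sgl_def grading.sg_sg[symmetric] card_less_remove[OF assms(1,2)] card_less_remove[OF assms(1,3)]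
  by (rule sg_cong_parity) (use assms(4) in auto)

text \<open>The form that \<open>d d = 0\<close> takes in both models, with one term for every
  ordered pair of operators. The diagonal is treated on its own, since antisymmetry leaves it
  undetermined in characteristic two.\<close>

lemma sum3_anti:
  fixes V :: "nat \<Rightarrow> nat \<Rightarrow> 'a::ab_group_add"
  assumes "\<And>i. i < 3 \<Longrightarrow> V i i = 0" "\<And>i j. i < 3 \<Longrightarrow> j < 3 \<Longrightarrow> i \<noteq> j \<Longrightarrow> V i j = - V j i"
  shows "(\<Sum>i<3. \<Sum>j<3. V i j) = 0"
proof -
  have "V 1 0 = - V 0 1" "V 2 0 = - V 0 2" "V 2 1 = - V 1 2" by (rule assms(2); simp)+
  moreover have "V 0 0 = 0" "V 1 1 = 0" "V 2 2 = 0" by (rule assms(1); simp)+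
  ultimately show ?thesis by (simp add: numeral_3_eq_3 numeral_2_eq_2 lessThan_Suc)
qed

lemma lin_on_sum:
  fixes f :: "'a::ab_group_add \<Rightarrow> 'b::ab_group_add"
  assumes "vector_space s" "module.subspace s V" "lin_on s V s' W f" "\<And>i. i \<in> A \<Longrightarrow> g i \<in> V"
  shows "f (\<Sum>i\<in>A. g i) = (\<Sum>i\<in>A. f (g i))"
proof -
  interpret vector_space s by fact
  have zero: "f 0 = 0" using lin_on_zero[OF assms(3) subspace_0[OF assms(2)]] .
  show ?thesis
  proof (cases "finite A")
    case True
    then have "(\<Sum>i\<in>A. g i) \<in> V \<and> f (\<Sum>i\<in>A. g i) = (\<Sum>i\<in>A. f (g i))" using assms(4)
      by (induction A rule: finite_induct) (auto simp: zero subspace_0[OF assms(2)] subspace_add[OF assms(2)] lin_onD(2)[OF assms(3)])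
    then show ?thesis by simp
  qed (simp add: zero)
qed

text \<open>The keys of the basis \<open>Q_S \<otimes> \<gamma>_a\<close> of the Koszul complex in
  homological degree \<open>r\<close>.\<close>

definition kkeys :: "int \<Rightarrow> kkey set" where
  "kkeys r = {(S, a). S \<subseteq> {..<3} \<and> set_mset a \<subseteq> {..<3} \<and> int (size a) = r}"

lemma finite_kkeys: "finite (kkeys r)"
proof -
  have "kkeys r \<subseteq> Pow {..<3} \<times> multisets_of_size {..<3} (nat r)"
    by (auto simp: kkeys_def multisets_of_size_def)
  then show ?thesis by (rule finite_subset) (auto intro: finite_multisets_of_size)
qed

lemma kkeys_move: "i < 3 \<Longrightarrow> i \<in> S \<Longrightarrow> (S - {i}, add_mset i a) \<in> kkeys (r + 1) \<longleftrightarrow> (S, a) \<in> kkeys r"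
  by (auto simp: kkeys_def)

lemma kkeys_add: "i < 3 \<Longrightarrow> (S, add_mset i a) \<in> kkeys (r + 1) \<longleftrightarrow> (S, a) \<in> kkeys r"
  by (auto simp: kkeys_def)

lemma kkeys_remove: "i < 3 \<Longrightarrow> i \<in> S \<Longrightarrow> (S - {i}, a) \<in> kkeys r \<longleftrightarrow> (S, a) \<in> kkeys r"
  by (auto simp: kkeys_def)

text \<open>The Koszul differential read on coefficients: \<open>Q_S \<otimes> \<gamma>_a\<close>
  receives contributions from the keys out of which it arises when one index \<open>i\<close> passes
  from the divided power to the exterior factor.\<close>

definition kz0 :: "(kkey \<Rightarrow> 'a::ab_group_add) \<Rightarrow> kkey \<Rightarrow> 'a" where
  "kz0 x = (\<lambda>(S, a). \<Sum>i<3. if i \<in> S then sgr i S (x (S - {i}, add_mset i a)) else 0)"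

text \<open>
  A contracting homotopy of the Koszul complex: with \<open>m\<close> the least index that occurs in
  \<open>Q\<^sub>S \<otimes> \<gamma>\<^sub>a\<close>, it sends \<open>Q\<^sub>m Q\<^sub>S \<otimes> \<gamma>\<^sub>a\<close> to \<open>\<plusminus>Q\<^sub>S \<otimes> \<gamma>\<^bsub>a+m\<^esub>\<close>, and elements without \<open>Q\<^sub>m\<close> to zero.
\<close>

definition contract :: "(kkey \<Rightarrow> 'a::ab_group_add) \<Rightarrow> kkey \<Rightarrow> 'a" where
  "contract x = (\<lambda>(S, a). let m = Min (S \<union> set_mset a) in
     if finite S \<and> (S, a) \<noteq> ({}, {#}) \<and> m \<notin> S then sg (int (card S)) (x (insert m S, a - {#m#})) else 0)"

text \<open>Let \<open>m\<close> be the least index of the key. If \<open>m \<in> S\<close>, the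
  second composite and all terms of the first but \<open>i = m\<close> vanish. If \<open>m\<close>
  occurs only in \<open>a\<close>, the terms with \<open>i \<noteq> m\<close> of the two composites
  cancel in pairs and the term \<open>i = m\<close> of the second remains.\<close>

lemma kz0_contract:
  fixes x :: "kkey \<Rightarrow> 'a::ab_group_add"
  assumes k: "(S, a) \<in> kkeys r" "(S, a) \<noteq> ({}, {#})"
  shows "kz0 (contract x) (S, a) + contract (kz0 x) (S, a) = x (S, a)"
proof -
  have fin: "finite S" and sub: "S \<subseteq> {..<3}" "set_mset a \<subseteq> {..<3}"
    using k(1) by (auto simp: kkeys_def intro: finite_subset)
  define m where "m = Min (S \<union> set_mset a)"
  have ne: "S \<union> set_mset a \<noteq> {}" "finite (S \<union> set_mset a)" using k(2) fin by auto
  have m: "m \<in> S \<union> set_mset a" "\<And>i. i \<in> S \<union> set_mset a \<Longrightarrow> m \<le> i"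
    unfolding m_def using Min_in[OF ne(2,1)] Min_le[OF ne(2)] by auto
  \<comment> \<open>Passing \<open>i\<close> from \<open>S\<close> to \<open>a\<close> leaves the
    union, and hence the least index \<open>m\<close>, unchanged.\<close>
  have Mini: "Min ((S - {i}) \<union> set_mset (add_mset i a)) = m" if "i \<in> S" for i
    using that by (simp add: m_def insert_absorb Un_commute) (metis Un_insert_right insert_Diff_single insert_absorb Un_commute)
  have khi: "contract x (S - {i}, add_mset i a) =
      (if m \<notin> S - {i} then sg (int (card S) - 1) (x (insert m (S - {i}), add_mset i a - {#m#})) else 0)" if "i \<in> S" for i
  proof -
    have "int (card (S - {i})) = int (card S) - 1"
      using that fin card_gt_0_iff[of S] by (auto simp: of_nat_diff)
    then show ?thesis using Mini[OF that] fin by (simp add: contract_def Let_def)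
  qed
  have m3: "m < 3" using m(1) sub by auto
  show ?thesis
  proof (cases "m \<in> S")
    case True
    have "contract (kz0 x) (S, a) = 0" using True by (simp add: contract_def Let_def m_def)
    moreover have "kz0 (contract x) (S, a) = (\<Sum>i<3. if i = m then x (S, a) else 0)"
      unfolding kz0_def prod.case
    proof (rule sum.cong)
      fix i
      show "(if i \<in> S then sgr i S (contract x (S - {i}, add_mset i a)) else 0) = (if i = m then x (S, a) else 0)"
      proof (cases "i = m")
        case True
        have "{j \<in> S. m < j} = S - {m}" using m(2) by (auto simp: less_le)
        then have "card {j \<in> S. m < j} = card S - 1"
          by (simp only: card_Diff_singleton[OF \<open>m \<in> S\<close>])
        moreover have "card S > 0" using \<open>m \<in> S\<close> fin card_gt_0_iff by blast
        ultimately have "int (card {j \<in> S. m < j}) = int (card S) - 1" by linarith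
        then have 1: "sgr m S y = sg (int (card S) - 1) y" for y :: 'a by (simp only: sgr_def)
        have "contract x (S - {m}, add_mset m a) = sg (int (card S) - 1) (x (S, a))"
          using khi[OF \<open>m \<in> S\<close>] \<open>m \<in> S\<close> by (simp add: insert_Diff insert_absorb)
        then show ?thesis using True \<open>m \<in> S\<close> by (simp only: 1 sg_simps simp_thms if_True minus_minus)
      next
        case False
        have "contract x (S - {i}, add_mset i a) = 0" if "i \<in> S"
          using khi[OF that] False \<open>m \<in> S\<close> by simp
        then show ?thesis using False by (simp add: sgr_lin)
      qed
    qed simp
    ultimately show ?thesis using m3 by simp
  next
    case False
    then have ma: "m \<in># a" using m(1) by auto
    let ?E = "\<lambda>i. if i \<in> S then sgr i S (contract x (S - {i}, add_mset i a)) else 0"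
    let ?F = "\<lambda>i. sg (int (card S)) (if i \<in> insert m S then sgr i (insert m S) (x (insert m S - {i}, add_mset i (a - {#m#}))) else 0)"
    have "contract (kz0 x) (S, a) = (\<Sum>i<3. ?F i)"
      using False k(2) fin by (auto simp: contract_def Let_def m_def[symmetric] kz0_def sg_def sum_negf)
    moreover have "kz0 (contract x) (S, a) = (\<Sum>i<3. ?E i)" by (simp add: kz0_def)
    moreover have "?E i + ?F i = (if i = m then x (S, a) else 0)" for i
    proof (cases "i = m")
      case True
      have "{j \<in> insert m S. m < j} = S" using m(2) False by (auto simp: less_le)
      then show ?thesis using True False ma by (simp add: sgr_def)
    next
      case im: False
      show ?thesis
      proof (cases "i \<in> S")
        case True
        \<comment> \<open>Adding the smaller \<open>m\<close> to \<open>S\<close> does not change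
          the number of letters above \<open>i\<close>, so the signs of the two terms differ only by
          \<open>card S - 1\<close> against \<open>card S\<close>.\<close>
        then have "m < i" using m(2)[of i] im by auto
        then have "{j \<in> insert m S. i < j} = {j \<in> S. i < j}" by auto
        moreover have "insert m (S - {i}) = insert m S - {i}" "add_mset i a - {#m#} = add_mset i (a - {#m#})"
          using im ma by auto
        ultimately show ?thesis using True False im khi[OF True] by (simp add: sgr_def) (simp add: sg_def)
      qed (use im in simp)
    qed
    ultimately have "kz0 (contract x) (S, a) + contract (kz0 x) (S, a) = (\<Sum>i<3. if i = m then x (S, a) else 0)"
      by (simp only: sum.distrib[symmetric])
    then show ?thesis using m3 by simp
  qed
qed

section \<open>The twisted complex and its E(2)-action\<close>

context exterior
begin

text \<open>The negative of the internal degree of \<open>Q_S \<otimes> \<gamma>_a\<close>; in total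
  degree \<open>n\<close> the coefficient at \<open>k\<close> therefore has degree
  \<open>n + kdeg k\<close> in the module.\<close>

definition kdeg :: "kkey \<Rightarrow> int" where
  "kdeg = (\<lambda>(S, a). (\<Sum>i\<in>S. qdeg p i) + (\<Sum>i\<in>#a. qdeg p i))"

lemma kdeg_add: "kdeg (S, add_mset i a) = kdeg (S, a) + qdeg p i"
  by (simp add: kdeg_def)

lemma kdeg_remove: "finite S \<Longrightarrow> i \<in> S \<Longrightarrow> kdeg (S - {i}, a) = kdeg (S, a) - qdeg p i"
  by (simp add: kdeg_def sum_diff1)

definition kz1 :: "('f, 'a::ab_group_add) emod \<Rightarrow> int \<Rightarrow> (kkey \<Rightarrow> 'a) \<Rightarrow> kkey \<Rightarrow> 'a" where
  "kz1 M n x = (\<lambda>(S, a). \<Sum>i<3. eact M i (n + kdeg (S, add_mset i a)) (x (S, add_mset i a)))"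

text \<open>
  The value \<open>x (S, a)\<close> is the coefficient in \<open>M\<close> of \<open>Q\<^sub>S \<otimes> \<gamma>\<^sub>a\<close>. The differential combines the Koszul
  differential with the action of \<open>Q\<^sub>i\<close> on \<open>M\<close>, where \<open>(-1)\<^sup>u\<close> makes the two parts anticommute.
\<close>

definition Eres :: "('f, 'a::ab_group_add) emod \<Rightarrow> ('f, kkey \<Rightarrow> 'a) gmod" where
  "Eres M = \<lparr>gsc = (\<lambda>u c x k. escale M c (x k)),
     gco = (\<lambda>u n. fun_sub (kkeys (- u)) (\<lambda>k. ecomp M (n + kdeg k))),
     gd = (\<lambda>u n x. if x \<in> fun_sub (kkeys (- u)) (\<lambda>k. ecomp M (n + kdeg k))
       then (\<lambda>k. kz0 x k + sg u (kz1 M n x k)) else 0),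
     gop = (\<lambda>i u n x (S, a). if i \<in> S then sgl i S (x (S - {i}, a)) else 0)\<rparr>"

lemma Eres_sel:
  "gsc (Eres M) u c x = (\<lambda>k. escale M c (x k))"
  "gco (Eres M) u n = fun_sub (kkeys (- u)) (\<lambda>k. ecomp M (n + kdeg k))"
  "x \<in> gco (Eres M) u n \<Longrightarrow> gd (Eres M) u n x = (\<lambda>k. kz0 x k + sg u (kz1 M n x k))"
  "x \<notin> gco (Eres M) u n \<Longrightarrow> gd (Eres M) u n x = 0"
  "gop (Eres M) i u n x (S, a) = (if i \<in> S then sgl i S (x (S - {i}, a)) else 0)"
  by (simp_all add: Eres_def)

lemma Eres_gsc: "gsc (Eres M) u = (\<lambda>c x k. escale M c (x k))"
  by (simp add: Eres_def)

context
  fixes M :: "('f::field, 'a::ab_group_add) emod"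
  assumes M: "E2_module p M"
begin

lemma M_closed:
  "0 \<in> ecomp M n" "x \<in> ecomp M n \<Longrightarrow> y \<in> ecomp M n \<Longrightarrow> x + y \<in> ecomp M n"
  "x \<in> ecomp M n \<Longrightarrow> - x \<in> ecomp M n" "x \<in> ecomp M n \<Longrightarrow> sg a x \<in> ecomp M n"
  "x \<in> ecomp M n \<Longrightarrow> sgl i S x \<in> ecomp M n" "x \<in> ecomp M n \<Longrightarrow> sgr i S x \<in> ecomp M n"
  "x \<in> ecomp M n \<Longrightarrow> escale M c x \<in> ecomp M n"
  using subspace_zero[OF E2_vs[OF M] E2_sub[OF M]] subspace_add[OF E2_vs[OF M] E2_sub[OF M]]
    subspace_neg[OF E2_vs[OF M] E2_sub[OF M]] subspace_scale[OF E2_vs[OF M] E2_sub[OF M]]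
  by (auto simp: sg_def sgl_def sgr_def)

lemma Q_in: "i < 3 \<Longrightarrow> x \<in> ecomp M n \<Longrightarrow> n' = n - qdeg p i \<Longrightarrow> eact M i n x \<in> ecomp M n'"
  using lin_onD(1)[OF E2_lin[OF M]] by blast

lemma Q_zero: "i < 3 \<Longrightarrow> eact M i n 0 = 0"
  using lin_on_zero[OF E2_lin[OF M] M_closed(1)] .

lemma Q_lin:
  assumes "i < 3" "x \<in> ecomp M n"
  shows "y \<in> ecomp M n \<Longrightarrow> eact M i n (x + y) = eact M i n x + eact M i n y"
    "eact M i n (- x) = - eact M i n x" "eact M i n (sg a x) = sg a (eact M i n x)"
    "eact M i n (sgl j S x) = sgl j S (eact M i n x)" "eact M i n (sgr j S x) = sgr j S (eact M i n x)"
    "eact M i n (escale M c x) = escale M c (eact M i n x)"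
  using lin_onD(2,3)[OF E2_lin[OF M assms(1)] assms(2)] lin_on_neg[OF E2_vs[OF M] E2_sub[OF M] E2_lin[OF M assms(1)] assms(2)]
  by (auto simp: sg_def sgl_def sgr_def)

lemma escale_lin: "escale M c (x + y) = escale M c x + escale M c y" "escale M c 0 = 0"
  "escale M c (sg a x) = sg a (escale M c x)" "escale M c (sgl i S x) = sgl i S (escale M c x)" "escale M c (sgr i S x) = sgr i S (escale M c x)"
  "escale M c (\<Sum>i\<in>A. g i) = (\<Sum>i\<in>A. escale M c (g i))"
proof -
  interpret vector_space "escale M" by (rule E2_vs[OF M])
  show "escale M c (x + y) = escale M c x + escale M c y" "escale M c 0 = 0"
    "escale M c (sg a x) = sg a (escale M c x)" "escale M c (sgl i S x) = sgl i S (escale M c x)" "escale M c (sgr i S x) = sgr i S (escale M c x)"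
    "escale M c (\<Sum>i\<in>A. g i) = (\<Sum>i\<in>A. escale M c (g i))"
    by (auto simp: scale_right_distrib sg_def sgl_def sgr_def scale_sum_right)
qed

lemma M_sum: "(\<And>i. i \<in> A \<Longrightarrow> g i \<in> ecomp M n) \<Longrightarrow> (\<Sum>i\<in>A. g i) \<in> ecomp M n"
proof -
  interpret vector_space "escale M" by (rule E2_vs[OF M])
  show "(\<And>i. i \<in> A \<Longrightarrow> g i \<in> ecomp M n) \<Longrightarrow> (\<Sum>i\<in>A. g i) \<in> ecomp M n"
    by (rule subspace_sum[OF E2_sub[OF M]])
qed

abbreviation RC :: "int \<Rightarrow> int \<Rightarrow> (kkey \<Rightarrow> 'a) set" where
  "RC u n \<equiv> fun_sub (kkeys (- u)) (\<lambda>k. ecomp M (n + kdeg k))"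

lemma RC_D:
  assumes "x \<in> RC u n"
  shows "m = n + kdeg k \<Longrightarrow> x k \<in> ecomp M m" "k \<notin> kkeys (- u) \<Longrightarrow> x k = 0"
proof -
  have *: "if k \<in> kkeys (- u) then x k \<in> ecomp M (n + kdeg k) else x k = 0"
    using assms unfolding fun_sub_def by blast
  show "m = n + kdeg k \<Longrightarrow> x k \<in> ecomp M m" "k \<notin> kkeys (- u) \<Longrightarrow> x k = 0"
    using * M_closed(1) by (simp_all split: if_splits)
qed

lemma RC_I: "(\<And>k. k \<in> kkeys (- u) \<Longrightarrow> x k \<in> ecomp M (n + kdeg k)) \<Longrightarrow> (\<And>k. k \<notin> kkeys (- u) \<Longrightarrow> x k = 0) \<Longrightarrow> x \<in> RC u n"
  by (simp add: fun_sub_def)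

lemma kkeys_fin: "(S, a) \<in> kkeys r \<Longrightarrow> finite S"
  by (auto simp: kkeys_def intro: finite_subset)

lemma kz0_in:
  assumes x: "x \<in> RC u n"
  shows "kz0 x \<in> RC (u + 1) n"
proof (rule RC_I)
  fix k assume "k \<in> kkeys (- (u + 1))"
  then obtain S a where k: "k = (S, a)" "(S, a) \<in> kkeys (- (u + 1))" by (cases k) auto
  have "x (S - {i}, add_mset i a) \<in> ecomp M (n + kdeg k)" if "i \<in> S" for i
    using that kkeys_fin[OF k(2)] by (intro RC_D(1)[OF x]) (simp add: k kdeg_add kdeg_remove)
  then show "kz0 x k \<in> ecomp M (n + kdeg k)"
    by (auto simp: kz0_def k(1) intro!: M_sum M_closed)
next
  fix k assume "k \<notin> kkeys (- (u + 1))"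
  then obtain S a where k: "k = (S, a)" "(S, a) \<notin> kkeys (- u - 1)" by (cases k) auto
  have "x (S - {i}, add_mset i a) = 0" if "i \<in> S" "i < 3" for i
    using kkeys_move[OF that(2,1), of a "- u - 1"] k(2) by (intro RC_D(2)[OF x]) simp
  then show "kz0 x k = 0" unfolding kz0_def k(1) prod.case by (intro sum.neutral) (simp add: sgr_lin)
qed

lemma kz1_in:
  assumes x: "x \<in> RC u n"
  shows "kz1 M n x \<in> RC (u + 1) n"
proof (rule RC_I)
  fix k :: kkey assume "k \<in> kkeys (- (u + 1))"
  obtain S a where k: "k = (S, a)" by (cases k)
  have "eact M i (n + kdeg (S, add_mset i a)) (x (S, add_mset i a)) \<in> ecomp M (n + kdeg k)" if "i < 3" for i
    using that by (intro Q_in RC_D(1)[OF x]) (auto simp: k kdeg_add)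
  then show "kz1 M n x k \<in> ecomp M (n + kdeg k)"
    by (auto simp: kz1_def k intro!: M_sum)
next
  fix k assume "k \<notin> kkeys (- (u + 1))"
  then obtain S a where k: "k = (S, a)" "(S, a) \<notin> kkeys (- u - 1)" by (cases k) auto
  have "x (S, add_mset i a) = 0" if "i < 3" for i
    using kkeys_add[OF that, of S a "- u - 1"] k(2) by (intro RC_D(2)[OF x]) simp
  then show "kz1 M n x k = 0" unfolding kz1_def k(1) prod.case by (intro sum.neutral) (simp add: Q_zero)
qed

lemma RC_sub: "module.subspace (\<lambda>c x k. escale M c (x k)) (RC u n)"
  by (rule fun_sub_subspace[OF E2_vs[OF M] E2_sub[OF M]])

lemma RC_add: "x \<in> RC u n \<Longrightarrow> y \<in> RC u n \<Longrightarrow> x + y \<in> RC u n"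
  using subspace_add[OF vector_space_fun[OF E2_vs[OF M]] RC_sub] .

lemma RC_sg: "x \<in> RC u n \<Longrightarrow> (\<lambda>k. sg b (x k)) \<in> RC u n"
  using M_closed(4) by (auto simp: fun_sub_def split: if_splits)

lemma Eres_d_in:
  assumes x: "x \<in> RC u n"
  shows "(\<lambda>k. kz0 x k + sg u (kz1 M n x k)) \<in> RC (u + 1) n"
proof -
  have "kz0 x + (\<lambda>k. sg u (kz1 M n x k)) \<in> RC (u + 1) n"
    by (rule RC_add[OF kz0_in[OF x] RC_sg[OF kz1_in[OF x]]])
  then show ?thesis by (simp add: plus_fun_def)
qed

lemma Eres_gop_in:
  assumes x: "x \<in> RC u n" and i: "i < 3"
  shows "gop (Eres M) i u n x \<in> RC u (n - qdeg p i)"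
proof (rule RC_I)
  fix k assume "k \<in> kkeys (- u)"
  then obtain S a where k: "k = (S, a)" "(S, a) \<in> kkeys (- u)" by (cases k) auto
  have "x (S - {i}, a) \<in> ecomp M (n - qdeg p i + kdeg k)" if "i \<in> S"
    using that kkeys_fin[OF k(2)] by (intro RC_D(1)[OF x]) (simp add: k kdeg_remove)
  then show "gop (Eres M) i u n x k \<in> ecomp M (n - qdeg p i + kdeg k)"
    by (auto simp: Eres_sel k(1) intro!: M_closed)
next
  fix k assume "k \<notin> kkeys (- u)"
  then obtain S a where k: "k = (S, a)" "(S, a) \<notin> kkeys (- u)" by (cases k) auto
  have "x (S - {i}, a) = 0" if "i \<in> S"
    using kkeys_remove[OF i that] k(2) by (intro RC_D(2)[OF x]) simp
  then show "gop (Eres M) i u n x k = 0" by (simp add: Eres_sel k(1) sgl_lin)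
qed

text \<open>The square is a sum over pairs of operators. Koszul against Koszul cancels since the
  \<open>Q_i\<close> anticommute in the exterior factor, action against action since they
  anticommute on \<open>M\<close>, and the mixed terms cancel because the sign \<open>(-1)^u\<close>
  of the action part flips from one degree to the next.\<close>

lemma Eres_dd:
  assumes x: "x \<in> RC u n"
  shows "gd (Eres M) (u + 1) n (gd (Eres M) u n x) = 0"
proof
  fix k :: kkey
  let ?y = "\<lambda>k. kz0 x k + sg u (kz1 M n x k)"
  let ?z = "\<lambda>k. kz0 ?y k + sg (u + 1) (kz1 M n ?y k)"
  have y: "?y \<in> RC (u + 1) n" by (rule Eres_d_in[OF x])
  have z: "?z \<in> RC (u + 1 + 1) n" by (rule Eres_d_in[OF y])
  have eq: "gd (Eres M) (u + 1) n (gd (Eres M) u n x) = ?z"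
    using x y by (simp add: Eres_sel)
  obtain S a where k: "k = (S, a)" by (cases k)
  have "?z (S, a) = 0"
  proof (cases "(S, a) \<in> kkeys (- (u + 1 + 1))")
    case False
    then show ?thesis using RC_D(2)[OF z] by simp
  next
    case True
    have fin: "finite S" by (rule kkeys_fin[OF True])
    have xin: "x (T, b) \<in> ecomp M (n + kdeg (T, b))" for T b by (rule RC_D(1)[OF x]) simp
    let ?X = "\<lambda>T b. x (T, b)" and ?Q = "\<lambda>i T b. eact M i (n + kdeg (T, b))"
    \<comment> \<open>\<open>?T j\<close> is the part of the differential due to \<open>Q_j\<close>,
      and \<open>?V i j\<close> applies the part due to \<open>Q_i\<close> to it; the minus sign in
      \<open>?V\<close> is the sign of degree \<open>u + 1\<close>.\<close>
    let ?T = "\<lambda>j T b. (if j \<in> T then sgr j T (?X (T - {j}) (add_mset j b)) else 0) + sg u (?Q j T (add_mset j b) (?X T (add_mset j b)))"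
    let ?V = "\<lambda>i j. (if i \<in> S then sgr i S (?T j (S - {i}) (add_mset i a)) else 0) - sg u (?Q i S (add_mset i a) (?T j S (add_mset i a)))"
    have y_eq: "?y (T, b) = (\<Sum>j<3. ?T j T b)" for T b
      by (simp add: kz0_def kz1_def sum.distrib sg_def sum_negf)
    have Tin: "?T j S (add_mset i a) \<in> ecomp M (n + kdeg (S, add_mset i a))" if "j < 3" for i j
    proof -
      have "?X (S - {j}) (add_mset j (add_mset i a)) \<in> ecomp M (n + kdeg (S, add_mset i a))" if "j \<in> S"
        using that fin by (intro RC_D(1)[OF x]) (simp add: kdeg_add kdeg_remove)
      moreover have "?Q j S (add_mset j (add_mset i a)) (?X S (add_mset j (add_mset i a))) \<in> ecomp M (n + kdeg (S, add_mset i a))"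
        by (rule Q_in[OF that xin]) (simp add: kdeg_add)
      ultimately show ?thesis by (auto intro!: M_closed)
    qed
    have "?z (S, a) = (\<Sum>i<3. (if i \<in> S then sgr i S (\<Sum>j<3. ?T j (S - {i}) (add_mset i a)) else 0) - sg u (?Q i S (add_mset i a) (\<Sum>j<3. ?T j S (add_mset i a))))"
      unfolding kz0_def[of ?y] kz1_def[of M n ?y] prod.case y_eq
      by (simp add: sum_subtractf sg_def sum_negf)
    also have "\<dots> = (\<Sum>i<3. \<Sum>j<3. ?V i j)"
    proof (rule sum.cong)
      fix i :: nat assume "i \<in> {..<3}"
      then have i: "i < 3" by simp
      have "?Q i S (add_mset i a) (\<Sum>j<3. ?T j S (add_mset i a)) = (\<Sum>j<3. ?Q i S (add_mset i a) (?T j S (add_mset i a)))"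
        by (rule lin_on_sum[OF E2_vs[OF M] E2_sub[OF M] E2_lin[OF M i] Tin]) simp
      then show "(if i \<in> S then sgr i S (\<Sum>j<3. ?T j (S - {i}) (add_mset i a)) else 0) - sg u (?Q i S (add_mset i a) (\<Sum>j<3. ?T j S (add_mset i a)))
          = (\<Sum>j<3. ?V i j)"
        by (cases "i \<in> S") (simp_all only: if_True if_False sgr_sum sg_sum sum_subtractf sum_negf diff_0)
    qed simp
    also have "\<dots> = 0"
    proof (rule sum3_anti)
      fix i j :: nat assume i: "i < 3" and j: "j < 3"
      let ?a = "add_mset i (add_mset j a)"
      have aa: "add_mset j (add_mset i a) = ?a" by (rule add_mset_commute)
      have xi: "?X (S - {i}) (add_mset i b) \<in> ecomp M (n + kdeg (S, b))" if "i \<in> S" for i b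
        using that fin by (intro RC_D(1)[OF x]) (simp add: kdeg_add kdeg_remove)
      have Qx: "?Q j S (add_mset j (add_mset i a)) (?X S (add_mset j (add_mset i a))) \<in> ecomp M (n + kdeg (S, add_mset i a))" if "j < 3" for i j
        by (rule Q_in[OF that xin]) (simp add: kdeg_add)
      have V: "?V i j = (if i \<in> S then (if j \<in> S \<and> j \<noteq> i then sgr i S (sgr j (S - {i}) (?X (S - {i} - {j}) (add_mset j (add_mset i a)))) else 0) else 0)
          + (if i \<in> S then sg u (sgr i S (?Q j S (add_mset j a) (?X (S - {i}) (add_mset j (add_mset i a))))) else 0)
          - (if j \<in> S then sg u (sgr j S (?Q i S (add_mset i a) (?X (S - {j}) (add_mset j (add_mset i a))))) else 0)
          - ?Q i S (add_mset i a) (?Q j S (add_mset j (add_mset i a)) (?X S (add_mset j (add_mset i a))))"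
        if ij: "i < 3" "j < 3" for i j
      proof -
        have 1: "?Q j (S - {i}) (add_mset j (add_mset i a)) = ?Q j S (add_mset j a)" if "i \<in> S"
          using that fin by (simp add: kdeg_add kdeg_remove)
        have 2: "?Q i S (add_mset i a) (?T j S (add_mset i a)) =
            (if j \<in> S then sgr j S (?Q i S (add_mset i a) (?X (S - {j}) (add_mset j (add_mset i a)))) else 0)
            + sg u (?Q i S (add_mset i a) (?Q j S (add_mset j (add_mset i a)) (?X S (add_mset j (add_mset i a)))))"
          using xi[of j "add_mset i a"] Qx[OF ij(2), of i] by (auto simp: Q_lin[OF ij(1)] M_closed Q_zero[OF ij(1)])
        show ?thesis unfolding 2 using 1 by (auto simp: sgr_lin)
      qed
      have Qd: "n + kdeg (S, add_mset i a) = n + kdeg (S, add_mset i (add_mset j a)) - qdeg p j" for i j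
        by (simp add: kdeg_add)
      have "?Q i S (add_mset i a) (?Q i S (add_mset i (add_mset i a)) (?X S (add_mset i (add_mset i a)))) = 0"
        unfolding Qd[of i i] by (rule E2_sq[OF M i xin])
      then show "?V i i = 0"
        unfolding V[OF i i] by auto
      assume ij: "i \<noteq> j"
      have QQ: "?Q i S (add_mset i a) (?Q j S (add_mset j (add_mset i a)) (?X S (add_mset j (add_mset i a)))) =
         - ?Q j S (add_mset j a) (?Q i S (add_mset i (add_mset j a)) (?X S (add_mset i (add_mset j a))))"
        using E2_anti[OF M i j xin, of S "add_mset i (add_mset j a)"] by (simp add: kdeg_add aa algebra_simps)
      have "S - {j} - {i} = S - {i} - {j}" by auto
      then show "?V i j = - ?V j i"
        unfolding V[OF i j] V[OF j i] QQ using sgr_anti[OF fin, of i j "?X (S - {i} - {j}) ?a"] ij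
        by (auto simp: aa)
    qed
    finally show ?thesis .
  qed
  then show "gd (Eres M) (u + 1) n (gd (Eres M) u n x) k = 0 k" unfolding eq k by simp
qed

text \<open>\<open>E(2)\<close> acts by left multiplication, the Koszul differential multiplies on
  the right, and the action part does not touch the exterior factor.\<close>

lemma Eres_dop:
  assumes x: "x \<in> RC u n" and i: "i < 3"
  shows "gd (Eres M) u (n - qdeg p i) (gop (Eres M) i u n x) = gop (Eres M) i (u + 1) n (gd (Eres M) u n x)"
proof
  fix k :: kkey
  obtain S a where k: "k = (S, a)" by (cases k)
  let ?g = "gop (Eres M) i u n x"
  let ?y = "\<lambda>k. kz0 x k + sg u (kz1 M n x k)"
  have g: "?g \<in> RC u (n - qdeg p i)" by (rule Eres_gop_in[OF x i])
  have L: "gd (Eres M) u (n - qdeg p i) ?g = (\<lambda>k. kz0 ?g k + sg u (kz1 M (n - qdeg p i) ?g k))"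
    using g by (simp add: Eres_sel)
  have R: "gd (Eres M) u n x = ?y" using x by (simp add: Eres_sel)
  show "gd (Eres M) u (n - qdeg p i) ?g k = gop (Eres M) i (u + 1) n (gd (Eres M) u n x) k"
  proof (cases "(S, a) \<in> kkeys (- (u + 1))")
    case False
    then show ?thesis
      using RC_D(2)[OF Eres_d_in[OF g]] RC_D(2)[OF Eres_gop_in[OF Eres_d_in[OF x] i]] unfolding L R k by simp
  next
    case True
    have fin: "finite S" by (rule kkeys_fin[OF True])
    have 0: "kz0 ?g (S, a) = (if i \<in> S then sgl i S (kz0 x (S - {i}, a)) else 0)"
    proof (cases "i \<in> S")
      case True
      have "(\<Sum>j<3. if j \<in> S then sgr j S (if i \<in> S - {j} then sgl i (S - {j}) (x (S - {j} - {i}, add_mset j a)) else 0) else 0) =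
        (\<Sum>j<3. sgl i S (if j \<in> S - {i} then sgr j (S - {i}) (x (S - {i} - {j}, add_mset j a)) else 0))"
      proof (rule sum.cong)
        fix j
        have "S - {j} - {i} = S - {i} - {j}" by auto
        then show "(if j \<in> S then sgr j S (if i \<in> S - {j} then sgl i (S - {j}) (x (S - {j} - {i}, add_mset j a)) else 0) else 0)
            = sgl i S (if j \<in> S - {i} then sgr j (S - {i}) (x (S - {i} - {j}, add_mset j a)) else 0)"
          using sgl_sgr[OF fin True, of j "x (S - {i} - {j}, add_mset j a)"]
          by (cases "j \<in> S \<and> j \<noteq> i") (auto simp: True sgr_lin(3) sgl_lin(3))
      qed simp
      then show ?thesis using True by (simp only: kz0_def prod.case Eres_sel(5) if_True sgl_sum)
    qed (auto simp: kz0_def Eres_sel sgr_lin intro!: sum.neutral)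
    have 1: "kz1 M (n - qdeg p i) ?g (S, a) = (if i \<in> S then sgl i S (kz1 M n x (S - {i}, a)) else 0)"
    proof (cases "i \<in> S")
      case True
      have "eact M j (n - qdeg p i + kdeg (S, add_mset j a)) (sgl i S (x (S - {i}, add_mset j a))) =
         sgl i S (eact M j (n + kdeg (S - {i}, add_mset j a)) (x (S - {i}, add_mset j a)))" if j: "j < 3" for j
      proof -
        have e: "n - qdeg p i + kdeg (S, add_mset j a) = n + kdeg (S - {i}, add_mset j a)"
          using fin True by (simp add: kdeg_remove)
        show ?thesis unfolding e by (intro Q_lin(4)[OF j] RC_D(1)[OF x]) simp
      qed
      then have "kz1 M (n - qdeg p i) ?g (S, a) = (\<Sum>j<3. sgl i S (eact M j (n + kdeg (S - {i}, add_mset j a)) (x (S - {i}, add_mset j a))))"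
        unfolding kz1_def prod.case Eres_sel using True by (intro sum.cong) auto
      then show ?thesis using True by (simp add: kz1_def sgl_def sg_def sum_negf)
    qed (simp add: kz1_def Eres_sel Q_zero)
    show ?thesis unfolding L R k by (simp add: Eres_sel 0 1 sgl_lin)
  qed
qed

lemma gmodule_Eres: "E.gmodule (Eres M)"
  unfolding E.gmodule_def
proof (intro conjI allI impI ballI)
  fix u n
  show "vector_space (gsc (Eres M) u)" unfolding Eres_gsc Eres_sel(2) by (rule vector_space_fun[OF E2_vs[OF M]])
  show "module.subspace (gsc (Eres M) u) (gco (Eres M) u n)" unfolding Eres_gsc Eres_sel(2) by (rule RC_sub)
  show "lin_on (gsc (Eres M) u) (gco (Eres M) u n) (gsc (Eres M) (u + 1)) (gco (Eres M) (u + 1) n) (gd (Eres M) u n)"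
  proof (rule E.lin_onI)
    fix x assume x: "x \<in> gco (Eres M) u n"
    then have x': "x \<in> RC u n" by (simp add: Eres_sel)
    show "gd (Eres M) u n x \<in> gco (Eres M) (u + 1) n"
      using x Eres_d_in[OF x'] by (simp add: Eres_sel)
    have xin: "x k \<in> ecomp M (n + kdeg k)" for k by (rule RC_D(1)[OF x']) simp
    show "gd (Eres M) u n (gsc (Eres M) u c x) = gsc (Eres M) (u + 1) c (gd (Eres M) u n x)" for c
    proof -
      have "gsc (Eres M) u c x \<in> gco (Eres M) u n"
        using x' by (auto simp: Eres_sel fun_sub_def M_closed escale_lin split: if_splits)
      moreover have "kz0 (\<lambda>k. escale M c (x k)) k = escale M c (kz0 x k)" for k
        by (cases k) (auto simp: kz0_def escale_lin intro!: sum.cong)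
      moreover have "kz1 M n (\<lambda>k. escale M c (x k)) k = escale M c (kz1 M n x k)" for k
        by (cases k) (auto simp: kz1_def escale_lin Q_lin(6)[OF _ xin] intro!: sum.cong)
      ultimately show ?thesis using x by (simp add: Eres_sel escale_lin)
    qed
    fix y assume y: "y \<in> gco (Eres M) u n"
    then have y': "y \<in> RC u n" by (simp add: Eres_sel)
    have yin: "y k \<in> ecomp M (n + kdeg k)" for k by (rule RC_D(1)[OF y']) simp
    have "x + y \<in> gco (Eres M) u n" using RC_add[OF x' y'] by (simp add: Eres_sel)
    moreover have "kz0 (x + y) k = kz0 x k + kz0 y k" for k
      by (cases k) (auto simp: kz0_def sgr_lin sum.distrib[symmetric] intro!: sum.cong)
    moreover have "kz1 M n (x + y) k = kz1 M n x k + kz1 M n y k" for k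
      by (cases k) (auto simp: kz1_def Q_lin(1)[OF _ xin yin] sum.distrib[symmetric] intro!: sum.cong)
    ultimately show "gd (Eres M) u n (x + y) = gd (Eres M) u n x + gd (Eres M) u n y"
      using x y by (simp add: Eres_sel fun_eq_iff)
  qed
  fix x assume "x \<in> gco (Eres M) u n"
  then show "gd (Eres M) (u + 1) n (gd (Eres M) u n x) = 0" by (intro Eres_dd) (simp add: Eres_sel)
next
  fix i :: nat and u n assume i: "i < 3"
  show "lin_on (gsc (Eres M) u) (gco (Eres M) u n) (gsc (Eres M) (u + 0)) (gco (Eres M) (u + 0) (n + - qdeg p i)) (gop (Eres M) i u n)"
    using Eres_gop_in[OF _ i]
    by (intro E.lin_onI) (auto simp: Eres_sel sgl_lin escale_lin fun_eq_iff)
  fix x assume "x \<in> gco (Eres M) u n"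
  then have x: "x \<in> RC u n" by (simp add: Eres_sel)
  show "gd (Eres M) (u + 0) (n + - qdeg p i) (gop (Eres M) i u n x) = gop (Eres M) i (u + 1) n (gd (Eres M) u n x)"
    using Eres_dop[OF x i] by simp
  show "gop (Eres M) i (u + 0) (n + - qdeg p i) (gop (Eres M) i u n x) = 0"
    by (auto simp: Eres_sel fun_eq_iff sgl_lin)
next
  fix i j :: nat and u n x assume i: "i < 3" "j < 3" and "x \<in> gco (Eres M) u n"
  then have x: "x \<in> RC u n" by (simp add: Eres_sel)
  have *: "gop (Eres M) i u' n' (gop (Eres M) j u n x) = - gop (Eres M) j u' n'' (gop (Eres M) i u n x)" for u' n' n''
  proof
    fix k :: kkey
    obtain S a where k: "k = (S, a)" by (cases k)
    show "gop (Eres M) i u' n' (gop (Eres M) j u n x) k = (- gop (Eres M) j u' n'' (gop (Eres M) i u n x)) k"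
    proof (cases "finite S")
      case True
      have "S - {j} - {i} = S - {i} - {j}" by auto
      then show ?thesis using sgl_anti[OF True, of i j "x (S - {i} - {j}, a)"]
        by (auto simp: k Eres_sel sgl_lin)
    next
      case False
      \<comment> \<open>The type of keys admits infinite \<open>S\<close>; there every coefficient
        vanishes.\<close>
      have "x (S - {i} - {j}, b) = 0" "x (S - {j} - {i}, b) = 0" for i j b
        using False kkeys_fin by (auto intro!: RC_D(2)[OF x] dest!: kkeys_fin)
      then show ?thesis by (simp add: k Eres_sel sgl_lin)
    qed
  qed
  show "gop (Eres M) i (u + 0) (n + - qdeg p j) (gop (Eres M) j u n x) =
       (if True then - gop (Eres M) j (u + 0) (n + - qdeg p i) (gop (Eres M) i u n x)
        else gop (Eres M) j (u + 0) (n + - qdeg p i) (gop (Eres M) i u n x))"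
    using *[of "u + 0" "n + - qdeg p j" "n + - qdeg p i"] by simp
qed

end

end

section \<open>Freeness and exactness of the resolution\<close>

lemma delta_0: "delta k (0::'a::zero) = (\<lambda>_. 0)"
  by (simp add: delta_def)

lemma delta_inject: "y \<noteq> 0 \<Longrightarrow> delta k y = delta k' y' \<longleftrightarrow> k = k' \<and> y = y'"
  unfolding delta_def fun_eq_iff by metis

lemma basis_family_nonzero:
  assumes "vector_space s" "basis_family s V B (\<lambda>b. b)" "b \<in> B"
  shows "b \<noteq> 0"
proof -
  interpret vector_space s by fact
  show ?thesis using assms(2,3) dependent_zero[of B] by (auto simp: basis_family_def)
qed

lemma sum_list_sorted_list_of_set:
  assumes "finite S"
  shows "(\<Sum>j\<leftarrow>sorted_list_of_set S. f j) = (\<Sum>j\<in>S. f j)"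
  using assms by (simp add: sum_list_distinct_conv_sum_set)

context exterior
begin

lemma kdeg_split: "kdeg (S, a) = (\<Sum>i\<in>S. qdeg p i) + kdeg ({}, a)"
  by (simp add: kdeg_def)

text \<open>The free generators \<open>1 \<otimes> \<gamma>_a \<otimes> b\<close>, with
  \<open>b\<close> in a basis of the module.\<close>

definition zgens :: "(int \<Rightarrow> 'a::zero set) \<Rightarrow> int \<Rightarrow> int \<Rightarrow> (kkey \<Rightarrow> 'a) set" where
  "zgens Bas u t = {delta ({}, a) b | a b. ({}, a) \<in> kkeys (- u) \<and> b \<in> Bas (t + kdeg ({}, a))}"

lemma gop_Eres_delta:
  fixes y :: "'a::ab_group_add"
  assumes "i \<notin> S"
  shows "gop (Eres M) i u n (delta (S, a) y) = delta (insert i S, a) (sgl i (insert i S) y)"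
proof
  fix k :: kkey
  obtain T c where k: "k = (T, c)" by (cases k)
  have "T - {i} = S \<longleftrightarrow> T = insert i S" if "i \<in> T" using that assms by auto
  then show "gop (Eres M) i u n (delta (S, a) y) k = delta (insert i S, a) (sgl i (insert i S) y) k"
    unfolding k by (auto simp: Eres_sel delta_def sgl_lin(3))
qed

text \<open>No sign appears, since each letter of an increasing word is smaller than all those to
  its right.\<close>

lemma gword_Eres:
  fixes y :: "'a::ab_group_add"
  assumes "sorted_wrt (<) w"
  shows "E.gword (Eres M) w u n (delta ({}, a) y) = delta (set w, a) y"
  using assms
proof (induction w)
  case (Cons i w)
  then have "i \<notin> set w" "{j \<in> insert i (set w). j < i} = {}" by auto
  then have "sgl i (insert i (set w)) y = y" by (simp only: sgl_def card.empty of_nat_0 sg_simps)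
  then show ?case using Cons \<open>i \<notin> set w\<close> by (simp add: gop_Eres_delta)
qed simp

context
  fixes M :: "('f::field, 'a::ab_group_add) emod"
  assumes M: "E2_module p M"
begin

text \<open>The basis of the direct sum, indexed by a key \<open>(S, a)\<close> and a basis vector,
  becomes the basis of words on generators once \<open>S\<close> is read as an increasing
  word.\<close>

lemma gfree_Eres:
  assumes Bas: "\<And>m. basis_family (escale M) (ecomp M m) (Bas m) (\<lambda>b. b)"
  shows "E.gfree (Eres M) (zgens Bas)"
  unfolding E.gfree_def
proof (intro conjI allI gmodule_Eres[OF M])
  fix u t :: int
  let ?h = "\<lambda>((S, a), b). (sorted_list_of_set S, u, t + (\<Sum>i\<in>S. qdeg p i), delta ({} :: nat set, a) b)"
  let ?I = "Sigma (kkeys (- u)) (\<lambda>k. Bas (t + kdeg k))"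
  have fin: "finite S" if "(S, a) \<in> kkeys r" for S a r using that by (auto simp: kkeys_def intro: finite_subset)
  \<comment> \<open>A zero vector would make \<open>delta\<close> forget its key; basis vectors are
    nonzero, so keys can be recovered.\<close>
  have nz: "b \<noteq> 0" if "b \<in> Bas m" for b m by (rule basis_family_nonzero[OF E2_vs[OF M] Bas that])
  have neg: "(\<Sum>j\<leftarrow>w. - qdeg p j) = - (\<Sum>j\<leftarrow>w. qdeg p j)" for w by (induction w) auto
  have bas: "basis_family (gsc (Eres M) u) (gco (Eres M) u t) ?I (\<lambda>(k, b). delta k b)"
    unfolding Eres_gsc Eres_sel(2) by (rule fun_basis[OF E2_vs[OF M] finite_kkeys Bas])
  show "basis_family (gsc (Eres M) u) (gco (Eres M) u t) (E.gindex (zgens Bas) u t) (E.gwd (Eres M))"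
  proof (rule basis_family_reindex[OF bas, of ?h])
    show "E.gwd (Eres M) (?h i) = (case i of (k, b) \<Rightarrow> delta k b)" if i: "i \<in> ?I" for i
    proof -
      obtain S a b where "i = ((S, a), b)" "(S, a) \<in> kkeys (- u)" using i by auto
      then show ?thesis using fin[of S a "- u"] by (simp add: gword_Eres)
    qed
    show "bij_betw ?h ?I (E.gindex (zgens Bas) u t)"
      unfolding bij_betw_def
    proof
      show "inj_on ?h ?I"
      proof (rule inj_onI)
        fix i j assume ij: "i \<in> ?I" "j \<in> ?I" "?h i = ?h j"
        obtain S a b where i: "i = ((S, a), b)" "(S, a) \<in> kkeys (- u)" "b \<in> Bas (t + kdeg (S, a))" using ij(1) by auto
        obtain T c d where j: "j = ((T, c), d)" "(T, c) \<in> kkeys (- u)" using ij(2) by auto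
        have "set (sorted_list_of_set S) = set (sorted_list_of_set T)" using ij(3) by (simp add: i j)
        then have "S = T" using fin[OF i(2)] fin[OF j(2)] by simp
        moreover have "a = c \<and> b = d" using ij(3) delta_inject[OF nz[OF i(3)], of "({}, a)" "({}, c) :: kkey" d] by (auto simp: i j)
        ultimately show "i = j" by (simp add: i j)
      qed
      show "?h ` ?I = E.gindex (zgens Bas) u t"
      proof
        show "?h ` ?I \<subseteq> E.gindex (zgens Bas) u t"
        proof
          fix k assume "k \<in> ?h ` ?I"
          then obtain S a b where k: "k = ?h ((S, a), b)" "(S, a) \<in> kkeys (- u)" "b \<in> Bas (t + kdeg (S, a))" by auto
          have "delta ({}, a) b \<in> zgens Bas u (t + (\<Sum>i\<in>S. qdeg p i))"
            using k(2,3) kdeg_split[of S a] unfolding zgens_def by (auto simp: kkeys_def add_ac intro!: exI[of _ a] exI[of _ b])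
          then show "k \<in> E.gindex (zgens Bas) u t"
            using k(2) fin[OF k(2)] by (auto simp: k(1) E.gindex_def vwords_def neg sum_list_sorted_list_of_set kkeys_def)
        qed
        show "E.gindex (zgens Bas) u t \<subseteq> ?h ` ?I"
        proof
          fix k assume "k \<in> E.gindex (zgens Bas) u t"
          moreover obtain w u' t' z where kk: "k = (w, u', t', z)" by (cases k)
          ultimately have k: "k = (w, u, t', z)" "sorted_wrt (<) w" "set w \<subseteq> {..<3}"
            "z \<in> zgens Bas u t'" "t' = t + (\<Sum>j\<leftarrow>w. qdeg p j)"
            by (simp_all add: E.gindex_def vwords_def neg)
          from k(4) obtain a b where z: "z = delta ({}, a) b" "({}, a) \<in> kkeys (- u)" "b \<in> Bas (t' + kdeg ({}, a))"
            unfolding zgens_def by blast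
          have w: "sorted_list_of_set (set w) = w" "(\<Sum>j\<leftarrow>w. qdeg p j) = (\<Sum>j\<in>set w. qdeg p j)"
            using k(2) by (auto simp: sorted_list_of_set.idem_if_sorted_distinct strict_sorted_iff sum_list_distinct_conv_sum_set)
          have "((set w, a), b) \<in> ?I" using k z w(2) by (auto simp: kkeys_def kdeg_split[of "set w"] add_ac)
          moreover have "k = ?h ((set w, a), b)" using k z w by simp
          ultimately show "k \<in> ?h ` ?I" by blast
        qed
      qed
    qed
  qed
qed

lemma Eres_delta_in: "k \<in> kkeys (- u) \<Longrightarrow> y \<in> ecomp M (n + kdeg k) \<Longrightarrow> delta k y \<in> gco (Eres M) u n"
  by (auto simp: Eres_sel fun_sub_def delta_def M_closed[OF M])

lemma contract_in:
  assumes x: "x \<in> gco (Eres M) u n"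
  shows "contract x \<in> gco (Eres M) (u - 1) n"
proof -
  have x': "x \<in> fun_sub (kkeys (- u)) (\<lambda>k. ecomp M (n + kdeg k))" using x by (simp add: Eres_sel)
  have "contract x \<in> fun_sub (kkeys (- (u - 1))) (\<lambda>k. ecomp M (n + kdeg k))"
  proof (rule RC_I[OF M])
    fix k :: kkey
    obtain S a where k: "k = (S, a)" by (cases k)
    define m where "m = Min (S \<union> set_mset a)"
    have contract: "contract x k = (if finite S \<and> (S, a) \<noteq> ({}, {#}) \<and> m \<notin> S then sg (int (card S)) (x (insert m S, a - {#m#})) else 0)"
      by (auto simp: contract_def k Let_def m_def)
    \<comment> \<open>A least index outside \<open>S\<close> must occur in \<open>a\<close>, so
      moving it from \<open>a\<close> into \<open>S\<close> keeps the degree of the key.\<close>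
    have ma: "m \<in># a" if "finite S" "(S, a) \<noteq> ({}, {#})" "m \<notin> S"
    proof -
      have "m \<in> S \<union> set_mset a" unfolding m_def by (rule Min_in) (use that in auto)
      then show ?thesis using that by simp
    qed
    have deg: "kdeg (insert m S, a - {#m#}) = kdeg (S, a)" if "finite S" "(S, a) \<noteq> ({}, {#})" "m \<notin> S"
    proof -
      have "m \<in># a" by (rule ma[OF that])
      then obtain b where "a = add_mset m b" using multi_member_split by metis
      then show ?thesis using that by (simp add: kdeg_def)
    qed
    show "contract x k \<in> ecomp M (n + kdeg k)"
    proof (cases "finite S \<and> (S, a) \<noteq> ({}, {#}) \<and> m \<notin> S")
      case True
      then have "x (insert m S, a - {#m#}) \<in> ecomp M (n + kdeg k)"
        using deg by (intro RC_D(1)[OF M x']) (simp add: k)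
      then show ?thesis unfolding contract using M_closed[OF M] by simp
    next
      case False
      show ?thesis unfolding contract if_not_P[OF False] by (rule M_closed(1)[OF M])
    qed
    assume nk: "k \<notin> kkeys (- (u - 1))"
    show "contract x k = 0"
    proof (cases "finite S \<and> (S, a) \<noteq> ({}, {#}) \<and> m \<notin> S")
      case True
      have "(insert m S, a - {#m#}) \<notin> kkeys (- u)"
      proof
        assume "(insert m S, a - {#m#}) \<in> kkeys (- u)"
        moreover obtain b where "a = add_mset m b" using multi_member_split[OF ma] True by blast
        ultimately have "(S, a) \<in> kkeys (- (u - 1))" by (auto simp: kkeys_def)
        then show False using nk k by simp
      qed
      then show ?thesis unfolding contract using RC_D(2)[OF M x'] by (simp add: sg_0)
    next
      case False
      show ?thesis unfolding contract by (rule if_not_P[OF False])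
    qed
  qed
  then show ?thesis by (simp add: Eres_sel)
qed

text \<open>\<open>n + kdeg k\<close> is the degree in \<open>M\<close> of the coefficient at
  \<open>k\<close>, and the filtration bounds these degrees from above. The unit key is exempt
  because the contracting homotopy does not reach it.\<close>

definition filt :: "int \<Rightarrow> int \<Rightarrow> (kkey \<Rightarrow> 'b::zero) \<Rightarrow> bool" where
  "filt l n x \<longleftrightarrow> (\<forall>k. k \<noteq> ({}, {#}) \<longrightarrow> n + kdeg k \<ge> l \<longrightarrow> x k = 0)"

text \<open>Each \<open>Q_i\<close> lowers the degree in \<open>M\<close> by
  \<open>qdeg p i\<close>, which is at least one.\<close>

lemma kz1_filt:
  assumes "filt (l + 1) n x"
  shows "filt l n (kz1 M n x)"
  unfolding filt_def
proof (intro allI impI)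
  fix k :: kkey assume k: "k \<noteq> ({}, {#})" "l \<le> n + kdeg k"
  obtain S a where k': "k = (S, a)" by (cases k)
  have "x (S, add_mset i a) = 0" for i
    using assms k(2) qdeg_pos[of i] by (simp add: filt_def k' kdeg_add)
  then show "kz1 M n x k = 0" unfolding k' kz1_def prod.case
    by (intro sum.neutral) (simp add: Q_zero[OF M])
qed

lemma contract_filt:
  assumes "filt l n x" and x: "x \<in> gco (Eres M) u n"
  shows "filt l n (contract x)"
  unfolding filt_def
proof (intro allI impI)
  fix k :: kkey assume k: "k \<noteq> ({}, {#})" "l \<le> n + kdeg k"
  obtain S a where k': "k = (S, a)" by (cases k)
  define m where "m = Min (S \<union> set_mset a)"
  have contract: "contract x k = (if finite S \<and> (S, a) \<noteq> ({}, {#}) \<and> m \<notin> S then sg (int (card S)) (x (insert m S, a - {#m#})) else 0)"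
    by (auto simp: contract_def k' Let_def m_def)
  show "contract x k = 0"
  proof (cases "finite S \<and> (S, a) \<noteq> ({}, {#}) \<and> m \<notin> S")
    case True
    have "m \<in> S \<union> set_mset a" unfolding m_def by (rule Min_in) (use True in auto)
    then have "m \<in># a" using True by simp
    then have "a = add_mset m (a - {#m#})" by simp
    then have "kdeg (insert m S, a - {#m#}) = kdeg k"
      using True kdeg_add[of S m "a - {#m#}"] by (simp add: k') (simp add: kdeg_def)
    then have "x (insert m S, a - {#m#}) = 0" using assms(1) k(2) by (simp add: filt_def)
    then show ?thesis by (simp add: contract sg_0)
  next
    case False
    show ?thesis unfolding contract by (rule if_not_P[OF False])
  qed
qed

text \<open>Off the unit key, \<open>x\<close> is \<open>contract (kz0 x)\<close> plus the Koszul
  part of \<open>d (contract x)\<close>. For a cycle, \<open>kz0 x\<close> is up to sign the action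
  part of \<open>d x\<close>, which lies one step lower in the filtration; so does the action part
  of \<open>d (contract x)\<close>.\<close>

lemma Eres_homotopy:
  assumes x: "x \<in> gco (Eres M) u n" "gd (Eres M) u n x = 0" and f: "filt (l + 1) n x"
  shows "filt l n (x - gd (Eres M) (u - 1) n (contract x))"
  unfolding filt_def
proof (intro allI impI)
  fix k :: kkey assume k: "k \<noteq> ({}, {#})" "l \<le> n + kdeg k"
  have x': "x \<in> fun_sub (kkeys (- u)) (\<lambda>k. ecomp M (n + kdeg k))" using x by (simp add: Eres_sel)
  have hx: "contract x \<in> gco (Eres M) (u - 1) n" by (rule contract_in[OF x(1)])
  have dh: "gd (Eres M) (u - 1) n (contract x) = (\<lambda>k. kz0 (contract x) k + sg (u - 1) (kz1 M n (contract x) k))"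
    by (rule Eres_sel(3)[OF hx])
  have 1: "kz1 M n (contract x) k = 0"
    using kz1_filt[OF contract_filt[OF f x(1)]] k unfolding filt_def by blast
  have "kz0 x = (\<lambda>k. - sg u (kz1 M n x k))"
  proof
    fix k
    have "kz0 x k + sg u (kz1 M n x k) = 0"
      using fun_cong[OF x(2), of k] Eres_sel(3)[OF x(1)] by simp
    then show "kz0 x k = - sg u (kz1 M n x k)" by (simp add: eq_neg_iff_add_eq_0)
  qed
  moreover have "filt l n (\<lambda>k. - sg u (kz1 M n x k))"
    using kz1_filt[OF f] by (simp add: filt_def sg_0)
  ultimately have kf: "filt l n (kz0 x)" by (simp only:)
  have "kz0 x \<in> gco (Eres M) (u + 1) n" using kz0_in[OF M x'] by (simp add: Eres_sel)
  from contract_filt[OF kf this] have 2: "contract (kz0 x) k = 0"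
    using k unfolding filt_def by blast
  show "(x - gd (Eres M) (u - 1) n (contract x)) k = 0"
  proof (cases "k \<in> kkeys (- u)")
    case True
    obtain S a where k': "k = (S, a)" by (cases k)
    have "kz0 (contract x) k + contract (kz0 x) k = x k"
      using kz0_contract[of S a "- u" x] True k(1) by (simp add: k')
    then show ?thesis using 1 2 by (simp add: dh sg_0)
  next
    case False
    have "gd (Eres M) (u - 1) n (contract x) \<in> gco (Eres M) (u - 1 + 1) n"
      by (rule E.gd_in[OF gmodule_Eres[OF M] hx])
    then have "gd (Eres M) (u - 1) n (contract x) \<in> fun_sub (kkeys (- u)) (\<lambda>k. ecomp M (n + kdeg k))" by (simp add: Eres_sel)
    from RC_D(2)[OF M this False] RC_D(2)[OF M x' False] show ?thesis by simp
  qed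
qed

text \<open>Successive approximation: each step subtracts a boundary and lowers the filtration by
  one. At level 0 only the coefficient at the unit key is left, as \<open>M\<close> vanishes in
  negative degrees, and the augmentation detects it.\<close>

lemma Eres_exact:
  assumes nonneg: "\<And>n. n < 0 \<Longrightarrow> ecomp M n = {0}"
    and e: "e \<in> E.ghom (Eres M) (gM M) 0 0" "gD (Eres M) (gM M) 0 0 e = 0"
    and e0: "\<And>n y. y \<in> ecomp M n \<Longrightarrow> e 0 n (delta ({}, {#}) y) = y"
    and x: "x \<in> gco (Eres M) u n" "gd (Eres M) u n x = 0" "e u n x = 0"
  shows "\<exists>y\<in>gco (Eres M) (u - 1) n. x = gd (Eres M) (u - 1) n y"
proof -
  note R = gmodule_Eres[OF M]
  have *: "\<exists>y\<in>gco (Eres M) (u - 1) n. x = gd (Eres M) (u - 1) n y"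
    if "x \<in> gco (Eres M) u n" "gd (Eres M) u n x = 0" "e u n x = 0" "filt (int l) n x" for x l
    using that
  proof (induction l arbitrary: x)
    case 0
    have x': "x \<in> fun_sub (kkeys (- u)) (\<lambda>k. ecomp M (n + kdeg k))" using 0(1) by (simp add: Eres_sel)
    have x1: "x k = 0" if "k \<noteq> ({}, {#})" for k
    proof (cases "n + kdeg k \<ge> 0")
      case False
      then show ?thesis using nonneg[of "n + kdeg k"] RC_D(1)[OF M x', of "n + kdeg k" k] by simp
    next
      case True
      then show ?thesis using 0(4) that unfolding filt_def of_nat_0 by blast
    qed
    then have xd: "x = delta ({}, {#}) (x ({}, {#}))" by (auto simp: delta_def)
    have "x ({}, {#}) = 0"
    proof (cases "u = 0")
      case True
      have "x ({}, {#}) \<in> ecomp M n" by (rule RC_D(1)[OF M x']) (simp add: kdeg_def)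
      from e0[OF this] show ?thesis using 0(3) xd True by simp
    next
      case False
      then show ?thesis by (intro RC_D(2)[OF M x']) (simp add: kkeys_def)
    qed
    then have "x = 0" using xd by (simp add: delta_0 zero_fun_def)
    then show ?case using E.gd_lin(6)[OF R E.gco_closed(1)[OF R]] E.gco_closed(1)[OF R] by metis
  next
    case (Suc l)
    let ?x = "x - gd (Eres M) (u - 1) n (contract x)"
    have h: "contract x \<in> gco (Eres M) (u - 1) n" by (rule contract_in[OF Suc.prems(1)])
    have dh: "gd (Eres M) (u - 1) n (contract x) \<in> gco (Eres M) u n" using E.gd_in[OF R h] by simp
    have 1: "?x \<in> gco (Eres M) u n" using E.gco_closed(3)[OF R Suc.prems(1) dh] .
    have 2: "gd (Eres M) u n ?x = 0"
      using E.gd_lin(2)[OF R Suc.prems(1) dh] Suc.prems(2) E.gmodule_dd[OF R h] by (simp add: zero_fun_def)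
    have "e (u - 1 + 1) n (gd (Eres M) (u - 1) n (contract x)) = 0"
      using fun_cong[OF fun_cong[OF fun_cong[OF e(2)]], of "u - 1" n "contract x"] h by (simp add: gD_def)
    then have 3: "e u n ?x = 0"
      using E.ghom_lin'(1)[OF R e(1) Suc.prems(1) dh] Suc.prems(3) by simp
    have 4: "filt (int l) n ?x" by (rule Eres_homotopy[OF Suc.prems(1,2)]) (use Suc.prems(4) in \<open>simp add: add.commute\<close>)
    obtain y where y: "y \<in> gco (Eres M) (u - 1) n" "?x = gd (Eres M) (u - 1) n y"
      using Suc.IH[OF 1 2 3 4] by blast
    then have "x = gd (Eres M) (u - 1) n (y + contract x)"
      using E.gd_lin(1)[OF R y(1) h] by (simp add: algebra_simps)
    then show ?case using E.gco_closed(2)[OF R y(1) h] by blast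
  qed
  have x': "x \<in> fun_sub (kkeys (- u)) (\<lambda>k. ecomp M (n + kdeg k))" using x by (simp add: Eres_sel)
  \<comment> \<open>There are finitely many keys in each homological degree, so the degrees of the
    coefficients are bounded and the induction can start.\<close>
  have "filt (int (nat (Max (insert 0 ((\<lambda>k. n + kdeg k) ` kkeys (- u))) + 1))) n x"
    unfolding filt_def
  proof (intro allI impI)
    fix k assume "k \<noteq> ({}, {#})" and k: "int (nat (Max (insert 0 ((\<lambda>k. n + kdeg k) ` kkeys (- u))) + 1)) \<le> n + kdeg k"
    have "k \<notin> kkeys (- u)"
    proof
      assume "k \<in> kkeys (- u)"
      then have "n + kdeg k \<le> Max (insert 0 ((\<lambda>k. n + kdeg k) ` kkeys (- u)))"
        using finite_kkeys by (intro Max_ge) auto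
      then show False using k by linarith
    qed
    then show "x k = 0" by (rule RC_D(2)[OF M x'])
  qed
  from *[OF x this] show ?thesis .
qed

text \<open>The augmentation sends \<open>1 \<otimes> 1 \<otimes> y\<close> to \<open>y\<close> and
  the generators of other degrees to zero, extended \<open>E(2)\<close>-linearly; thus
  \<open>Q_i \<otimes> 1 \<otimes> y\<close> goes to \<open>Q_i y\<close>.\<close>

lemma Eres_augmentation:
  assumes nonneg: "\<And>n. n < 0 \<Longrightarrow> ecomp M n = {0}"
  shows "\<exists>e. E.gquasi_iso (Eres M) (gM M) e"
proof -
  note R = gmodule_Eres[OF M] and MM = gmodule_gM[OF M]
  have "\<forall>m. \<exists>B. basis_family (escale M) (ecomp M m) B (\<lambda>b. b)"
    using subspace_basis[OF E2_vs[OF M] E2_sub[OF M]] by blast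
  from choice[OF this] obtain Bas where Bas: "\<And>m. basis_family (escale M) (ecomp M m) (Bas m) (\<lambda>b. b)" by blast
  note free = gfree_Eres[OF Bas]
  have BasM: "b \<in> ecomp M m" if "b \<in> Bas m" for b m using basis_familyD[OF E2_vs[OF M] Bas that] .
  define \<phi> where "\<phi> u (t::int) x = (if u = (0::int) then x ({}, {#}) else 0)" for u t and x :: "kkey \<Rightarrow> 'a"
  have key0: "({}, a) \<in> kkeys 0 \<longleftrightarrow> a = {#}" for a :: "nat multiset" by (auto simp: kkeys_def)
  have "\<phi> u t x \<in> gco (gM M) (u + 0) (t + 0)" if "x \<in> zgens Bas u t" for u t x
    using that BasM by (auto simp: \<phi>_def zgens_def delta_def key0 kdeg_def)
  from E.ghom_extend[OF free MM, of \<phi>, OF this] obtain e where e: "e \<in> E.ghom (Eres M) (gM M) 0 0"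
    "\<And>u t x. x \<in> zgens Bas u t \<Longrightarrow> e u t x = \<phi> u t x" by blast
  have k0: "({}, {#}) \<in> kkeys (- 0)" by (simp add: kkeys_def)
  have d0in: "delta ({}, {#}) y \<in> gco (Eres M) 0 n" if "y \<in> ecomp M n" for n y
    by (rule Eres_delta_in[OF k0]) (use that in \<open>simp add: kdeg_def\<close>)
  \<comment> \<open>The value is prescribed for basis vectors; linearity extends it to every
    \<open>y\<close>.\<close>
  have e0: "e 0 n (delta ({}, {#}) y) = y" if y: "y \<in> ecomp M n" for n y
  proof -
    have l: "lin_on (escale M) (ecomp M n) (escale M) (ecomp M n) (\<lambda>y. e 0 n (delta ({}, {#}) y))"
    proof (rule E.lin_onI)
      fix y assume y: "y \<in> ecomp M n"
      show "e 0 n (delta ({}, {#}) y) \<in> ecomp M n" using E.ghom_in[OF e(1) d0in[OF y]] by simp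
      have "delta ({}, {#}) (escale M c y) = gsc (Eres M) 0 c (delta ({}, {#}) y)" for c
        by (auto simp: delta_def Eres_sel escale_lin[OF M])
      then show "e 0 n (delta ({}, {#}) (escale M c y)) = escale M c (e 0 n (delta ({}, {#}) y))" for c
        using E.ghom_sc[OF e(1) d0in[OF y]] by simp
      fix z assume z: "z \<in> ecomp M n"
      have "delta ({}, {#}) (y + z) = delta ({}, {#}) y + (delta ({}, {#}) z :: kkey \<Rightarrow> 'a)" by (auto simp: delta_def)
      then show "e 0 n (delta ({}, {#}) (y + z)) = e 0 n (delta ({}, {#}) y) + e 0 n (delta ({}, {#}) z)"
        using E.ghom_add[OF e(1) d0in[OF y] d0in[OF z]] by simp
    qed
    show ?thesis
    proof (rule lin_on_eq_on_span[OF E2_vs[OF M] E2_sub[OF M] l lin_on_id[OF E2_vs[OF M]]])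
      show "Bas n \<subseteq> ecomp M n" using BasM by auto
      show "y \<in> module.span (escale M) (Bas n)" using Bas[of n] y by (simp add: basis_family_def)
      fix b assume b: "b \<in> Bas n"
      have "delta ({}, {#}) b \<in> zgens Bas 0 n" using b by (auto simp: zgens_def key0 kdeg_def)
      then show "e 0 n (delta ({}, {#}) b) = b" using e(2) by (simp add: \<phi>_def delta_def)
    qed
  qed
  have De: "gD (Eres M) (gM M) 0 0 e = 0"
  proof (rule E.ghom_eqI[OF free E.gD_ghom[OF R MM e(1)] E.ghom_0[OF R MM]])
    fix u t x assume x: "x \<in> zgens Bas u t"
    then obtain a b where ab: "x = delta ({}, a) b" "({}, a) \<in> kkeys (- u)" "b \<in> Bas (t + kdeg ({}, a))"
      by (auto simp: zgens_def)
    have xR: "x \<in> gco (Eres M) u t" by (rule E.gfree_gen[OF free x])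
    have "e (u + 1) t (gd (Eres M) u t x) = 0"
    \<comment> \<open>Outside degree -1 the target vanishes. In degree -1 a generator
      \<open>1 \<otimes> \<gamma>_i \<otimes> b\<close> has differential
      \<open>Q_i \<otimes> 1 \<otimes> b - 1 \<otimes> 1 \<otimes> Q_i b\<close>, and both terms are
      augmented to \<open>Q_i b\<close>.\<close>
    proof (cases "u = -1")
      case False
      then show ?thesis using E.ghom_in[OF e(1) E.gd_in[OF R xR]] by auto
    next
      case True
      have "size a = 1" "set_mset a \<subseteq> {..<3}" using ab(2) True by (auto simp: kkeys_def)
      moreover from this(1) obtain i where "a = {#i#}" using size_1_singleton_mset by blast
      ultimately have i: "a = {#i#}" "i < 3" by auto
      have b: "b \<in> ecomp M (t + qdeg p i)" using BasM[OF ab(3)] by (simp add: kdeg_def i)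
      have Qb: "eact M i (t + qdeg p i) b \<in> ecomp M t" by (rule Q_in[OF M i(2) b]) simp
      have "kz0 x k + sg u (kz1 M t x k) = (gop (Eres M) i 0 (t + qdeg p i) (delta ({}, {#}) b) - delta ({}, {#}) (eact M i (t + qdeg p i) b)) k" for k
      proof -
        obtain S c where k: "k = (S, c)" by (cases k)
        have "kz0 x k = gop (Eres M) i 0 (t + qdeg p i) (delta ({}, {#}) b) k"
        proof -
          have "kz0 x k = (\<Sum>j<3. if j = i then (if S = {i} \<and> c = {#} then b else 0) else 0)"
            unfolding kz0_def k prod.case
          proof (rule sum.cong)
            fix j
            have "{j' \<in> {i}. i < j'} = {}" by auto
            then have "sgr i {i} b = b" by (simp only: sgr_def card.empty of_nat_0 sg_simps)
            moreover have "S - {i} = {} \<longleftrightarrow> S = {i}" if "i \<in> S" using that by auto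
            ultimately show "(if j \<in> S then sgr j S (x (S - {j}, add_mset j c)) else 0) =
              (if j = i then (if S = {i} \<and> c = {#} then b else 0) else 0)"
              by (auto simp: ab(1) i(1) delta_def sgr_lin(3))
          qed simp
          also have "\<dots> = (if S = {i} \<and> c = {#} then b else 0)" using i(2) by simp
          also have "\<dots> = gop (Eres M) i 0 (t + qdeg p i) (delta ({}, {#}) b) k"
          proof -
            have "{j' \<in> {i}. j' < i} = {}" by auto
            then have "sgl i {i} b = b" by (simp only: sgl_def card.empty of_nat_0 sg_simps)
            moreover have "gop (Eres M) i 0 (t + qdeg p i) (delta ({}, {#}) b) = delta ({i}, {#}) (sgl i {i} b)"
              by (rule gop_Eres_delta) simp
            ultimately show ?thesis by (simp add: k delta_def)
          qed
          finally show ?thesis .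
        qed
        moreover have "kz1 M t x k = delta ({}, {#}) (eact M i (t + qdeg p i) b) k"
        proof -
          have "kz1 M t x k = (\<Sum>j<3. if j = i then (if S = {} \<and> c = {#} then eact M i (t + qdeg p i) b else 0) else 0)"
            unfolding kz1_def k prod.case
            by (rule sum.cong) (auto simp: ab(1) i(1) delta_def Q_zero[OF M] kdeg_def)
          also have "\<dots> = delta ({}, {#}) (eact M i (t + qdeg p i) b) k" using i(2) by (simp add: delta_def k)
          finally show ?thesis .
        qed
        ultimately show ?thesis by (simp add: True sg_def)
      qed
      then have dx: "gd (Eres M) u t x = gop (Eres M) i 0 (t + qdeg p i) (delta ({}, {#}) b) - delta ({}, {#}) (eact M i (t + qdeg p i) b)"
        using Eres_sel(3)[OF xR] by (simp add: fun_eq_iff)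
      have g: "gop (Eres M) i 0 (t + qdeg p i) (delta ({}, {#}) b) \<in> gco (Eres M) 0 t"
        using E.gop_in[OF R i(2) d0in[OF b]] by simp
      have "e 0 t (gd (Eres M) u t x) = e 0 t (gop (Eres M) i 0 (t + qdeg p i) (delta ({}, {#}) b)) - eact M i (t + qdeg p i) b"
        unfolding dx using E.ghom_lin'(1)[OF R e(1) g d0in[OF Qb]] e0[OF Qb] by simp
      also have "e 0 t (gop (Eres M) i 0 (t + qdeg p i) (delta ({}, {#}) b)) = eact M i (t + qdeg p i) b"
        using E.ghom_op[OF e(1) i(2) d0in[OF b]] e0[OF b] by simp
      finally show ?thesis using True by simp
    qed
    then show "gD (Eres M) (gM M) 0 0 e u t x = 0 u t x" by (simp add: gD_def)
  qed
  have "\<exists>x\<in>gco (Eres M) u n. gd (Eres M) u n x = 0 \<and> (\<exists>z\<in>gco (gM M) (u - 1) n. y - e u n x = gd (gM M) (u - 1) n z)"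
    if y: "y \<in> gco (gM M) u n" for u n y
  proof -
    have z: "0 \<in> gco (gM M) (u - 1) n" by (rule E.gco_closed(1)[OF MM])
    show ?thesis
    proof (cases "u = 0")
      case True
      then have yM: "y \<in> ecomp M n" using y by simp
      have d: "gd (Eres M) 0 n (delta ({}, {#}) y) = 0"
      proof
        fix k
        have "gd (Eres M) 0 n (delta ({}, {#}) y) \<in> gco (Eres M) (0 + 1) n" by (rule E.gd_in[OF R d0in[OF yM]])
        then have "gd (Eres M) 0 n (delta ({}, {#}) y) \<in> fun_sub (kkeys (- 1)) (\<lambda>k. ecomp M (n + kdeg k))" by (simp add: Eres_sel)
        then show "gd (Eres M) 0 n (delta ({}, {#}) y) k = 0 k"
          using RC_D(2)[OF M, of _ 1 n k] by (auto simp: kkeys_def)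
      qed
      show ?thesis using d0in[OF yM] d e0[OF yM] z True by (intro bexI[of _ "delta ({}, {#}) y"]) auto
    next
      case False
      then show ?thesis
        using y z E.gco_closed(1)[OF R, of u n] E.gd_lin(6)[OF R E.gco_closed(1)[OF R], of u n] E.ghom_zero[OF R e(1), of u n]
        by (intro bexI[of _ 0]) auto
    qed
  qed
  moreover have "\<exists>x'\<in>gco (Eres M) (u - 1) t. x = gd (Eres M) (u - 1) t x'"
    if "x \<in> gco (Eres M) u t" "gd (Eres M) u t x = 0" "\<exists>y\<in>gco (gM M) (u - 1) t. e u t x = gd (gM M) (u - 1) t y" for u t x
    using that by (intro Eres_exact[OF nonneg e(1) De e0]) auto
  ultimately have "E.gquasi_iso (Eres M) (gM M) e" unfolding E.gquasi_iso_def using e(1) De by blast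
  then show ?thesis by blast
qed

end

end

section \<open>A semifree model of \<open>G(M)\<close>\<close>

text \<open>Monomials of degree \<open>u\<close> in the \<open>v_i\<close>, and equally the basis of
  the divided power algebra in that degree.\<close>

definition mkeys :: "int \<Rightarrow> nat multiset set" where
  "mkeys u = {a. set_mset a \<subseteq> {..<3} \<and> int (size a) = u}"

lemma finite_mkeys: "finite (mkeys u)"
proof -
  have "mkeys u \<subseteq> multisets_of_size {..<3} (nat u)"
    by (auto simp: mkeys_def multisets_of_size_def)
  then show ?thesis by (rule finite_subset) (auto intro: finite_multisets_of_size)
qed

lemma remove2_iff: "i \<in># a \<and> j \<in># a - {#i#} \<longleftrightarrow> j \<in># a \<and> i \<in># a - {#j#}"
  by (cases "i = j") (auto simp: in_diff_count count_greater_zero_iff[symmetric] simp del: count_greater_zero_iff)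

lemma remove2_commute: "a - {#i#} - {#j#} = a - {#j#} - ({#i#} :: 'b multiset)"
  by (rule diff_right_commute)

context exterior
begin

definition mdeg :: "nat multiset \<Rightarrow> int" where
  "mdeg a = (\<Sum>i\<in>#a. qdeg p i)"

lemma mdeg_remove: "i \<in># a \<Longrightarrow> mdeg (a - {#i#}) = mdeg a - qdeg p i"
  by (metis add_diff_cancel_left' image_mset_add_mset insert_DiffM mdeg_def sum_mset.insert)

lemma mkeys_remove: "i \<in># a \<Longrightarrow> i < 3 \<Longrightarrow> a - {#i#} \<in> mkeys u \<longleftrightarrow> a \<in> mkeys (u + 1)"
proof -
  assume "i \<in># a" "i < 3"
  then obtain b where "a = add_mset i b" using multi_member_split by metis
  then show ?thesis using \<open>i < 3\<close> by (auto simp: mkeys_def)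
qed

text \<open>
  \<open>P(2) \<otimes> M\<close> with differential \<open>\<Sum>\<^sub>i v\<^sub>i \<otimes> Q\<^sub>i\<close>; the value \<open>x a\<close> is the coefficient of the monomial \<open>v\<^sup>a\<close>.
\<close>

definition Pres :: "('f, 'a::ab_group_add) emod \<Rightarrow> ('f, nat multiset \<Rightarrow> 'a) gmod" where
  "Pres M = \<lparr>gsc = (\<lambda>u c x a. escale M c (x a)),
     gco = (\<lambda>u t. fun_sub (mkeys u) (\<lambda>a. ecomp M (t - mdeg a))),
     gd = (\<lambda>u t x a. \<Sum>i<3. if i \<in># a then eact M i (t - mdeg (a - {#i#})) (x (a - {#i#})) else 0),
     gop = (\<lambda>i u t x a. if i \<in># a then x (a - {#i#}) else 0)\<rparr>"

lemma Pres_sel: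
  "gsc (Pres M) u = (\<lambda>c x a. escale M c (x a))"
  "gco (Pres M) u t = fun_sub (mkeys u) (\<lambda>a. ecomp M (t - mdeg a))"
  "gd (Pres M) u t x = (\<lambda>a. \<Sum>i<3. if i \<in># a then eact M i (t - mdeg (a - {#i#})) (x (a - {#i#})) else 0)"
  "gop (Pres M) i u t x = (\<lambda>a. if i \<in># a then x (a - {#i#}) else 0)"
  by (simp_all add: Pres_def)

lemma gop_Pres_delta: "gop (Pres M) i u t (delta c y) = delta (add_mset i c) y"
proof
  fix a
  have "a - {#i#} = c \<longleftrightarrow> a = add_mset i c" if "i \<in># a" using that by (metis add_mset_remove_trivial insert_DiffM)
  then show "gop (Pres M) i u t (delta c y) a = delta (add_mset i c) y a"
    by (auto simp: Pres_sel delta_def)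
qed

lemma gword_Pres: "P.gword (Pres M) w u t (delta c y) = delta (mset w + c) y"
  by (induction w) (simp_all add: gop_Pres_delta)

context
  fixes M :: "('f::field, 'a::ab_group_add) emod"
  assumes M: "E2_module p M"
begin

lemma Pres_D:
  assumes "x \<in> gco (Pres M) u t"
  shows "m = t - mdeg a \<Longrightarrow> x a \<in> ecomp M m" "a \<notin> mkeys u \<Longrightarrow> x a = 0"
proof -
  have *: "if a \<in> mkeys u then x a \<in> ecomp M (t - mdeg a) else x a = 0"
    using assms unfolding Pres_sel fun_sub_def by blast
  show "m = t - mdeg a \<Longrightarrow> x a \<in> ecomp M m" "a \<notin> mkeys u \<Longrightarrow> x a = 0"
    using * M_closed(1)[OF M] by (simp_all split: if_splits)
qed

lemma Pres_I: "(\<And>a. a \<in> mkeys u \<Longrightarrow> x a \<in> ecomp M (t - mdeg a)) \<Longrightarrow> (\<And>a. a \<notin> mkeys u \<Longrightarrow> x a = 0) \<Longrightarrow> x \<in> gco (Pres M) u t"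
  by (simp add: fun_sub_def Pres_sel)

lemma Pres_d_in:
  assumes x: "x \<in> gco (Pres M) u t"
  shows "gd (Pres M) u t x \<in> gco (Pres M) (u + 1) t"
proof (rule Pres_I)
  fix a
  have "eact M i (t - mdeg (a - {#i#})) (x (a - {#i#})) \<in> ecomp M (t - mdeg a)" if "i \<in># a" "i < 3" for i
    by (rule Q_in[OF M that(2) Pres_D(1)[OF x]]) (simp_all add: mdeg_remove[OF that(1)])
  then show "gd (Pres M) u t x a \<in> ecomp M (t - mdeg a)"
    unfolding Pres_sel by (intro M_sum[OF M]) (auto simp: M_closed[OF M])
  assume a: "a \<notin> mkeys (u + 1)"
  have "x (a - {#i#}) = 0" if "i \<in># a" "i < 3" for i
    using mkeys_remove[OF that] a by (intro Pres_D(2)[OF x]) simp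
  then show "gd (Pres M) u t x a = 0"
    unfolding Pres_sel by (intro sum.neutral) (auto simp: Q_zero[OF M])
qed

lemma Pres_op_in:
  assumes x: "x \<in> gco (Pres M) u t" and i: "i < 3"
  shows "gop (Pres M) i u t x \<in> gco (Pres M) (u + 1) (t + qdeg p i)"
proof (rule Pres_I)
  fix a
  show "gop (Pres M) i u t x a \<in> ecomp M (t + qdeg p i - mdeg a)"
    unfolding Pres_sel using M_closed(1)[OF M] by (auto intro!: Pres_D(1)[OF x] simp: mdeg_remove)
  assume a: "a \<notin> mkeys (u + 1)"
  show "gop (Pres M) i u t x a = 0"
    unfolding Pres_sel using mkeys_remove[of i a u] a i by (auto intro: Pres_D(2)[OF x])
qed

text \<open>The \<open>v_i\<close> commute and the \<open>Q_i\<close> anticommute, so the terms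
  \<open>v_i v_j \<otimes> Q_i Q_j\<close> cancel in pairs and vanish for
  \<open>i = j\<close>.\<close>

lemma Pres_dd:
  assumes x: "x \<in> gco (Pres M) u t"
  shows "gd (Pres M) (u + 1) t (gd (Pres M) u t x) = 0"
proof
  fix a
  let ?V = "\<lambda>i j. if i \<in># a \<and> j \<in># a - {#i#} then
      eact M i (t - mdeg (a - {#i#})) (eact M j (t - mdeg (a - {#i#} - {#j#})) (x (a - {#i#} - {#j#}))) else 0"
  have xin: "x b \<in> ecomp M (t - mdeg b)" for b by (rule Pres_D(1)[OF x]) simp
  have "gd (Pres M) (u + 1) t (gd (Pres M) u t x) a = (\<Sum>i<3. \<Sum>j<3. ?V i j)"
    unfolding Pres_sel
  proof (rule sum.cong)
    fix i :: nat assume "i \<in> {..<3}"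
    then have i: "i < 3" by simp
    let ?T = "\<lambda>j. if j \<in># a - {#i#} then eact M j (t - mdeg (a - {#i#} - {#j#})) (x (a - {#i#} - {#j#})) else 0"
    have "?T j \<in> ecomp M (t - mdeg (a - {#i#}))" if "j < 3" for j
    proof (cases "j \<in># a - {#i#}")
      case True
      show ?thesis unfolding if_P[OF True]
        by (rule Q_in[OF M that xin]) (use mdeg_remove[OF True] in linarith)
    next
      case False
      show ?thesis unfolding if_not_P[OF False] by (rule M_closed(1)[OF M])
    qed
    then have "eact M i (t - mdeg (a - {#i#})) (\<Sum>j<3. ?T j) = (\<Sum>j<3. eact M i (t - mdeg (a - {#i#})) (?T j))"
      by (intro lin_on_sum[OF E2_vs[OF M] E2_sub[OF M] E2_lin[OF M i]]) simp
    also have "\<dots> = (\<Sum>j<3. if j \<in># a - {#i#} then eact M i (t - mdeg (a - {#i#})) (eact M j (t - mdeg (a - {#i#} - {#j#})) (x (a - {#i#} - {#j#}))) else 0)"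
      by (intro sum.cong) (simp_all add: Q_zero[OF M i])
    finally show "(if i \<in># a then eact M i (t - mdeg (a - {#i#})) (\<Sum>j<3. ?T j) else 0) = (\<Sum>j<3. ?V i j)"
      by simp
  qed simp
  also have "\<dots> = 0"
  proof (rule sum3_anti)
    fix i j :: nat assume i: "i < 3" and j: "j < 3"
    have d: "t - mdeg (a - {#i#}) = t - mdeg (a - {#i#} - {#j#}) - qdeg p j" if "j \<in># a - {#i#}" for i j
      by (simp only: mdeg_remove[OF that])
    show "?V i i = 0"
    proof (cases "i \<in># a \<and> i \<in># a - {#i#}")
      case True
      show ?thesis unfolding if_P[OF True] d[OF conjunct2[OF True]] by (rule E2_sq[OF M i xin])
    next
      case False
      show ?thesis by (rule if_not_P[OF False])
    qed
    assume "i \<noteq> j"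
    show "?V i j = - ?V j i"
    proof (cases "i \<in># a \<and> j \<in># a - {#i#}")
      case True
      then have T: "j \<in># a" "i \<in># a - {#j#}" using remove2_iff[of i a j] by auto
      have "t - mdeg (a - {#i#}) = t - mdeg (a - {#i#} - {#j#}) - qdeg p j" using d True by blast
      moreover have "t - mdeg (a - {#j#}) = t - mdeg (a - {#i#} - {#j#}) - qdeg p i"
        using d[OF T(2)] by (simp only: remove2_commute[of a j i])
      ultimately show ?thesis
        using True T E2_anti[OF M i j xin, of "a - {#i#} - {#j#}"] by (simp only: remove2_commute[of a j i] if_True simp_thms)
    next
      case False
      then have "\<not> (j \<in># a \<and> i \<in># a - {#j#})" using remove2_iff[of i a j] by blast
      then show ?thesis unfolding if_not_P[OF False] by (simp only: if_False minus_zero)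
    qed
  qed
  finally show "gd (Pres M) (u + 1) t (gd (Pres M) u t x) a = 0 a" by simp
qed

lemma Pres_dop:
  assumes x: "x \<in> gco (Pres M) u t" and i: "i < 3"
  shows "gd (Pres M) (u + 1) (t + qdeg p i) (gop (Pres M) i u t x) = gop (Pres M) i (u + 1) t (gd (Pres M) u t x)"
proof
  fix a
  have "(if j \<in># a then eact M j (t + qdeg p i - mdeg (a - {#j#})) (if i \<in># a - {#j#} then x (a - {#j#} - {#i#}) else 0) else 0) =
    (if i \<in># a then if j \<in># a - {#i#} then eact M j (t - mdeg (a - {#i#} - {#j#})) (x (a - {#i#} - {#j#})) else 0 else 0)" if "j < 3" for j
  proof (cases "i \<in># a \<and> j \<in># a - {#i#}")
    case True
    then have T: "j \<in># a" "i \<in># a - {#j#}" using remove2_iff[of i a j] by auto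
    have "mdeg (a - {#i#} - {#j#}) = mdeg (a - {#j#}) - qdeg p i"
      using mdeg_remove[OF T(2)] by (simp only: remove2_commute[of a i j])
    then have "t + qdeg p i - mdeg (a - {#j#}) = t - mdeg (a - {#i#} - {#j#})" by linarith
    then show ?thesis using True T by (simp only: remove2_commute[of a j i] if_True simp_thms)
  next
    case False
    then have "\<not> (j \<in># a \<and> i \<in># a - {#j#})" using remove2_iff[of i a j] by blast
    then show ?thesis using False Q_zero[OF M that] by auto
  qed
  then have "(\<Sum>j<3. if j \<in># a then eact M j (t + qdeg p i - mdeg (a - {#j#})) (if i \<in># a - {#j#} then x (a - {#j#} - {#i#}) else 0) else 0) =
    (\<Sum>j<3. if i \<in># a then if j \<in># a - {#i#} then eact M j (t - mdeg (a - {#i#} - {#j#})) (x (a - {#i#} - {#j#})) else 0 else 0)"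
    by (intro sum.cong) simp_all
  then show "gd (Pres M) (u + 1) (t + qdeg p i) (gop (Pres M) i u t x) a = gop (Pres M) i (u + 1) t (gd (Pres M) u t x) a"
    unfolding Pres_sel by (cases "i \<in># a") simp_all
qed

lemma gmodule_Pres: "P.gmodule (Pres M)"
  unfolding P.gmodule_def
proof (intro conjI allI impI ballI)
  fix u t
  show "vector_space (gsc (Pres M) u)" unfolding Pres_sel by (rule vector_space_fun[OF E2_vs[OF M]])
  show "module.subspace (gsc (Pres M) u) (gco (Pres M) u t)" unfolding Pres_sel
    by (rule fun_sub_subspace[OF E2_vs[OF M] E2_sub[OF M]])
  show "lin_on (gsc (Pres M) u) (gco (Pres M) u t) (gsc (Pres M) (u + 1)) (gco (Pres M) (u + 1) t) (gd (Pres M) u t)"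
  proof (rule E.lin_onI)
    fix x assume x: "x \<in> gco (Pres M) u t"
    show "gd (Pres M) u t x \<in> gco (Pres M) (u + 1) t" by (rule Pres_d_in[OF x])
    have xin: "x b \<in> ecomp M (t - mdeg b)" for b by (rule Pres_D(1)[OF x]) simp
    show "gd (Pres M) u t (gsc (Pres M) u c x) = gsc (Pres M) (u + 1) c (gd (Pres M) u t x)" for c
      by (auto simp: Pres_sel fun_eq_iff escale_lin[OF M] Q_lin(6)[OF M _ xin] intro!: sum.cong)
    fix y assume y: "y \<in> gco (Pres M) u t"
    have yin: "y b \<in> ecomp M (t - mdeg b)" for b by (rule Pres_D(1)[OF y]) simp
    show "gd (Pres M) u t (x + y) = gd (Pres M) u t x + gd (Pres M) u t y"
      by (auto simp: Pres_sel fun_eq_iff Q_lin(1)[OF M _ xin yin] sum.distrib[symmetric] intro!: sum.cong)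
  qed
  fix x assume x: "x \<in> gco (Pres M) u t"
  show "gd (Pres M) (u + 1) t (gd (Pres M) u t x) = 0" by (rule Pres_dd[OF x])
next
  fix i :: nat and u t assume i: "i < 3"
  show "lin_on (gsc (Pres M) u) (gco (Pres M) u t) (gsc (Pres M) (u + 1)) (gco (Pres M) (u + 1) (t + qdeg p i)) (gop (Pres M) i u t)"
    using Pres_op_in[OF _ i]
    by (intro E.lin_onI) (auto simp: Pres_sel(1,4) escale_lin[OF M] fun_eq_iff)
  fix x assume x: "x \<in> gco (Pres M) u t"
  show "gd (Pres M) (u + 1) (t + qdeg p i) (gop (Pres M) i u t x) = gop (Pres M) i (u + 1) t (gd (Pres M) u t x)"
    by (rule Pres_dop[OF x i])
next
  fix i j :: nat and u t x assume i: "i < 3" "j < 3" and x: "x \<in> gco (Pres M) u t"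
  have "gop (Pres M) i (u + 1) (t + qdeg p j) (gop (Pres M) j u t x) a =
    gop (Pres M) j (u + 1) (t + qdeg p i) (gop (Pres M) i u t x) a" for a
    using remove2_iff[of i a j] remove2_commute[of a i j] unfolding Pres_sel by auto
  then show "gop (Pres M) i (u + 1) (t + qdeg p j) (gop (Pres M) j u t x) =
    (if False then - gop (Pres M) j (u + 1) (t + qdeg p i) (gop (Pres M) i u t x)
     else gop (Pres M) j (u + 1) (t + qdeg p i) (gop (Pres M) i u t x))"
    by auto
qed simp

definition pgens :: "(int \<Rightarrow> 'b::zero set) \<Rightarrow> int \<Rightarrow> int \<Rightarrow> (nat multiset \<Rightarrow> 'b) set" where
  "pgens Bas u t = (if u = 0 then delta {#} ` Bas t else {})"

text \<open>Monomials are read as weakly increasing words; the generators are the elements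
  \<open>1 \<otimes> b\<close>, which sit in cohomological degree 0.\<close>

lemma gfree_Pres:
  assumes Bas: "\<And>m. basis_family (escale M) (ecomp M m) (Bas m) (\<lambda>b. b)"
  shows "P.gfree (Pres M) (pgens Bas)"
  unfolding P.gfree_def
proof (intro conjI allI gmodule_Pres)
  fix u t :: int
  let ?h = "\<lambda>(a, b). (sorted_list_of_multiset a, 0::int, t - mdeg a, delta ({#} :: nat multiset) b)"
  let ?I = "Sigma (mkeys u) (\<lambda>a. Bas (t - mdeg a))"
  have nz: "b \<noteq> 0" if "b \<in> Bas m" for b m by (rule basis_family_nonzero[OF E2_vs[OF M] Bas that])
  have bas: "basis_family (gsc (Pres M) u) (gco (Pres M) u t) ?I (\<lambda>(k, b). delta k b)"
    unfolding Pres_sel by (rule fun_basis[OF E2_vs[OF M] finite_mkeys Bas])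
  have md: "(\<Sum>j\<leftarrow>w. qdeg p j) = mdeg (mset w)" for w
    by (simp add: mdeg_def flip: sum_mset_sum_list mset_map)
  show "basis_family (gsc (Pres M) u) (gco (Pres M) u t) (P.gindex (pgens Bas) u t) (P.gwd (Pres M))"
  proof (rule basis_family_reindex[OF bas, of ?h])
    show "P.gwd (Pres M) (?h i) = (case i of (k, b) \<Rightarrow> delta k b)" if i: "i \<in> ?I" for i
      by (cases i) (simp add: gword_Pres)
    show "bij_betw ?h ?I (P.gindex (pgens Bas) u t)"
      unfolding bij_betw_def
    proof
      show "inj_on ?h ?I"
      proof (rule inj_onI)
        fix i j assume ij: "i \<in> ?I" "j \<in> ?I" "?h i = ?h j"
        obtain a b where i: "i = (a, b)" "b \<in> Bas (t - mdeg a)" using ij(1) by auto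
        obtain c d where j: "j = (c, d)" using ij(2) by auto
        have "mset (sorted_list_of_multiset a) = mset (sorted_list_of_multiset c)" using ij(3) by (simp add: i j)
        moreover have "delta ({#} :: nat multiset) b = delta {#} d" using ij(3) by (simp add: i j)
        then have "b = d" unfolding delta_inject[OF nz[OF i(2)]] by simp
        ultimately show "i = j" by (simp add: i j)
      qed
      show "?h ` ?I = P.gindex (pgens Bas) u t"
      proof
        show "?h ` ?I \<subseteq> P.gindex (pgens Bas) u t"
        proof
          fix k assume "k \<in> ?h ` ?I"
          then obtain a b where k: "k = ?h (a, b)" "a \<in> mkeys u" "b \<in> Bas (t - mdeg a)" by auto
          have "length (sorted_list_of_multiset a) = size a" by (metis mset_sorted_list_of_multiset size_mset)
          then show "k \<in> P.gindex (pgens Bas) u t"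
            using k(2,3) by (auto simp: k(1) P.gindex_def vwords_def pgens_def md mkeys_def)
        qed
        show "P.gindex (pgens Bas) u t \<subseteq> ?h ` ?I"
        proof
          fix k assume "k \<in> P.gindex (pgens Bas) u t"
          moreover obtain w u' t' z where kk: "k = (w, u', t', z)" by (cases k)
          ultimately have k: "sorted w" "set w \<subseteq> {..<3}" "z \<in> pgens Bas u' t'" "u = u' + int (length w)" "t = t' + mdeg (mset w)"
            by (simp_all add: P.gindex_def vwords_def md)
          from k(3) obtain b where b: "u' = 0" "z = delta {#} b" "b \<in> Bas t'" by (auto simp: pgens_def split: if_splits)
          have "(mset w, b) \<in> ?I" using k b by (auto simp: mkeys_def)
          moreover have "k = ?h (mset w, b)" using k(1,5) b by (simp add: kk sorted_sort_id)
          ultimately show "k \<in> ?h ` ?I" by blast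
        qed
      qed
    qed
  qed
qed

lemma Pres_delta_in: "a \<in> mkeys u \<Longrightarrow> y \<in> ecomp M (t - mdeg a) \<Longrightarrow> delta a y \<in> gco (Pres M) u t"
  by (auto simp: Pres_sel fun_sub_def delta_def M_closed[OF M])

lemma gd_Pres_delta: "gd (Pres M) 0 t (delta {#} y) = (\<Sum>i<3. delta {#i#} (eact M i t y))"
proof
  fix a :: "nat multiset"
  have "(if i \<in># a then eact M i (t - mdeg (a - {#i#})) (delta {#} y (a - {#i#})) else 0) = delta {#i#} (eact M i t y) a"
    if "i < 3" for i
  proof (cases "a = {#i#}")
    case True
    then show ?thesis by (simp add: delta_def mdeg_def)
  next
    case False
    then have "a - {#i#} \<noteq> {#}" if "i \<in># a" using that by (metis add_mset_remove_trivial insert_DiffM)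
    then show ?thesis using False Q_zero[OF M that] by (auto simp: delta_def)
  qed
  then have "gd (Pres M) 0 t (delta {#} y) a = (\<Sum>i<3. delta {#i#} (eact M i t y) a)"
    unfolding Pres_sel by (intro sum.cong) simp_all
  also have "\<dots> = (\<Sum>i<3. delta {#i#} (eact M i t y)) a" by (simp add: numeral_3_eq_3 lessThan_Suc)
  finally show "gd (Pres M) 0 t (delta {#} y) a = (\<Sum>i<3. delta {#i#} (eact M i t y)) a" .
qed

lemma delta_lin_on:
  assumes "a \<in> mkeys u" "t - mdeg a = m"
  shows "lin_on (escale M) (ecomp M m) (gsc (Pres M) u) (gco (Pres M) u t) (delta a)"
proof (rule E.lin_onI)
  show "delta a y \<in> gco (Pres M) u t" if "y \<in> ecomp M m" for y using Pres_delta_in assms that by blast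
qed (auto simp: delta_def Pres_sel escale_lin[OF M])

text \<open>The filtration level of a generator \<open>1 \<otimes> b\<close> is the degree of
  \<open>b\<close>, a natural number by the lower bound. Its differential is the sum of the
  \<open>v_i \<otimes> Q_i b\<close>, which involve basis vectors of smaller degree.\<close>

lemma gsemifree_Pres:
  assumes nonneg: "\<And>n. n < 0 \<Longrightarrow> ecomp M n = {0}"
  shows "P.gsemifree (Pres M)"
proof -
  have "\<forall>m. \<exists>B. basis_family (escale M) (ecomp M m) B (\<lambda>b. b)"
    using subspace_basis[OF E2_vs[OF M] E2_sub[OF M]] by blast
  from choice[OF this] obtain Bas where Bas: "\<And>m. basis_family (escale M) (ecomp M m) (Bas m) (\<lambda>b. b)" by blast
  have nz: "b \<noteq> 0" if "b \<in> Bas m" for b m by (rule basis_family_nonzero[OF E2_vs[OF M] Bas that])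
  have BasM: "b \<in> ecomp M m" if "b \<in> Bas m" for b m using basis_familyD[OF E2_vs[OF M] Bas that] .
  have pos: "m \<ge> 0" if "b \<in> Bas m" for b m using nonneg[of m] BasM[OF that] nz[OF that] by force
  let ?B = "\<lambda>(l::nat) u t. if t = int l then pgens Bas u t else {}"
  have Un: "(\<Union>l. ?B l u t) = pgens Bas u t" for u t
    using pos by (auto simp: pgens_def split: if_splits intro!: exI[of _ "nat t"])
  have "gd (Pres M) u t x \<in> module.span (gsc (Pres M) (u + 1)) (P.gwd (Pres M) ` P.gindex (\<lambda>u' t'. \<Union>l'<l. ?B l' u' t') (u + 1) t)"
    if x: "x \<in> ?B l u t" for l u t x
  proof -
    interpret vector_space "gsc (Pres M) (u + 1)" by (rule P.gmodule_vs[OF gmodule_Pres])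
    from x obtain b where b: "u = 0" "t = int l" "x = delta {#} b" "b \<in> Bas t"
      by (auto simp: pgens_def split: if_splits)
    show ?thesis unfolding b(1,3) gd_Pres_delta
    proof (rule span_sum[unfolded b(1)])
      fix i :: nat assume "i \<in> {..<3}"
      then have i: "i < 3" by simp
      have "eact M i t b \<in> ecomp M (t - qdeg p i)" by (rule Q_in[OF M i BasM[OF b(4)]]) simp
      then have q: "eact M i t b \<in> module.span (escale M) (Bas (t - qdeg p i))"
        using Bas[of "t - qdeg p i"] by (simp add: basis_family_def)
      have k: "{#i#} \<in> mkeys (0 + 1)" using i by (simp add: mkeys_def)
      have "delta {#i#} (eact M i t b) \<in> module.span (gsc (Pres M) (0 + 1)) (delta {#i#} ` Bas (t - qdeg p i))"
        by (rule lin_on_span[OF E2_vs[OF M] P.gmodule_vs[OF gmodule_Pres] E2_sub[OF M] delta_lin_on[OF k, of t] _ q])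
          (auto simp: mdeg_def BasM)
      moreover have "delta {#i#} ` Bas (t - qdeg p i) \<subseteq> P.gwd (Pres M) ` P.gindex (\<lambda>u' t'. \<Union>l'<l. ?B l' u' t') (0 + 1) t"
      proof
        fix z assume "z \<in> delta {#i#} ` Bas (t - qdeg p i)"
        then obtain c where c: "z = delta {#i#} c" "c \<in> Bas (t - qdeg p i)" by auto
        \<comment> \<open>The drop \<open>qdeg p i\<close> is positive and the new degree is still
          nonnegative, so the new generator has a strictly smaller level.\<close>
        have "nat (t - qdeg p i) < l" "t - qdeg p i = int (nat (t - qdeg p i))" using pos[OF c(2)] qdeg_pos[of i] b(2) by auto
        then have "delta {#} c \<in> (\<Union>l'<l. ?B l' 0 (t - qdeg p i))"
          using c(2) by (auto simp: pgens_def intro!: bexI[of _ "nat (t - qdeg p i)"])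
        \<comment> \<open>\<open>v_i \<otimes> c\<close> is the one-letter word \<open>v_i\<close>
          on the generator \<open>1 \<otimes> c\<close>.\<close>
        then have "([i], 0, t - qdeg p i, delta {#} c) \<in> P.gindex (\<lambda>u' t'. \<Union>l'<l. ?B l' u' t') (0 + 1) t"
          using i by (simp add: P.gindex_def vwords_def)
        moreover have "z = P.gwd (Pres M) ([i], 0, t - qdeg p i, delta {#} c)"
          using gop_Pres_delta[of M i 0 "t - qdeg p i" "{#}" c] by (simp add: c(1))
        ultimately show "z \<in> P.gwd (Pres M) ` P.gindex (\<lambda>u' t'. \<Union>l'<l. ?B l' u' t') (0 + 1) t" by blast
      qed
      ultimately show "delta {#i#} (eact M i t b) \<in> module.span (gsc (Pres M) (0 + 1))
          (P.gwd (Pres M) ` P.gindex (\<lambda>u' t'. \<Union>l'<l. ?B l' u' t') (0 + 1) t)"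
        using span_mono b(1) by blast
    qed
  qed
  moreover have "P.gfree (Pres M) (\<lambda>u t. \<Union>l. ?B l u t)" unfolding Un by (rule gfree_Pres[OF Bas])
  ultimately show ?thesis unfolding P.gsemifree_def by (intro exI[of _ ?B]) blast
qed

end

end

section \<open>The Koszul resolution and the functor \<open>G\<close>\<close>

lemma pm_extend_superset:
  assumes "finite A" "Poly_Mapping.keys x \<subseteq> A"
  shows "pm_extend f x = (\<Sum>b\<in>A. pm_scale (Poly_Mapping.lookup x b) (f b :: 'l \<Rightarrow>\<^sub>0 'f::field))"
  unfolding pm_extend_def
proof (rule sum.mono_neutral_left[OF assms])
  interpret vector_space "pm_scale :: 'f \<Rightarrow> ('l \<Rightarrow>\<^sub>0 'f) \<Rightarrow> _" by (rule vector_space_pm)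
  show "\<forall>i\<in>A - Poly_Mapping.keys x. pm_scale (Poly_Mapping.lookup x i) (f i) = 0"
    by (simp add: in_keys_iff)
qed

lemma pm_extend_lin:
  "lin_on (pm_scale :: 'f::field \<Rightarrow> ('k \<Rightarrow>\<^sub>0 'f) \<Rightarrow> _) V pm_scale UNIV (pm_extend (f :: 'k \<Rightarrow> 'l \<Rightarrow>\<^sub>0 'f))"
proof -
  interpret vector_space "pm_scale :: 'f \<Rightarrow> ('l \<Rightarrow>\<^sub>0 'f) \<Rightarrow> _" by (rule vector_space_pm)
  have "pm_extend f (x + y) = pm_extend f x + pm_extend f y" for x y
  proof -
    let ?A = "Poly_Mapping.keys x \<union> Poly_Mapping.keys y"
    have "pm_extend f z = (\<Sum>b\<in>?A. pm_scale (Poly_Mapping.lookup z b) (f b))" if "Poly_Mapping.keys z \<subseteq> ?A" for z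
      by (rule pm_extend_superset[OF _ that]) simp
    then show ?thesis using Poly_Mapping.keys_add[of x y]
      by (simp add: lookup_add scale_left_distrib sum.distrib)
  qed
  moreover have "pm_extend f (pm_scale c x) = pm_scale c (pm_extend f x)" for c x
  proof -
    have "Poly_Mapping.keys (pm_scale c x) \<subseteq> Poly_Mapping.keys x" by (auto simp: in_keys_iff lookup_pm_scale)
    from pm_extend_superset[OF _ this, of f] show ?thesis
      by (simp add: pm_extend_def lookup_pm_scale scale_sum_right)
  qed
  ultimately show ?thesis by (simp add: lin_on_def)
qed

lemma pm_extend_single:
  fixes f :: "'k \<Rightarrow> 'l \<Rightarrow>\<^sub>0 'f::field"
  shows "pm_extend f (Poly_Mapping.single k 1) = f k"
proof -
  interpret vector_space "pm_scale :: 'f \<Rightarrow> ('l \<Rightarrow>\<^sub>0 'f) \<Rightarrow> _" by (rule vector_space_pm)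
  show ?thesis by (simp add: pm_extend_def)
qed

lemma pm_sub: "module.subspace (pm_scale :: 'f::field \<Rightarrow> _) {x. Poly_Mapping.keys x \<subseteq> A}"
  by (rule basis_family_subspace[OF vector_space_pm pm_basis])

lemma pm_ext:
  fixes F G :: "('k \<Rightarrow>\<^sub>0 'f::field) \<Rightarrow> 'b::ab_group_add"
  assumes "lin_on pm_scale {x. Poly_Mapping.keys x \<subseteq> A} s W F" "lin_on pm_scale {x. Poly_Mapping.keys x \<subseteq> A} s W' G"
    "\<And>k. k \<in> A \<Longrightarrow> F (Poly_Mapping.single k 1) = G (Poly_Mapping.single k 1)" "Poly_Mapping.keys x \<subseteq> A"
  shows "F x = G x"
proof (rule lin_on_eq_on_span[OF vector_space_pm pm_sub assms(1,2)])
  show "(\<lambda>k. Poly_Mapping.single k (1::'f)) ` A \<subseteq> {x. Poly_Mapping.keys x \<subseteq> A}" by auto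
  show "x \<in> module.span pm_scale ((\<lambda>k. Poly_Mapping.single k (1::'f)) ` A)"
    using pm_basis[of A, where 'f = 'f] assms(4) by (simp add: basis_family_def)
qed (use assms(3) in auto)

lemma pm_lin_into:
  fixes F :: "('k \<Rightarrow>\<^sub>0 'f::field) \<Rightarrow> 'b::ab_group_add"
  assumes F: "lin_on pm_scale {x. Poly_Mapping.keys x \<subseteq> A} s UNIV F" and s: "vector_space s" "module.subspace s W"
    and W: "\<And>k. k \<in> A \<Longrightarrow> F (Poly_Mapping.single k 1) \<in> W"
  shows "lin_on pm_scale {x. Poly_Mapping.keys x \<subseteq> A} s W F"
proof -
  interpret vector_space s by fact
  have "F x \<in> W" if "Poly_Mapping.keys x \<subseteq> A" for x
  proof -
    have "x \<in> module.span pm_scale ((\<lambda>k. Poly_Mapping.single k (1::'f)) ` A)"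
      using pm_basis[of A, where 'f = 'f] that by (simp add: basis_family_def)
    from lin_on_span[OF vector_space_pm s(1) pm_sub F _ this]
    have "F x \<in> span (F ` (\<lambda>k. Poly_Mapping.single k 1) ` A)" by fastforce
    then show ?thesis using span_minimal[OF _ s(2), of "F ` (\<lambda>k. Poly_Mapping.single k 1) ` A"] W by blast
  qed
  then show ?thesis using F by (auto simp: lin_on_def)
qed

lemma minus_one_power_sg: "Poly_Mapping.single k ((-1) ^ n) = sg (int n) (Poly_Mapping.single k (1::'f::field))"
  by (simp add: sg_def single_uminus minus_one_power_iff)

context exterior
begin

definition KK :: "int \<Rightarrow> int \<Rightarrow> kkey set" where
  "KK s n = {k \<in> kkeys s. n = - kdeg k}"

lemma koszul_comp_eq: "koszul_comp p s n = {x. Poly_Mapping.keys x \<subseteq> KK s n}"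
  by (auto simp: koszul_comp_def KK_def kkeys_def kdeg_def subset_iff split: prod.splits)

abbreviation ksing :: "kkey \<Rightarrow> 'f::field koszul" where
  "ksing k \<equiv> Poly_Mapping.single k 1"

lemma koszul_Q_single: "koszul_Q i (ksing (S, a)) = (if i \<in> S then 0 else sgl i S (ksing (insert i S, a)) :: 'f::field koszul)"
  by (simp add: koszul_Q_def pm_extend_single minus_one_power_sg sgl_def)

lemma koszul_Q_lin: "lin_on pm_scale V pm_scale UNIV (koszul_Q i :: 'f::field koszul \<Rightarrow> _)"
  unfolding koszul_Q_def by (rule pm_extend_lin)

lemma koszul_Q_add: "koszul_Q i (x + y) = koszul_Q i x + koszul_Q i (y :: 'f::field koszul)"
  and koszul_Q_scale: "koszul_Q i (pm_scale c x) = pm_scale c (koszul_Q i x)"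
  using lin_onD(2,3)[OF koszul_Q_lin[of UNIV]] by auto

lemma koszul_Q_neg: "koszul_Q i (- x) = - koszul_Q i (x :: 'f::field koszul)"
proof -
  interpret vector_space "pm_scale :: 'f \<Rightarrow> 'f koszul \<Rightarrow> _" by (rule vector_space_pm)
  show ?thesis using lin_on_neg[OF vector_space_pm subspace_UNIV koszul_Q_lin] by blast
qed

lemma koszul_Q_sg: "koszul_Q i (sg b x) = sg b (koszul_Q i (x :: 'f::field koszul))"
  by (simp add: sg_def koszul_Q_neg)

lemma koszul_Q_0: "koszul_Q i 0 = (0 :: 'f::field koszul)"
  using lin_on_zero[OF koszul_Q_lin, of UNIV i] by simp

lemma koszul_sub: "module.subspace pm_scale (koszul_comp p s n :: 'f::field koszul set)"
  unfolding koszul_comp_eq by (rule pm_sub)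

lemma koszul_single_in: "k \<in> kkeys s \<Longrightarrow> n = - kdeg k \<Longrightarrow> ksing k \<in> koszul_comp p s n"
  by (simp add: koszul_comp_eq KK_def)

lemma koszul_sg_in: "x \<in> koszul_comp p s n \<Longrightarrow> sg b x \<in> (koszul_comp p s n :: 'f::field koszul set)"
  using subspace_neg[OF vector_space_pm koszul_sub, of x s n] by (simp add: sg_def)

lemma kdeg_insert: "finite S \<Longrightarrow> i \<notin> S \<Longrightarrow> kdeg (insert i S, a) = kdeg (S, a) + qdeg p i"
  by (simp add: kdeg_def)

lemma kkeys_finite: "(S, a) \<in> kkeys r \<Longrightarrow> finite S"
  by (auto simp: kkeys_def intro: finite_subset)

lemma koszul_Q_lin_on:
  assumes "i < 3"
  shows "lin_on pm_scale (koszul_comp p s n) pm_scale (koszul_comp p s (n - qdeg p i)) (koszul_Q i :: 'f::field koszul \<Rightarrow> _)"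
  unfolding koszul_comp_eq[of s n]
proof (rule pm_lin_into[OF koszul_Q_lin vector_space_pm koszul_sub])
  fix k assume k: "k \<in> KK s n"
  obtain S a where k': "k = (S, a)" by (cases k)
  have "ksing (insert i S, a) \<in> koszul_comp p s (n - qdeg p i)" if "i \<notin> S"
    using k that assms kkeys_finite[of S a s] by (intro koszul_single_in) (auto simp: KK_def k' kdeg_insert kkeys_def)
  then show "koszul_Q i (ksing k) \<in> (koszul_comp p s (n - qdeg p i) :: 'f koszul set)"
    using subspace_zero[OF vector_space_pm koszul_sub] koszul_sg_in by (auto simp: k' koszul_Q_single sgl_def)
qed

lemma card_less_insert:
  assumes "finite S" "i \<notin> S"
  shows "int (card {k \<in> insert i S. k < j}) = int (card {k \<in> S. k < j}) + (if i < j then 1 else 0)"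
    "int (card {k \<in> insert i S. j < k}) = int (card {k \<in> S. j < k}) + (if j < i then 1 else 0)"
  using card_less_remove[of "insert i S" i j] assms by (simp_all add: Diff_insert_absorb)

lemma koszul_QQ:
  assumes i: "i < 3" "j < 3" and x: "x \<in> koszul_comp p s n"
  shows "koszul_Q i (koszul_Q j x) = - koszul_Q j (koszul_Q i (x :: 'f::field koszul))" "koszul_Q i (koszul_Q i x) = 0"
proof -
  have l: "lin_on pm_scale {x. Poly_Mapping.keys x \<subseteq> KK s n} pm_scale UNIV (\<lambda>x. koszul_Q i (koszul_Q j (x :: 'f koszul)))" for i j
    by (simp add: lin_on_def koszul_Q_add koszul_Q_scale)
  have l': "lin_on pm_scale {x. Poly_Mapping.keys x \<subseteq> KK s n} pm_scale UNIV (\<lambda>x. - koszul_Q i (koszul_Q j (x :: 'f koszul)))" for i j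
  proof -
    interpret vector_space "pm_scale :: 'f \<Rightarrow> 'f koszul \<Rightarrow> _" by (rule vector_space_pm)
    show ?thesis by (simp add: lin_on_def koszul_Q_add koszul_Q_scale)
  qed
  have l0: "lin_on pm_scale {x. Poly_Mapping.keys x \<subseteq> KK s n} pm_scale UNIV (\<lambda>x. 0 :: 'f koszul)"
  proof -
    interpret vector_space "pm_scale :: 'f \<Rightarrow> 'f koszul \<Rightarrow> _" by (rule vector_space_pm)
    show ?thesis by (simp add: lin_on_def)
  qed
  have xk: "Poly_Mapping.keys x \<subseteq> KK s n" using x by (simp add: koszul_comp_eq)
  show "koszul_Q i (koszul_Q j x) = - koszul_Q j (koszul_Q i x)"
  proof (rule pm_ext[OF l l' _ xk])
    fix k assume k: "k \<in> KK s n"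
    obtain S a where k': "k = (S, a)" by (cases k)
    have fin: "finite S" using k kkeys_finite[of S a s] by (simp add: KK_def k')
    show "koszul_Q i (koszul_Q j (ksing k)) = - koszul_Q j (koszul_Q i (ksing k :: 'f koszul))"
    proof (cases "i = j \<or> i \<in> S \<or> j \<in> S")
      case True
      then show ?thesis by (auto simp: k' koszul_Q_single koszul_Q_sg sgl_def koszul_Q_0 sg_0)
    next
      case False
      then have "koszul_Q i (koszul_Q j (ksing k)) = sgl j S (sgl i (insert j S) (ksing (insert i (insert j S), a)) :: 'f koszul)"
        "koszul_Q j (koszul_Q i (ksing k)) = sgl i S (sgl j (insert i S) (ksing (insert j (insert i S), a)) :: 'f koszul)"
        by (simp_all add: k' koszul_Q_single koszul_Q_sg sgl_def)
      moreover have "sgl j S (sgl i (insert j S) y) = - sgl i S (sgl j (insert i S) y)" for y :: "'f koszul"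
      proof -
        have ij: "i \<notin> S" "j \<notin> S" using False by auto
        show ?thesis
          unfolding sgl_def grading.sg_sg[symmetric] card_less_insert[OF fin ij(1)] card_less_insert[OF fin ij(2)]
          by (rule sg_odd) (use False in auto)
      qed
      ultimately show ?thesis by (simp add: insert_commute)
    qed
  qed
  show "koszul_Q i (koszul_Q i x) = 0"
  proof (rule pm_ext[OF l l0 _ xk])
    fix k assume "k \<in> KK s n"
    obtain S a where k': "k = (S, a)" by (cases k)
    show "koszul_Q i (koszul_Q i (ksing k)) = (0 :: 'f koszul)"
      by (auto simp: k' koszul_Q_single koszul_Q_sg sgl_def koszul_Q_0 sg_0)
  qed
qed

lemma koszul_sel: "escale (koszul_mod p s) = pm_scale" "ecomp (koszul_mod p s) n = koszul_comp p s n"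
  "eact (koszul_mod p s) i n = koszul_Q i"
  by (simp_all add: koszul_mod_def)

lemma E2_koszul: "E2_module p (koszul_mod p s :: ('f::field, 'f koszul) emod)"
  unfolding E2_module_def koszul_sel eq_neg_iff_add_eq_0[symmetric]
  using koszul_Q_lin_on koszul_QQ koszul_sub vector_space_pm by blast

text \<open>The free generators \<open>1 \<otimes> \<gamma>_a\<close> of a single Koszul module, in
  cohomological degree 0 where \<open>gM\<close> puts it.\<close>

definition kgens :: "int \<Rightarrow> int \<Rightarrow> int \<Rightarrow> 'f::field koszul set" where
  "kgens s u t = (if u = 0 then {ksing ({}, a) | a. a \<in> mkeys s \<and> t = - mdeg a} else {})"

lemma kdeg_empty: "kdeg ({}, a) = mdeg a"
  by (simp add: kdeg_def mdeg_def)

lemma gword_koszul: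
  assumes "sorted_wrt (<) w"
  shows "E.gword (gM (koszul_mod p s)) w 0 t (ksing ({}, a)) = (ksing (set w, a) :: 'f::field koszul)"
  using assms
proof (induction w)
  case (Cons i w)
  then have "i \<notin> set w" "{j \<in> set w. j < i} = {}" by auto
  then have "koszul_Q i (ksing (set w, a)) = (ksing (insert i (set w), a) :: 'f koszul)"
    by (simp only: koszul_Q_single sgl_def card.empty of_nat_0 sg_simps if_False)
  then show ?case using Cons by (simp add: koszul_sel)
qed simp

lemma ksing_inject: "ksing k = (ksing k' :: 'f::field koszul) \<longleftrightarrow> k = k'"
proof
  assume "ksing k = (ksing k' :: 'f koszul)"
  then have "Poly_Mapping.lookup (ksing k) k = Poly_Mapping.lookup (ksing k' :: 'f koszul) k" by simp
  then show "k = k'" by (simp add: lookup_single when_def split: if_splits)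
qed simp

text \<open>Regarding one Koszul module as a complex in degree 0 makes the extension and uniqueness
  results for free modules available for \<open>Hom_E\<close> out of it.\<close>

lemma gfree_koszul: "E.gfree (gM (koszul_mod p s :: ('f::field, 'f koszul) emod)) (kgens s)"
  unfolding E.gfree_def
proof (intro conjI allI gmodule_gM[OF E2_koszul])
  fix u n :: int
  let ?X = "gM (koszul_mod p s :: ('f, 'f koszul) emod)"
  show "basis_family (gsc ?X u) (gco ?X u n) (E.gindex (kgens s) u n) (E.gwd ?X)"
  proof (cases "u = 0")
    case False
    interpret vector_space "pm_scale :: 'f \<Rightarrow> 'f koszul \<Rightarrow> _" by (rule vector_space_pm)
    have "E.gindex (kgens s) u n = ({} :: (nat list \<times> int \<times> int \<times> 'f koszul) set)" using False by (auto simp: E.gindex_def kgens_def)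
    then show ?thesis using False independent_empty by (simp add: basis_family_def koszul_sel)
  next
    case True
    let ?h = "\<lambda>(S, a). (sorted_list_of_set S, 0::int, n + (\<Sum>i\<in>S. qdeg p i), ksing ({} :: nat set, a) :: 'f koszul)"
    have neg: "(\<Sum>j\<leftarrow>w. - qdeg p j) = - (\<Sum>j\<leftarrow>w. qdeg p j)" for w by (induction w) auto
    have fin: "finite S" if "(S, a) \<in> KK s n" for S a using that kkeys_finite by (auto simp: KK_def)
    have bas: "basis_family (gsc ?X u) (gco ?X u n) (KK s n) ksing"
      using pm_basis[of "KK s n"] True by (simp add: koszul_sel koszul_comp_eq)
    show ?thesis
    proof (rule basis_family_reindex[OF bas, of ?h])
      show "E.gwd ?X (?h i) = ksing i" if i: "i \<in> KK s n" for i
        using i fin by (cases i) (simp add: gword_koszul)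
      show "bij_betw ?h (KK s n) (E.gindex (kgens s) u n)"
        unfolding bij_betw_def
      proof
        show "inj_on ?h (KK s n)"
        proof (rule inj_onI)
          fix i j assume ij: "i \<in> KK s n" "j \<in> KK s n" "?h i = ?h j"
          obtain S a where i: "i = (S, a)" by (cases i)
          obtain T c where j: "j = (T, c)" by (cases j)
          have "set (sorted_list_of_set S) = set (sorted_list_of_set T)" using ij(3) by (simp add: i j)
          then have "S = T" using fin ij(1,2) i j by simp
          moreover have "ksing ({} :: nat set, a) = (ksing ({}, c) :: 'f koszul)" using ij(3) by (simp add: i j)
          then have "a = c" by (simp only: ksing_inject prod.inject)
          ultimately show "i = j" by (simp add: i j)
        qed
        show "?h ` KK s n = E.gindex (kgens s) u n"
        proof
          show "?h ` KK s n \<subseteq> E.gindex (kgens s) u n"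
          proof
            fix k assume "k \<in> ?h ` KK s n"
            then obtain S a where k: "k = ?h (S, a)" "(S, a) \<in> KK s n" by auto
            have "ksing ({}, a) \<in> (kgens s 0 (n + (\<Sum>i\<in>S. qdeg p i)) :: 'f koszul set)"
              using k(2) kdeg_split[of S a] by (auto simp: kgens_def KK_def kkeys_def mkeys_def kdeg_empty)
            moreover have "vwords True (sorted_list_of_set S)"
              using k(2) fin[OF k(2)] by (auto simp: vwords_def KK_def kkeys_def)
            ultimately show "k \<in> E.gindex (kgens s) u n"
              using fin[OF k(2)] True by (simp add: k(1) E.gindex_def neg sum_list_sorted_list_of_set)
          qed
          show "E.gindex (kgens s) u n \<subseteq> ?h ` KK s n"
          proof
            fix k :: "nat list \<times> int \<times> int \<times> 'f koszul" assume "k \<in> E.gindex (kgens s) u n"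
            moreover obtain w u' t' z where kk: "k = (w, u', t', z)" by (cases k)
            ultimately have k: "k = (w, 0, t', z)" "sorted_wrt (<) w" "set w \<subseteq> {..<3}"
              "z \<in> kgens s 0 t'" "t' = n + (\<Sum>j\<leftarrow>w. qdeg p j)"
              using True by (auto simp: E.gindex_def vwords_def neg)
            from k(4) obtain a where a: "z = ksing ({}, a)" "a \<in> mkeys s" "t' = - mdeg a" by (auto simp: kgens_def)
            have w: "sorted_list_of_set (set w) = w" "(\<Sum>j\<leftarrow>w. qdeg p j) = (\<Sum>j\<in>set w. qdeg p j)"
              using k(2) by (auto simp: sorted_list_of_set.idem_if_sorted_distinct strict_sorted_iff sum_list_distinct_conv_sum_set)
            have "(set w, a) \<in> KK s n" using k a w(2) by (auto simp: KK_def kkeys_def mkeys_def kdeg_split[of "set w"] kdeg_empty)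
            moreover have "k = ?h (set w, a)" using k a w by simp
            ultimately show "k \<in> ?h ` KK s n" by blast
          qed
        qed
      qed
    qed
  qed
qed

lemma Hom_E_ghom:
  assumes M: "E2_module p M" and N: "E2_module p N"
  shows "F \<in> Hom_E p M N t \<Longrightarrow> (\<lambda>v. if v = 0 then F else (\<lambda>n x. 0)) \<in> E.ghom (gM M) (gM N) 0 t"
    "f \<in> E.ghom (gM M) (gM N) 0 t \<Longrightarrow> f 0 \<in> Hom_E p M N t"
proof -
  show "f 0 \<in> Hom_E p M N t" if f: "f \<in> E.ghom (gM M) (gM N) 0 t"
    using E.ghom_lin[OF f, of 0] E.ghom_out[OF f, of _ 0] E.ghom_op[OF f, of _ _ 0]
    by (auto simp: Hom_E_def lin_maps_def)
  assume F: "F \<in> Hom_E p M N t"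
  show "(\<lambda>v. if v = 0 then F else (\<lambda>n x. 0)) \<in> E.ghom (gM M) (gM N) 0 t"
  proof (rule E.ghomI)
    fix v n
    interpret vector_space "escale N" by (rule E2_vs[OF N])
    show "lin_on (gsc (gM M) v) (gco (gM M) v n) (gsc (gM N) (v + 0)) (gco (gM N) (v + 0) (n + t)) ((if v = 0 then F else (\<lambda>n x. 0)) n)"
    proof (cases "v = 0")
      case True
      then show ?thesis using Hom_E_D(1)[OF F, of n] by simp
    qed (simp add: lin_on_def)
  qed (use Hom_E_D(3,4)[OF F] in auto)
qed

context
  fixes M :: "('f::field, 'a::ab_group_add) emod"
  assumes M: "E2_module p M"
begin

lemma ksing_gen_in: "a \<in> mkeys u \<Longrightarrow> ksing ({}, a) \<in> koszul_comp p u (- mdeg a)"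
  by (rule koszul_single_in) (auto simp: mkeys_def kkeys_def kdeg_empty)

lemma Hom_koszul_ex:
  assumes x: "x \<in> gco (Pres M) u t"
  shows "\<exists>f\<in>Hom_E p (koszul_mod p u) M t. \<forall>a\<in>mkeys u. f (- mdeg a) (ksing ({}, a)) = x a"
proof -
  \<comment> \<open>\<open>THE\<close> recovers the multiset from the generator, which is possible
    because singletons of different keys differ.\<close>
  define \<phi> where "\<phi> (v::int) (n::int) z = x (THE a. z = (ksing ({}, a) :: 'f koszul))" for v n z
  have \<phi>: "\<phi> v n (ksing ({}, a)) = x a" for v n a
    unfolding \<phi>_def by (simp add: ksing_inject)
  have "\<phi> v n z \<in> gco (gM M) (v + 0) (n + t)" if "z \<in> kgens u v n" for v n z
    using that Pres_D(1)[OF M x] by (auto simp: kgens_def \<phi> split: if_splits)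
  from E.ghom_extend[OF gfree_koszul gmodule_gM[OF M], of u \<phi>, OF this]
  obtain f where f: "f \<in> E.ghom (gM (koszul_mod p u)) (gM M) 0 t" "\<And>v n z. z \<in> kgens u v n \<Longrightarrow> f v n z = \<phi> v n z" by blast
  have "f 0 (- mdeg a) (ksing ({}, a)) = x a" if "a \<in> mkeys u" for a
    using f(2)[of "ksing ({}, a)" 0 "- mdeg a"] that by (auto simp: kgens_def \<phi>)
  then show ?thesis using Hom_E_ghom(2)[OF E2_koszul M f(1)] by blast
qed

lemma Hom_koszul_eqI:
  assumes f: "f \<in> Hom_E p (koszul_mod p u) M t" "g \<in> Hom_E p (koszul_mod p u) M t"
    and eq: "\<And>a. a \<in> mkeys u \<Longrightarrow> f (- mdeg a) (ksing ({}, a)) = g (- mdeg a) (ksing ({}, a))"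
  shows "f = g"
proof -
  have "(\<lambda>v. if v = (0::int) then f else (\<lambda>n x. 0)) = (\<lambda>v. if v = 0 then g else (\<lambda>n x. 0))"
    by (rule E.ghom_eqI[OF gfree_koszul Hom_E_ghom(1)[OF E2_koszul M f(1)] Hom_E_ghom(1)[OF E2_koszul M f(2)]])
      (auto simp: kgens_def eq split: if_splits)
  from fun_cong[OF this, of 0] show ?thesis by simp
qed

end

end

section \<open>The Koszul differential and the operators v_i on basis elements\<close>

context exterior
begin

lemma koszul_d_raw_lin: "lin_on pm_scale (koszul_comp p s n) pm_scale UNIV (koszul_d p s n :: 'f::field koszul \<Rightarrow> _)"
proof -
  have in': "x + y \<in> koszul_comp p s n" "pm_scale c x \<in> koszul_comp p s n"
    if "x \<in> koszul_comp p s n" "y \<in> koszul_comp p s n" for x y :: "'f koszul" and c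
    using subspace_add[OF vector_space_pm koszul_sub] subspace_scale[OF vector_space_pm koszul_sub] that by blast+
  show ?thesis
    unfolding lin_on_def koszul_d_def using in' by (simp add: lin_onD(2,3)[OF pm_extend_lin[where V = UNIV]])
qed

lemma koszul_v_raw_lin: "lin_on pm_scale (koszul_comp p s n) pm_scale UNIV (koszul_v p i s n :: 'f::field koszul \<Rightarrow> _)"
proof -
  have in': "x + y \<in> koszul_comp p s n" "pm_scale c x \<in> koszul_comp p s n"
    if "x \<in> koszul_comp p s n" "y \<in> koszul_comp p s n" for x y :: "'f koszul" and c
    using subspace_add[OF vector_space_pm koszul_sub] subspace_scale[OF vector_space_pm koszul_sub] that by blast+
  show ?thesis
    unfolding lin_on_def koszul_v_def using in' by (simp add: lin_onD(2,3)[OF pm_extend_lin[where V = UNIV]])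
qed

text \<open>The sum runs over all three indices, with a guard, so that it can be compared term by
  term with the models.\<close>

lemma koszul_d_single:
  assumes "(S, a) \<in> kkeys s" "n = - kdeg (S, a)"
  shows "koszul_d p s n (ksing (S, a)) =
    (\<Sum>i<3. if i \<in># a \<and> i \<notin> S then sgr i S (ksing (insert i S, a - {#i#})) else 0 :: 'f::field koszul)"
proof -
  have "set_mset a \<subseteq> {..<3}" using assms(1) by (simp add: kkeys_def)
  then have *: "{..<3} \<inter> (set_mset a - S) = set_mset a - S" by auto
  have "koszul_d p s n (ksing (S, a)) = (\<Sum>i\<in>set_mset a - S. sgr i S (ksing (insert i S, a - {#i#})) :: 'f koszul)"
    by (simp add: koszul_single_in[OF assms] koszul_d_def pm_extend_single minus_one_power_sg sgr_def)
  also have "\<dots> = (\<Sum>i<3. if i \<in> set_mset a - S then sgr i S (ksing (insert i S, a - {#i#})) else 0)"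
    by (subst sum.inter_restrict[symmetric]) (simp_all only: * finite_lessThan)
  finally show ?thesis by simp
qed

lemma koszul_v_single:
  assumes "(S, a) \<in> kkeys s" "n = - kdeg (S, a)"
  shows "koszul_v p i s n (ksing (S, a)) = (if i \<in># a then ksing (S, a - {#i#}) else 0 :: 'f::field koszul)"
  by (simp add: koszul_single_in[OF assms] koszul_v_def pm_extend_single)

lemma kkeys_remove_mset: "i \<in># a \<Longrightarrow> i < 3 \<Longrightarrow> (S, a - {#i#}) \<in> kkeys s \<longleftrightarrow> (S, a) \<in> kkeys (s + 1)"
proof -
  assume "i \<in># a" "i < 3"
  then obtain b where "a = add_mset i b" using multi_member_split by metis
  then show ?thesis using \<open>i < 3\<close> by (auto simp: kkeys_def)
qed

lemma kdeg_remove_mset: "i \<in># a \<Longrightarrow> kdeg (S, a - {#i#}) = kdeg (S, a) - qdeg p i"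
  by (metis kdeg_add insert_DiffM add_diff_cancel_right')

lemma koszul_ext:
  fixes F G :: "'f::field koszul \<Rightarrow> 'b::ab_group_add"
  assumes "lin_on pm_scale (koszul_comp p s n) s' W F" "lin_on pm_scale (koszul_comp p s n) s' W' G"
    "\<And>k. k \<in> kkeys s \<Longrightarrow> n = - kdeg k \<Longrightarrow> F (ksing k) = G (ksing k)" "x \<in> koszul_comp p s n"
  shows "F x = G x"
  using pm_ext[of "KK s n" s' W F W' G x] assms unfolding koszul_comp_eq by (simp add: KK_def)

lemma koszul_into:
  fixes F :: "'f::field koszul \<Rightarrow> 'b::ab_group_add"
  assumes "lin_on pm_scale (koszul_comp p s n) s' UNIV F" "vector_space s'" "module.subspace s' W"
    "\<And>k. k \<in> kkeys s \<Longrightarrow> n = - kdeg k \<Longrightarrow> F (ksing k) \<in> W"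
  shows "lin_on pm_scale (koszul_comp p s n) s' W F"
  using pm_lin_into[of "KK s n" s' F W] assms unfolding koszul_comp_eq by (simp add: KK_def)

lemma koszul_sgr_in: "x \<in> koszul_comp p s n \<Longrightarrow> sgr i S x \<in> (koszul_comp p s n :: 'f::field koszul set)"
  by (simp add: sgr_def koszul_sg_in)

lemma koszul_sum_in: "(\<And>i. i \<in> A \<Longrightarrow> g i \<in> koszul_comp p s n) \<Longrightarrow> (\<Sum>i\<in>A. g i) \<in> (koszul_comp p s n :: 'f::field koszul set)"
proof -
  interpret vector_space "pm_scale :: 'f \<Rightarrow> 'f koszul \<Rightarrow> _" by (rule vector_space_pm)
  show "(\<And>i. i \<in> A \<Longrightarrow> g i \<in> koszul_comp p s n) \<Longrightarrow> (\<Sum>i\<in>A. g i) \<in> (koszul_comp p s n :: 'f koszul set)"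
    by (rule subspace_sum[OF koszul_sub])
qed

lemma koszul_0_in: "0 \<in> (koszul_comp p s n :: 'f::field koszul set)"
  by (rule subspace_zero[OF vector_space_pm koszul_sub])

lemma koszul_d_lin:
  "lin_on pm_scale (koszul_comp p (s + 1) n) pm_scale (koszul_comp p s n) (koszul_d p (s + 1) n :: 'f::field koszul \<Rightarrow> _)"
proof (rule koszul_into[OF koszul_d_raw_lin vector_space_pm koszul_sub])
  fix k assume k: "k \<in> kkeys (s + 1)" "n = - kdeg k"
  obtain S a where k': "k = (S, a)" by (cases k)
  have "ksing (insert i S, a - {#i#}) \<in> (koszul_comp p s n :: 'f koszul set)" if "i \<in># a" "i \<notin> S" "i < 3" for i
  proof (rule koszul_single_in)
    have "(S, a - {#i#}) \<in> kkeys s" using k(1) kkeys_remove_mset[OF that(1,3)] by (simp add: k')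
    then show "(insert i S, a - {#i#}) \<in> kkeys s" using that(3) by (auto simp: kkeys_def)
    show "n = - kdeg (insert i S, a - {#i#})"
      using kkeys_finite[of S a "s + 1"] k that by (simp add: k' kdeg_insert kdeg_remove_mset)
  qed
  then show "koszul_d p (s + 1) n (ksing k) \<in> (koszul_comp p s n :: 'f koszul set)"
    using k unfolding k' by (subst koszul_d_single) (auto intro!: koszul_sum_in koszul_sgr_in koszul_0_in)
qed

lemma koszul_v_lin:
  assumes i: "i < 3"
  shows "lin_on pm_scale (koszul_comp p (s + 1) n) pm_scale (koszul_comp p s (n + qdeg p i)) (koszul_v p i (s + 1) n :: 'f::field koszul \<Rightarrow> _)"
proof (rule koszul_into[OF koszul_v_raw_lin vector_space_pm koszul_sub])
  fix k assume k: "k \<in> kkeys (s + 1)" "n = - kdeg k"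
  obtain S a where k': "k = (S, a)" by (cases k)
  have "ksing (S, a - {#i#}) \<in> (koszul_comp p s (n + qdeg p i) :: 'f koszul set)" if "i \<in># a"
    using k kkeys_remove_mset[OF that i] kdeg_remove_mset[OF that] by (intro koszul_single_in) (simp_all add: k')
  then show "koszul_v p i (s + 1) n (ksing k) \<in> (koszul_comp p s (n + qdeg p i) :: 'f koszul set)"
    using k by (simp add: k' koszul_v_single koszul_0_in)
qed

lemma koszul_Q_sum: "koszul_Q i (\<Sum>j\<in>A. g j) = (\<Sum>j\<in>A. koszul_Q i (g j :: 'f::field koszul))"
proof -
  interpret vector_space "pm_scale :: 'f \<Rightarrow> 'f koszul \<Rightarrow> _" by (rule vector_space_pm)
  show ?thesis by (rule lin_on_sum[OF vector_space_pm subspace_UNIV koszul_Q_lin]) simp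
qed

text \<open>Left multiplication by \<open>Q_i\<close> commutes with the right multiplications in the
  Koszul differential. On a basis element this is a parity count: adding \<open>i\<close> changes
  the count above \<open>j\<close> exactly when adding \<open>j\<close> changes the count below
  \<open>i\<close>.\<close>

lemma koszul_dQ:
  fixes x :: "'f::field koszul"
  assumes i: "i < 3" and x: "x \<in> koszul_comp p s n"
  shows "koszul_d p s (n - qdeg p i) (koszul_Q i x) = koszul_Q i (koszul_d p s n x)"
proof (rule koszul_ext[OF _ _ _ x])
  show "lin_on pm_scale (koszul_comp p s n) pm_scale UNIV (\<lambda>x :: 'f koszul. koszul_d p s (n - qdeg p i) (koszul_Q i x))"
    by (simp add: lin_on_def lin_onD[OF koszul_Q_lin_on[OF i, of s n]] lin_onD[OF koszul_d_raw_lin[of s "n - qdeg p i"]])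
  show "lin_on pm_scale (koszul_comp p s n) pm_scale UNIV (\<lambda>x :: 'f koszul. koszul_Q i (koszul_d p s n x))"
    by (simp add: lin_on_def koszul_Q_add koszul_Q_scale lin_onD[OF koszul_d_raw_lin[of s n]])
  fix k assume k: "k \<in> kkeys s" "n = - kdeg k"
  obtain S a where k': "k = (S, a)" by (cases k)
  have fin: "finite S" using k kkeys_finite by (simp add: k')
  let ?t = "\<lambda>S j. if j \<in># a \<and> j \<notin> S then sgr j S (ksing (insert j S, a - {#j#})) else 0 :: 'f koszul"
  have d: "koszul_d p s n (ksing k) = (\<Sum>j<3. ?t S j)"
    using koszul_d_single[of S a s n] k by (simp add: k')
  show "koszul_d p s (n - qdeg p i) (koszul_Q i (ksing k)) = koszul_Q i (koszul_d p s n (ksing k :: 'f koszul))"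
  proof (cases "i \<in> S")
    case True
    have "koszul_Q i (?t S j) = 0" for j
      using True by (simp add: sgr_def koszul_Q_sg koszul_Q_single sg_0 koszul_Q_0)
    then have "koszul_Q i (koszul_d p s n (ksing k)) = (0 :: 'f koszul)" unfolding d koszul_Q_sum by simp
    moreover have "koszul_Q i (ksing k) = (0 :: 'f koszul)" using True by (simp add: k' koszul_Q_single)
    moreover have "koszul_d p s (n - qdeg p i) 0 = (0 :: 'f koszul)"
      by (rule lin_on_zero[OF koszul_d_raw_lin koszul_0_in])
    ultimately show ?thesis by simp
  next
    case False
    have key: "(insert i S, a) \<in> kkeys s" "n - qdeg p i = - kdeg (insert i S, a)"
      using k i False fin by (auto simp: k' kkeys_def kdeg_insert)
    have "koszul_d p s (n - qdeg p i) (koszul_Q i (ksing k)) = koszul_d p s (n - qdeg p i) (sgl i S (ksing (insert i S, a)) :: 'f koszul)"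
      using False by (simp add: k' koszul_Q_single)
    also have "\<dots> = sgl i S (koszul_d p s (n - qdeg p i) (ksing (insert i S, a)))"
      by (simp add: sgl_def sg_def lin_on_neg[OF vector_space_pm koszul_sub koszul_d_raw_lin koszul_single_in[OF key]])
    also have "\<dots> = (\<Sum>j<3. sgl i S (?t (insert i S) j))"
      unfolding koszul_d_single[OF key] sgl_sum ..
    also have "\<dots> = (\<Sum>j<3. koszul_Q i (?t S j))"
    proof (rule sum.cong)
      fix j
      show "sgl i S (?t (insert i S) j) = koszul_Q i (?t S j)"
      proof (cases "j \<in># a \<and> j \<notin> insert i S")
        case True
        have "koszul_Q i (sgr j S (ksing (insert j S, a - {#j#}))) = sgr j S (sgl i (insert j S) (ksing (insert i (insert j S), a - {#j#})) :: 'f koszul)"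
          using True False by (simp add: sgr_def koszul_Q_sg koszul_Q_single)
        moreover have "sgl i S (sgr j (insert i S) y) = sgr j S (sgl i (insert j S) y)" for y :: "'f koszul"
        proof -
          have j: "j \<notin> S" using True by auto
          show ?thesis
            unfolding sgl_def sgr_def grading.sg_sg[symmetric] card_less_insert[OF fin False] card_less_insert[OF fin j]
            by (rule sg_cong_parity) auto
        qed
        ultimately show ?thesis using True by (simp add: insert_commute)
      next
        case f: False
        then show ?thesis using False
          by (cases "j = i") (auto simp: sgr_def koszul_Q_sg koszul_Q_single sg_0 koszul_Q_0 sgl_lin(3))
      qed
    qed simp
    finally show ?thesis unfolding d koszul_Q_sum .
  qed
qed

lemma koszul_vQ:
  fixes x :: "'f::field koszul"
  assumes i: "i < 3" and x: "x \<in> koszul_comp p s n"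
  shows "koszul_v p j s (n - qdeg p i) (koszul_Q i x) = koszul_Q i (koszul_v p j s n x)"
proof (rule koszul_ext[OF _ _ _ x])
  show "lin_on pm_scale (koszul_comp p s n) pm_scale UNIV (\<lambda>x :: 'f koszul. koszul_v p j s (n - qdeg p i) (koszul_Q i x))"
    by (simp add: lin_on_def lin_onD[OF koszul_Q_lin_on[OF i, of s n]] lin_onD[OF koszul_v_raw_lin[of s "n - qdeg p i"]])
  show "lin_on pm_scale (koszul_comp p s n) pm_scale UNIV (\<lambda>x :: 'f koszul. koszul_Q i (koszul_v p j s n x))"
    by (simp add: lin_on_def koszul_Q_add koszul_Q_scale lin_onD[OF koszul_v_raw_lin[of s n]])
  fix k assume k: "k \<in> kkeys s" "n = - kdeg k"
  obtain S a where k': "k = (S, a)" by (cases k)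
  have fin: "finite S" using k kkeys_finite by (simp add: k')
  have z: "koszul_v p j s (n - qdeg p i) 0 = (0 :: 'f koszul)"
    by (rule lin_on_zero[OF koszul_v_raw_lin koszul_0_in])
  show "koszul_v p j s (n - qdeg p i) (koszul_Q i (ksing k)) = koszul_Q i (koszul_v p j s n (ksing k :: 'f koszul))"
  proof (cases "i \<in> S")
    case True
    then show ?thesis using k z by (simp add: k' koszul_Q_single koszul_v_single koszul_Q_0)
  next
    case False
    have key: "(insert i S, a) \<in> kkeys s" "n - qdeg p i = - kdeg (insert i S, a)"
      using k i False fin by (auto simp: k' kkeys_def kdeg_insert)
    have "koszul_v p j s (n - qdeg p i) (sgl i S (ksing (insert i S, a))) = sgl i S (koszul_v p j s (n - qdeg p i) (ksing (insert i S, a)) :: 'f koszul)"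
      by (simp add: sgl_def sg_def lin_on_neg[OF vector_space_pm koszul_sub koszul_v_raw_lin koszul_single_in[OF key]])
    also have "\<dots> = sgl i S (if j \<in># a then ksing (insert i S, a - {#j#}) else 0)"
      unfolding koszul_v_single[OF key] ..
    finally show ?thesis using False k by (simp add: k' koszul_Q_single koszul_v_single koszul_Q_0 sgl_lin)
  qed
qed

lemma koszul_d_Hom: "koszul_d p (s + 1) \<in> Hom_E p (koszul_mod p (s + 1)) (koszul_mod p s :: ('f::field, 'f koszul) emod) 0"
proof -
  have "koszul_d p (s + 1) n x = 0" if "x \<notin> koszul_comp p (s + 1) n" for n and x :: "'f koszul"
    using that by (simp add: koszul_d_def)
  then show ?thesis
    by (simp add: Hom_E_def lin_maps_def koszul_sel koszul_d_lin koszul_dQ)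
qed

lemma koszul_v_Hom:
  assumes "i < 3"
  shows "koszul_v p i (s + 1) \<in> Hom_E p (koszul_mod p (s + 1)) (koszul_mod p s :: ('f::field, 'f koszul) emod) (qdeg p i)"
proof -
  have "koszul_v p i (s + 1) n x = 0" if "x \<notin> koszul_comp p (s + 1) n" for n and x :: "'f koszul"
    using that by (simp add: koszul_v_def)
  then show ?thesis
    by (simp add: Hom_E_def lin_maps_def koszul_sel koszul_v_lin[OF assms] koszul_vQ)
qed

lemma Hom_E_comp:
  fixes K :: "('f::field, 'a::ab_group_add) emod" and L :: "('f, 'b::ab_group_add) emod" and N :: "('f, 'c::ab_group_add) emod"
  assumes g: "g \<in> Hom_E p K L a" and f: "f \<in> Hom_E p L N b" and L: "E2_module p L"
  shows "(\<lambda>n x. f (n + a) (g n x)) \<in> Hom_E p K N (b + a)"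
proof -
  have f0: "f n 0 = 0" for n
    using lin_on_zero[OF Hom_E_D(1)[OF f] subspace_zero[OF E2_vs[OF L] E2_sub[OF L]]] .
  have "lin_on (escale K) (ecomp K n) (escale N) (ecomp N (n + (b + a))) (\<lambda>x. f (n + a) (g n x))" for n
    using lin_onD[OF Hom_E_D(1)[OF g, of n]] lin_onD[OF Hom_E_D(1)[OF f, of "n + a"]] by (simp add: lin_on_def add_ac)
  moreover have "f (n - qdeg p i + a) (g (n - qdeg p i) (eact K i n x)) = eact N i (n + (b + a)) (f (n + a) (g n x))"
    if "i < 3" "x \<in> ecomp K n" for i n x
    using Hom_E_D(4)[OF g that] Hom_E_D(4)[OF f that(1) Hom_E_D(2)[OF g that(2)]] by (simp add: algebra_simps)
  ultimately show ?thesis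
    using Hom_E_D(3)[OF g] f0 by (simp add: Hom_E_def lin_maps_def)
qed

section \<open>Elements of G(M) through their values on divided powers\<close>

lemma G_sel: "dscale (G_functor p M) = (\<lambda>c f n x. escale M c (f n x))" "dcomp (G_functor p M) u t = Hom_E p (koszul_mod p u) M t"
  "diff (G_functor p M) u t = (\<lambda>f n x. f n (koszul_d p (u + 1) n x))"
  "vact (G_functor p M) i u t = (\<lambda>f n x. f (n + qdeg p i) (koszul_v p i (u + 1) n x))"
  by (simp_all add: G_functor_def)

text \<open>The isomorphism from degree \<open>u\<close> of \<open>G(M)\<close> to degree
  \<open>u\<close> of \<open>Pres M\<close>: the value at \<open>1 \<otimes> \<gamma>_a\<close>
  becomes the coefficient of the monomial indexed by \<open>a\<close>.\<close>

definition kth :: "int \<Rightarrow> (int \<Rightarrow> 'f::field koszul \<Rightarrow> 'a::zero) \<Rightarrow> nat multiset \<Rightarrow> 'a" where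
  "kth u f = (\<lambda>a. if a \<in> mkeys u then f (- mdeg a) (ksing ({}, a)) else 0)"

context
  fixes M :: "('f::field, 'a::ab_group_add) emod"
  assumes M: "E2_module p M"
begin

abbreviation GC :: "int \<Rightarrow> int \<Rightarrow> (int \<Rightarrow> 'f koszul \<Rightarrow> 'a) set" where
  "GC u t \<equiv> Hom_E p (koszul_mod p u) M t"

lemma GC_d: "f \<in> GC u t \<Longrightarrow> (\<lambda>n x. f n (koszul_d p (u + 1) n x)) \<in> GC (u + 1) t"
  using Hom_E_comp[OF koszul_d_Hom _ E2_koszul, of f u M t] by simp

lemma GC_v: "f \<in> GC u t \<Longrightarrow> i < 3 \<Longrightarrow> (\<lambda>n x. f (n + qdeg p i) (koszul_v p i (u + 1) n x)) \<in> GC (u + 1) (t + qdeg p i)"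
  using Hom_E_comp[OF koszul_v_Hom _ E2_koszul, of i f u M t] by simp

lemma GC_sub: "module.subspace (\<lambda>c f n x. escale M c (f n x)) (GC u t)" (is "module.subspace ?s _")
  and GC_vs: "vector_space (\<lambda>c f (n::int) (x :: 'f koszul). escale M c (f n x))"
proof -
  show vs: "vector_space (\<lambda>c f (n::int) (x :: 'f koszul). escale M c (f n x))"
    by (rule vector_space_fun[OF vector_space_fun[OF E2_vs[OF M]]])
  interpret V: vector_space "\<lambda>c f (n::int) (x :: 'f koszul). escale M c (f n x)" by (rule vs)
  interpret E: vector_space "escale M" by (rule E2_vs[OF M])
  show "module.subspace ?s (GC u t)"
  proof (rule V.subspaceI)
    show "0 \<in> GC u t" by (auto simp: Hom_E_def lin_maps_def lin_on_def M_closed[OF M] Q_zero[OF M])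
    fix f assume f: "f \<in> GC u t"
    show "(\<lambda>n x. escale M c (f n x)) \<in> GC u t" for c
      using Hom_E_D[OF f] lin_onD[OF Hom_E_D(1)[OF f]]
      by (auto simp: Hom_E_def lin_maps_def lin_on_def M_closed(7)[OF M] E.scale_right_distrib Q_lin(6)[OF M] mult.commute)
    fix g assume g: "g \<in> GC u t"
    show "f + g \<in> GC u t"
      using Hom_E_D[OF f] lin_onD[OF Hom_E_D(1)[OF f]] Hom_E_D[OF g] lin_onD[OF Hom_E_D(1)[OF g]]
      by (auto simp: Hom_E_def lin_maps_def lin_on_def M_closed(2)[OF M] E.scale_right_distrib Q_lin(1)[OF M])
  qed
qed

lemma GC_lin0: "f \<in> GC u t \<Longrightarrow> f n 0 = 0"
  using lin_on_zero[OF Hom_E_D(1)[of f "koszul_mod p u" M t n]] by (simp add: koszul_sel koszul_0_in)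

lemma GC_sum:
  assumes "f \<in> GC u t" "\<And>i. i \<in> A \<Longrightarrow> g i \<in> koszul_comp p u n"
  shows "f n (\<Sum>i\<in>A. g i) = (\<Sum>i\<in>A. f n (g i))"
  using lin_on_sum[OF vector_space_pm koszul_sub Hom_E_D(1)[OF assms(1), of n, unfolded koszul_sel] assms(2)] .

lemma kth_in:
  assumes f: "f \<in> GC u t"
  shows "kth u f \<in> gco (Pres M) u t"
proof (rule Pres_I[OF M])
  fix a assume a: "a \<in> mkeys u"
  then show "kth u f a \<in> ecomp M (t - mdeg a)"
    using Hom_E_D(2)[OF f, of "ksing ({}, a)" "- mdeg a"] ksing_gen_in[OF M a] by (simp add: kth_def koszul_sel add.commute)
qed (simp add: kth_def)

lemma kth_inj: "f \<in> GC u t \<Longrightarrow> g \<in> GC u t \<Longrightarrow> kth u f = kth u g \<Longrightarrow> f = g"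
  by (rule Hom_koszul_eqI[OF M]) (auto simp: kth_def fun_eq_iff split: if_splits dest: spec)

lemma kth_surj: "x \<in> gco (Pres M) u t \<Longrightarrow> \<exists>f\<in>GC u t. kth u f = x"
  using Hom_koszul_ex[OF M, of x u t] Pres_D(2)[OF M, of x u t] by (auto simp: kth_def fun_eq_iff)

lemma kth_lin: "kth u (f + g) = kth u f + kth u (g :: int \<Rightarrow> 'f koszul \<Rightarrow> 'a)"
  "kth u (\<lambda>n x. escale M c (f n x)) = (\<lambda>a. escale M c (kth u f a))"
  by (auto simp: kth_def fun_eq_iff escale_lin[OF M])

lemma mkeys_kkeys: "a \<in> mkeys u \<longleftrightarrow> ({}, a) \<in> kkeys u"
  by (simp add: mkeys_def kkeys_def)

text \<open>The differential of \<open>1 \<otimes> \<gamma>_a\<close> is the sum of the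
  \<open>Q_i\<close> times the generators with one \<open>i\<close> removed from \<open>a\<close>,
  and linearity of \<open>f\<close> pulls \<open>Q_i\<close> out. This is the origin of the
  differential of \<open>Pres M\<close>.\<close>

lemma kth_d:
  assumes f: "f \<in> GC u t"
  shows "kth (u + 1) (\<lambda>n x. f n (koszul_d p (u + 1) n x)) = gd (Pres M) u t (kth u f)"
proof
  fix a
  show "kth (u + 1) (\<lambda>n x. f n (koszul_d p (u + 1) n x)) a = gd (Pres M) u t (kth u f) a"
  proof (cases "a \<in> mkeys (u + 1)")
    case False
    then show ?thesis using Pres_D(2)[OF M Pres_d_in[OF M kth_in[OF f]] False] by (simp add: kth_def)
  next
    case True
    let ?T = "\<lambda>i. if i \<in># a then ksing ({i}, a - {#i#}) else 0 :: 'f koszul"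
    have key: "({}, a - {#i#}) \<in> kkeys u" if "i \<in># a" "i < 3" for i
      using kkeys_remove_mset[OF that, of "{}" u] True by (simp add: mkeys_kkeys)
    have sgr0: "sgr i {} y = y" for i and y :: "'f koszul" by (simp add: sgr_def)
    have d: "koszul_d p (u + 1) (- mdeg a) (ksing ({}, a)) = (\<Sum>i<3. ?T i)"
      using True by (subst koszul_d_single) (simp_all add: mkeys_kkeys kdeg_empty sgr0 cong: if_cong)
    have TQ: "?T i = koszul_Q i (ksing ({}, a - {#i#}))" "ksing ({}, a - {#i#}) \<in> (koszul_comp p u (- mdeg (a - {#i#})) :: 'f koszul set)"
      if "i \<in># a" "i < 3" for i
      using that key[OF that] by (auto simp: koszul_Q_single sgl_def kdeg_empty intro!: koszul_single_in)
    have Tin: "?T i \<in> koszul_comp p u (- mdeg a)" if "i < 3" for i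
    proof (cases "i \<in># a")
      case True
      then show ?thesis using lin_onD(1)[OF koszul_Q_lin_on[OF that, of u "- mdeg (a - {#i#})"] TQ(2)[OF True that]] TQ(1)[OF True that]
        by (simp add: mdeg_remove)
    qed (simp add: koszul_0_in)
    have fT: "f (- mdeg a) (?T i) = (if i \<in># a then eact M i (t - mdeg (a - {#i#})) (kth u f (a - {#i#})) else 0)" if i: "i < 3" for i
    proof (cases "i \<in># a")
      case ia: True
      have "f (- mdeg (a - {#i#}) - qdeg p i) (koszul_Q i (ksing ({}, a - {#i#}))) = eact M i (- mdeg (a - {#i#}) + t) (f (- mdeg (a - {#i#})) (ksing ({}, a - {#i#})))"
        using Hom_E_D(4)[OF f i, of "ksing ({}, a - {#i#})" "- mdeg (a - {#i#})"] TQ(2)[OF ia i] by (simp add: koszul_sel)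
      moreover have "a - {#i#} \<in> mkeys u" using key[OF ia i] by (simp add: mkeys_kkeys)
      ultimately show ?thesis using ia TQ(1)[OF ia i] by (simp add: kth_def mdeg_remove algebra_simps)
    qed (simp add: GC_lin0[OF f])
    have "kth (u + 1) (\<lambda>n x. f n (koszul_d p (u + 1) n x)) a = f (- mdeg a) (\<Sum>i<3. ?T i)"
      using True d by (simp add: kth_def)
    also have "\<dots> = (\<Sum>i<3. f (- mdeg a) (?T i))" by (rule GC_sum[OF f]) (use Tin in simp)
    also have "\<dots> = gd (Pres M) u t (kth u f) a" unfolding Pres_sel by (rule sum.cong) (use fT in simp_all)
    finally show ?thesis .
  qed
qed

lemma kth_v:
  assumes f: "f \<in> GC u t" and i: "i < 3"
  shows "kth (u + 1) (\<lambda>n x. f (n + qdeg p i) (koszul_v p i (u + 1) n x)) = gop (Pres M) i u t (kth u f)"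
proof
  fix a
  show "kth (u + 1) (\<lambda>n x. f (n + qdeg p i) (koszul_v p i (u + 1) n x)) a = gop (Pres M) i u t (kth u f) a"
  proof (cases "a \<in> mkeys (u + 1)")
    case False
    then show ?thesis using Pres_D(2)[OF M Pres_op_in[OF M kth_in[OF f] i] False] by (simp add: kth_def)
  next
    case True
    have v: "koszul_v p i (u + 1) (- mdeg a) (ksing ({}, a)) = (if i \<in># a then ksing ({}, a - {#i#}) else 0 :: 'f koszul)"
      using True by (intro koszul_v_single) (simp_all add: mkeys_kkeys kdeg_empty)
    have "a - {#i#} \<in> mkeys u" if "i \<in># a" using mkeys_remove[OF that i] True by simp
    then show ?thesis using True by (simp add: kth_def v Pres_sel mdeg_remove GC_lin0[OF f])
  qed
qed

text \<open>The relations between the operations are not checked on the Koszul complex: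
  \<open>kth\<close> is injective and compatible with the operations, so they are inherited from
  \<open>Pres M\<close>.\<close>

lemma gmodule_G: "P.gmodule (gP (G_functor p M))"
  unfolding P.gmodule_def gP_sel G_sel if_False
proof (intro conjI allI impI ballI)
  fix u t
  show "vector_space (\<lambda>c f (n::int) (x :: 'f koszul). escale M c (f n x))" by (rule GC_vs)
  show "module.subspace (\<lambda>c f n x. escale M c (f n x)) (GC u t)" by (rule GC_sub)
  show "lin_on (\<lambda>c f n x. escale M c (f n x)) (GC u t) (\<lambda>c f n x. escale M c (f n x)) (GC (u + 1) t)
     (\<lambda>f n x. f n (koszul_d p (u + 1) n x))"
    using GC_d by (intro E.lin_onI) (auto simp: fun_eq_iff)
  fix f assume f: "f \<in> GC u t"
  note PM = gmodule_Pres[OF M]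
  show "(\<lambda>n x. f n (koszul_d p (u + 1) n (koszul_d p (u + 1 + 1) n x))) = 0"
  proof (rule kth_inj)
    show "(\<lambda>n x. f n (koszul_d p (u + 1) n (koszul_d p (u + 1 + 1) n x))) \<in> GC (u + 1 + 1) t" by (rule GC_d[OF GC_d[OF f]])
    show "0 \<in> GC (u + 1 + 1) t" by (rule subspace_zero[OF GC_vs GC_sub])
    have "kth (u + 1 + 1) (\<lambda>n x. f n (koszul_d p (u + 1) n (koszul_d p (u + 1 + 1) n x))) = 0"
      using kth_d[OF GC_d[OF f]] kth_d[OF f] P.gmodule_dd[OF PM kth_in[OF f]] by simp
    then show "kth (u + 1 + 1) (\<lambda>n x. f n (koszul_d p (u + 1) n (koszul_d p (u + 1 + 1) n x))) = kth (u + 1 + 1) (0 :: int \<Rightarrow> 'f koszul \<Rightarrow> 'a)"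
      by (simp add: kth_def fun_eq_iff)
  qed
next
  fix i :: nat and u t assume i: "i < 3"
  note PM = gmodule_Pres[OF M]
  show "lin_on (\<lambda>c f n x. escale M c (f n x)) (GC u t) (\<lambda>c f n x. escale M c (f n x)) (GC (u + 1) (t + qdeg p i))
     (\<lambda>f n x. f (n + qdeg p i) (koszul_v p i (u + 1) n x))"
    using GC_v[OF _ i] by (intro E.lin_onI) (auto simp: fun_eq_iff)
  fix f assume f: "f \<in> GC u t"
  show "(\<lambda>n x. f (n + qdeg p i) (koszul_v p i (u + 1) n (koszul_d p (u + 1 + 1) n x))) =
     (\<lambda>n x. f (n + qdeg p i) (koszul_d p (u + 1) (n + qdeg p i) (koszul_v p i (u + 1 + 1) n x)))"
  proof (rule kth_inj)
    show "(\<lambda>n x. f (n + qdeg p i) (koszul_v p i (u + 1) n (koszul_d p (u + 1 + 1) n x))) \<in> GC (u + 1 + 1) (t + qdeg p i)"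
      by (rule GC_d[OF GC_v[OF f i]])
    show "(\<lambda>n x. f (n + qdeg p i) (koszul_d p (u + 1) (n + qdeg p i) (koszul_v p i (u + 1 + 1) n x))) \<in> GC (u + 1 + 1) (t + qdeg p i)"
      by (rule GC_v[OF GC_d[OF f] i])
    show "kth (u + 1 + 1) (\<lambda>n x. f (n + qdeg p i) (koszul_v p i (u + 1) n (koszul_d p (u + 1 + 1) n x))) =
       kth (u + 1 + 1) (\<lambda>n x. f (n + qdeg p i) (koszul_d p (u + 1) (n + qdeg p i) (koszul_v p i (u + 1 + 1) n x)))"
      using kth_d[OF GC_v[OF f i]] kth_v[OF f i] kth_v[OF GC_d[OF f] i] kth_d[OF f] P.gmodule_dop[OF PM i kth_in[OF f]] by simp
  qed
next
  fix i j :: nat and u t f assume ij: "i < 3" "j < 3" and f: "f \<in> GC u t"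
  note PM = gmodule_Pres[OF M]
  let ?L = "\<lambda>i j n x. f (n + qdeg p i + qdeg p j) (koszul_v p j (u + 1) (n + qdeg p i) (koszul_v p i (u + 1 + 1) n x))"
  have in': "?L i j \<in> GC (u + 1 + 1) (t + qdeg p i + qdeg p j)" if "i < 3" "j < 3" for i j
    using GC_v[OF GC_v[OF f that(2)] that(1)] by (simp add: add_ac)
  have "kth (u + 1 + 1) (?L i j) = gop (Pres M) i (u + 1) (t + qdeg p j) (gop (Pres M) j u t (kth u f))" if "i < 3" "j < 3" for i j
    using kth_v[OF GC_v[OF f that(2)] that(1)] kth_v[OF f that(2)] by simp
  then have "kth (u + 1 + 1) (?L i j) = kth (u + 1 + 1) (?L j i)"
    using P.gmodule_opop[OF PM ij kth_in[OF f]] ij by simp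
  then have "?L i j = ?L j i" using in'[OF ij] in'[OF ij(2,1)] by (intro kth_inj) (simp_all add: add_ac)
  then show "?L i j = ?L j i" .
qed simp

text \<open>\<open>kth\<close> is bijective in each bidegree, and its inverse is the required
  map.\<close>

lemma G_model: "\<exists>e. P.gquasi_iso (Pres M) (gP (G_functor p M)) e"
proof -
  let ?e = "\<lambda>u t f. if f \<in> GC u t then kth u f else 0"
  have h: "?e \<in> P.ghom (gP (G_functor p M)) (Pres M) 0 0"
  proof (rule P.ghomI)
    fix u t
    show "lin_on (gsc (gP (G_functor p M)) u) (gco (gP (G_functor p M)) u t) (gsc (Pres M) (u + 0)) (gco (Pres M) (u + 0) (t + 0)) (?e u t)"
      using subspace_add[OF GC_vs GC_sub, of _ u t] subspace_scale[OF GC_vs GC_sub, of _ u t] kth_in[of _ u t]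
      by (intro E.lin_onI) (auto simp: G_sel kth_lin Pres_sel(1))
    show "?e u t f = 0" if "f \<notin> gco (gP (G_functor p M)) u t" for f using that by (simp add: G_sel)
    fix i :: nat and f assume "i < 3" "f \<in> gco (gP (G_functor p M)) u t"
    then show "?e (u + 1) (t + qdeg p i) (gop (gP (G_functor p M)) i u t f) = gop (Pres M) i (u + 0) (t + 0) (?e u t f)"
      using GC_v[of f u t i] kth_v[of f u t i] by (simp add: G_sel)
  qed
  have D: "gD (gP (G_functor p M)) (Pres M) 0 0 ?e = 0"
  proof (rule ext, rule ext, rule ext)
    fix u t f
    show "gD (gP (G_functor p M)) (Pres M) 0 0 ?e u t f = 0 u t f"
      using GC_d[of f u t] kth_d[of f u t] by (simp add: gD_def G_sel)
  qed
  have "bij_betw (?e u t) (gco (gP (G_functor p M)) u t) (gco (Pres M) u t)" for u t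
    unfolding bij_betw_def
  proof
    show "inj_on (?e u t) (gco (gP (G_functor p M)) u t)" using kth_inj by (auto simp: inj_on_def G_sel)
    show "?e u t ` gco (gP (G_functor p M)) u t = gco (Pres M) u t"
      using kth_in kth_surj by (fastforce simp: G_sel image_iff)
  qed
  from P.gquasi_iso_bij[OF gmodule_G gmodule_Pres[OF M] h D this] show ?thesis .
qed

end

end

section \<open>Comparison of the two Hom complexes\<close>

lemma sgl_insert: "sgl i (insert i S) y = sgl i S y"
proof -
  have "{j \<in> insert i S. j < i} = {j \<in> S. j < i}" by auto
  then show ?thesis by (simp only: sgl_def)
qed

lemma sgr_insert: "sgr i (insert i S) y = sgr i S y"
proof -
  have "{j \<in> insert i S. i < j} = {j \<in> S. i < j}" by auto
  then show ?thesis by (simp only: sgr_def)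
qed

context exterior
begin

lemma gop_Eres_delta0: "i \<in> S \<Longrightarrow> gop (Eres M) i u n (delta (S, a) y) = 0"
proof
  fix k :: kkey assume "i \<in> S"
  obtain T c where k: "k = (T, c)" by (cases k)
  have "T - {i} \<noteq> S" using \<open>i \<in> S\<close> by auto
  then show "gop (Eres M) i u n (delta (S, a) y) k = 0 k"
    by (auto simp: k Eres_sel delta_def sgl_lin(3))
qed

context
  fixes L :: "('f::field, 'a::ab_group_add) emod"
  assumes L: "E2_module p L"
begin

text \<open>The elements \<open>Q_S \<otimes> \<gamma>_a \<otimes> y\<close> span the resolution, so
  identities between linear maps on it can be tested there.\<close>

lemma Eres_ext:
  fixes F G :: "(kkey \<Rightarrow> 'a) \<Rightarrow> 'b::ab_group_add"
  assumes F: "lin_on (gsc (Eres L) v) (gco (Eres L) v n) s W F" and G: "lin_on (gsc (Eres L) v) (gco (Eres L) v n) s W' G"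
    and eq: "\<And>S a y. (S, a) \<in> kkeys (- v) \<Longrightarrow> y \<in> ecomp L (n + kdeg (S, a)) \<Longrightarrow> F (delta (S, a) y) = G (delta (S, a) y)"
    and x: "x \<in> gco (Eres L) v n"
  shows "F x = G x"
proof -
  note R = gmodule_Eres[OF L]
  let ?T = "{delta k y | k y. k \<in> kkeys (- v) \<and> y \<in> ecomp L (n + kdeg k)}"
  interpret vector_space "gsc (Eres L) v" by (rule E.gmodule_vs[OF R])
  have x': "x \<in> fun_sub (kkeys (- v)) (\<lambda>k. ecomp L (n + kdeg k))" using x by (simp add: Eres_sel)
  show ?thesis
  proof (rule lin_on_eq_on_span[OF E.gmodule_vs[OF R] E.gmodule_sub[OF R] F G])
    show "?T \<subseteq> gco (Eres L) v n" using Eres_delta_in[OF L] by auto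
    show "F z = G z" if z: "z \<in> ?T" for z
    proof -
      obtain k y where "z = delta k y" "k \<in> kkeys (- v)" "y \<in> ecomp L (n + kdeg k)" using z by auto
      then show ?thesis using eq[of "fst k" "snd k" y] by simp
    qed
    have "x = (\<Sum>k\<in>kkeys (- v). delta k (x k))"
      by (rule fun_sum_delta[OF finite_kkeys]) (rule RC_D(2)[OF L x'])
    also have "\<dots> \<in> span ?T"
      by (intro span_sum span_base) (auto intro: RC_D(1)[OF L x'])
    finally show "x \<in> span ?T" .
  qed
qed

text \<open>The differential, defined on coefficients, is turned into its effect on
  \<open>Q_S \<otimes> \<gamma>_a \<otimes> y\<close>: the first sum moves an index from
  \<open>\<gamma>_a\<close> into \<open>Q_S\<close>, the second lets it act on
  \<open>y\<close>.\<close>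

lemma gd_Eres_delta:
  assumes k: "(S, a) \<in> kkeys (- v)" and y: "y \<in> ecomp L (n + kdeg (S, a))"
  shows "gd (Eres L) v n (delta (S, a) y) =
    (\<Sum>i<3. if i \<in># a \<and> i \<notin> S then delta (insert i S, a - {#i#}) (sgr i S y) else 0) +
    (\<Sum>i<3. if i \<in># a then delta (S, a - {#i#}) (sg v (eact L i (n + kdeg (S, a)) y)) else 0)"
proof
  fix K :: kkey
  obtain T c where K: "K = (T, c)" by (cases K)
  have sum3: "(\<Sum>i<3. g i) K = (\<Sum>i<3. g i K)" for g :: "nat \<Rightarrow> kkey \<Rightarrow> 'a"
    by (simp add: numeral_3_eq_3 lessThan_Suc)
  have c: "add_mset i c = a \<longleftrightarrow> i \<in># a \<and> c = a - {#i#}" for i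
    by (metis add_mset_remove_trivial insert_DiffM union_single_eq_member)
  have T: "i \<in> T \<and> T - {i} = S \<longleftrightarrow> i \<notin> S \<and> T = insert i S" for i by auto
  have 0: "(if i \<in> T then sgr i T (delta (S, a) y (T - {i}, add_mset i c)) else 0) =
      (if i \<in># a \<and> i \<notin> S then delta (insert i S, a - {#i#}) (sgr i S y) else 0) K" for i
  proof (cases "i \<in> T \<and> T - {i} = S \<and> add_mset i c = a")
    case True
    then have "i \<notin> S" "T = insert i S" "i \<in># a" "c = a - {#i#}" using T[of i] c[of i] by auto
    then show ?thesis using True by (simp add: K delta_def sgr_insert)
  next
    case False
    then have "\<not> (i \<in># a \<and> i \<notin> S \<and> T = insert i S \<and> c = a - {#i#})" using T[of i] c[of i] by blast
    then show ?thesis using False by (auto simp: K delta_def sgr_lin(3))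
  qed
  have 1: "sg v (eact L i (n + kdeg (T, add_mset i c)) (delta (S, a) y (T, add_mset i c))) =
      (if i \<in># a then delta (S, a - {#i#}) (sg v (eact L i (n + kdeg (S, a)) y)) else 0) K" if i: "i < 3" for i
  proof (cases "T = S \<and> add_mset i c = a")
    case True
    then have "i \<in># a" "c = a - {#i#}" using c[of i] by auto
    then show ?thesis using True by (simp add: K delta_def)
  next
    case False
    then have "\<not> (i \<in># a \<and> T = S \<and> c = a - {#i#})" using c[of i] by blast
    then show ?thesis using False by (auto simp: K delta_def Q_zero[OF L i] sg_0)
  qed
  have "gd (Eres L) v n (delta (S, a) y) K = kz0 (delta (S, a) y) K + sg v (kz1 L n (delta (S, a) y) K)"
    using Eres_sel(3)[OF Eres_delta_in[OF L k y]] by simp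
  also have "sg v (kz1 L n (delta (S, a) y) K) = (\<Sum>i<3. sg v (eact L i (n + kdeg (T, add_mset i c)) (delta (S, a) y (T, add_mset i c))))"
    by (simp add: kz1_def K sg_sum)
  also have "\<dots> = (\<Sum>i<3. (if i \<in># a then delta (S, a - {#i#}) (sg v (eact L i (n + kdeg (S, a)) y)) else 0) K)"
    by (rule sum.cong) (use 1 in simp_all)
  also have "kz0 (delta (S, a) y) K = (\<Sum>i<3. (if i \<in># a \<and> i \<notin> S then delta (insert i S, a - {#i#}) (sgr i S y) else 0) K)"
    unfolding K kz0_def prod.case unfolding K[symmetric] by (rule sum.cong) (use 0 in simp_all)
  finally show "gd (Eres L) v n (delta (S, a) y) K =
    ((\<Sum>i<3. if i \<in># a \<and> i \<notin> S then delta (insert i S, a - {#i#}) (sgr i S y) else 0) +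
    (\<Sum>i<3. if i \<in># a then delta (S, a - {#i#}) (sg v (eact L i (n + kdeg (S, a)) y)) else 0)) K"
    by (simp only: sum3 plus_fun_apply)
qed

end

text \<open>
  The adjunction \<open>Hom\<^sub>P(P(2) \<otimes> L, Hom\<^sub>E(K, N)) \<cong> Hom\<^sub>E(K \<otimes> L, N)\<close>. In bidegrees, \<open>Q\<^sub>S \<otimes> \<gamma>\<^sub>a\<close> has degree
  \<open>- kdeg (S, a)\<close> in \<open>K\<close>.
\<close>

definition hom_compare :: "('f, 'a::ab_group_add) emod \<Rightarrow> int \<Rightarrow> (int \<Rightarrow> int \<Rightarrow> (nat multiset \<Rightarrow> 'a) \<Rightarrow> int \<Rightarrow> 'f::field koszul \<Rightarrow> 'b::ab_group_add) \<Rightarrow>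
    int \<Rightarrow> (kkey \<Rightarrow> 'a) \<Rightarrow> 'b" where
  "hom_compare L u f = (\<lambda>n x. if x \<in> gco (Eres L) (- u) n
     then \<Sum>k\<in>kkeys u. f 0 (n + kdeg k) (delta {#} (x k)) (- kdeg k) (ksing k) else 0)"

context
  fixes L :: "('f::field, 'a::ab_group_add) emod" and N :: "('f, 'b::ab_group_add) emod"
  assumes L: "E2_module p L" and N: "E2_module p N"
begin

abbreviation "PHom \<equiv> P.ghom (Pres L) (gP (G_functor p N))"
abbreviation "EHom u \<equiv> Hom_E p (ofE (Eres L) u) N"

lemma delta0_in: "y \<in> ecomp L m \<Longrightarrow> delta {#} y \<in> gco (Pres L) 0 m"
  by (rule Pres_delta_in[OF L]) (simp_all add: mkeys_def mdeg_def)

lemma f_delta: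
  assumes f: "f \<in> PHom u t" and y: "y \<in> ecomp L m"
  shows "f 0 m (delta {#} y) \<in> Hom_E p (koszul_mod p u) N (m + t)"
    "z \<in> ecomp L m \<Longrightarrow> f 0 m (delta {#} (y + z)) = f 0 m (delta {#} y) + f 0 m (delta {#} z)"
    "f 0 m (delta {#} (escale L c y)) = (\<lambda>n x. escale N c (f 0 m (delta {#} y) n x))"
    "f 0 m (delta {#} (sg b y)) = sg b (f 0 m (delta {#} y))"
    "f 0 m (delta {#} 0) = 0"
proof -
  note PX = gmodule_Pres[OF L]
  have add: "delta {#} (y + z) = delta {#} y + (delta {#} z :: nat multiset \<Rightarrow> 'a)" for y z by (auto simp: delta_def)
  have neg: "delta {#} (sg b y) = sg b (delta {#} y :: nat multiset \<Rightarrow> 'a)" for y by (auto simp: delta_def sg_def)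
  have sc: "delta {#} (escale L c y) = gsc (Pres L) 0 c (delta {#} y)" for c y
    by (auto simp: delta_def Pres_sel(1) escale_lin[OF L])
  show "f 0 m (delta {#} y) \<in> Hom_E p (koszul_mod p u) N (m + t)"
    using P.ghom_in[OF f delta0_in[OF y]] by (simp add: G_sel)
  show "z \<in> ecomp L m \<Longrightarrow> f 0 m (delta {#} (y + z)) = f 0 m (delta {#} y) + f 0 m (delta {#} z)"
    unfolding add by (rule P.ghom_add[OF f delta0_in[OF y] delta0_in])
  show "f 0 m (delta {#} (escale L c y)) = (\<lambda>n x. escale N c (f 0 m (delta {#} y) n x))"
    unfolding sc using P.ghom_sc[OF f delta0_in[OF y], of c] by (simp add: G_sel)
  show "f 0 m (delta {#} (sg b y)) = sg b (f 0 m (delta {#} y))"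
    unfolding neg by (rule P.ghom_lin'(3)[OF PX f delta0_in[OF y]])
  have "delta {#} 0 = (0 :: nat multiset \<Rightarrow> 'a)" by (auto simp: delta_def)
  then show "f 0 m (delta {#} 0) = 0" using P.ghom_zero[OF PX f] by simp
qed

lemma sg_apply: "(sg b g) x = sg b (g x)"
  by (simp add: sg_def)

lemma f_delta_in:
  assumes f: "f \<in> PHom u t" and y: "y \<in> ecomp L (n + kdeg k)" and k: "k \<in> kkeys u"
  shows "f 0 (n + kdeg k) (delta {#} y) (- kdeg k) (ksing k) \<in> ecomp N (n + t)"
  using Hom_E_D(2)[OF f_delta(1)[OF f y], of "ksing k" "- kdeg k"] koszul_single_in[OF k, of "- kdeg k"]
  by (simp add: koszul_sel add_ac)

text \<open>On \<open>Q_S \<otimes> \<gamma>_a \<otimes> y\<close> the comparison is plain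
  adjunction: \<open>f (1 \<otimes> y)\<close> evaluated at \<open>Q_S \<otimes> \<gamma>_a\<close>.
  Equivariance, bijectivity and compatibility with the differentials are checked through this
  formula.\<close>

lemma hom_compare_delta:
  assumes f: "f \<in> PHom u t" and k: "k \<in> kkeys u" and y: "y \<in> ecomp L (n + kdeg k)"
  shows "hom_compare L u f n (delta k y) = f 0 (n + kdeg k) (delta {#} y) (- kdeg k) (ksing k)"
proof -
  have "delta k y \<in> gco (Eres L) (- u) n" using Eres_delta_in[OF L _ y, of "- u"] k by simp
  then have "hom_compare L u f n (delta k y) = (\<Sum>k'\<in>kkeys u. f 0 (n + kdeg k') (delta {#} (delta k y k')) (- kdeg k') (ksing k'))"
    by (simp add: hom_compare_def)
  also have "\<dots> = (\<Sum>k'\<in>kkeys u. if k' = k then f 0 (n + kdeg k) (delta {#} y) (- kdeg k) (ksing k) else 0)"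
    by (rule sum.cong) (auto simp: delta_def[of k] f_delta(5)[OF f M_closed(1)[OF L]])
  also have "\<dots> = f 0 (n + kdeg k) (delta {#} y) (- kdeg k) (ksing k)"
    using k finite_kkeys by simp
  finally show ?thesis .
qed

lemma hom_compare_lin:
  assumes f: "f \<in> PHom u t"
  shows "lin_on (gsc (Eres L) (- u)) (gco (Eres L) (- u) n) (escale N) (ecomp N (n + t)) (hom_compare L u f n)"
proof (rule E.lin_onI)
  note R = gmodule_Eres[OF L]
  fix x assume x: "x \<in> gco (Eres L) (- u) n"
  then have x': "x \<in> fun_sub (kkeys (- (- u))) (\<lambda>k. ecomp L (n + kdeg k))" by (simp only: Eres_sel)
  have xk: "x k \<in> ecomp L (n + kdeg k)" for k by (rule RC_D(1)[OF L x']) simp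
  show "hom_compare L u f n x \<in> ecomp N (n + t)"
    using x f_delta_in[OF f xk] by (auto simp: hom_compare_def intro: M_sum[OF N])
  show "hom_compare L u f n (gsc (Eres L) (- u) c x) = escale N c (hom_compare L u f n x)" for c
    using x E.gco_closed(6)[OF R x, of c] f_delta(3)[OF f xk] by (simp add: hom_compare_def escale_lin(6)[OF N] Eres_sel(1))
  fix y assume y: "y \<in> gco (Eres L) (- u) n"
  then have y': "y \<in> fun_sub (kkeys (- (- u))) (\<lambda>k. ecomp L (n + kdeg k))" by (simp only: Eres_sel)
  have yk: "y k \<in> ecomp L (n + kdeg k)" for k by (rule RC_D(1)[OF L y']) simp
  show "hom_compare L u f n (x + y) = hom_compare L u f n x + hom_compare L u f n y"
    using x y E.gco_closed(2)[OF R x y] f_delta(2)[OF f xk yk] by (simp add: hom_compare_def sum.distrib)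
qed

lemma hom_compare_out: "x \<notin> gco (Eres L) (- u) n \<Longrightarrow> hom_compare L u f n x = 0"
  by (simp add: hom_compare_def)

lemma ofE_sel: "escale (ofE X s) = gsc X (- s)" "ecomp (ofE X s) n = gco X (- s) n" "eact (ofE X s) i n = gop X i (- s) n"
  by (simp_all add: ofE_def)

text \<open>\<open>E(2)\<close> acts on the Koszul factor of the resolution, where
  \<open>f (1 \<otimes> y)\<close> is linear; the sign from inserting \<open>i\<close> is the same
  in the resolution and in the Koszul complex.\<close>

lemma hom_compare_Hom:
  assumes f: "f \<in> PHom u t"
  shows "hom_compare L u f \<in> EHom u t"
proof -
  note R = gmodule_Eres[OF L]
  have "hom_compare L u f (n - qdeg p i) (gop (Eres L) i (- u) n x) = eact N i (n + t) (hom_compare L u f n x)"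
    if i: "i < 3" and x: "x \<in> gco (Eres L) (- u) n" for i n x
  proof (rule Eres_ext[OF L _ _ _ x])
    have "lin_on (gsc (Eres L) (- u)) (gco (Eres L) (- u) n) (gsc (Eres L) (- u)) (gco (Eres L) (- u) (n - qdeg p i)) (gop (Eres L) i (- u) n)"
      using E.gmodule_op[OF R i, of "- u" n] by simp
    from lin_onD[OF this] lin_onD[OF hom_compare_lin[OF f, of "n - qdeg p i"]]
    show "lin_on (gsc (Eres L) (- u)) (gco (Eres L) (- u) n) (escale N) UNIV (\<lambda>x. hom_compare L u f (n - qdeg p i) (gop (Eres L) i (- u) n x))"
      by (simp add: lin_on_def)
    from lin_onD[OF hom_compare_lin[OF f, of n]] lin_onD[OF E2_lin[OF N i, of "n + t"]]
    show "lin_on (gsc (Eres L) (- u)) (gco (Eres L) (- u) n) (escale N) UNIV (\<lambda>x. eact N i (n + t) (hom_compare L u f n x))"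
      by (simp add: lin_on_def)
    fix S a y assume k: "(S, a) \<in> kkeys (- (- u))" and y: "y \<in> ecomp L (n + kdeg (S, a))"
    have k': "(S, a) \<in> kkeys u" using k by simp
    have fin: "finite S" by (rule kkeys_finite[OF k])
    let ?g = "f 0 (n + kdeg (S, a)) (delta {#} y)"
    have g: "?g \<in> Hom_E p (koszul_mod p u) N (n + kdeg (S, a) + t)" by (rule f_delta(1)[OF f y])
    have "?g (- kdeg (S, a) - qdeg p i) (koszul_Q i (ksing (S, a))) = eact N i (- kdeg (S, a) + (n + kdeg (S, a) + t)) (?g (- kdeg (S, a)) (ksing (S, a)))"
      using Hom_E_D(4)[OF g i, of "ksing (S, a)" "- kdeg (S, a)"] koszul_single_in[OF k', of "- kdeg (S, a)"]
      by (simp add: koszul_sel)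
    then have R: "eact N i (n + t) (hom_compare L u f n (delta (S, a) y)) = ?g (- kdeg (S, a) - qdeg p i) (koszul_Q i (ksing (S, a)))"
      using hom_compare_delta[OF f k' y] by (simp add: algebra_simps)
    show "hom_compare L u f (n - qdeg p i) (gop (Eres L) i (- u) n (delta (S, a) y)) = eact N i (n + t) (hom_compare L u f n (delta (S, a) y))"
    proof (cases "i \<in> S")
      case True
      have "hom_compare L u f (n - qdeg p i) 0 = 0"
        by (rule lin_on_zero[OF hom_compare_lin[OF f] E.gco_closed(1)[OF gmodule_Eres[OF L]]])
      then show ?thesis unfolding R using True by (simp add: gop_Eres_delta0 koszul_Q_single GC_lin0[OF N g])
    next
      case False
      have key: "(insert i S, a) \<in> kkeys u" using k' i by (auto simp: kkeys_def)
      have deg: "kdeg (insert i S, a) = kdeg (S, a) + qdeg p i" by (rule kdeg_insert[OF fin False])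
      have deg': "- (kdeg (S, a) + qdeg p i) = - kdeg (S, a) - qdeg p i" by simp
      have y': "sgl i S y \<in> ecomp L (n - qdeg p i + kdeg (insert i S, a))" using M_closed(5)[OF L y] by (simp add: deg)
      have "hom_compare L u f (n - qdeg p i) (gop (Eres L) i (- u) n (delta (S, a) y)) =
          f 0 (n + kdeg (S, a)) (delta {#} (sgl i S y)) (- kdeg (S, a) - qdeg p i) (ksing (insert i S, a))"
        using hom_compare_delta[OF f key y'] deg' by (simp add: gop_Eres_delta[OF False] sgl_insert deg)
      also have "\<dots> = sgl i S (?g (- kdeg (S, a) - qdeg p i) (ksing (insert i S, a)))"
        using f_delta(4)[OF f y] by (simp add: sgl_def sg_apply)
      also have "\<dots> = ?g (- kdeg (S, a) - qdeg p i) (sgl i S (ksing (insert i S, a)))"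
      proof -
        have "ksing (insert i S, a) \<in> (koszul_comp p u (- kdeg (S, a) - qdeg p i) :: 'f koszul set)"
          by (rule koszul_single_in[OF key]) (simp add: deg)
        then show ?thesis
          using lin_on_neg[OF vector_space_pm koszul_sub Hom_E_D(1)[OF g, unfolded koszul_sel], of "ksing (insert i S, a)"]
          by (simp add: sgl_def sg_def)
      qed
      finally show ?thesis unfolding R using False by (simp add: koszul_Q_single)
    qed
  qed
  then show ?thesis using hom_compare_lin[OF f] by (simp add: Hom_E_def lin_maps_def ofE_sel hom_compare_out)
qed

text \<open>Two layers of freeness: \<open>f\<close> is determined by the maps
  \<open>f (1 \<otimes> b)\<close>, and each of these by its values at the
  \<open>1 \<otimes> \<gamma>_a\<close>.\<close>

lemma hom_compare_inj:
  assumes f: "f \<in> PHom u t" "f' \<in> PHom u t" and eq: "hom_compare L u f = hom_compare L u f'"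
  shows "f = f'"
proof -
  have "\<forall>m. \<exists>B. basis_family (escale L) (ecomp L m) B (\<lambda>b. b)"
    using subspace_basis[OF E2_vs[OF L] E2_sub[OF L]] by blast
  from choice[OF this] obtain Bas where Bas: "\<And>m. basis_family (escale L) (ecomp L m) (Bas m) (\<lambda>b. b)" by blast
  show ?thesis
  proof (rule P.ghom_eqI[OF gfree_Pres[OF L Bas] f])
    fix v m x assume "x \<in> pgens Bas v m"
    then obtain b where b: "v = 0" "x = delta {#} b" "b \<in> Bas m" by (auto simp: pgens_def[OF L] split: if_splits)
    have bL: "b \<in> ecomp L m" using basis_familyD[OF E2_vs[OF L] Bas b(3)] .
    show "f v m x = f' v m x" unfolding b(1,2)
    proof (rule Hom_koszul_eqI[OF N f_delta(1)[OF f(1) bL] f_delta(1)[OF f(2) bL]])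
      fix a assume "a \<in> mkeys u"
      then have k: "({}, a) \<in> kkeys u" by (simp add: mkeys_def kkeys_def)
      have b': "b \<in> ecomp L (m - mdeg a + kdeg ({}, a))" using bL by (simp add: kdeg_empty)
      show "f 0 m (delta {#} b) (- mdeg a) (ksing ({}, a)) = f' 0 m (delta {#} b) (- mdeg a) (ksing ({}, a))"
        using hom_compare_delta[OF f(1) k b'] hom_compare_delta[OF f(2) k b'] eq by (simp add: kdeg_empty)
    qed
  qed
qed

text \<open>The element \<open>\<kappa> \<otimes> b\<close> of the resolution, for
  \<open>\<kappa>\<close> in the Koszul complex.\<close>

definition tz :: "'f koszul \<Rightarrow> 'a \<Rightarrow> kkey \<Rightarrow> 'a" where
  "tz \<kappa> b = (\<lambda>k. escale L (Poly_Mapping.lookup \<kappa> k) b)"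

lemma tz_ksing: "tz (ksing k) b = delta k b"
proof -
  interpret vector_space "escale L" by (rule E2_vs[OF L])
  show ?thesis by (auto simp: tz_def delta_def lookup_single when_def)
qed

lemma tz_in:
  assumes "\<kappa> \<in> koszul_comp p u n" "b \<in> ecomp L m"
  shows "tz \<kappa> b \<in> gco (Eres L) (- u) (n + m)"
proof -
  interpret vector_space "escale L" by (rule E2_vs[OF L])
  have "tz \<kappa> b \<in> fun_sub (kkeys (- (- u))) (\<lambda>k. ecomp L (n + m + kdeg k))"
  proof (rule RC_I[OF L])
    have sub: "Poly_Mapping.keys \<kappa> \<subseteq> KK u n" using assms(1) by (simp add: koszul_comp_eq)
    fix k
    show "tz \<kappa> b k \<in> ecomp L (n + m + kdeg k)"
    proof (cases "k \<in> Poly_Mapping.keys \<kappa>")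
      case True
      then have "n = - kdeg k" using sub by (auto simp: KK_def)
      then show ?thesis using M_closed(7)[OF L assms(2)] by (simp add: tz_def)
    qed (simp add: tz_def in_keys_iff M_closed[OF L])
    assume "k \<notin> kkeys (- (- u))"
    then have "k \<notin> Poly_Mapping.keys \<kappa>" using sub by (auto simp: KK_def)
    then show "tz \<kappa> b k = 0" by (simp add: tz_def in_keys_iff)
  qed
  then show ?thesis by (simp only: Eres_sel)
qed

lemma tz_lin: "tz (\<kappa> + \<kappa>') b = tz \<kappa> b + tz \<kappa>' b" "tz (pm_scale c \<kappa>) b = (\<lambda>k. escale L c (tz \<kappa> b k))"
proof -
  interpret vector_space "escale L" by (rule E2_vs[OF L])
  show "tz (\<kappa> + \<kappa>') b = tz \<kappa> b + tz \<kappa>' b" "tz (pm_scale c \<kappa>) b = (\<lambda>k. escale L c (tz \<kappa> b k))"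
    by (auto simp: tz_def lookup_add scale_left_distrib lookup_pm_scale)
qed

lemma tz_Q:
  assumes \<kappa>: "\<kappa> \<in> koszul_comp p u n"
  shows "tz (koszul_Q i \<kappa>) b = gop (Eres L) i v m (tz \<kappa> b)"
proof (rule koszul_ext[OF _ _ _ \<kappa>])
  show "lin_on pm_scale (koszul_comp p u n) (\<lambda>c x k. escale L c (x k)) UNIV (\<lambda>\<kappa>. tz (koszul_Q i \<kappa>) b)"
    by (simp add: lin_on_def koszul_Q_add koszul_Q_scale tz_lin)
  show "lin_on pm_scale (koszul_comp p u n) (\<lambda>c x k. escale L c (x k)) UNIV (\<lambda>\<kappa>. gop (Eres L) i v m (tz \<kappa> b))"
    by (auto simp: lin_on_def tz_lin Eres_sel fun_eq_iff sgl_lin escale_lin[OF L])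
  fix k assume "k \<in> kkeys u"
  obtain S a where k: "k = (S, a)" by (cases k)
  show "tz (koszul_Q i (ksing k)) b = gop (Eres L) i v m (tz (ksing k) b)"
  proof (cases "i \<in> S")
    case True
    interpret vector_space "escale L" by (rule E2_vs[OF L])
    have "tz 0 b = 0" by (rule ext) (simp add: tz_def)
    then show ?thesis using True by (simp add: k koszul_Q_single tz_ksing gop_Eres_delta0)
  next
    case False
    have "tz (sgl i S \<kappa>) b = (\<lambda>k. sgl i S (tz \<kappa> b k))" for \<kappa>
    proof -
      interpret vector_space "escale L" by (rule E2_vs[OF L])
      show ?thesis by (auto simp: tz_def sgl_def sg_def)
    qed
    moreover have "(\<lambda>k. sgl i S (delta K b k)) = delta K (sgl i S b)" for K :: kkey
      by (auto simp: delta_def sgl_lin(3))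
    ultimately show ?thesis using False by (simp add: k koszul_Q_single tz_ksing gop_Eres_delta sgl_insert)
  qed
qed

text \<open>The preimage of \<open>F\<close> sends \<open>1 \<otimes> b\<close> to the map taking
  \<open>\<kappa>\<close> to \<open>F (\<kappa> \<otimes> b)\<close>, extended by freeness over
  \<open>P(2)\<close>.\<close>

lemma hom_compare_surj:
  assumes F: "F \<in> EHom u t"
  shows "\<exists>f\<in>PHom u t. hom_compare L u f = F"
proof -
  note R = gmodule_Eres[OF L]
  have Flin: "lin_on (gsc (Eres L) (- u)) (gco (Eres L) (- u) n) (escale N) (ecomp N (n + t)) (F n)" for n
    using Hom_E_D(1)[OF F, of n] by (simp add: ofE_sel)
  have FQ: "F (n - qdeg p i) (gop (Eres L) i (- u) n x) = eact N i (n + t) (F n x)" if "i < 3" "x \<in> gco (Eres L) (- u) n" for i n x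
    using Hom_E_D(4)[OF F that(1), of x n] that(2) by (simp add: ofE_sel)
  define g where "g m b = (\<lambda>n \<kappa>. if \<kappa> \<in> koszul_comp p u n then F (n + m) (tz \<kappa> b) else 0)" for m b
  have g: "g m b \<in> Hom_E p (koszul_mod p u) N (m + t)" if b: "b \<in> ecomp L m" for m b
  proof -
    have in': "x + y \<in> koszul_comp p u n" "pm_scale c x \<in> koszul_comp p u n"
      if "x \<in> koszul_comp p u n" "y \<in> koszul_comp p u n" for x y :: "'f koszul" and c n
      using subspace_add[OF vector_space_pm koszul_sub] subspace_scale[OF vector_space_pm koszul_sub] that by blast+
    have "lin_on pm_scale (koszul_comp p u n) (escale N) (ecomp N (n + (m + t))) (g m b n)" for n
    proof (rule E.lin_onI)
      fix \<kappa> :: "'f koszul" assume \<kappa>: "\<kappa> \<in> koszul_comp p u n"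
      show "g m b n \<kappa> \<in> ecomp N (n + (m + t))"
        using lin_onD(1)[OF Flin tz_in[OF \<kappa> b]] \<kappa> by (simp add: g_def add_ac)
      show "g m b n (pm_scale c \<kappa>) = escale N c (g m b n \<kappa>)" for c
        using lin_onD(3)[OF Flin tz_in[OF \<kappa> b], of c] \<kappa> in'[OF \<kappa> \<kappa>] by (simp add: g_def tz_lin Eres_sel(1))
      fix \<kappa>' :: "'f koszul" assume \<kappa>': "\<kappa>' \<in> koszul_comp p u n"
      show "g m b n (\<kappa> + \<kappa>') = g m b n \<kappa> + g m b n \<kappa>'"
        using lin_onD(2)[OF Flin tz_in[OF \<kappa> b] tz_in[OF \<kappa>' b]] \<kappa> \<kappa>' in'[OF \<kappa> \<kappa>'] by (simp add: g_def tz_lin)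
    qed
    moreover have "g m b (n - qdeg p i) (koszul_Q i \<kappa>) = eact N i (n + (m + t)) (g m b n \<kappa>)"
      if i: "i < 3" and \<kappa>: "\<kappa> \<in> koszul_comp p u n" for i n \<kappa>
    proof -
      have "koszul_Q i \<kappa> \<in> koszul_comp p u (n - qdeg p i)" using lin_onD(1)[OF koszul_Q_lin_on[OF i] \<kappa>] .
      then have "g m b (n - qdeg p i) (koszul_Q i \<kappa>) = F (n + m - qdeg p i) (gop (Eres L) i (- u) (n + m) (tz \<kappa> b))"
        using tz_Q[OF \<kappa>, of i b "- u" "n + m"] by (simp add: g_def algebra_simps)
      also have "\<dots> = eact N i (n + m + t) (F (n + m) (tz \<kappa> b))" by (rule FQ[OF i tz_in[OF \<kappa> b]])
      finally show ?thesis using \<kappa> by (simp add: g_def add_ac)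
    qed
    ultimately show ?thesis by (simp add: Hom_E_def lin_maps_def koszul_sel g_def)
  qed
  have "\<forall>m. \<exists>B. basis_family (escale L) (ecomp L m) B (\<lambda>b. b)"
    using subspace_basis[OF E2_vs[OF L] E2_sub[OF L]] by blast
  from choice[OF this] obtain Bas where Bas: "\<And>m. basis_family (escale L) (ecomp L m) (Bas m) (\<lambda>b. b)" by blast
  have BasL: "b \<in> ecomp L m" if "b \<in> Bas m" for b m using basis_familyD[OF E2_vs[OF L] Bas that] .
  define \<phi> where "\<phi> (v::int) m x = g m (x {#})" for v m and x :: "nat multiset \<Rightarrow> 'a"
  have "\<phi> v m x \<in> gco (gP (G_functor p N)) (v + u) (m + t)" if "x \<in> pgens Bas v m" for v m x
    using that g BasL by (auto simp: pgens_def[OF L] \<phi>_def G_sel delta_def split: if_splits)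
  from P.ghom_extend[OF gfree_Pres[OF L Bas] gmodule_G[OF N], of \<phi>, OF this] obtain f where
    f: "f \<in> PHom u t" "\<And>v m x. x \<in> pgens Bas v m \<Longrightarrow> f v m x = \<phi> v m x" by blast
  have fb: "f 0 m (delta {#} b) = g m b" if "b \<in> Bas m" for m b
    using f(2)[of "delta {#} b" 0 m] that by (simp add: pgens_def[OF L] \<phi>_def delta_def)
  have "hom_compare L u f n x = F n x" for n x
  proof (cases "x \<in> gco (Eres L) (- u) n")
    case False
    then show ?thesis using Hom_E_D(3)[OF F, of x n] by (simp add: hom_compare_out ofE_sel)
  next
    case True
    show ?thesis
    proof (rule Eres_ext[OF L hom_compare_lin[OF f(1)] Flin _ True])
      fix S a y assume "(S, a) \<in> kkeys (- (- u))" and y: "y \<in> ecomp L (n + kdeg (S, a))"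
      then have k: "(S, a) \<in> kkeys u" by simp
      let ?m = "n + kdeg (S, a)"
      have l1: "lin_on (escale L) (ecomp L ?m) (escale N) UNIV (\<lambda>y. f 0 ?m (delta {#} y) (- kdeg (S, a)) (ksing (S, a)))"
        using f_delta(2,3)[OF f(1)] by (simp add: lin_on_def)
      have D: "lin_on (escale L) (ecomp L ?m) (gsc (Eres L) (- u)) (gco (Eres L) (- u) n) (delta (S, a))"
      proof (rule E.lin_onI)
        show "delta (S, a) y \<in> gco (Eres L) (- u) n" if "y \<in> ecomp L ?m" for y
          using Eres_delta_in[OF L _ that, of "- u"] k by simp
      qed (auto simp: delta_def Eres_sel escale_lin[OF L])
      have l2: "lin_on (escale L) (ecomp L ?m) (escale N) UNIV (\<lambda>y. F n (delta (S, a) y))"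
        using lin_onD[OF D] lin_onD[OF Flin[of n]] by (simp add: lin_on_def)
      \<comment> \<open>\<open>f\<close> was prescribed only at basis vectors; both sides are linear
        in \<open>y\<close>, so the agreement extends to every \<open>y\<close>.\<close>
      have "f 0 ?m (delta {#} y) (- kdeg (S, a)) (ksing (S, a)) = F n (delta (S, a) y)"
      proof (rule lin_on_eq_on_span[OF E2_vs[OF L] E2_sub[OF L] l1 l2])
        show "Bas ?m \<subseteq> ecomp L ?m" using BasL by auto
        show "y \<in> module.span (escale L) (Bas ?m)" using Bas[of ?m] y by (simp add: basis_family_def)
        fix b assume b: "b \<in> Bas ?m"
        have ksu: "ksing (S, a) \<in> (koszul_comp p u (- kdeg (S, a)) :: 'f koszul set)"
          by (rule koszul_single_in[OF k refl])
        show "f 0 ?m (delta {#} b) (- kdeg (S, a)) (ksing (S, a)) = F n (delta (S, a) b)"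
          using fb[OF b] ksu by (simp add: g_def tz_ksing)
      qed
      then show "hom_compare L u f n (delta (S, a) y) = F n (delta (S, a) y)"
        using hom_compare_delta[OF f(1) k y] by simp
    qed
  qed
  then have "hom_compare L u f = F" by (intro ext) simp
  then show ?thesis using f(1) by blast
qed

text \<open>The terms \<open>A i\<close> come from the Koszul differential and the terms
  \<open>B i\<close> from \<open>v_i \<otimes> Q_i\<close>. The Hom complex gives the sum of the
  \<open>A i\<close> minus \<open>(-1)^u\<close> times that of the \<open>B i\<close>; the
  resolution gives the same because its action part carries the sign of degree
  \<open>- (u + 1)\<close>.\<close>

lemma hom_compare_D:
  assumes f: "f \<in> PHom u t"
  shows "hom_compare L (u + 1) (gD (Pres L) (gP (G_functor p N)) u t f) = (\<lambda>n x. hom_compare L u f n (gd (Eres L) (- (u + 1)) n x))"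
proof -
  note R = gmodule_Eres[OF L] and PX = gmodule_Pres[OF L] and GN = gmodule_G[OF N]
  let ?D = "gD (Pres L) (gP (G_functor p N)) u t f"
  have Df: "?D \<in> PHom (u + 1) t" by (rule P.gD_ghom[OF PX GN f])
  have "hom_compare L (u + 1) ?D n x = hom_compare L u f n (gd (Eres L) (- (u + 1)) n x)" if x: "x \<in> gco (Eres L) (- (u + 1)) n" for n x
  proof (rule Eres_ext[OF L hom_compare_lin[OF Df] _ _ x])
    have "lin_on (gsc (Eres L) (- (u + 1))) (gco (Eres L) (- (u + 1)) n) (gsc (Eres L) (- u)) (gco (Eres L) (- u) n) (gd (Eres L) (- (u + 1)) n)"
      using E.gmodule_d[OF R, of "- (u + 1)" n] by simp
    from lin_onD[OF this] lin_onD[OF hom_compare_lin[OF f, of n]]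
    show "lin_on (gsc (Eres L) (- (u + 1))) (gco (Eres L) (- (u + 1)) n) (escale N) UNIV (\<lambda>x. hom_compare L u f n (gd (Eres L) (- (u + 1)) n x))"
      by (simp add: lin_on_def)
    fix S a y assume k: "(S, a) \<in> kkeys (- (- (u + 1)))" and y: "y \<in> ecomp L (n + kdeg (S, a))"
    have k': "(S, a) \<in> kkeys (u + 1)" using k by (simp only: minus_minus)
    have fin: "finite S" by (rule kkeys_finite[OF k'])
    define m where "m = n + kdeg (S, a)"
    have ym: "y \<in> ecomp L m" using y by (simp add: m_def)
    define g where "g = f 0 m (delta {#} y)"
    have g: "g \<in> Hom_E p (koszul_mod p u) N (m + t)" unfolding g_def by (rule f_delta(1)[OF f ym])
    define A where "A i = (if i \<in># a \<and> i \<notin> S then sgr i S (g (- kdeg (S, a)) (ksing (insert i S, a - {#i#}))) else 0)" for i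
    define B where "B i = (if i \<in># a then f 0 (m - qdeg p i) (delta {#} (eact L i m y)) (- kdeg (S, a) + qdeg p i) (ksing (S, a - {#i#})) else 0)" for i
    have Qy: "eact L i m y \<in> ecomp L (m - qdeg p i)" if "i < 3" for i by (rule Q_in[OF L that ym refl])
    have keyA: "(insert i S, a - {#i#}) \<in> kkeys u" "kdeg (insert i S, a - {#i#}) = kdeg (S, a)"
      if "i < 3" "i \<in># a" "i \<notin> S" for i
      using kkeys_remove_mset[OF that(2,1), of S u] k' that by (auto simp: kkeys_def kdeg_insert[OF fin that(3)] kdeg_remove_mset)
    have keyB: "(S, a - {#i#}) \<in> kkeys u" "kdeg (S, a - {#i#}) = kdeg (S, a) - qdeg p i" if "i < 3" "i \<in># a" for i
      using kkeys_remove_mset[OF that(2,1), of S u] k' that by (auto simp: kdeg_remove_mset)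
    have A: "g (- kdeg (S, a)) (koszul_d p (u + 1) (- kdeg (S, a)) (ksing (S, a))) = (\<Sum>i<3. A i)"
    proof -
      have sA: "g (- kdeg (S, a)) (sgr i S x) = sgr i S (g (- kdeg (S, a)) x)" if "x \<in> koszul_comp p u (- kdeg (S, a))" for i x
        using lin_on_neg[OF vector_space_pm koszul_sub Hom_E_D(1)[OF g, unfolded koszul_sel] that] by (simp add: sgr_def sg_def)
      have inA: "ksing (insert i S, a - {#i#}) \<in> (koszul_comp p u (- kdeg (S, a)) :: 'f koszul set)"
        if "i < 3" "i \<in># a" "i \<notin> S" for i
        by (rule koszul_single_in[OF keyA(1)[OF that]]) (simp add: keyA(2)[OF that])
      have "g (- kdeg (S, a)) (koszul_d p (u + 1) (- kdeg (S, a)) (ksing (S, a))) =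
          (\<Sum>i<3. g (- kdeg (S, a)) (if i \<in># a \<and> i \<notin> S then sgr i S (ksing (insert i S, a - {#i#})) else 0))"
        unfolding koszul_d_single[OF k' refl]
        by (rule GC_sum[OF N g]) (auto intro!: koszul_sgr_in koszul_0_in inA)
      also have "\<dots> = (\<Sum>i<3. A i)"
        by (rule sum.cong) (simp_all add: A_def sA inA GC_lin0[OF N g])
      finally show ?thesis .
    qed
    have B: "f 1 m (gd (Pres L) 0 m (delta {#} y)) (- kdeg (S, a)) (ksing (S, a)) = (\<Sum>i<3. B i)"
    proof -
      \<comment> \<open>\<open>v_i \<otimes> z\<close> is \<open>v_i\<close> applied to
        \<open>1 \<otimes> z\<close>, so the value of \<open>f\<close> there is dictated by
        \<open>P(2)\<close>-linearity.\<close>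
      have dz: "delta {#i#} z = gop (Pres L) i 0 (m - qdeg p i) (delta {#} z)" for i z
        by (simp add: gop_Pres_delta)
      have inB: "delta {#i#} (eact L i m y) \<in> gco (Pres L) 1 m" if "i < 3" for i
        using P.gop_in[OF PX that delta0_in[OF Qy[OF that]]] by (simp add: gop_Pres_delta)
      have sum: "f 1 m (gd (Pres L) 0 m (delta {#} y)) = (\<Sum>i<3. f 1 m (delta {#i#} (eact L i m y)))"
        unfolding gd_Pres_delta[OF L]
        by (rule lin_on_sum[OF P.gmodule_vs[OF PX] P.gmodule_sub[OF PX] P.ghom_lin[OF f, of 1 m]]) (use inB in auto)
      have "f 1 m (gd (Pres L) 0 m (delta {#} y)) (- kdeg (S, a)) (ksing (S, a)) = (\<Sum>i<3. f 1 m (delta {#i#} (eact L i m y)) (- kdeg (S, a)) (ksing (S, a)))"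
        unfolding sum by (simp add: numeral_3_eq_3 lessThan_Suc)
      also have "\<dots> = (\<Sum>i<3. B i)"
      proof (rule sum.cong)
        fix i :: nat assume "i \<in> {..<3}"
        then have i: "i < 3" by simp
        let ?h = "f 0 (m - qdeg p i) (delta {#} (eact L i m y))"
        have h: "?h \<in> Hom_E p (koszul_mod p u) N (m - qdeg p i + t)" by (rule f_delta(1)[OF f Qy[OF i]])
        have "f 1 m (delta {#i#} (eact L i m y)) = (\<lambda>n x. ?h (n + qdeg p i) (koszul_v p i (u + 1) n x))"
          using P.ghom_op[OF f i delta0_in[OF Qy[OF i]]] unfolding dz by (simp add: G_sel)
        then show "f 1 m (delta {#i#} (eact L i m y)) (- kdeg (S, a)) (ksing (S, a)) = B i"
          by (simp add: koszul_v_single[OF k' refl] B_def GC_lin0[OF N h])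
      qed simp
      finally show ?thesis .
    qed
    have "hom_compare L (u + 1) ?D n (delta (S, a) y) = ?D 0 m (delta {#} y) (- kdeg (S, a)) (ksing (S, a))"
      unfolding m_def by (rule hom_compare_delta[OF Df k' y])
    also have "\<dots> = (\<Sum>i<3. A i) - sg u (\<Sum>i<3. B i)"
      using A B by (simp add: gD_def delta0_in[OF ym] G_sel g_def sg_apply)
    finally have lhs: "hom_compare L (u + 1) ?D n (delta (S, a) y) = (\<Sum>i<3. A i) - sg u (\<Sum>i<3. B i)" .
    define w where "w = - (u + 1)"
    let ?a = "\<lambda>i. if i \<in># a \<and> i \<notin> S then delta (insert i S, a - {#i#}) (sgr i S y) else 0"
    let ?b = "\<lambda>i. if i \<in># a then delta (S, a - {#i#}) (sg w (eact L i m y)) else 0"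
    let ?R = "gco (Eres L) (- u) n"
    have ma: "sgr i S y \<in> ecomp L (n + kdeg (insert i S, a - {#i#}))" if "i < 3" "i \<in># a" "i \<notin> S" for i
      using M_closed(6)[OF L ym] by (simp add: keyA(2)[OF that] m_def)
    have mb: "sg c (eact L i m y) \<in> ecomp L (n + kdeg (S, a - {#i#}))" if "i < 3" "i \<in># a" for i c
      using M_closed(4)[OF L Qy[OF that(1)]] by (simp add: keyB(2)[OF that] m_def algebra_simps)
    have a_in: "?a i \<in> ?R" if "i < 3" for i
      using Eres_delta_in[OF L _ ma, of i "- u"] keyA(1)[OF that] that E.gco_closed(1)[OF R] by auto
    have b_in: "?b i \<in> ?R" if i: "i < 3" for i
    proof (cases "i \<in># a")
      case True
      have "delta (S, a - {#i#}) (sg w (eact L i m y)) \<in> ?R"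
        by (rule Eres_delta_in[OF L _ mb[OF i True]]) (use keyB(1)[OF i True] in simp)
      then show ?thesis using True by (simp only: if_True)
    qed (use E.gco_closed(1)[OF R] in simp)
    have k0: "hom_compare L u f n 0 = 0" by (rule lin_on_zero[OF hom_compare_lin[OF f] E.gco_closed(1)[OF R]])
    have fn0: "f 0 m 0 = 0" for m by (rule P.ghom_zero[OF PX f])
    have ka: "hom_compare L u f n (?a i) = A i" if "i < 3" for i
    proof (cases "i \<in># a \<and> i \<notin> S")
      case True
      then have i: "i \<in># a" "i \<notin> S" by auto
      show ?thesis
        using hom_compare_delta[OF f keyA(1)[OF that i] ma[OF that i]] f_delta(4)[OF f ym] True
        by (simp add: keyA(2)[OF that i] A_def g_def sgr_def sg_apply m_def)
    next
      case False
      show ?thesis unfolding A_def if_not_P[OF False] by (rule k0)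
    qed
    have kb: "hom_compare L u f n (?b i) = sg w (B i)" if "i < 3" for i
    proof (cases "i \<in># a")
      case True
      have deg: "n + (kdeg (S, a) - qdeg p i) = m - qdeg p i" by (simp add: m_def)
      show ?thesis
        using hom_compare_delta[OF f keyB(1)[OF that True] mb[OF that True, of w]] f_delta(4)[OF f Qy[OF that]] True
        by (simp add: keyB(2)[OF that True] B_def sg_apply deg)
    next
      case False
      show ?thesis unfolding B_def if_not_P[OF False] sg_0 by (rule k0)
    qed
    have sR: "(\<Sum>i<3. ?a i) \<in> ?R" "(\<Sum>i<3. ?b i) \<in> ?R"
    proof -
      interpret RV: vector_space "gsc (Eres L) (- u)" by (rule E.gmodule_vs[OF R])
      show "(\<Sum>i<3. ?a i) \<in> ?R" by (rule RV.subspace_sum[OF E.gmodule_sub[OF R]], rule a_in, simp)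
      show "(\<Sum>i<3. ?b i) \<in> ?R" by (rule RV.subspace_sum[OF E.gmodule_sub[OF R]], rule b_in, simp)
    qed
    have "hom_compare L u f n (gd (Eres L) (- (u + 1)) n (delta (S, a) y)) = hom_compare L u f n ((\<Sum>i<3. ?a i) + (\<Sum>i<3. ?b i))"
      using gd_Eres_delta[OF L k y] by (simp only: m_def w_def)
    also have "\<dots> = hom_compare L u f n (\<Sum>i<3. ?a i) + hom_compare L u f n (\<Sum>i<3. ?b i)"
      by (rule lin_onD(2)[OF hom_compare_lin[OF f] sR])
    also have "hom_compare L u f n (\<Sum>i<3. ?a i) = (\<Sum>i<3. hom_compare L u f n (?a i))"
      by (rule lin_on_sum[OF E.gmodule_vs[OF R] E.gmodule_sub[OF R] hom_compare_lin[OF f]]) (use a_in in auto)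
    also have "\<dots> = (\<Sum>i<3. A i)" by (rule sum.cong) (use ka in auto)
    also have "hom_compare L u f n (\<Sum>i<3. ?b i) = (\<Sum>i<3. hom_compare L u f n (?b i))"
      by (rule lin_on_sum[OF E.gmodule_vs[OF R] E.gmodule_sub[OF R] hom_compare_lin[OF f]]) (use b_in in auto)
    also have "\<dots> = (\<Sum>i<3. sg w (B i))" by (rule sum.cong) (use kb in auto)
    also have "\<dots> = - sg u (\<Sum>i<3. B i)" unfolding sg_sum[symmetric] by (rule sg_odd) (simp add: w_def)
    finally show "hom_compare L (u + 1) ?D n (delta (S, a) y) = hom_compare L u f n (gd (Eres L) (- (u + 1)) n (delta (S, a) y))"
      unfolding lhs by simp
  qed
  moreover have "hom_compare L (u + 1) ?D n x = hom_compare L u f n (gd (Eres L) (- (u + 1)) n x)" if x: "x \<notin> gco (Eres L) (- (u + 1)) n" for n x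
    using hom_compare_out[OF x] Eres_sel(4)[OF x] lin_on_zero[OF hom_compare_lin[OF f] E.gco_closed(1)[OF R], of n] by simp
  ultimately show ?thesis by (intro ext) blast
qed

text \<open>Bijectivity of \<open>hom_compare\<close> in every degree turns the cycles and
  boundaries on the \<open>P(2)\<close> side exactly into those on the \<open>E(2)\<close>
  side.\<close>

lemma hom_compare_gH:
  "sq_wf (HomE_cohomology p (ofE (Eres L)) (\<lambda>s. gd (Eres L) (- s)) N u t)"
  "sq_map (P.gH (Pres L) (gP (G_functor p N)) u t) (HomE_cohomology p (ofE (Eres L)) (\<lambda>s. gd (Eres L) (- s)) N u t) (hom_compare L u)"
proof -
  note PX = gmodule_Pres[OF L] and GN = gmodule_G[OF N]
  let ?D = "gD (Pres L) (gP (G_functor p N))"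
  have z: "hom_compare L v (0 :: int \<Rightarrow> int \<Rightarrow> (nat multiset \<Rightarrow> 'a) \<Rightarrow> int \<Rightarrow> 'f koszul \<Rightarrow> 'b) = 0" for v by (intro ext) (simp add: hom_compare_def)
  have D0: "?D u t f = 0 \<longleftrightarrow> (\<forall>n x. hom_compare L u f n (gd (Eres L) (- (u + 1)) n x) = 0)" if f: "f \<in> PHom u t" for f
  proof -
    \<comment> \<open>Injectivity in degree \<open>u + 1\<close> lets the cocycle condition be
      tested after the comparison.\<close>
    have "?D u t f = 0 \<longleftrightarrow> hom_compare L (u + 1) (?D u t f) = 0"
      using hom_compare_inj[OF P.gD_ghom[OF PX GN f] P.ghom_0[OF PX GN]] by (metis z)
    then show ?thesis unfolding hom_compare_D[OF f] by (simp add: fun_eq_iff)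
  qed
  have c: "cycles (HomE_cohomology p (ofE (Eres L)) (\<lambda>s. gd (Eres L) (- s)) N u t) = hom_compare L u ` cycles (P.gH (Pres L) (gP (G_functor p N)) u t)"
  proof (intro equalityI subsetI)
    fix F assume "F \<in> cycles (HomE_cohomology p (ofE (Eres L)) (\<lambda>s. gd (Eres L) (- s)) N u t)"
    then have F: "F \<in> EHom u t" "\<forall>n x. F n (gd (Eres L) (- (u + 1)) n x) = 0" by (simp_all add: HomE_cohomology_def)
    obtain f where f: "f \<in> PHom u t" "hom_compare L u f = F" using hom_compare_surj[OF F(1)] by blast
    then have "?D u t f = 0" using D0[OF f(1)] F(2) by simp
    then show "F \<in> hom_compare L u ` cycles (P.gH (Pres L) (gP (G_functor p N)) u t)" using f by (auto simp: P.gH_def)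
  next
    fix F assume "F \<in> hom_compare L u ` cycles (P.gH (Pres L) (gP (G_functor p N)) u t)"
    then obtain f where f: "f \<in> PHom u t" "?D u t f = 0" "F = hom_compare L u f" by (auto simp: P.gH_def)
    then show "F \<in> cycles (HomE_cohomology p (ofE (Eres L)) (\<lambda>s. gd (Eres L) (- s)) N u t)"
      using D0[OF f(1)] hom_compare_Hom[OF f(1)] by (simp add: HomE_cohomology_def)
  qed
  have D1: "hom_compare L u (?D (u - 1) t f) = (\<lambda>n x. hom_compare L (u - 1) f n (gd (Eres L) (- u) n x))" if f: "f \<in> PHom (u - 1) t" for f
    using hom_compare_D[OF f] by simp
  have b: "boundaries (HomE_cohomology p (ofE (Eres L)) (\<lambda>s. gd (Eres L) (- s)) N u t) = hom_compare L u ` boundaries (P.gH (Pres L) (gP (G_functor p N)) u t)"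
  proof (intro equalityI subsetI)
    fix F assume "F \<in> boundaries (HomE_cohomology p (ofE (Eres L)) (\<lambda>s. gd (Eres L) (- s)) N u t)"
    then obtain g where g: "g \<in> EHom (u - 1) t" "F = (\<lambda>n x. g n (gd (Eres L) (- u) n x))" by (auto simp: HomE_cohomology_def)
    obtain f where f: "f \<in> PHom (u - 1) t" "hom_compare L (u - 1) f = g" using hom_compare_surj[OF g(1)] by blast
    then have "F = hom_compare L u (?D (u - 1) t f)" using D1[OF f(1)] g(2) by simp
    then show "F \<in> hom_compare L u ` boundaries (P.gH (Pres L) (gP (G_functor p N)) u t)" using f(1) by (auto simp: P.gH_def)
  next
    fix F assume "F \<in> hom_compare L u ` boundaries (P.gH (Pres L) (gP (G_functor p N)) u t)"
    then obtain f where f: "f \<in> PHom (u - 1) t" "F = hom_compare L u (?D (u - 1) t f)" by (auto simp: P.gH_def)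
    have "hom_compare L (u - 1) f \<in> EHom (u - 1) t" by (rule hom_compare_Hom[OF f(1)])
    then show "F \<in> boundaries (HomE_cohomology p (ofE (Eres L)) (\<lambda>s. gd (Eres L) (- s)) N u t)"
      unfolding f(2) D1[OF f(1)] by (auto simp: HomE_cohomology_def)
  qed
  have inj: "inj_on (hom_compare L u) (cycles (P.gH (Pres L) (gP (G_functor p N)) u t))"
    by (rule inj_onI) (rule hom_compare_inj, auto simp: P.gH_def)
  have add: "hom_compare L u (f + g) = hom_compare L u f + hom_compare L u g" for f g :: "int \<Rightarrow> int \<Rightarrow> (nat multiset \<Rightarrow> 'a) \<Rightarrow> int \<Rightarrow> 'f koszul \<Rightarrow> 'b"
    by (intro ext) (simp add: hom_compare_def sum.distrib)
  have sc: "hom_compare L u (\<lambda>v t x. gsc (gP (G_functor p N)) (v + u) c (f v t x)) = (\<lambda>n x. escale N c (hom_compare L u f n x))" for c f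
    by (rule ext, rule ext) (simp add: hom_compare_def escale_lin[OF N] G_sel)
  note im = sq_image[OF P.gH_wf[OF PX GN] c b inj, OF add, unfolded P.gH_def HomE_cohomology_def subquotient.simps, OF sc]
  show "sq_wf (HomE_cohomology p (ofE (Eres L)) (\<lambda>s. gd (Eres L) (- s)) N u t)"
    unfolding HomE_cohomology_def by (rule im(1))
  show "sq_map (P.gH (Pres L) (gP (G_functor p N)) u t) (HomE_cohomology p (ofE (Eres L)) (\<lambda>s. gd (Eres L) (- s)) N u t) (hom_compare L u)"
    unfolding P.gH_def HomE_cohomology_def by (rule im(2))
qed

end

end

section \<open>Derived Hom over \<open>P(2)\<close> and Ext over \<open>E(2)\<close>\<close>

context exterior
begin

context
  fixes L :: "('f::field, 'a::ab_group_add) emod"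
  assumes L: "E2_module p L" and nonneg: "\<And>n. n < 0 \<Longrightarrow> ecomp L n = {0}"
begin

text \<open>The choice in \<open>Ext_E2\<close> ranges over resolutions with elements of type
  \<open>resolving\<close>; the model \<open>Eres L\<close> is copied there, a key consisting of
  \<open>S\<close>, \<open>a\<close> and a basis vector of the ambient space of
  \<open>L\<close>.\<close>

lemma free_resolution_exists:
  "\<exists>(R :: int \<Rightarrow> ('f, ('f, 'a) resolving) emod) d \<epsilon>. free_resolution p R d \<epsilon> L"
proof -
  note R = gmodule_Eres[OF L]
  have vs: "vector_space (escale L)" by (rule E2_vs[OF L])
  have "\<forall>m. \<exists>B. basis_family (escale L) (ecomp L m) B (\<lambda>b. b)"
    using subspace_basis[OF vs E2_sub[OF L]] by blast
  from choice[OF this] obtain Bas where Bas: "\<And>m. basis_family (escale L) (ecomp L m) (Bas m) (\<lambda>b. b)" by blast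
  \<comment> \<open>A basis of the whole type, not of the components: one embedding has to serve all
    internal degrees at once.\<close>
  obtain B0 where B0: "basis_family (escale L) UNIV B0 (\<lambda>b. b)"
    using subspace_basis[OF vs module.subspace_UNIV[OF vs[unfolded module_iff_vector_space[symmetric]]]] by blast
  define W where "W u = fun_sub (kkeys (- u)) (\<lambda>_. UNIV :: 'a set)" for u
  have inj: "inj_on (\<lambda>((S, a), b). (S, a, b)) I" for I :: "(kkey \<times> 'a) set" by (auto simp: inj_on_def)
  have "\<forall>u. \<exists>J :: (kkey \<Rightarrow> 'a) \<Rightarrow> ('f, 'a) resolving. lin_on (gsc (Eres L) u) (W u) pm_scale UNIV J \<and> inj_on J (W u)"
    unfolding Eres_gsc W_def
    by (intro allI embed_pm[OF vector_space_fun[OF vs] fun_basis[OF vs finite_kkeys B0] inj])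
  from choice[OF this] obtain J :: "int \<Rightarrow> (kkey \<Rightarrow> 'a) \<Rightarrow> ('f, 'a) resolving"
    where J: "\<And>u. lin_on (gsc (Eres L) u) (W u) pm_scale UNIV (J u)" "\<And>u. inj_on (J u) (W u)" by blast
  have W: "gco (Eres L) u t \<subseteq> W u" for u t by (auto simp: Eres_sel W_def fun_sub_def)
  note tr = R vector_space_pm J W
  obtain e where "E.gquasi_iso (Eres L) (gM L) e" using Eres_augmentation[OF L nonneg] by blast
  from E.gquasi_iso_transport[OF tr this] obtain e' where e': "E.gquasi_iso (E.transport J W pm_scale (Eres L)) (gM L) e'" by blast
  have empty: "(\<lambda>t. J u ` zgens Bas u t) = (\<lambda>t. {})" if "u > 0" for u
    using that by (auto simp: zgens_def kkeys_def)
  have "free_resolution p (ofE (E.transport J W pm_scale (Eres L))) (\<lambda>s. gd (E.transport J W pm_scale (Eres L)) (- s)) (e' 0) L"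
    by (rule free_resolution_ofE[OF E.gfree_transport(1)[OF tr gfree_Eres[OF L Bas]] empty L e' E.transport_sel(4)[OF tr]])
  then show ?thesis by blast
qed

lemma semifree_resolution_exists:
  "\<exists>(Z :: ('f, ('f, int \<Rightarrow> 'f koszul \<Rightarrow> 'a) resolving) dgmod) e. semifree p Z \<and> dg_quasi_iso p Z (G_functor p L) e"
proof -
  note R = gmodule_Pres[OF L]
  have vs: "vector_space (escale L)" by (rule E2_vs[OF L])
  obtain B0 where B0: "basis_family (escale L) UNIV B0 (\<lambda>b. b)"
    using subspace_basis[OF vs module.subspace_UNIV[OF vs[unfolded module_iff_vector_space[symmetric]]]] by blast
  define W where "W u = fun_sub (mkeys u) (\<lambda>_. UNIV :: 'a set)" for u
  \<comment> \<open>The prescribed type is built from elements of \<open>G(L)\<close>, which are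
    functions. A basis vector \<open>b\<close> of the ambient space of \<open>L\<close> is therefore
    encoded as a constant function, and the subset component of the key stays empty.\<close>
  let ?\<kappa> = "\<lambda>(a, b). ({} :: nat set, a, \<lambda>(_ :: int) (_ :: 'f koszul). b)"
  have inj: "inj_on ?\<kappa> I" for I :: "(nat multiset \<times> 'a) set" by (auto simp: inj_on_def fun_eq_iff)
  have "\<forall>u. \<exists>J :: (nat multiset \<Rightarrow> 'a) \<Rightarrow> ('f, int \<Rightarrow> 'f koszul \<Rightarrow> 'a) resolving.
      lin_on (gsc (Pres L) u) (W u) pm_scale UNIV J \<and> inj_on J (W u)"
    unfolding Pres_sel(1) W_def
    by (intro allI embed_pm[OF vector_space_fun[OF vs] fun_basis[OF vs finite_mkeys B0] inj])
  from choice[OF this] obtain J :: "int \<Rightarrow> (nat multiset \<Rightarrow> 'a) \<Rightarrow> ('f, int \<Rightarrow> 'f koszul \<Rightarrow> 'a) resolving"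
    where J: "\<And>u. lin_on (gsc (Pres L) u) (W u) pm_scale UNIV (J u)" "\<And>u. inj_on (J u) (W u)" by blast
  have W: "gco (Pres L) u t \<subseteq> W u" for u t by (auto simp: Pres_sel W_def fun_sub_def)
  note tr = R vector_space_pm J W
  obtain e where "P.gquasi_iso (Pres L) (gP (G_functor p L)) e" using G_model[OF L] by blast
  from P.gquasi_iso_transport[OF tr this] obtain e' where e': "P.gquasi_iso (P.transport J W pm_scale (Pres L)) (gP (G_functor p L)) e'" by blast
  let ?T = "P.transport J W pm_scale (Pres L)"
  let ?Z = "\<lparr>dscale = pm_scale, dcomp = gco ?T, diff = gd ?T, vact = gop ?T\<rparr>"
  have "gP ?Z = ?T" by (simp add: gP_def P.transport_def)
  then have "semifree p ?Z" "dg_quasi_iso p ?Z (G_functor p L) e'"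
    using P.gsemifree_transport[OF tr gsemifree_Pres[OF L nonneg]] e' by (simp_all add: gsemifree_gP gquasi_iso_gP)
  then show ?thesis by blast
qed

text \<open>A chain of isomorphisms links the chosen semifree resolution of \<open>G(L)\<close>, the
  model \<open>Pres L\<close>, the resolution \<open>Eres L\<close> by adjunction, and the chosen
  free resolution of \<open>L\<close>. The last link passes through Hom complexes into
  \<open>N\<close> in degree 0, where independence of resolutions applies.\<close>

theorem RHom_P2_iso_Ext_E2:
  fixes N :: "('f, 'b::ab_group_add) emod"
  assumes N: "E2_module p N"
  shows "\<exists>\<phi>. sq_iso (RHom_P2_cohomology p (G_functor p L) (G_functor p N) u t) (Ext_E2 p L N u t) \<phi>"
proof -
  note GL = gmodule_G[OF L] and GN = gmodule_G[OF N] and Eres = gmodule_Eres[OF L] and NM = gmodule_gM[OF N]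
  let ?GN = "gP (G_functor p N)"
  define r where "r = (SOME (R :: int \<Rightarrow> ('f, ('f, 'a) resolving) emod, d, \<epsilon>). free_resolution p R d \<epsilon> L)"
  obtain R :: "int \<Rightarrow> ('f, ('f, 'a) resolving) emod" and d \<epsilon> where r: "r = (R, d, \<epsilon>)" by (cases r)
  \<comment> \<open>Existence in the right type is what makes the chosen triple a
    resolution.\<close>
  have "case r of (R, d, \<epsilon>) \<Rightarrow> free_resolution p R d \<epsilon> L"
    unfolding r_def by (rule someI_ex) (use free_resolution_exists in auto)
  then have res: "free_resolution p R d \<epsilon> L" by (simp add: r)
  have Ext: "Ext_E2 p L N u t = HomE_cohomology p R d N u t"
    unfolding Ext_E2_def r_def[symmetric] by (simp add: r)
  define z where "z = (SOME (Z :: ('f, ('f, int \<Rightarrow> 'f koszul \<Rightarrow> 'a) resolving) dgmod, e). semifree p Z \<and> dg_quasi_iso p Z (G_functor p L) e)"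
  obtain Z :: "('f, ('f, int \<Rightarrow> 'f koszul \<Rightarrow> 'a) resolving) dgmod" and e where z: "z = (Z, e)" by (cases z)
  have "case z of (Z, e) \<Rightarrow> semifree p Z \<and> dg_quasi_iso p Z (G_functor p L) e"
    unfolding z_def by (rule someI_ex) (use semifree_resolution_exists in auto)
  then have Z: "P.gsemifree (gP Z)" "P.gquasi_iso (gP Z) (gP (G_functor p L)) e" by (simp_all add: z gsemifree_gP gquasi_iso_gP)
  have RHom: "RHom_P2_cohomology p (G_functor p L) (G_functor p N) u t = P.gH (gP Z) ?GN u t"
    unfolding RHom_P2_cohomology_def z_def[symmetric] by (simp add: z gH_gP)
  note gE = free_resolution_gE[OF res L]
  have dout: "d s n x = 0" if "x \<notin> ecomp (R s) n" for s n x
    using res that by (auto simp: free_resolution_def dest: Hom_E_D(3))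
  note Pres = gsemifree_Pres[OF L nonneg]
  obtain e1 where e1: "P.gquasi_iso (Pres L) (gP (G_functor p L)) e1" using G_model[OF L] by blast
  obtain \<Phi>1 where "sq_map (P.gH (gP Z) ?GN u t) (P.gH (Pres L) ?GN u t) \<Phi>1"
    using P.resolution_independence[OF Pres Z(1) GL GN e1 Z(2)] by blast
  from sq_map_iso[OF P.gH_wf[OF P.gsemifree_gmodule[OF Z(1)] GN] P.gH_wf[OF gmodule_Pres[OF L] GN] this]
  obtain \<phi>1 where \<phi>1: "sq_iso (P.gH (gP Z) ?GN u t) (P.gH (Pres L) ?GN u t) \<phi>1" by blast
  let ?H = "HomE_cohomology p (ofE (Eres L)) (\<lambda>s. gd (Eres L) (- s)) N u t"
  from sq_map_iso[OF P.gH_wf[OF gmodule_Pres[OF L] GN] hom_compare_gH[OF L N]]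
  obtain \<phi>2 where \<phi>2: "sq_iso (P.gH (Pres L) ?GN u t) ?H \<phi>2" by blast
  have "\<forall>m. \<exists>B. basis_family (escale L) (ecomp L m) B (\<lambda>b. b)"
    using subspace_basis[OF E2_vs[OF L] E2_sub[OF L]] by blast
  from choice[OF this] obtain Bas where Bas: "\<And>m. basis_family (escale L) (ecomp L m) (Bas m) (\<lambda>b. b)" by blast
  have RZf: "E.gsemifree (Eres L)"
    by (rule gsemifree_E[OF gfree_Eres[OF L Bas]]) (auto simp: zgens_def kkeys_def)
  have "x \<notin> ecomp (ofE (Eres L) s) n \<Longrightarrow> gd (Eres L) (- s) n x = 0" for s n x
    by (simp add: ofE_def Eres_sel(4))
  note HR = HomE_gH[of "ofE (Eres L)" "\<lambda>s. gd (Eres L) (- s)", unfolded gE_ofE, OF Eres this N]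
  from sq_map_iso[OF E.gH_wf[OF Eres NM] HR(1,2)]
  obtain \<phi>3 where "sq_iso (E.gH (Eres L) (gM N) u t) ?H \<phi>3" by blast
  \<comment> \<open>This comparison has to be run backwards, from \<open>HomE_cohomology\<close> of
    the model to its Hom complex.\<close>
  from sq_iso_sym[OF E.gH_wf[OF Eres NM] HR(1) this]
  obtain \<phi>4 where \<phi>4: "sq_iso ?H (E.gH (Eres L) (gM N) u t) \<phi>4" by blast
  obtain e2 where e2: "E.gquasi_iso (Eres L) (gM L) e2" using Eres_augmentation[OF L nonneg] by blast
  obtain \<Phi>5 where "sq_map (E.gH (Eres L) (gM N) u t) (E.gH (gE R d) (gM N) u t) \<Phi>5"
    using E.resolution_independence[OF gE(1) RZf gmodule_gM[OF L] NM gE(2) e2] by blast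
  from sq_map_iso[OF E.gH_wf[OF Eres NM] E.gH_wf[OF E.gsemifree_gmodule[OF gE(1)] NM] this]
  obtain \<phi>5 where \<phi>5: "sq_iso (E.gH (Eres L) (gM N) u t) (E.gH (gE R d) (gM N) u t) \<phi>5" by blast
  note HE = HomE_gH[OF E.gsemifree_gmodule[OF gE(1)] dout N]
  from sq_map_iso[OF E.gH_wf[OF E.gsemifree_gmodule[OF gE(1)] NM] HE]
  obtain \<phi>6 where \<phi>6: "sq_iso (E.gH (gE R d) (gM N) u t) (HomE_cohomology p R d N u t) \<phi>6" by blast
  show ?thesis unfolding RHom Ext
    using sq_iso_trans[OF \<phi>1 sq_iso_trans[OF \<phi>2 sq_iso_trans[OF \<phi>4 sq_iso_trans[OF \<phi>5 \<phi>6]]]] by blast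
qed

end

end

section \<open>The Milnor primitives on the dual Steenrod algebra\<close>

text \<open>A common form of the two Leibniz formulas: the factor \<open>k\<close> of the monomial \<open>m\<close>, a factor that
  \<open>Q\<^sub>j\<close> affects if \<open>k \<in> A j m\<close>, is traded for factors that no \<open>Q\<^sub>i\<close> sees.\<close>

definition leibniz ::
  "(nat \<Rightarrow> 'm \<Rightarrow> nat set) \<Rightarrow> (nat \<Rightarrow> nat \<Rightarrow> 'm \<Rightarrow> 'm) \<Rightarrow> (nat \<Rightarrow> 'm \<Rightarrow> 'f) \<Rightarrow> nat \<Rightarrow> ('m \<Rightarrow>\<^sub>0 'f::field) \<Rightarrow> ('m \<Rightarrow>\<^sub>0 'f)" where
  "leibniz A T c j = pm_extend (\<lambda>m. \<Sum>k\<in>A j m. Poly_Mapping.single (T j k m) (c k m))"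

lemma pm_scale_single: "pm_scale b (Poly_Mapping.single k a) = Poly_Mapping.single k (b * a :: 'f::field)"
  by (rule poly_mapping_eqI) (simp add: lookup_pm_scale lookup_single when_def)

lemma leibniz_lin: "lin_on pm_scale V pm_scale UNIV (leibniz A T c j)"
  unfolding leibniz_def by (rule pm_extend_lin)

lemma leibniz_single:
  fixes c :: "nat \<Rightarrow> 'm \<Rightarrow> 'f::field"
  shows "leibniz A T c j (Poly_Mapping.single m b) = (\<Sum>k\<in>A j m. Poly_Mapping.single (T j k m) (b * c k m))"
proof -
  interpret vector_space "pm_scale :: 'f \<Rightarrow> ('m \<Rightarrow>\<^sub>0 'f) \<Rightarrow> _" by (rule vector_space_pm)
  have "leibniz A T c j (Poly_Mapping.single m b) = leibniz A T c j (pm_scale b (Poly_Mapping.single m 1))"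
    by (simp add: pm_scale_single)
  also have "\<dots> = pm_scale b (leibniz A T c j (Poly_Mapping.single m 1))"
    by (rule lin_onD(3)[OF leibniz_lin[where V = UNIV]]) simp
  finally show ?thesis by (simp add: leibniz_def pm_extend_single scale_sum_right pm_scale_single)
qed

lemma leibniz_leibniz_single:
  fixes c :: "nat \<Rightarrow> 'm \<Rightarrow> 'f::field"
  shows "leibniz A T c i (leibniz A T c j (Poly_Mapping.single m 1)) =
    (\<Sum>k\<in>A j m. \<Sum>l\<in>A i (T j k m). Poly_Mapping.single (T i l (T j k m)) (c k m * c l (T j k m)))"
proof -
  interpret vector_space "pm_scale :: 'f \<Rightarrow> ('m \<Rightarrow>\<^sub>0 'f) \<Rightarrow> _" by (rule vector_space_pm)
  have "leibniz A T c i (\<Sum>k\<in>A j m. Poly_Mapping.single (T j k m) (c k m)) =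
      (\<Sum>k\<in>A j m. leibniz A T c i (Poly_Mapping.single (T j k m) (c k m)))"
    by (rule lin_on_sum[OF vector_space_pm subspace_UNIV leibniz_lin]) simp
  then show ?thesis by (simp add: leibniz_single)
qed

text \<open>Both sides run over ordered pairs of distinct elements, with the order of summation
  exchanged.\<close>

lemma sum_off_diagonal_antisym:
  fixes g h :: "nat \<Rightarrow> nat \<Rightarrow> 'a::ab_group_add"
  assumes "finite A" "finite B" and gh: "\<And>k l. k \<in> A \<Longrightarrow> l \<in> B \<Longrightarrow> k \<noteq> l \<Longrightarrow> g k l = - h l k"
  shows "(\<Sum>k\<in>A. \<Sum>l\<in>B - {k}. g k l) = - (\<Sum>l\<in>B. \<Sum>k\<in>A - {l}. h l k)"
proof -
  have 1: "(\<Sum>l\<in>B - {k}. g k l) = (\<Sum>l\<in>B. if k \<noteq> l then - h l k else 0)" if "k \<in> A" for k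
    by (rule sum.mono_neutral_cong_left) (use assms that in auto)
  have 2: "(\<Sum>k\<in>A. if k \<noteq> l then - h l k else 0) = (\<Sum>k\<in>A - {l}. - h l k)" for l
    by (rule sum.mono_neutral_cong_right) (use assms(1) in auto)
  have "(\<Sum>k\<in>A. \<Sum>l\<in>B - {k}. g k l) = (\<Sum>k\<in>A. \<Sum>l\<in>B. if k \<noteq> l then - h l k else 0)"
    by (rule sum.cong[OF refl 1])
  also have "\<dots> = (\<Sum>l\<in>B. \<Sum>k\<in>A. if k \<noteq> l then - h l k else 0)" by (rule sum.swap)
  also have "\<dots> = (\<Sum>l\<in>B. \<Sum>k\<in>A - {l}. - h l k)" unfolding 2 ..
  finally show ?thesis by (simp add: sum_negf)
qed

text \<open>Needed separately because antisymmetry alone says nothing in characteristic two.\<close>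

lemma sum_off_diagonal_zero:
  fixes g :: "nat \<Rightarrow> nat \<Rightarrow> 'a::ab_group_add"
  assumes A: "finite A" and g: "\<And>k l. k \<in> A \<Longrightarrow> l \<in> A \<Longrightarrow> k \<noteq> l \<Longrightarrow> g k l = - g l k"
  shows "(\<Sum>k\<in>A. \<Sum>l\<in>A - {k}. g k l) = 0"
proof -
  \<comment> \<open>The pairs are split by their order; exchanging the indices maps one half onto
    the other with the opposite sign.\<close>
  have "(\<Sum>l\<in>A - {k}. g k l) = (\<Sum>l\<in>A. if l < k then g k l else 0) + (\<Sum>l\<in>A. if k < l then g k l else 0)" for k
  proof -
    have "(\<Sum>l\<in>A - {k}. g k l) = (\<Sum>l\<in>A. (if l < k then g k l else 0) + (if k < l then g k l else 0))"
      by (rule sum.mono_neutral_cong_left) (use A in auto)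
    then show ?thesis by (simp add: sum.distrib)
  qed
  then have "(\<Sum>k\<in>A. \<Sum>l\<in>A - {k}. g k l) =
      (\<Sum>k\<in>A. \<Sum>l\<in>A. if l < k then g k l else 0) + (\<Sum>k\<in>A. \<Sum>l\<in>A. if k < l then g k l else 0)"
    by (simp add: sum.distrib)
  also have "(\<Sum>k\<in>A. \<Sum>l\<in>A. if k < l then g k l else 0) = (\<Sum>l\<in>A. \<Sum>k\<in>A. if k < l then g k l else 0)"
    by (rule sum.swap)
  also have "\<dots> = (\<Sum>k\<in>A. \<Sum>l\<in>A. - (if l < k then g k l else 0))"
  proof (rule sum.cong[OF refl], rule sum.cong[OF refl])
    fix l k assume "l \<in> A" "k \<in> A"
    then show "(if k < l then g k l else 0) = - (if k < l then g l k else 0)"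
      using g[of k l] by (cases "k < l") (simp_all only: if_True if_False minus_zero less_irrefl)
  qed
  finally show ?thesis by (simp add: sum_negf)
qed

text \<open>On a monomial \<open>Q_i Q_j\<close> is a sum over ordered pairs of distinct factors,
  because by \<open>rem\<close> a traded factor is gone and its replacements are invisible.
  Exchanging the pair changes the sign by \<open>comm\<close> and \<open>anti\<close>, which gives
  anticommutation and, for \<open>i = j\<close>, the square-zero relation.\<close>

lemma E2_module_leibniz:
  fixes c :: "nat \<Rightarrow> steenrod_monom \<Rightarrow> 'f::field"
  assumes fin: "\<And>i m. finite (A i m)"
    and rem: "\<And>i j k m. k \<in> A j m \<Longrightarrow> A i (T j k m) = A i m - {k}"
    and comm: "\<And>i j k l m. k \<in> A j m \<Longrightarrow> l \<in> A i m \<Longrightarrow> k \<noteq> l \<Longrightarrow> T i l (T j k m) = T j k (T i l m)"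
    and anti: "\<And>i j k l m. k \<in> A j m \<Longrightarrow> l \<in> A i m \<Longrightarrow> k \<noteq> l \<Longrightarrow> c k m * c l (T j k m) = - (c l m * c k (T i l m))"
    and Q: "\<And>j. milnor_Q p j = leibniz A T c j"
    and S: "\<And>j k m. m \<in> S \<Longrightarrow> k \<in> A j m \<Longrightarrow> T j k m \<in> S"
    and deg: "\<And>j k m. m \<in> S \<Longrightarrow> k \<in> A j m \<Longrightarrow> monom_degree p (T j k m) = monom_degree p m - qdeg p j"
  shows "E2_module p (steenrod_sub p S :: ('f, _) emod)"
proof -
  let ?M = "steenrod_sub p S :: ('f, _) emod"
  let ?Q = "leibniz A T c"
  define K where "K n = {m \<in> S. monom_degree p m = n}" for n
  have sel: "escale ?M = pm_scale" "ecomp ?M n = {x. Poly_Mapping.keys x \<subseteq> K n}" "eact ?M i n = ?Q i" for i n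
    by (auto simp: steenrod_sub_def Q K_def)
  have sum: "?Q i (?Q j (Poly_Mapping.single m 1)) =
      (\<Sum>k\<in>A j m. \<Sum>l\<in>A i m - {k}. Poly_Mapping.single (T i l (T j k m)) (c k m * c l (T j k m)))" for i j m
    unfolding leibniz_leibniz_single by (rule sum.cong) (simp_all add: rem)
  have swap: "Poly_Mapping.single (T i l (T j k m)) (c k m * c l (T j k m)) =
      - Poly_Mapping.single (T j k (T i l m)) (c l m * c k (T i l m))"
    if "k \<in> A j m" "l \<in> A i m" "k \<noteq> l" for i j k l m
    by (simp only: comm[OF that] anti[OF that] single_uminus)
  have QQ: "lin_on pm_scale UNIV pm_scale UNIV (\<lambda>x. ?Q i (?Q j x))" for i j
    using lin_onD(2,3)[OF leibniz_lin[of UNIV A T c]] by (simp add: lin_on_def)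
  have lin: "lin_on pm_scale {x. Poly_Mapping.keys x \<subseteq> UNIV} pm_scale UNIV (\<lambda>x. ?Q i (?Q j x))" for i j
    using QQ by simp
  have lin0: "lin_on pm_scale {x. Poly_Mapping.keys x \<subseteq> UNIV} pm_scale UNIV (\<lambda>x :: steenrod_monom \<Rightarrow>\<^sub>0 'f. 0 :: steenrod_monom \<Rightarrow>\<^sub>0 'f)"
    by (simp add: lin_on_def pm_scale_def Poly_Mapping.map.rep_eq poly_mapping_eq_iff fun_eq_iff when_def)
  have linm: "lin_on pm_scale {x. Poly_Mapping.keys x \<subseteq> UNIV} pm_scale UNIV (\<lambda>x. ?Q i (?Q j x) + ?Q j (?Q i x))" for i j
  proof -
    interpret vector_space "pm_scale :: 'f \<Rightarrow> (steenrod_monom \<Rightarrow>\<^sub>0 'f) \<Rightarrow> _" by (rule vector_space_pm)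
    show ?thesis using lin_onD(2,3)[OF QQ] by (simp add: lin_on_def scale_right_distrib)
  qed
  have sq: "?Q i (?Q i x) = 0" for i x
  proof (rule pm_ext[OF lin lin0])
    show "?Q i (?Q i (Poly_Mapping.single m 1)) = 0" for m
      unfolding sum by (rule sum_off_diagonal_zero[OF fin]) (rule swap)
  qed simp
  have ac: "?Q i (?Q j x) + ?Q j (?Q i x) = 0" for i j x
  proof (rule pm_ext[OF linm lin0])
    have "?Q i (?Q j (Poly_Mapping.single m 1)) = - ?Q j (?Q i (Poly_Mapping.single m 1))" for m
      unfolding sum by (rule sum_off_diagonal_antisym[OF fin fin]) (rule swap)
    then show "?Q i (?Q j (Poly_Mapping.single m 1)) + ?Q j (?Q i (Poly_Mapping.single m 1)) = 0" for m by simp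
  qed simp
  have into: "lin_on pm_scale {x. Poly_Mapping.keys x \<subseteq> K n} pm_scale {x. Poly_Mapping.keys x \<subseteq> K (n - qdeg p i)} (?Q i)" for i n
  proof (rule pm_lin_into[OF leibniz_lin vector_space_pm pm_sub])
    fix m assume m: "m \<in> K n"
    interpret vector_space "pm_scale :: 'f \<Rightarrow> (steenrod_monom \<Rightarrow>\<^sub>0 'f) \<Rightarrow> _" by (rule vector_space_pm)
    show "?Q i (Poly_Mapping.single m 1) \<in> {x. Poly_Mapping.keys x \<subseteq> K (n - qdeg p i)}"
      unfolding leibniz_single
    proof (rule subspace_sum[OF pm_sub])
      fix k assume "k \<in> A i m"
      then have "T i k m \<in> K (n - qdeg p i)" using m S[of m k i] deg[of m k i] by (simp add: K_def)
      then show "Poly_Mapping.single (T i k m) (1 * c k m) \<in> {x. Poly_Mapping.keys x \<subseteq> K (n - qdeg p i)}"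
        by (auto simp: keys_single split: if_splits)
    qed
  qed
  show ?thesis unfolding E2_module_def sel
    using vector_space_pm pm_sub into sq ac by blast
qed

lemma sum_mset_xi_power:
  fixes f :: "nat \<Rightarrow> 'a::comm_semiring_1"
  shows "(\<Sum>i\<in>#xi_power k n. f i) = (if k = 0 then 0 else of_nat n * f k)"
  by (simp add: xi_power_def)

lemma even_count_xi_power: "even n \<Longrightarrow> even (count (xi_power k n) l)"
  by (simp add: xi_power_def)

lemma of_nat_char_two: "(2::'f::field) = 0 \<Longrightarrow> of_nat n = (if odd n then 1 else 0 :: 'f)"
proof (induction n)
  case (Suc n)
  have "(1::'f) + 1 = 0" using Suc.prems by simp
  then show ?case using Suc by auto
qed simp

text \<open>In characteristic two only factors with odd exponent contribute, with coefficient 1, and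
  the power \<open>2^(j+1)\<close> brought in is even, so it is never seen again. The degree
  \<open>2^(j+1) (2^(k-j-1) - 1)\<close> is less than \<open>2^k - 1\<close> by
  \<open>qdeg 2 j\<close>; the weight is kept, except that it drops when the new index is 0.\<close>

lemma E2_module_steenrod_sub_even:
  assumes two: "(2::'f::field) = 0" and m: "S = AE_monoms 2 m \<or> S = {x \<in> AE_monoms 2 m. monom_weight 2 x \<le> w}"
  shows "E2_module 2 (steenrod_sub 2 S :: ('f, _) emod)"
proof (rule E2_module_leibniz)
  let ?A = "\<lambda>j (r :: nat multiset, e :: nat set). {k. odd (count r k) \<and> j < k}"
  let ?T = "\<lambda>j k (r :: nat multiset, e :: nat set). (r - {#k#} + xi_power (k - j - 1) (2 ^ (j + 1)), e)"
  let ?c = "\<lambda>(k :: nat) (x :: steenrod_monom). 1 :: 'f"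
  \<comment> \<open>All coefficients are 1, so antisymmetry amounts to
    \<open>1 = - 1\<close>.\<close>
  have m1: "(1::'f) = - 1" using two by (metis add_eq_0_iff one_add_one)
  have fin: "finite {k. odd (count r k) \<and> j < k}" for r :: "nat multiset" and j
  proof (rule finite_subset)
    show "{k. odd (count r k) \<and> j < k} \<subseteq> set_mset r" by (auto intro: ccontr simp: not_in_iff)
  qed simp
  \<comment> \<open>Adding an even power changes no parity, so the only exponent whose parity
    changes is that of \<open>k\<close>.\<close>
  have odd_iff: "odd (count (r - {#k#} + xi_power a (2 ^ (j + 1))) l) \<longleftrightarrow> odd (count r l) \<and> l \<noteq> k" if "odd (count r k)" for r k a j l
    using even_count_xi_power[of "2 ^ (j + 1)" a l] that by (cases "l = k") auto
  show "finite (?A i x)" for i x using fin by (cases x) simp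
  show "?A i (?T j k x) = ?A i x - {k}" if "k \<in> ?A j x" for i j k x
    using that odd_iff by (cases x) auto
  show "?T i l (?T j k x) = ?T j k (?T i l x)" if kl: "k \<in> ?A j x" "l \<in> ?A i x" "k \<noteq> l" for i j k l x
  proof -
    obtain r e where x: "x = (r, e)" by (cases x)
    have "k \<in># r" "l \<in># r" using kl by (auto simp: x intro: ccontr simp: not_in_iff)
    then obtain r' where "r = add_mset k (add_mset l r')"
      using kl(3) by (metis insert_DiffM insert_noteq_member)
    then show ?thesis by (auto simp: x multiset_eq_iff)
  qed
  show "?c k x * ?c l (?T j k x) = - (?c l x * ?c k (?T i l x))" for i j k l x
    using m1 by simp
  show "milnor_Q 2 j = leibniz ?A ?T ?c j" for j
    unfolding milnor_Q_def leibniz_def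
  proof (rule arg_cong[where f = pm_extend], rule ext)
    fix x :: steenrod_monom
    obtain r e where x: "x = (r, e)" by (cases x)
    have "(\<Sum>k | k \<in># r \<and> j < k. Poly_Mapping.single (r - {#k#} + xi_power (k - j - 1) (2 ^ (j + 1)), e) (of_nat (count r k) :: 'f)) =
        (\<Sum>k | odd (count r k) \<and> j < k. Poly_Mapping.single (r - {#k#} + xi_power (k - j - 1) (2 ^ (j + 1)), e) 1)"
      by (rule sum.mono_neutral_cong_right)
        (auto simp: of_nat_char_two[OF two] intro: ccontr simp: not_in_iff)
    then show "(case x of (r, e) \<Rightarrow> if (2::nat) = 2 then \<Sum>k | k \<in># r \<and> j < k.
          Poly_Mapping.single (r - {#k#} + xi_power (k - j - 1) (2 ^ (j + 1)), e) (of_nat (count r k))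
        else \<Sum>k | k \<in> e \<and> j \<le> k. Poly_Mapping.single (r + xi_power (k - j) (2 ^ j), e - {k}) ((-1) ^ card {i \<in> e. i < k})) =
      (\<Sum>k\<in>?A j x. Poly_Mapping.single (?T j k x) (?c k x))"
      by (simp add: x)
  qed
  have S': "S \<subseteq> AE_monoms 2 m" using m by auto
  have step: "?T j k x \<in> AE_monoms 2 m \<and> monom_degree 2 (?T j k x) = monom_degree 2 x - qdeg 2 j \<and>
      monom_weight 2 (?T j k x) \<le> monom_weight 2 x" if x: "x \<in> S" and k: "k \<in> ?A j x" for j k x
  proof -
    obtain r e where xr: "x = (r, e)" by (cases x)
    have ok: "odd (count r k)" "j < k" using k by (simp_all add: xr)
    then have "k \<in># r" by (auto intro: ccontr simp: not_in_iff)
    then obtain r' where r: "r = add_mset k r'" by (metis insert_DiffM)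
    have AE: "0 \<notin># r" "e = {}" "\<And>l. l \<in> {1..m + 1} \<Longrightarrow> even (count r l)" using x S' by (auto simp: xr AE_monoms_def)
    have "?T j k x \<in> AE_monoms 2 m"
    proof -
      define q where "q = r - {#k#} + xi_power (k - j - 1) (2 ^ (j + 1))"
      have "0 \<notin># q" using AE(1) by (auto simp: q_def xi_power_def dest: in_diffD)
      moreover have "\<forall>l\<in>{1..m + 1}. even (count q l)"
        using odd_iff[OF ok(1), of "k - j - 1" j] AE(3) unfolding q_def by blast
      ultimately have "(q, e) \<in> AE_monoms 2 m" by (simp add: AE_monoms_def AE(2))
      then show ?thesis by (simp add: xr q_def)
    qed
    moreover have pw: "(2::int) ^ (j + 1) * 2 ^ (k - j - 1) = 2 ^ k"
      unfolding power_add[symmetric] using ok(2) by simp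
    have "monom_degree 2 (?T j k x) = monom_degree 2 x - qdeg 2 j"
      using pw ok(2) by (cases "k - j - 1 = 0") (auto simp: xr r AE monom_degree_def sum_mset_xi_power qdeg_def algebra_simps)
    moreover have "monom_weight 2 (?T j k x) \<le> monom_weight 2 x"
    proof (cases "k - j - 1 = 0")
      case False
      then have e: "j + 1 + (k - j - 1 - 1) = k - 1" by simp
      have "(2::nat) ^ (j + 1) * 2 ^ (k - j - 1 - 1) = 2 ^ (k - 1)"
        unfolding power_add[symmetric] e ..
      then show ?thesis using False by (simp add: xr r AE monom_weight_def sum_mset_xi_power)
    qed (simp add: xr r AE monom_weight_def sum_mset_xi_power)
    ultimately show ?thesis by blast
  qed
  show "?T j k x \<in> S" if "x \<in> S" "k \<in> ?A j x" for j k x using step[OF that] m that(1) by auto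
  show "monom_degree 2 (?T j k x) = monom_degree 2 x - qdeg 2 j" if "x \<in> S" "k \<in> ?A j x" for j k x
    using step[OF that] by blast
qed

text \<open>The \<open>\<xi>\<close> are annihilated, so trading a \<open>\<tau>\<close> for a power
  of \<open>\<xi>\<close> leaves nothing new to act on, and the signs anticommute as in an exterior
  algebra. The degree drops from \<open>2 p^k - 1\<close> to \<open>2 p^j (p^(k-j) - 1)\<close>,
  that is by \<open>qdeg p j\<close>; the weight is kept, or drops when
  \<open>k = j\<close>.\<close>

lemma E2_module_steenrod_sub_odd:
  assumes p: "p \<noteq> 2" and m: "S = AE_monoms p m \<or> S = {x \<in> AE_monoms p m. monom_weight p x \<le> w}"
  shows "E2_module p (steenrod_sub p S :: ('f::field, _) emod)"
proof (rule E2_module_leibniz)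
  \<comment> \<open>For infinite \<open>e\<close> the sum in \<open>milnor_Q\<close> runs over an
    infinite set and is \<open>0\<close> by convention; the condition \<open>finite e\<close> makes
    the index set empty instead, so that it is always finite.\<close>
  let ?A = "\<lambda>j (r :: nat multiset, e :: nat set). {k \<in> e. finite e \<and> j \<le> k}"
  let ?T = "\<lambda>j k (r :: nat multiset, e :: nat set). (r + xi_power (k - j) (p ^ j), e - {k})"
  let ?c = "\<lambda>k (r :: nat multiset, e :: nat set). (-1) ^ card {i \<in> e. i < k} :: 'f"
  show "finite (?A i x)" for i x
  proof -
    obtain r e where x: "x = (r, e)" by (cases x)
    show ?thesis unfolding x by (cases "finite e") simp_all
  qed
  show "?A i (?T j k x) = ?A i x - {k}" if "k \<in> ?A j x" for i j k x using that by (cases x) auto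
  show "?T i l (?T j k x) = ?T j k (?T i l x)" if "k \<in> ?A j x" "l \<in> ?A i x" "k \<noteq> l" for i j k l x
    by (cases x) (auto simp: add_ac)
  show "?c k x * ?c l (?T j k x) = - (?c l x * ?c k (?T i l x))" if kl: "k \<in> ?A j x" "l \<in> ?A i x" "k \<noteq> l" for i j k l x
  proof -
    obtain r e where x: "x = (r, e)" by (cases x)
    have sgl: "sgl a E y = (-1) ^ card {i \<in> E. i < a} * y" for a E and y :: 'f
      by (simp add: sgl_def sg_def minus_one_power_iff)
    show ?thesis using sgl_anti[of e k l "1::'f"] kl by (simp add: x sgl)
  qed
  show "milnor_Q p j = leibniz ?A ?T ?c j" for j
    unfolding milnor_Q_def leibniz_def
  proof (rule arg_cong[where f = pm_extend], rule ext)
    fix x :: steenrod_monom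
    obtain r e where x: "x = (r, e)" by (cases x)
    have "(\<Sum>k | k \<in> e \<and> j \<le> k. g k) = (\<Sum>k\<in>?A j x. g k)" for g :: "nat \<Rightarrow> steenrod_monom \<Rightarrow>\<^sub>0 'f"
    proof (cases "finite e")
      case False
      have "infinite {k \<in> e. j \<le> k}"
      proof
        assume "finite {k \<in> e. j \<le> k}"
        moreover have "e \<subseteq> {k \<in> e. j \<le> k} \<union> {..<j}" by auto
        ultimately show False using False by (meson finite_UnI finite_lessThan finite_subset)
      qed
      then show ?thesis using False by (simp add: x)
    qed (simp add: x)
    then show "(case x of (r, e) \<Rightarrow> if p = 2 then \<Sum>k | k \<in># r \<and> j < k.
          Poly_Mapping.single (r - {#k#} + xi_power (k - j - 1) (2 ^ (j + 1)), e) (of_nat (count r k))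
        else \<Sum>k | k \<in> e \<and> j \<le> k. Poly_Mapping.single (r + xi_power (k - j) (p ^ j), e - {k}) ((-1) ^ card {i \<in> e. i < k})) =
      (\<Sum>k\<in>?A j x. Poly_Mapping.single (?T j k x) (?c k x))"
      using p by (simp add: x)
  qed
  have S': "S \<subseteq> AE_monoms p m" using m by auto
  have step: "?T j k x \<in> AE_monoms p m \<and> monom_degree p (?T j k x) = monom_degree p x - qdeg p j \<and>
      monom_weight p (?T j k x) \<le> monom_weight p x" if x: "x \<in> S" and k: "k \<in> ?A j x" for j k x
  proof -
    obtain r e where xr: "x = (r, e)" by (cases x)
    have AE: "0 \<notin># r" "finite e" "\<And>l. l \<in> e \<Longrightarrow> m < l" and k': "k \<in> e" "j \<le> k"
      using x S' k p by (auto simp: xr AE_monoms_def)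
    have "?T j k x \<in> AE_monoms p m"
      using AE p by (auto simp: xr AE_monoms_def xi_power_def)
    moreover have pw: "int p ^ j * int p ^ (k - j) = int p ^ k" "p ^ j * p ^ (k - j) = p ^ k"
      unfolding power_add[symmetric] using k'(2) by simp_all
    have rm: "sum g e = g k + sum g (e - {k})" for g :: "nat \<Rightarrow> 'z::comm_monoid_add" by (rule sum.remove[OF AE(2) k'(1)])
    have "monom_degree p (?T j k x) = monom_degree p x - qdeg p j"
      using pw(1) k'(2) p by (cases "k - j = 0") (auto simp: xr rm monom_degree_def sum_mset_xi_power qdeg_def algebra_simps)
    moreover have "monom_weight p (?T j k x) \<le> monom_weight p x"
      using pw(2) p by (simp add: xr rm monom_weight_def sum_mset_xi_power)
    ultimately show ?thesis by blast
  qed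
  show "?T j k x \<in> S" if "x \<in> S" "k \<in> ?A j x" for j k x using step[OF that] m that(1) by auto
  show "monom_degree p (?T j k x) = monom_degree p x - qdeg p j" if "x \<in> S" "k \<in> ?A j x" for j k x
    using step[OF that] by blast
qed

section \<open>Nonnegative degrees, and the comparison for the two comodules\<close>

lemma monom_degree_nonneg: "p > 0 \<Longrightarrow> 0 \<le> monom_degree p x"
proof -
  assume p: "p > 0"
  have 1: "(1::int) \<le> int p ^ k" for k using p by simp
  have m: "0 \<le> (\<Sum>k\<in>#r. f k)" if "\<And>k. 0 \<le> f k" for f :: "nat \<Rightarrow> int" and r
    using that by (induction r) (simp_all add: add_nonneg_nonneg)
  obtain r e where x: "x = (r, e)" by (cases x)
  have "0 \<le> (\<Sum>k\<in>#r. if p = 2 then 2 ^ k - 1 else 2 * (int p ^ k - 1))" using 1 by (intro m) auto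
  moreover have "0 \<le> (\<Sum>k\<in>e. 2 * int p ^ k - 1)"
  proof (rule sum_nonneg)
    show "0 \<le> 2 * int p ^ k - 1" for k using 1[of k] by linarith
  qed
  ultimately show ?thesis by (simp add: x monom_degree_def)
qed

lemma steenrod_sub_nonneg:
  assumes "p > 0" "n < 0"
  shows "ecomp (steenrod_sub p S :: ('f::field, _) emod) n = {0}"
proof -
  have "x = 0" if "x \<in> ecomp (steenrod_sub p S :: ('f, _) emod) n" for x
  proof -
    have "monom_degree p m = n" if "m \<in> Poly_Mapping.keys x" for m
      using that \<open>x \<in> _\<close> by (simp add: steenrod_sub_def)
    then have "Poly_Mapping.keys x = {}"
      using monom_degree_nonneg[OF assms(1)] assms(2) by (metis all_not_in_conv not_le)
    then show ?thesis by simp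
  qed
  then show ?thesis by (auto simp: steenrod_sub_def)
qed

lemma E2_module_H:
  fixes k :: nat
  defines "p \<equiv> CARD('p::prime_card)"
  shows "E2_module p (H_l p k :: ('p mod_ring, _) emod)" "E2_module p (H_BP2 p :: ('p mod_ring, _) emod)"
proof -
  \<comment> \<open>At \<open>p = 2\<close> the Leibniz coefficients \<open>count r k\<close> matter
    modulo two, which is where the characteristic of the field enters.\<close>
  have "(of_nat p :: 'p mod_ring) = 0" unfolding p_def by (rule of_nat_card_eq_0)
  then have two: "(2 :: 'p mod_ring) = 0" if "p = 2" using that by simp
  show "E2_module p (H_l p k :: ('p mod_ring, _) emod)" "E2_module p (H_BP2 p :: ('p mod_ring, _) emod)"
    unfolding H_l_def H_BP2_def
    using E2_module_steenrod_sub_odd[where 'f = "'p mod_ring", of p] E2_module_steenrod_sub_even[where 'f = "'p mod_ring", OF two]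
    by (cases "p = 2"; blast)+
qed

text \<open>Specific to this case are the relations among the Milnor primitives and the vanishing of
  the homology of \<open>l_k\<close> in negative degrees. The isomorphisms are obtained one bidegree
  at a time, and \<open>\<phi>\<close> collects the choices.\<close>

theorem corollary4p13:
  fixes k :: nat
  defines "p \<equiv> CARD('p::prime_card)"
  defines "L \<equiv> (H_l p k :: ('p mod_ring, _) emod)"
  defines "BP \<equiv> (H_BP2 p :: ('p mod_ring, _) emod)"
  shows "\<exists>\<phi>. \<forall>u t.
    sq_iso (RHom_P2_cohomology p (G_functor p L) (G_functor p BP) u t) (Ext_E2 p L BP u t) (\<phi> u t)"
proof -
  have pos: "p > 0" unfolding p_def by (rule zero_less_card_finite)
  interpret exterior p by unfold_locales (rule pos)
  have L: "E2_module p L" and BP: "E2_module p BP"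
    unfolding L_def BP_def p_def by (rule E2_module_H)+
  have "ecomp L n = {0}" if "n < 0" for n
    unfolding L_def H_l_def by (rule steenrod_sub_nonneg[OF pos that])
  then have "\<exists>\<phi>. sq_iso (RHom_P2_cohomology p (G_functor p L) (G_functor p BP) u t) (Ext_E2 p L BP u t) \<phi>" for u t
    by (rule RHom_P2_iso_Ext_E2[OF L _ BP])
  then show ?thesis by metis
qed

end
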